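(* Let $\lambda=(20+\sqrt{205})/15$ and $\nu=\log2/\log\lambda$. Let $X$ be the loop-erased random walk on the infinite pre-Sierpiński gasket starting at the origin (constructed in the context), $E$ the expectation under its law $P$, and $|\cdot|$ the Euclidean distance from the origin. For any $s>0$ there exist positive constants $C_1(s)$ and $C_2(s)$ such that for all $n\in\mathbb N$ $$C_1(s)\,n^{s\nu}\le E[|X(n)|^s]\le C_2(s)\,n^{s\nu}.$$
   Context: **Graph.** $\mathbb N=\{1,2,\dots\}$, $\mathbb Z_+=\{0,1,2,\dots\}$. Let $O=(0,0)$, $a_0=(\frac12,\frac{\sqrt3}2)$, $b_0=(1,0)$, $a_N=2^Na_0$, $b_N=2^Nb_0$. Let $F'_0$ be the graph consisting of the three vertices and three edges of the triangle $Oa_0b_0$, and $F'_{N+1}=F'_N\cup(F'_N+a_N)\cup(F'_N+b_N)$ for $N\in\mathbb Z_+$. Let $F'^R_N$ be the reflection of $F'_N$ in the $y$-axis. The (infinite) pre-Sierpiński gasket is $F_0=\bigcup_{N\ge1}(F'_N\cup F'^R_N)$, with vertex set $G_0$ and edge set $E_0$ (every vertex has degree 4). For $M\in\mathbb Z_+$ put $G_M=2^MG_0$, $E_M=2^ME_0$. A $2^M$-triangle is a translate of the closed filled triangle $Oa_Mb_M$ with vertices in $G_M$ and sides that are edges in $E_M$. **Paths.** A finite path is $w=(w(0),\dots,w(n))$ in $G_0$ with $w(i-1),w(i)$ joined by an edge of $E_0$; its length is $\ell(w)=n$. It is loopless if $w(i)\ne w(j)$ for $i\neq j$. For a path with $w(0)\in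 G_M$ let $T^M_0(w)=0$ and $T^M_i(w)=\inf\{j>T^M_{i-1}(w): w(j)\in G_M\setminus\{w(T^M_{i-1}(w))\}\}$, $i=1,\dots,m$, where $m$ is the smallest integer with $T^M_{m+1}(w)=\infty$. For $N\in\mathbb Z_+$ define sets of finite paths starting at $O$: - $W_N$: $w(T^N_1)=a_N$ and $\ell(w)=T^N_1(w)$; - $V_N$: $w(T^N_1)=b_N$, $w(T^N_2)=a_N$ and $\ell(w)=T^N_2(w)$; - $W_N^b$, $V_N^b$: the same with the roles of $a_N$ and $b_N$ exchanged. Let $U_N=W_N\cup V_N\cup W_N^b\cup V_N^b$ and let $\Gamma_N$ be the set of loopless paths in $U_N$. **Exit times.** For a path $w$ starting at $O$ (with $m\ge1$), let $T^{ex,M}_0(w)=0$ and let $\Delta_1$ be the $2^M$-triangle containing $w(T^M_0)$ and $w(T^M_1)$. For $i\ge1$ let $J(i)$ be the smallest $j<m$ with $T^M_j(w)>T^{ex,M}_{i-1}(w)$ and $w(T^M_{j+1})\notin\Delta_i$ if such $j$ exists, and $J(i)=m$ otherwise; put $T^{ex,M}_i(w)=T^M_{J(i)}(w)$. If $J(i)<m$, let $\Delta_{i+1}$ be the $2^M$-triangle containing $w(T_i^{ex,M})$ and $w(T^M_{J(i)+1})$ and continue; if $J(i)=m$, stop. **Loop erasure (erasing larger loops first).** For a path $u$ with both endpoints in $G_k$ and $\ell(u)=T^k_m(u)$, set $c_j=u(T^k_j)$, $\tau_0=\max\{j:c_j=c_0\}$ and, while $\tau_i<m$, $\tau_{i+1}=\max\{j:c_j=c_{\tau_i+1}\}$;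 let $\mathcal E_ku$ be the concatenation of the segments of $u$ over the time intervals $[T^k_{\tau_i},T^k_{\tau_i+1}]$, over all $i$ with $\tau_i<m$, in order. (That is, the coarse path $(c_0,\dots,c_m)$ is loop-erased chronologically and the original fine structure is restored on the surviving coarse steps.) For $w\in U_N$ put $w^{(N)}=w$; for $k=N-1,N-2,\dots,0$ cut $w^{(k+1)}$ at its exit times $T^{ex,k+1}_i$ into consecutive pieces, apply $\mathcal E_k$ to each piece, and concatenate to obtain $w^{(k)}$. Set $Lw=w^{(0)}\in\Gamma_N$. **Measures.** Let $P^{(1)}_N,P^{(2)}_N$ be the probability measures on $W_N$, $W_N^b$ giving each path $w$ mass $(1/4)^{\ell(w)-1}$, and $P_N^{(3)},P_N^{(4)}$ those on $V_N$, $V_N^b$ giving each $w$ mass $(1/4)^{\ell(w)-2}$. Let $\hat P^{(i)}_N=P^{(i)}_N\circ L^{-1}$ on $\Gamma_N$. For $w\in\Gamma_N$ and $N\ge1$, $w|_{N-1}$ denotes $w$ stopped at $T_1^{ex,N-1}(w)$. Let $$\Omega=\{\omega=(\omega_0,\omega_1,\dots):\omega_N\in\Gamma_N\ (N\in\mathbb Z_+),\ \omega_N|_{N-1}=\omega_{N-1}\ (N\in\mathbb N)\},$$ $\mathcal B$ the $\sigma$-algebra generated by cylinder sets, $\pi_N\omega=(\omega_0,\dots,\omega_N)$, and let $\tilde P_N$ be the probability measure on $\pi_N\Omega$ given by $$\tilde P_N[(\omega_0,\dots,\omega_N)]=\tfrac{11}{28}\big(\hat P^{(1)}_N[\omega_N]+\hat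 P^{(2)}_N[\omega_N]\big)+\tfrac{3}{28}\big(\hat P^{(3)}_N[\omega_N]+\hat P^{(4)}_N[\omega_N]\big).$$ **The walk.** $P$ is the unique probability measure on $(\Omega,\mathcal B)$ with $P\circ\pi_N^{-1}=\tilde P_N$ for all $N\in\mathbb Z_+$ (it exists by Kolmogorov's extension theorem). The loop-erased random walk $X$ on $F_0$ is $X(\omega)(i)=\omega_N(i)$ for $i\le2^N$, under $P$. *)

theory Defs
  imports "HOL-Probability.Probability"
begin

definition vert_a :: "nat \<Rightarrow> complex" where
  "vert_a N = 2 ^ N * Complex (1/2) (sqrt 3 / 2)"

definition vert_b :: "nat \<Rightarrow> complex" where
  "vert_b N = 2 ^ N * Complex 1 0"

primrec pre_vertices :: "nat \<Rightarrow> complex set" where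
  "pre_vertices 0 = {0, vert_a 0, vert_b 0}"
| "pre_vertices (Suc N) = pre_vertices N
     \<union> (\<lambda>z. z + vert_a N) ` pre_vertices N \<union> (\<lambda>z. z + vert_b N) ` pre_vertices N"

primrec pre_edges :: "nat \<Rightarrow> complex set set" where
  "pre_edges 0 = {{0, vert_a 0}, {vert_a 0, vert_b 0}, {vert_b 0, 0}}"
| "pre_edges (Suc N) = pre_edges N
     \<union> (`) (\<lambda>z. z + vert_a N) ` pre_edges N \<union> (`) (\<lambda>z. z + vert_b N) ` pre_edges N"

definition y_reflect :: "complex \<Rightarrow> complex" where
  "y_reflect z = Complex (- Re z) (Im z)"

definition gasket_vertices :: "nat \<Rightarrow> complex set" where
  "gasket_vertices M =
     (\<lambda>z. 2 ^ M * z) ` (\<Union>N\<in>{1..}. pre_vertices N \<union> y_reflect ` pre_vertices N)"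

definition gasket_edges :: "nat \<Rightarrow> complex set set" where
  "gasket_edges M =
     (`) (\<lambda>z. 2 ^ M * z) ` (\<Union>N\<in>{1..}. pre_edges N \<union> (`) y_reflect ` pre_edges N)"

definition triangles :: "nat \<Rightarrow> complex set set" where
  "triangles M = {convex hull {c, c + vert_a M, c + vert_b M} | c.
     {c, c + vert_a M, c + vert_b M} \<subseteq> gasket_vertices M \<and>
     {{c, c + vert_a M}, {c + vert_a M, c + vert_b M}, {c + vert_b M, c}} \<subseteq> gasket_edges M}"

text \<open>Two \<open>gasket_edges M\<close>-neighbours lie in exactly one element of \<open>triangles M\<close>, so the
  description below is proper wherever it is used.\<close>

definition triangle_of :: "nat \<Rightarrow> complex \<Rightarrow> complex \<Rightarrow> complex set" where
  "triangle_of M x y = (THE D. D \<in> triangles M \<and> x \<in> D \<and> y \<in> D)"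

text \<open>A path \<open>w(0), \<dots>, w(n)\<close> is the nonempty list of its \<open>n + 1\<close> vertices.\<close>

type_synonym walk = "complex list"

definition wlen :: "walk \<Rightarrow> nat" where
  "wlen w = length w - 1"

definition is_walk :: "walk \<Rightarrow> bool" where
  "is_walk w \<longleftrightarrow> w \<noteq> [] \<and> set w \<subseteq> gasket_vertices 0 \<and>
     (\<forall>i<wlen w. {w ! i, w ! Suc i} \<in> gasket_edges 0)"

text \<open>The restriction of a path to the time interval \<open>[s, t]\<close>.\<close>

definition segment :: "walk \<Rightarrow> nat \<Rightarrow> nat \<Rightarrow> walk" where
  "segment w s t = take (Suc (t - s)) (drop s w)"

text \<open>Concatenation, identifying the end of each path with the start of the next; the start
  point \<open>x\<close> is given separately to cover the empty list of paths.\<close>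

definition concat_walks :: "complex \<Rightarrow> walk list \<Rightarrow> walk" where
  "concat_walks x us = x # concat (map tl us)"

text \<open>In \<open>hit_time\<close>, the infimum of the empty set is \<open>\<infinity>\<close>; once \<open>\<infinity>\<close> is reached, it is kept.\<close>

primrec hit_time :: "nat \<Rightarrow> walk \<Rightarrow> nat \<Rightarrow> enat" where
  "hit_time M w 0 = 0"
| "hit_time M w (Suc i) = Inf {enat j | j. j \<le> wlen w \<and> hit_time M w i < enat j \<and>
     w ! j \<in> gasket_vertices M - {w ! the_enat (hit_time M w i)}}"

definition hit_num :: "nat \<Rightarrow> walk \<Rightarrow> nat" where
  "hit_num M w = (LEAST m. hit_time M w (Suc m) = \<infinity>)"

abbreviation hit :: "nat \<Rightarrow> walk \<Rightarrow> nat \<Rightarrow> nat" where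
  "hit M w i \<equiv> the_enat (hit_time M w i)"

text \<open>\<open>walks_W N (vert_a N)\<close> and \<open>walks_V N (vert_b N) (vert_a N)\<close> are the sets \<open>W\<^sub>N\<close> and \<open>V\<^sub>N\<close>;
  exchanging \<open>vert_a\<close> and \<open>vert_b\<close> gives the other two sets.\<close>

definition walks_W :: "nat \<Rightarrow> complex \<Rightarrow> walk set" where
  "walks_W N x = {w. is_walk w \<and> w ! 0 = 0 \<and>
     hit_time N w 1 = enat (wlen w) \<and> w ! hit N w 1 = x}"

definition walks_V :: "nat \<Rightarrow> complex \<Rightarrow> complex \<Rightarrow> walk set" where
  "walks_V N x y = {w. is_walk w \<and> w ! 0 = 0 \<and>
     hit_time N w 2 = enat (wlen w) \<and> w ! hit N w 1 = x \<and> w ! hit N w 2 = y}"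

definition walks_U :: "nat \<Rightarrow> walk set" where
  "walks_U N = walks_W N (vert_a N) \<union> walks_V N (vert_b N) (vert_a N)
     \<union> walks_W N (vert_b N) \<union> walks_V N (vert_a N) (vert_b N)"

definition loopless_walks :: "nat \<Rightarrow> walk set" where
  "loopless_walks N = {w \<in> walks_U N. distinct w}"

text \<open>\<open>exit_index M w i\<close> is \<open>J(i)\<close>, with \<open>J(0) = 0\<close>. The triangle \<open>\<Delta>\<^sub>i\<^sub>+\<^sub>1\<close> contains the points
  visited at hitting times \<open>J(i)\<close> and \<open>J(i) + 1\<close>. Once \<open>J(i) = hit_num M w\<close>, the set \<open>S\<close> is
  empty and the sequence stays constant.\<close>

primrec exit_index :: "nat \<Rightarrow> walk \<Rightarrow> nat \<Rightarrow> nat" where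
  "exit_index M w 0 = 0"
| "exit_index M w (Suc i) =
     (let J = exit_index M w i;
          D = triangle_of M (w ! hit M w J) (w ! hit M w (Suc J));
          S = {j. j < hit_num M w \<and> hit M w J < hit M w j \<and> w ! hit M w (Suc j) \<notin> D}
      in if S = {} then hit_num M w else Min S)"

definition exit_time :: "nat \<Rightarrow> walk \<Rightarrow> nat \<Rightarrow> nat" where
  "exit_time M w i = hit M w (exit_index M w i)"

definition exit_pieces :: "nat \<Rightarrow> walk \<Rightarrow> walk list" where
  "exit_pieces M w = map (\<lambda>i. segment w (exit_time M w i) (exit_time M w (Suc i)))
     [0..<(LEAST r. exit_index M w r = hit_num M w)]"

definition stopped :: "nat \<Rightarrow> walk \<Rightarrow> walk" where
  "stopped M w = segment w 0 (exit_time M w 1)"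

primrec erase_index :: "nat \<Rightarrow> walk \<Rightarrow> nat \<Rightarrow> nat" where
  "erase_index k u 0 = Max {j. j \<le> hit_num k u \<and> u ! hit k u j = u ! hit k u 0}"
| "erase_index k u (Suc i) =
     (if erase_index k u i < hit_num k u
      then Max {j. j \<le> hit_num k u \<and> u ! hit k u j = u ! hit k u (Suc (erase_index k u i))}
      else hit_num k u)"

definition erase_coarse :: "nat \<Rightarrow> walk \<Rightarrow> walk" where
  "erase_coarse k u = concat_walks (u ! 0)
     (map (\<lambda>i. segment u (hit k u (erase_index k u i)) (hit k u (Suc (erase_index k u i))))
       [0..<(LEAST r. \<not> erase_index k u r < hit_num k u)])"

definition erase_step :: "nat \<Rightarrow> walk \<Rightarrow> walk" where
  "erase_step k w = concat_walks (w ! 0) (map (erase_coarse k) (exit_pieces (Suc k) w))"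

text \<open>\<open>loop_erase N w\<close> is \<open>Lw\<close> for \<open>w \<in> walks_U N\<close>.\<close>

primrec loop_erase :: "nat \<Rightarrow> walk \<Rightarrow> walk" where
  "loop_erase 0 w = w"
| "loop_erase (Suc k) w = loop_erase k (erase_step k w)"

definition law_W :: "nat \<Rightarrow> complex \<Rightarrow> walk measure" where
  "law_W N x = point_measure (walks_W N x) (\<lambda>w. ennreal ((1/4) ^ (wlen w - 1)))"

definition law_V :: "nat \<Rightarrow> complex \<Rightarrow> complex \<Rightarrow> walk measure" where
  "law_V N x y = point_measure (walks_V N x y) (\<lambda>w. ennreal ((1/4) ^ (wlen w - 2)))"

definition erased_prob :: "nat \<Rightarrow> walk measure \<Rightarrow> walk \<Rightarrow> real" where
  "erased_prob N Q \<gamma> = measure (distr Q (count_space UNIV) (loop_erase N)) {\<gamma>}"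

definition Omega :: "(nat \<Rightarrow> walk) set" where
  "Omega = {\<omega>. (\<forall>N. \<omega> N \<in> loopless_walks N) \<and> (\<forall>N. stopped N (\<omega> (Suc N)) = \<omega> N)}"

definition proj_upto :: "nat \<Rightarrow> (nat \<Rightarrow> walk) \<Rightarrow> walk list" where
  "proj_upto N \<omega> = map \<omega> [0..<Suc N]"

definition cylinder_space :: "(nat \<Rightarrow> walk) measure" where
  "cylinder_space = sigma Omega {proj_upto N -` C \<inter> Omega | N C. C \<subseteq> proj_upto N ` Omega}"

definition marginal :: "nat \<Rightarrow> walk list measure" where
  "marginal N = point_measure (proj_upto N ` Omega) (\<lambda>c. ennreal (
       11/28 * (erased_prob N (law_W N (vert_a N)) (last c)
              + erased_prob N (law_W N (vert_b N)) (last c))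
     + 3/28 * (erased_prob N (law_V N (vert_b N) (vert_a N)) (last c)
              + erased_prob N (law_V N (vert_a N) (vert_b N)) (last c))))"

definition is_lerw_law :: "(nat \<Rightarrow> walk) measure \<Rightarrow> bool" where
  "is_lerw_law P \<longleftrightarrow> prob_space P \<and> space P = Omega \<and> sets P = sets cylinder_space \<and>
     (\<forall>N. distr P (count_space (proj_upto N ` Omega)) (proj_upto N) = marginal N)"

text \<open>On \<open>Omega\<close>, the value \<open>\<omega> N ! i\<close> is the same for all \<open>N\<close> with \<open>i \<le> 2 ^ N\<close>, since the
  paths \<open>\<omega> N\<close> extend each other and have length at least \<open>2 ^ N\<close>.\<close>

definition lerw :: "(nat \<Rightarrow> walk) \<Rightarrow> nat \<Rightarrow> complex" where
  "lerw \<omega> i = \<omega> (LEAST N. i \<le> 2 ^ N) ! i"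

definition lerw_lambda :: real where
  "lerw_lambda = (20 + sqrt 205) / 15"

definition lerw_nu :: real where
  "lerw_nu = ln 2 / ln lerw_lambda"

end

theory Submission
  imports Defs
begin

text \<open>
  Erasing larger loops first turns the erased walk into a branching structure. One step of size
  \<open>2\<^sup>N\<^sup>+\<^sup>1\<close> stands for a random path of steps of size \<open>2\<^sup>N\<close> in its triangle and the adjacent ones.
  Erasing the loops of that path removes its excursions to other triangles (\<open>lerase_nodes\<close>), and
  the surviving steps, grouped by the triangles of size \<open>2\<^sup>N\<close> that they cross, form two or three
  pieces of one or two steps each (\<open>piece_counts\<close>). All further erasure acts inside the pieces
  (\<open>loop_erase_piece\<close>), and the pieces are independent with the same laws one scale below
  (\<open>length_gf_recursion\<close>). So the length \<open>L\<^sub>N\<close> of the erased walk of level \<open>N\<close> is the size of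
  generation \<open>N\<close> of a two-type branching process. Its mean matrix has the rows \<open>(9/5, 2/5)\<close> and
  \<open>(26/15, 13/15)\<close> (\<open>piece_means\<close>) and \<open>lerw_lambda\<close> as its largest eigenvalue.

  The means are expectations over infinitely many paths. Chronological loop erasure can be done
  forward in time, cutting back the path erased so far at each revisit; this is a Markov chain on a
  finite set of erased paths. The expected values are then harmonic functions of this chain, and it
  is enough to exhibit a table of values and to check harmonicity state by state
  (\<open>walk_sum_harmonic\<close>).

  The deviation of the generating function of \<open>L\<^sub>N\<close> from \<open>1\<close> grows like \<open>\<lambda>\<^sup>N\<close> while it is small.
  Because every piece has at least two descendants, the generating function then drops at least to
  its square at each further level. Hence \<open>L\<^sub>N\<close> exceeds
  \<open>24 \<lambda>\<^sup>N\<close> with probability at most \<open>1/2\<close> (\<open>long_walk_prob\<close>), and \<open>j\<close> levels later a length below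
  \<open>\<lambda>\<^sup>n\<close> has a probability that is doubly exponentially small in \<open>j\<close> (\<open>short_walk_prob\<close>).

  Up to time \<open>L\<^sub>N\<close> the walk has distance at most \<open>2\<^sup>N\<close> from the origin (\<open>lerw_norm_le\<close>). From
  that time on, being loopless, it cannot enter a triangle of size \<open>2\<^sup>N\<close> at the origin again, and
  its distance is at least the height \<open>(\<surd>3 / 2) 2\<^sup>N\<close> of such a triangle (\<open>lerw_norm_ge\<close>). As
  \<open>2 = \<lambda>\<^sup>\<nu>\<close>, the bounds on the lengths become bounds on the distance at time \<open>n\<close>: the lower bound
  uses one level, the upper bound sums over all levels that the walk may have completed too early.
\<close>

section \<open>Lattice coordinates and the cells of the gasket\<close>

definition lat :: "real \<Rightarrow> real \<Rightarrow> complex" where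
  "lat u v = Complex (u/2 + v) (u * sqrt 3 / 2)"

lemma lat_eq_iff [simp]: "lat u v = lat u' v' \<longleftrightarrow> u = u' \<and> v = v'"
  by (auto simp: lat_def)

lemma lat_add: "lat u v + lat u' v' = lat (u + u') (v + v')"
  by (simp add: lat_def complex_eq_iff field_simps)

lemma lat_scaleR: "r *\<^sub>R lat u v = lat (r * u) (r * v)"
  by (simp add: lat_def complex_eq_iff field_simps)

lemma lat_scale: "2 ^ M * lat u v = lat (2 ^ M * u) (2 ^ M * v)"
proof -
  have "2 ^ M * lat u v = (2 ^ M) *\<^sub>R lat u v"
    by (simp add: scaleR_conv_of_real)
  then show ?thesis by (simp add: lat_scaleR)
qed

lemma vert_a_lat: "vert_a N = lat (2 ^ N) 0" and vert_b_lat: "vert_b N = lat 0 (2 ^ N)"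
proof -
  have "vert_a N = 2 ^ N * lat 1 0" "vert_b N = 2 ^ N * lat 0 1"
    by (simp_all add: vert_a_def vert_b_def lat_def)
  then show "vert_a N = lat (2 ^ N) 0" "vert_b N = lat 0 (2 ^ N)"
    by (simp_all only: lat_scale mult_1_right mult_zero_right)
qed

lemma zero_lat: "0 = lat 0 0"
  by (simp add: lat_def complex_eq_iff)

lemma y_reflect_lat: "y_reflect (lat u v) = lat u (- (u + v))"
  by (simp add: lat_def y_reflect_def complex_eq_iff field_simps)

definition cell_corners :: "nat \<Rightarrow> int \<Rightarrow> int \<Rightarrow> complex set" where
  "cell_corners N i j = {lat (2 ^ N * of_int i) (2 ^ N * of_int j),
     lat (2 ^ N * (of_int i + 1)) (2 ^ N * of_int j),
     lat (2 ^ N * of_int i) (2 ^ N * (of_int j + 1))}"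

primrec pre_cells :: "nat \<Rightarrow> (int \<times> int) set" where
  "pre_cells 0 = {(0, 0)}"
| "pre_cells (Suc N) = pre_cells N \<union> (\<lambda>(i, j). (i + 2 ^ N, j)) ` pre_cells N
     \<union> (\<lambda>(i, j). (i, j + 2 ^ N)) ` pre_cells N"

definition cell :: "int \<Rightarrow> int \<Rightarrow> bool" where
  "cell i j \<longleftrightarrow> (\<exists>N. (i, j) \<in> pre_cells N \<or> (i, - (i + j) - 1) \<in> pre_cells N)"

definition cells :: "nat \<Rightarrow> complex set set" where
  "cells N = {cell_corners N i j | i j. cell i j}"

definition edges_of :: "complex set \<Rightarrow> complex set set" where
  "edges_of t = {{x, y} | x y. x \<in> t \<and> y \<in> t \<and> x \<noteq> y}"

lemma edges_of_triple:
  "x \<noteq> y \<Longrightarrow> y \<noteq> z \<Longrightarrow> z \<noteq> x \<Longrightarrow> edges_of {x, y, z} = {{x, y}, {y, z}, {z, x}}"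
  unfolding edges_of_def by (intro equalityI subsetI) (auto 4 0 simp: insert_commute)

lemma edges_of_image:
  assumes "inj f"
  shows "(`) f ` edges_of t = edges_of (f ` t)"
proof (intro set_eqI iffI)
  fix e assume "e \<in> (`) f ` edges_of t"
  then obtain x y where "x \<in> t" "y \<in> t" "x \<noteq> y" "e = {f x, f y}"
    unfolding edges_of_def by auto
  with assms show "e \<in> edges_of (f ` t)"
    unfolding edges_of_def by (auto dest: injD)
next
  fix e assume "e \<in> edges_of (f ` t)"
  then obtain x y where "x \<in> t" "y \<in> t" "x \<noteq> y" "e = f ` {x, y}"
    unfolding edges_of_def by auto
  then show "e \<in> (`) f ` edges_of t"
    unfolding edges_of_def by blast
qed

lemma shift_a_corners: "(\<lambda>z. z + vert_a N) ` cell_corners 0 i j = cell_corners 0 (i + 2 ^ N) j"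
  and shift_b_corners: "(\<lambda>z. z + vert_b N) ` cell_corners 0 i j = cell_corners 0 i (j + 2 ^ N)"
  by (simp_all add: cell_corners_def vert_a_lat vert_b_lat lat_add algebra_simps)

lemma reflect_corners: "y_reflect ` cell_corners 0 i j = cell_corners 0 i (- (i + j) - 1)"
  unfolding cell_corners_def by (auto simp: y_reflect_lat)

lemma scale_corners: "(\<lambda>z. 2 ^ M * z) ` cell_corners 0 i j = cell_corners M i j"
  by (simp add: cell_corners_def lat_scale)

lemma pre_vertices_eq: "pre_vertices N = (\<Union>(i, j)\<in>pre_cells N. cell_corners 0 i j)"
proof (induction N)
  case 0
  show ?case by (simp add: cell_corners_def zero_lat vert_a_lat vert_b_lat)
next
  case (Suc N)
  show ?case
    by (simp add: Suc image_UN case_prod_beta' shift_a_corners shift_b_corners)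
qed

lemma pre_edges_eq: "pre_edges N = (\<Union>(i, j)\<in>pre_cells N. edges_of (cell_corners 0 i j))"
proof (induction N)
  case 0
  show ?case
    by (simp add: cell_corners_def zero_lat vert_a_lat vert_b_lat edges_of_triple insert_commute)
next
  case (Suc N)
  have "inj (\<lambda>z. z + vert_a N)" "inj (\<lambda>z. z + vert_b N)" by (simp_all add: inj_def)
  then show ?case
    by (simp add: Suc image_UN case_prod_beta' edges_of_image shift_a_corners shift_b_corners)
qed

lemma pre_cells_mono: "M \<le> N \<Longrightarrow> pre_cells M \<subseteq> pre_cells N"
  by (induction rule: dec_induct) auto

lemma pre_cells_nonneg: "(i, j) \<in> pre_cells N \<Longrightarrow> 0 \<le> i \<and> 0 \<le> j"
proof (induction N arbitrary: i j)
  case (Suc N)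
  have "(0::int) \<le> 2 ^ N" by simp
  then show ?case using Suc.prems by (auto dest!: Suc.IH)
qed simp

lemma cell_iff_ge1:
  "cell i j \<longleftrightarrow> (\<exists>N\<ge>1. (i, j) \<in> pre_cells N \<or> (i, - (i + j) - 1) \<in> pre_cells N)"
  unfolding cell_def using pre_cells_mono by (metis le_cases subsetD)

lemma union_pre_cells:
  fixes f :: "complex set \<Rightarrow> 'a set"
  shows "(\<Union>N\<in>{1..}. (\<Union>(i, j)\<in>pre_cells N. f (cell_corners 0 i j)) \<union>
     (\<Union>(i, j)\<in>pre_cells N. f (cell_corners 0 i (- (i + j) - 1)))) =
     (\<Union>t\<in>cells 0. f t)" (is "?L = ?R")
proof
  show "?L \<subseteq> ?R"
  proof
    fix x assume "x \<in> ?L"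
    then obtain N i j where "(i, j) \<in> pre_cells N"
      "x \<in> f (cell_corners 0 i j) \<or> x \<in> f (cell_corners 0 i (- (i + j) - 1))" by auto
    moreover from this have "cell i j" "cell i (- (i + j) - 1)" by (auto simp: cell_def)
    ultimately show "x \<in> ?R" by (auto simp: cells_def)
  qed
  show "?R \<subseteq> ?L"
  proof
    fix x assume "x \<in> ?R"
    then obtain i j where ij: "cell i j" "x \<in> f (cell_corners 0 i j)" by (auto simp: cells_def)
    then obtain N where N: "N \<ge> 1" "(i, j) \<in> pre_cells N \<or> (i, - (i + j) - 1) \<in> pre_cells N"
      by (auto simp: cell_iff_ge1)
    have "cell_corners 0 i (- (i + (- (i + j) - 1)) - 1) = cell_corners 0 i j" by simp
    then have "x \<in> (\<Union>(i, j)\<in>pre_cells N. f (cell_corners 0 i j)) \<union>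
        (\<Union>(i, j)\<in>pre_cells N. f (cell_corners 0 i (- (i + j) - 1)))"
      using N(2)
    proof (elim disjE)
      assume "(i, j) \<in> pre_cells N"
      then show ?thesis using ij(2) by blast
    next
      assume "(i, - (i + j) - 1) \<in> pre_cells N"
      moreover assume "cell_corners 0 i (- (i + (- (i + j) - 1)) - 1) = cell_corners 0 i j"
      ultimately show ?thesis using ij(2) by (intro UnI2 UN_I[of "(i, - (i + j) - 1)"]) auto
    qed
    then show "x \<in> ?L" using N(1) by blast
  qed
qed

lemma cells_scale: "cells M = (`) (\<lambda>z. 2 ^ M * z) ` cells 0"
proof (intro equalityI subsetI)
  fix t assume "t \<in> cells M"
  then obtain i j where "cell i j" "t = (\<lambda>z. 2 ^ M * z) ` cell_corners 0 i j"
    unfolding cells_def scale_corners by auto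
  then show "t \<in> (`) (\<lambda>z. 2 ^ M * z) ` cells 0" unfolding cells_def by auto
next
  fix t assume "t \<in> (`) (\<lambda>z. 2 ^ M * z) ` cells 0"
  then obtain i j where "cell i j" "t = cell_corners M i j"
    by (auto simp: cells_def scale_corners)
  then show "t \<in> cells M" unfolding cells_def by auto
qed

lemma gasket_vertices_eq: "gasket_vertices M = \<Union> (cells M)"
proof -
  have eq: "pre_vertices N \<union> y_reflect ` pre_vertices N =
      (\<Union>(i, j)\<in>pre_cells N. cell_corners 0 i j) \<union>
      (\<Union>(i, j)\<in>pre_cells N. cell_corners 0 i (- (i + j) - 1))" for N
    by (simp only: pre_vertices_eq image_UN case_prod_beta' reflect_corners)
  have "gasket_vertices M = (\<lambda>z. 2 ^ M * z) ` (\<Union>t\<in>cells 0. t)"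
    unfolding gasket_vertices_def eq union_pre_cells[of "\<lambda>t. t"] ..
  also have "\<dots> = \<Union> (cells M)"
    by (simp add: cells_scale[of M] image_Union)
  finally show ?thesis .
qed

lemma gasket_edges_eq: "gasket_edges M = (\<Union>t\<in>cells M. edges_of t)"
proof -
  have inj: "inj y_reflect" "inj (\<lambda>z::complex. 2 ^ M * z)"
    by (simp add: inj_def y_reflect_def complex_eq_iff) (simp add: inj_def)
  have eq: "pre_edges N \<union> (`) y_reflect ` pre_edges N =
      (\<Union>(i, j)\<in>pre_cells N. edges_of (cell_corners 0 i j)) \<union>
      (\<Union>(i, j)\<in>pre_cells N. edges_of (cell_corners 0 i (- (i + j) - 1)))" for N
    by (simp only: pre_edges_eq image_UN case_prod_beta' reflect_corners edges_of_image[OF inj(1)])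
  have "gasket_edges M = (`) (\<lambda>z. 2 ^ M * z) ` (\<Union>t\<in>cells 0. edges_of t)"
    unfolding gasket_edges_def eq union_pre_cells[of edges_of] ..
  also have "\<dots> = (\<Union>t\<in>cells M. edges_of t)"
    by (simp add: cells_scale[of M] image_UN edges_of_image[OF inj(2)])
  finally show ?thesis .
qed

lemma pre_cells_Suc_iff:
  "(i, j) \<in> pre_cells (Suc N) \<longleftrightarrow>
     (i div 2, j div 2) \<in> pre_cells N \<and> \<not> (odd i \<and> odd j)"
proof (induction N arbitrary: i j)
  case 0
  have "(i, j) \<in> pre_cells (Suc 0) \<longleftrightarrow> (i, j) \<in> {(0, 0), (1, 0), (0, 1)}" by auto
  also have "\<dots> \<longleftrightarrow> i div 2 = 0 \<and> j div 2 = 0 \<and> \<not> (odd i \<and> odd j)"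
    unfolding insert_iff empty_iff prod.inject by presburger
  finally show ?case by simp
next
  case (Suc N)
  have A: "(i, j) \<in> pre_cells (Suc n) \<longleftrightarrow> (i, j) \<in> pre_cells n \<or>
      (i - 2 ^ n, j) \<in> pre_cells n \<or> (i, j - 2 ^ n) \<in> pre_cells n" for n i j
  proof -
    have "(i, j) \<in> (\<lambda>(i, j). (i + 2 ^ n, j)) ` pre_cells n \<longleftrightarrow> (i - 2 ^ n, j) \<in> pre_cells n"
      by (auto intro: rev_image_eqI)
    moreover have "(i, j) \<in> (\<lambda>(i, j). (i, j + 2 ^ n)) ` pre_cells n \<longleftrightarrow> (i, j - 2 ^ n) \<in> pre_cells n"
      by (auto intro: rev_image_eqI)
    ultimately show ?thesis by (simp only: pre_cells.simps Un_iff disj_assoc)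
  qed
  have D': "(k - 2 * m) div 2 = k div 2 - m" "odd (k - 2 * m) = odd k" for k m :: int
    by presburger+
  have D: "(k - 2 ^ Suc N) div 2 = k div 2 - 2 ^ N" "odd (k - 2 ^ Suc N) = odd k" for k :: int
    unfolding power_Suc by (rule D')+
  have "(i, j) \<in> pre_cells (Suc (Suc N)) \<longleftrightarrow>
      ((i div 2, j div 2) \<in> pre_cells N \<or> (i div 2 - 2 ^ N, j div 2) \<in> pre_cells N \<or>
       (i div 2, j div 2 - 2 ^ N) \<in> pre_cells N) \<and> \<not> (odd i \<and> odd j)"
    unfolding A[of i j "Suc N"] Suc D by blast
  also have "\<dots> \<longleftrightarrow> (i div 2, j div 2) \<in> pre_cells (Suc N) \<and> \<not> (odd i \<and> odd j)"
    unfolding A[of "i div 2" "j div 2" N] ..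
  finally show ?case .
qed

lemma cell_rec: "cell i j \<longleftrightarrow> cell (i div 2) (j div 2) \<and> \<not> (odd i \<and> odd j)"
proof -
  have "cell i j \<longleftrightarrow> (\<exists>N. (i, j) \<in> pre_cells (Suc N) \<or> (i, - (i + j) - 1) \<in> pre_cells (Suc N))"
    unfolding cell_iff_ge1
  proof (intro iffI; elim exE conjE)
    fix N :: nat assume "1 \<le> N" "(i, j) \<in> pre_cells N \<or> (i, - (i + j) - 1) \<in> pre_cells N"
    then show "\<exists>N. (i, j) \<in> pre_cells (Suc N) \<or> (i, - (i + j) - 1) \<in> pre_cells (Suc N)"
      by (intro exI[of _ "N - 1"]) simp
  next
    fix N assume "(i, j) \<in> pre_cells (Suc N) \<or> (i, - (i + j) - 1) \<in> pre_cells (Suc N)"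
    then show "\<exists>N\<ge>1. (i, j) \<in> pre_cells N \<or> (i, - (i + j) - 1) \<in> pre_cells N"
      by (intro exI[of _ "Suc N"]) (simp del: pre_cells.simps)
  qed
  also have "\<dots> \<longleftrightarrow> cell (i div 2) (j div 2) \<and> \<not> (odd i \<and> odd j)"
  proof (cases "odd i \<and> odd j")
    case True
    then show ?thesis by (simp add: pre_cells_Suc_iff del: pre_cells.simps)
  next
    case False
    then have "(- (i + j) - 1) div 2 = - (i div 2 + j div 2) - 1" "\<not> (odd i \<and> odd (- (i + j) - 1))"
      by presburger+
    with False show ?thesis
      by (auto simp add: pre_cells_Suc_iff cell_def simp del: pre_cells.simps)
  qed
  finally show ?thesis .
qed

lemma cell_nonneg: "cell i j \<Longrightarrow> 0 \<le> i"
  using pre_cells_nonneg by (auto simp: cell_def)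

lemma cell_origin: "cell 0 0" "cell 0 (-1)" "\<not> cell (-1) 0"
proof -
  have "(0, 0) \<in> pre_cells 0" by simp
  then show "cell 0 0" unfolding cell_def by blast
  have "(0, - (0 + - 1) - 1) \<in> pre_cells 0" by simp
  then show "cell 0 (-1)" unfolding cell_def by blast
  show "\<not> cell (-1) 0" using cell_nonneg[of "-1" 0] by auto
qed

text \<open>The three cells that could contain a lattice point are halved by the parent map. A point
  with an odd coordinate lies in two sibling cells or in none, and the count for a point with
  even coordinates equals the count for its half, down to the origin.\<close>

lemma cells_at_point:
  "(\<not> cell i j \<and> \<not> cell (i - 1) j \<and> \<not> cell i (j - 1)) \<or>
   (cell i j \<and> cell (i - 1) j \<and> \<not> cell i (j - 1)) \<or>
   (cell i j \<and> \<not> cell (i - 1) j \<and> cell i (j - 1)) \<or>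
   (\<not> cell i j \<and> cell (i - 1) j \<and> cell i (j - 1))"
proof (induction "nat \<bar>i\<bar> + nat \<bar>j\<bar>" arbitrary: i j rule: less_induct)
  case less
  show ?case
  proof (cases "i = 0 \<and> j = 0")
    case True
    then show ?thesis using cell_origin by simp
  next
    case False
    note rec = cell_rec[of i j] cell_rec[of "i - 1" j] cell_rec[of i "j - 1"]
    consider (ee) "even i" "even j" | (oe) "odd i" "even j" | (eo) "even i" "odd j"
      | (oo) "odd i" "odd j" by blast
    then show ?thesis
    proof cases
      case ee
      obtain k l where kl: "i = 2 * k" "j = 2 * l" using ee by (auto elim!: evenE)
      have "nat \<bar>i div 2\<bar> + nat \<bar>j div 2\<bar> < nat \<bar>i\<bar> + nat \<bar>j\<bar>" 
      proof -
        have "nat \<bar>2 * m\<bar> = 2 * nat \<bar>m\<bar>" for m :: int by (simp add: abs_mult nat_mult_distrib)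
        moreover have "nat \<bar>k\<bar> + nat \<bar>l\<bar> > 0" using False kl by auto
        ultimately show ?thesis by (auto simp: kl)
      qed
      note IH = less[OF this]
      have "(i - 1) div 2 = i div 2 - 1" "(j - 1) div 2 = j div 2 - 1" using ee by presburger+
      then show ?thesis using IH ee unfolding rec by auto
    next
      case oe
      then have "(i - 1) div 2 = i div 2" by presburger
      then show ?thesis using oe unfolding rec by auto
    next
      case eo
      then have "(j - 1) div 2 = j div 2" by presburger
      then show ?thesis using eo unfolding rec by auto
    next
      case oo
      then have "(i - 1) div 2 = i div 2" "(j - 1) div 2 = j div 2" by presburger+
      then show ?thesis using oo unfolding rec by auto
    qed
  qed
qed

section \<open>Incidence geometry of the cells\<close>

definition lpoint :: "nat \<Rightarrow> int \<Rightarrow> int \<Rightarrow> complex" where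
  "lpoint N i j = lat (2 ^ N * of_int i) (2 ^ N * of_int j)"

lemma lpoint_eq_iff [simp]: "lpoint N i j = lpoint N i' j' \<longleftrightarrow> i = i' \<and> j = j'"
  by (simp add: lpoint_def)

lemma cell_corners_lpoint: "cell_corners N i j = {lpoint N i j, lpoint N (i + 1) j, lpoint N i (j + 1)}"
  by (simp add: cell_corners_def lpoint_def)

lemma lpoint_Suc: "lpoint (Suc N) i j = lpoint N (2 * i) (2 * j)"
  by (simp add: lpoint_def)

lemma lpoint_Suc_eq_iff [simp]:
  "lpoint (Suc N) i j = lpoint N k l \<longleftrightarrow> k = 2 * i \<and> l = 2 * j"
  "lpoint N k l = lpoint (Suc N) i j \<longleftrightarrow> k = 2 * i \<and> l = 2 * j"
  by (auto simp: lpoint_Suc)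

lemma lpoint_midpoint:
  "midpoint (lpoint (Suc N) i j) (lpoint (Suc N) i' j') = lpoint N (i + i') (j + j')"
  by (simp add: midpoint_def lpoint_def lat_add lat_scaleR algebra_simps)

definition adjacent :: "nat \<Rightarrow> complex \<Rightarrow> complex \<Rightarrow> bool" where
  "adjacent N x y \<longleftrightarrow> x \<noteq> y \<and> (\<exists>t\<in>cells N. x \<in> t \<and> y \<in> t)"

lemma gasket_edge_iff: "{x, y} \<in> gasket_edges N \<longleftrightarrow> adjacent N x y"
  unfolding gasket_edges_eq edges_of_def adjacent_def by (auto simp: doubleton_eq_iff)

lemma adjacent_commute: "adjacent N x y \<longleftrightarrow> adjacent N y x"
  unfolding adjacent_def by blast

lemma adjacent_vertices:
  "adjacent N x y \<Longrightarrow> x \<in> gasket_vertices N" "adjacent N x y \<Longrightarrow> y \<in> gasket_vertices N"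
  unfolding adjacent_def gasket_vertices_eq by blast+

lemma cells_cases:
  assumes "t \<in> cells N"
  obtains i j where "cell i j" "t = {lpoint N i j, lpoint N (i + 1) j, lpoint N i (j + 1)}"
  using assms unfolding cells_def cell_corners_lpoint by blast

lemma vertex_cases:
  assumes "x \<in> gasket_vertices N"
  obtains i j where "x = lpoint N i j"
  using assms unfolding gasket_vertices_eq by (auto elim!: cells_cases)

lemma cells_eqI:
  assumes "t \<in> cells N" "t' \<in> cells N" "x \<in> t" "y \<in> t" "x \<in> t'" "y \<in> t'" "x \<noteq> y"
  shows "t = t'"
  using assms by (elim cells_cases) auto

lemma cell_third_corner:
  assumes "t \<in> cells N" "x \<in> t" "y \<in> t" "x \<noteq> y"
  obtains z where "t = {x, y, z}" "z \<noteq> x" "z \<noteq> y"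
  using assms(1)
proof (rule cells_cases)
  fix i j assume t: "t = {lpoint N i j, lpoint N (i + 1) j, lpoint N i (j + 1)}"
  have "\<exists>z. t = {x, y, z} \<and> z \<noteq> x \<and> z \<noteq> y"
    using assms(2-4) unfolding t by (elim insertE emptyE; simp; fastforce)
  then show thesis using that by blast
qed

lemma cell_other_corners:
  assumes "t \<in> cells N" "x \<in> t"
  obtains y z where "t = {x, y, z}" "y \<noteq> x" "z \<noteq> x" "y \<noteq> z"
proof -
  obtain i j where "cell i j" "t = {lpoint N i j, lpoint N (i + 1) j, lpoint N i (j + 1)}"
    using assms(1) by (rule cells_cases)
  then have "lpoint N i j \<in> t" "lpoint N (i + 1) j \<in> t" "lpoint N i j \<noteq> lpoint N (i + 1) j" by auto
  then obtain y where y: "y \<in> t" "x \<noteq> y" by blast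
  obtain z where "t = {x, y, z}" "z \<noteq> x" "z \<noteq> y"
    using assms y by (rule cell_third_corner)
  then show thesis using y(2) by (intro that[of y z]) auto
qed

lemma cells_containing_lpoint:
  "u \<in> cells N \<and> lpoint N i j \<in> u \<longleftrightarrow>
     (\<exists>(k, l)\<in>{(i, j), (i - 1, j), (i, j - 1)}. cell k l \<and> u = cell_corners N k l)"
proof
  assume "u \<in> cells N \<and> lpoint N i j \<in> u"
  then obtain k l where "cell k l" "u = cell_corners N k l" "lpoint N i j \<in> cell_corners N k l"
    unfolding cells_def by auto
  moreover from this(3) have "(k, l) \<in> {(i, j), (i - 1, j), (i, j - 1)}"
    by (auto simp: cell_corners_lpoint)
  ultimately show "\<exists>(k, l)\<in>{(i, j), (i - 1, j), (i, j - 1)}. cell k l \<and> u = cell_corners N k l"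
    by blast
next
  assume "\<exists>(k, l)\<in>{(i, j), (i - 1, j), (i, j - 1)}. cell k l \<and> u = cell_corners N k l"
  then obtain k l where kl: "(k, l) \<in> {(i, j), (i - 1, j), (i, j - 1)}" "cell k l" "u = cell_corners N k l"
    by blast
  then have "u \<in> cells N" unfolding cells_def by blast
  moreover have "lpoint N i j \<in> u" using kl(1,3) by (auto simp: cell_corners_lpoint)
  ultimately show "u \<in> cells N \<and> lpoint N i j \<in> u" ..
qed

lemma cell_corners_inj: "cell_corners N i j = cell_corners N k l \<longleftrightarrow> i = k \<and> j = l"
proof
  assume eq: "cell_corners N i j = cell_corners N k l"
  have "lpoint N i j \<in> cell_corners N i j" "lpoint N k l \<in> cell_corners N k l"
    by (simp_all add: cell_corners_lpoint)
  then have "lpoint N i j \<in> cell_corners N k l" "lpoint N k l \<in> cell_corners N i j"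
    using eq by simp_all
  then show "i = k \<and> j = l" by (auto simp: cell_corners_lpoint)
qed simp

lemma cells_at_vertex:
  assumes "x \<in> gasket_vertices N"
  obtains t t' where "t \<noteq> t'" "{u \<in> cells N. x \<in> u} = {t, t'}"
proof -
  obtain i j where x: "x = lpoint N i j" using assms by (rule vertex_cases)
  have "\<exists>u. u \<in> cells N \<and> lpoint N i j \<in> u" using assms x by (auto simp: gasket_vertices_eq)
  then have "cell i j \<or> cell (i - 1) j \<or> cell i (j - 1)"
    unfolding cells_containing_lpoint by auto
  then consider "cell i j" "cell (i - 1) j" "\<not> cell i (j - 1)"
    | "cell i j" "\<not> cell (i - 1) j" "cell i (j - 1)"
    | "\<not> cell i j" "cell (i - 1) j" "cell i (j - 1)"
    using cells_at_point[of i j] by blast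
  then show thesis
  proof cases
    case 1
    then show thesis unfolding x cells_containing_lpoint
      by (intro that[of "cell_corners N i j" "cell_corners N (i - 1) j"])
        (auto simp: x cells_containing_lpoint cell_corners_inj)
  next
    case 2
    then show thesis unfolding x cells_containing_lpoint
      by (intro that[of "cell_corners N i j" "cell_corners N i (j - 1)"])
        (auto simp: x cells_containing_lpoint cell_corners_inj)
  next
    case 3
    then show thesis unfolding x cells_containing_lpoint
      by (intro that[of "cell_corners N (i - 1) j" "cell_corners N i (j - 1)"])
        (auto simp: x cells_containing_lpoint cell_corners_inj)
  qed
qed

lemma cell_at_vertex_other:
  assumes "t \<in> cells N" "x \<in> t"
  obtains t' where "t' \<in> cells N" "x \<in> t'" "t' \<noteq> t" "\<And>u. u \<in> cells N \<Longrightarrow> x \<in> u \<Longrightarrow> u = t \<or> u = t'"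
proof -
  have "x \<in> gasket_vertices N" using assms by (auto simp: gasket_vertices_eq)
  then obtain a b where ab: "a \<noteq> b" "{u \<in> cells N. x \<in> u} = {a, b}" by (rule cells_at_vertex)
  then have "t = a \<or> t = b" using assms by blast
  then show thesis
  proof
    assume "t = a" then show thesis using ab by (intro that[of b]) blast+
  next
    assume "t = b" then show thesis using ab by (intro that[of a]) blast+
  qed
qed

definition nodes :: "complex set \<Rightarrow> complex set" where
  "nodes t = {midpoint u v | u v. u \<in> t \<and> v \<in> t}"

definition subcell :: "complex set \<Rightarrow> complex \<Rightarrow> complex set" where
  "subcell t x = (\<lambda>u. midpoint x u) ` t"

lemma subcell_nodes: "x \<in> t \<Longrightarrow> subcell t x \<subseteq> nodes t"
  unfolding subcell_def nodes_def by blast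

lemma corners_nodes: "t \<subseteq> nodes t"
proof
  fix x assume "x \<in> t"
  then have "midpoint x x \<in> nodes t" unfolding nodes_def by blast
  then show "x \<in> nodes t" by simp
qed

lemma corner_in_subcell: "x \<in> t \<Longrightarrow> x \<in> subcell t x"
  unfolding subcell_def by (rule image_eqI[of _ _ x]) auto

lemma subcell_corners:
  "subcell (cell_corners (Suc N) i j) (lpoint (Suc N) i j) = cell_corners N (2 * i) (2 * j)"
  "subcell (cell_corners (Suc N) i j) (lpoint (Suc N) (i + 1) j) = cell_corners N (2 * i + 1) (2 * j)"
  "subcell (cell_corners (Suc N) i j) (lpoint (Suc N) i (j + 1)) = cell_corners N (2 * i) (2 * j + 1)"
  by (auto simp: subcell_def cell_corners_lpoint lpoint_midpoint algebra_simps)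

lemma subcell_in_cells:
  assumes "t \<in> cells (Suc N)" "x \<in> t"
  shows "subcell t x \<in> cells N"
proof -
  obtain i j where ij: "cell i j" "t = cell_corners (Suc N) i j"
    using assms(1) unfolding cells_def by blast
  have "cell (2 * i) (2 * j)" "cell (2 * i + 1) (2 * j)" "cell (2 * i) (2 * j + 1)"
    using ij(1) cell_rec[of "2 * i" "2 * j"] cell_rec[of "2 * i + 1" "2 * j"] cell_rec[of "2 * i" "2 * j + 1"]
    by simp_all
  moreover have "x \<in> {lpoint (Suc N) i j, lpoint (Suc N) (i + 1) j, lpoint (Suc N) i (j + 1)}"
    using assms(2) ij(2) by (simp add: cell_corners_lpoint)
  ultimately show ?thesis unfolding ij(2)
    using subcell_corners[of N i j] by (auto simp: cells_def)
qed

lemma parent_cell: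
  assumes "u \<in> cells N"
  obtains t x where "t \<in> cells (Suc N)" "x \<in> t" "u = subcell t x"
proof -
  obtain i j where ij: "cell i j" "u = cell_corners N i j"
    using assms unfolding cells_def by blast
  define k l where "k = i div 2" and "l = j div 2"
  have kl: "cell k l" "\<not> (odd i \<and> odd j)" using cell_rec[of i j] ij(1) by (auto simp: k_def l_def)
  have t: "cell_corners (Suc N) k l \<in> cells (Suc N)" using kl(1) unfolding cells_def by blast
  have "(i = 2 * k \<and> j = 2 * l) \<or> (i = 2 * k + 1 \<and> j = 2 * l) \<or> (i = 2 * k \<and> j = 2 * l + 1)"
    using kl(2) unfolding k_def l_def by presburger
  then consider "i = 2 * k" "j = 2 * l" | "i = 2 * k + 1" "j = 2 * l" | "i = 2 * k" "j = 2 * l + 1"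
    by blast
  then show thesis
  proof cases
    case 1
    then show thesis using that[OF t, of "lpoint (Suc N) k l"] subcell_corners(1)[of N k l] ij(2)
      by (simp add: cell_corners_lpoint)
  next
    case 2
    then show thesis using that[OF t, of "lpoint (Suc N) (k + 1) l"] subcell_corners(2)[of N k l] ij(2)
      by (simp add: cell_corners_lpoint)
  next
    case 3
    then show thesis using that[OF t, of "lpoint (Suc N) k (l + 1)"] subcell_corners(3)[of N k l] ij(2)
      by (simp add: cell_corners_lpoint)
  qed
qed

lemma gasket_vertices_Suc: "gasket_vertices (Suc N) \<subseteq> gasket_vertices N"
proof
  fix x assume "x \<in> gasket_vertices (Suc N)"
  then obtain t where "t \<in> cells (Suc N)" "x \<in> t" by (auto simp: gasket_vertices_eq)
  then show "x \<in> gasket_vertices N"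
    using subcell_in_cells corner_in_subcell by (fastforce simp: gasket_vertices_eq)
qed

text \<open>A node with an odd lattice coordinate reveals its cell by halving; the other nodes are
  corners.\<close>

lemma nodes_cell_corners:
  assumes "p \<in> nodes (cell_corners (Suc N) i j)"
  obtains k l where "p = lpoint N k l" "even k \<and> even l \<Longrightarrow> p \<in> cell_corners (Suc N) i j"
    "\<not> (even k \<and> even l) \<Longrightarrow> i = k div 2 \<and> j = l div 2"
proof -
  have "p \<in> {lpoint N (2*i) (2*j), lpoint N (2*i+1) (2*j), lpoint N (2*i) (2*j+1),
      lpoint N (2*i+2) (2*j), lpoint N (2*i+1) (2*j+1), lpoint N (2*i) (2*j+2)}"
    using assms unfolding nodes_def cell_corners_lpoint
    by (auto simp: lpoint_midpoint algebra_simps)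
  then obtain k l where kl: "p = lpoint N k l" "(k, l) \<in> {(2*i, 2*j), (2*i+1, 2*j), (2*i, 2*j+1),
      (2*i+2, 2*j), (2*i+1, 2*j+1), (2*i, 2*j+2)}" by blast
  show thesis
  proof (rule that[OF kl(1)])
    show "p \<in> cell_corners (Suc N) i j" if "even k \<and> even l"
      using kl that by (auto simp: cell_corners_lpoint)
    show "i = k div 2 \<and> j = l div 2" if "\<not> (even k \<and> even l)"
      using kl(2) that by auto
  qed
qed

lemma nodes_inter:
  assumes "t \<in> cells (Suc N)" "t' \<in> cells (Suc N)" "t \<noteq> t'" "p \<in> nodes t" "p \<in> nodes t'"
  shows "p \<in> t \<and> p \<in> t'"
proof -
  obtain i j where t: "t = cell_corners (Suc N) i j" using assms(1) unfolding cells_def by blast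
  obtain i' j' where t': "t' = cell_corners (Suc N) i' j'" using assms(2) unfolding cells_def by blast
  obtain k l where p: "p = lpoint N k l" "even k \<and> even l \<Longrightarrow> p \<in> t"
    "\<not> (even k \<and> even l) \<Longrightarrow> i = k div 2 \<and> j = l div 2"
    using nodes_cell_corners[OF assms(4)[unfolded t], folded t] by metis
  obtain k' l' where p': "p = lpoint N k' l'" "even k' \<and> even l' \<Longrightarrow> p \<in> t'"
    "\<not> (even k' \<and> even l') \<Longrightarrow> i' = k' div 2 \<and> j' = l' div 2"
    using nodes_cell_corners[OF assms(5)[unfolded t'], folded t'] by metis
  have "k' = k" "l' = l" using p(1) p'(1) by auto
  then show ?thesis using p p' assms(3) t t' by auto
qed

lemma midpoint_not_vertex:
  assumes "t \<in> cells (Suc N)" "x \<in> t" "y \<in> t" "x \<noteq> y"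
  shows "midpoint x y \<notin> gasket_vertices (Suc N)"
proof
  assume "midpoint x y \<in> gasket_vertices (Suc N)"
  then obtain k l where "midpoint x y = lpoint N (2 * k) (2 * l)"
    unfolding lpoint_Suc[symmetric] by (rule vertex_cases)
  with assms show False
    by (elim cells_cases) (auto simp: lpoint_midpoint; presburger)
qed

lemma node_vertex_corner:
  assumes "t \<in> cells (Suc N)" "p \<in> nodes t" "p \<in> gasket_vertices (Suc N)"
  shows "p \<in> t"
proof -
  obtain x y where "x \<in> t" "y \<in> t" "p = midpoint x y" using assms(2) unfolding nodes_def by blast
  with midpoint_not_vertex[OF assms(1)] assms(3) show ?thesis by (cases "x = y") auto
qed

lemma midpoint_in_subcell:
  assumes "t \<in> cells (Suc N)" "x \<in> t" "y \<in> t" "x \<noteq> y" "w \<in> t" "midpoint x y \<in> subcell t w"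
  shows "w = x \<or> w = y"
  using assms unfolding subcell_def by (elim cells_cases) (auto simp: lpoint_midpoint)

lemma cell_at_midpoint:
  assumes "t \<in> cells (Suc N)" "x \<in> t" "y \<in> t" "x \<noteq> y" "u \<in> cells N" "midpoint x y \<in> u"
  shows "u = subcell t x \<or> u = subcell t y"
proof -
  obtain t' w where t': "t' \<in> cells (Suc N)" "w \<in> t'" "u = subcell t' w"
    using assms(5) by (rule parent_cell)
  have "midpoint x y \<in> nodes t" using assms unfolding nodes_def by blast
  moreover have "midpoint x y \<in> nodes t'" using assms(6) t' subcell_nodes by blast
  ultimately have "t' = t"
    using nodes_inter[OF assms(1) t'(1)] midpoint_not_vertex[OF assms(1-4)] assms(1)
    by (auto simp: gasket_vertices_eq)
  then show ?thesis using midpoint_in_subcell[OF assms(1-4)] t' assms(6) by blast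
qed

lemma cell_at_coarse_vertex:
  assumes "x \<in> gasket_vertices (Suc N)" "u \<in> cells N" "x \<in> u"
  obtains t where "t \<in> cells (Suc N)" "x \<in> t" "u = subcell t x"
proof -
  obtain t w where t: "t \<in> cells (Suc N)" "w \<in> t" "u = subcell t w"
    using assms(2) by (rule parent_cell)
  then obtain v where v: "v \<in> t" "x = midpoint w v" using assms(3) by (auto simp: subcell_def)
  then have "w = v" using midpoint_not_vertex[OF t(1,2) v(1)] assms(1) by auto
  then show thesis using that t v by simp
qed

lemma adjacent_node:
  assumes "t \<in> cells (Suc N)" "p \<in> nodes t" "p \<notin> gasket_vertices (Suc N)" "adjacent N p q"
  shows "q \<in> nodes t"
proof -
  obtain x y where xy: "x \<in> t" "y \<in> t" "p = midpoint x y" using assms(2) unfolding nodes_def by blast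
  then have "x \<noteq> y" using assms(1,3) by (auto simp: gasket_vertices_eq)
  obtain u where "u \<in> cells N" "p \<in> u" "q \<in> u" using assms(4) unfolding adjacent_def by blast
  then show ?thesis
    using cell_at_midpoint[OF assms(1) xy(1,2) \<open>x \<noteq> y\<close>] xy subcell_nodes by blast
qed

lemma adjacent_coarse_vertex:
  assumes "x \<in> gasket_vertices (Suc N)" "adjacent N x q"
  obtains t y where "t \<in> cells (Suc N)" "x \<in> t" "y \<in> t" "y \<noteq> x" "q = midpoint x y"
proof -
  obtain u where u: "u \<in> cells N" "x \<in> u" "q \<in> u" "x \<noteq> q" using assms(2) unfolding adjacent_def by blast
  obtain t where "t \<in> cells (Suc N)" "x \<in> t" "u = subcell t x"
    using assms(1) u(1,2) by (rule cell_at_coarse_vertex)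
  with u that show thesis unfolding subcell_def by fastforce
qed

lemma adjacent_corner_midpoint:
  assumes "t \<in> cells (Suc N)" "x \<in> t" "y \<in> t" "x \<noteq> y"
  shows "adjacent N x (midpoint x y)"
proof -
  have "x \<noteq> midpoint x y" using assms(4) by (metis midpoint_eq_endpoint(1))
  moreover have "midpoint x y \<in> subcell t x" using assms unfolding subcell_def by blast
  ultimately show ?thesis
    using subcell_in_cells[OF assms(1,2)] corner_in_subcell[OF assms(2)] unfolding adjacent_def by blast
qed

lemma adjacent_midpoints:
  assumes "t \<in> cells (Suc N)" "x \<in> t" "y \<in> t" "z \<in> t" "y \<noteq> z"
  shows "adjacent N (midpoint x y) (midpoint x z)"
proof -
  have "midpoint x y \<in> subcell t x" "midpoint x z \<in> subcell t x" using assms unfolding subcell_def by blast+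
  moreover have "midpoint x y \<noteq> midpoint x z" using assms(5) by (simp add: midpoint_def)
  ultimately show ?thesis using subcell_in_cells[OF assms(1,2)] unfolding adjacent_def by blast
qed

lemma cell_between_nodes:
  assumes "t \<in> cells (Suc N)" "u \<in> cells N" "p \<in> u" "q \<in> u" "p \<noteq> q" "p \<in> nodes t" "q \<in> nodes t"
  shows "\<exists>w\<in>t. u = subcell t w"
proof -
  obtain t' w where t': "t' \<in> cells (Suc N)" "w \<in> t'" "u = subcell t' w"
    using assms(2) by (rule parent_cell)
  then have pq: "p \<in> nodes t'" "q \<in> nodes t'" using assms subcell_nodes by blast+
  have "t = t'"
  proof (rule ccontr)
    assume "t \<noteq> t'"
    then have "p \<in> t \<and> p \<in> t'" "q \<in> t \<and> q \<in> t'" using nodes_inter[OF assms(1) t'(1)] pq assms(6,7) by blast+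
    then show False using cells_eqI[OF assms(1) t'(1)] assms(5) \<open>t \<noteq> t'\<close> by blast
  qed
  then show ?thesis using t' by blast
qed

section \<open>Filled triangles\<close>

lemma hull_cell_corners:
  "convex hull (cell_corners N i j) =
     {lat (2 ^ N * (of_int i + a)) (2 ^ N * (of_int j + b)) | a b. 0 \<le> a \<and> 0 \<le> b \<and> a + b \<le> 1}"
proof -
  have "lat u v + a *\<^sub>R (lat u' v' - lat u v) + b *\<^sub>R (lat u'' v'' - lat u v) =
      lat (u + a * (u' - u) + b * (u'' - u)) (v + a * (v' - v) + b * (v'' - v))" for u v u' v' u'' v'' a b
    by (simp add: lat_def complex_eq_iff algebra_simps add_divide_distrib diff_divide_distrib)
  then show ?thesis
    unfolding cell_corners_def convex_hull_3_alt by (simp add: algebra_simps)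
qed

lemma hull_vertices:
  assumes "t \<in> cells N"
  shows "convex hull t \<inter> gasket_vertices N = t"
proof
  show "t \<subseteq> convex hull t \<inter> gasket_vertices N"
    using assms hull_subset[of t convex] by (auto simp: gasket_vertices_eq)
  show "convex hull t \<inter> gasket_vertices N \<subseteq> t"
  proof
    fix p assume p: "p \<in> convex hull t \<inter> gasket_vertices N"
    obtain i j where t: "t = cell_corners N i j" using assms unfolding cells_def by blast
    obtain k l where kl: "p = lpoint N k l" using p by (auto elim: vertex_cases)
    obtain a b :: real where ab: "0 \<le> a" "0 \<le> b" "a + b \<le> 1" "of_int k = of_int i + a" "of_int l = of_int j + b"
      using p unfolding t hull_cell_corners kl lpoint_def by auto
    then have "k \<ge> i" "l \<ge> j" "k + l \<le> i + j + 1" by linarith+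
    then have "(k = i \<and> l = j) \<or> (k = i + 1 \<and> l = j) \<or> (k = i \<and> l = j + 1)" by linarith
    then show "p \<in> t" unfolding t kl cell_corners_lpoint by auto
  qed
qed

lemma triangles_eq: "triangles N = (\<lambda>t. convex hull t) ` cells N"
proof -
  have corners: "cell_corners N i j =
      {lpoint N i j, lpoint N i j + vert_a N, lpoint N i j + vert_b N}" for i j
    by (simp add: cell_corners_def lpoint_def vert_a_lat vert_b_lat lat_add algebra_simps)
  have ne: "vert_a N \<noteq> 0" "vert_b N \<noteq> 0" "vert_a N \<noteq> vert_b N"
    by (simp_all add: vert_a_lat vert_b_lat zero_lat)
  have base: "{c, c + vert_a N, c + vert_b N} \<in> cells N" if "{c, c + vert_a N} \<in> gasket_edges N" for c
  proof -
    obtain i j where ij: "cell i j" "c \<in> cell_corners N i j" "c + vert_a N \<in> cell_corners N i j"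
    proof -
      obtain t where t: "t \<in> cells N" "c \<in> t" "c + vert_a N \<in> t"
        using \<open>{c, c + vert_a N} \<in> gasket_edges N\<close> unfolding gasket_edge_iff adjacent_def by blast
      obtain i j where "cell i j" "t = cell_corners N i j" using t(1) by (auto simp: cells_def)
      then show thesis using t that by blast
    qed
    then have "c = lpoint N i j"
      using zero_less_power[of "2::real" N] unfolding cell_corners_def lpoint_def
      by (auto simp: vert_a_lat lat_add algebra_simps)
    then show ?thesis using ij(1) corners[of i j] by (auto simp: cells_def)
  qed
  show ?thesis
  proof (intro equalityI subsetI)
    fix D assume "D \<in> triangles N"
    then show "D \<in> (\<lambda>t. convex hull t) ` cells N" unfolding triangles_def using base by blast
  next
    fix D assume "D \<in> (\<lambda>t. convex hull t) ` cells N"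
    then obtain i j where ij: "cell i j" "D = convex hull (cell_corners N i j)" unfolding cells_def by auto
    define c where "c = lpoint N i j"
    have c: "{c, c + vert_a N, c + vert_b N} \<in> cells N"
      using ij(1) corners[of i j] by (auto simp: cells_def c_def)
    have "{c, c + vert_a N, c + vert_b N} \<subseteq> gasket_vertices N" unfolding gasket_vertices_eq using c by blast
    moreover have "adjacent N c (c + vert_a N)" "adjacent N (c + vert_a N) (c + vert_b N)"
        "adjacent N (c + vert_b N) c"
      unfolding adjacent_def using ne by (intro conjI bexI[OF _ c]; simp)+
    ultimately show "D \<in> triangles N"
      unfolding triangles_def ij(2) corners[of i j] c_def[symmetric] gasket_edge_iff[symmetric]
      by (intro CollectI exI[of _ c] conjI refl) simp_all
  qed
qed

lemma triangle_of_eq: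
  assumes "t \<in> cells N" "x \<in> t" "y \<in> t" "x \<noteq> y"
  shows "triangle_of N x y = convex hull t"
  unfolding triangle_of_def
proof (rule the_equality)
  show "convex hull t \<in> triangles N \<and> x \<in> convex hull t \<and> y \<in> convex hull t"
    using assms(1) hull_inc[of x t convex] hull_inc[of y t convex] assms(2,3)
    unfolding triangles_eq by blast
next
  fix D assume "D \<in> triangles N \<and> x \<in> D \<and> y \<in> D"
  then obtain t' where t': "t' \<in> cells N" "D = convex hull t'" "x \<in> D" "y \<in> D" by (auto simp: triangles_eq)
  then have "x \<in> t'" "y \<in> t'"
    using hull_vertices[OF t'(1)] assms by (auto simp: gasket_vertices_eq)
  then show "D = convex hull t" using cells_eqI[OF assms(1) t'(1)] assms t' by blast
qed

lemma triangle_of_eq_iff: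
  assumes "t \<in> cells N" "x \<in> t" "y \<in> t" "x \<noteq> y" "t' \<in> cells N" "x' \<in> t'" "y' \<in> t'" "x' \<noteq> y'"
  shows "triangle_of N x y = triangle_of N x' y' \<longleftrightarrow> t = t'"
  unfolding triangle_of_eq[OF assms(1-4)] triangle_of_eq[OF assms(5-8)]
  using hull_vertices[OF assms(1)] hull_vertices[OF assms(5)] by metis

lemma subcell_hull:
  assumes "x \<in> t"
  shows "convex hull (subcell t x) \<subseteq> convex hull t"
proof (rule hull_minimal)
  show "subcell t x \<subseteq> convex hull t"
  proof
    fix p assume "p \<in> subcell t x"
    then obtain u where "u \<in> t" "p = midpoint x u" by (auto simp: subcell_def)
    moreover have "midpoint x u \<in> convex hull t"
      using convexD_alt[of "convex hull t" x u "1/2"] assms calculation(1)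
      by (simp add: midpoint_def hull_inc scaleR_add_right)
    ultimately show "p \<in> convex hull t" by simp
  qed
qed (rule convex_convex_hull)

lemma norm_lat: "norm (lat u v) = sqrt (u * u + u * v + v * v)"
  unfolding cmod_def lat_def by (simp add: power2_eq_square algebra_simps)

lemma cell_side_length:
  assumes "t \<in> cells N" "x \<in> t" "y \<in> t" "x \<noteq> y"
  shows "dist x y = 2 ^ N"
proof -
  have diff: "lat u v - lat u' v' = lat (u - u') (v - v')" for u v u' v'
    by (simp add: lat_def complex_eq_iff algebra_simps diff_divide_distrib)
  show ?thesis
    using assms unfolding dist_norm
    by (elim cells_cases) (auto simp: lpoint_def diff norm_lat right_diff_distrib[symmetric])
qed

lemma norm_in_hull_le:
  assumes "t \<in> cells N" "0 \<in> t" "p \<in> convex hull t"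
  shows "norm p \<le> 2 ^ N"
proof -
  have "t \<subseteq> cball 0 (2 ^ N)"
  proof
    fix x assume "x \<in> t"
    then show "x \<in> cball 0 (2 ^ N)" using cell_side_length[OF assms(1,2)] by (cases "x = 0") auto
  qed
  then have "convex hull t \<subseteq> cball 0 (2 ^ N)" by (intro hull_minimal) auto
  then show ?thesis using assms(3) by auto
qed

text \<open>The two cells at the origin are those with coordinates \<open>(0, 0)\<close> and \<open>(0, -1)\<close>. Every other
  cell lies above the line through their top corners, or to the right or to the left of them.\<close>

lemma norm_in_hull_ge:
  assumes "t \<in> cells N" "0 \<notin> t" "p \<in> convex hull t"
  shows "norm p \<ge> sqrt 3 / 2 * 2 ^ N"
proof -
  obtain i j where ij: "cell i j" "t = cell_corners N i j" using assms(1) unfolding cells_def by blast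
  obtain a b :: real where ab: "0 \<le> a" "0 \<le> b" "a + b \<le> 1"
    and p: "p = lat (2 ^ N * (of_int i + a)) (2 ^ N * (of_int j + b))"
    using assms(3) unfolding ij(2) hull_cell_corners by auto
  have s: "0 \<le> sqrt 3 / 2 * 2 ^ N" "sqrt 3 / 2 * 2 ^ N \<le> (2::real) ^ N"
    by (simp_all add: real_le_lsqrt)
  have "i \<ge> 0" using cell_nonneg[OF ij(1)] .
  have ne: "\<not> (i = 0 \<and> j = 0)" "\<not> (i = 0 \<and> j = -1)"
    using assms(2) unfolding ij(2) cell_corners_def zero_lat by auto
  consider "i \<ge> 1" | "i = 0" "j \<ge> 1" | "i = 0" "j \<le> -2" using \<open>i \<ge> 0\<close> ne by linarith
  then show ?thesis
  proof cases
    case 1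
    then have "(1::real) \<le> of_int i" by linarith
    then have "1 \<le> of_int i + a" using ab(1) by linarith
    then have "sqrt 3 / 2 * 2 ^ N * 1 \<le> sqrt 3 / 2 * 2 ^ N * (of_int i + a)"
      using s(1) by (rule mult_left_mono)
    also have "\<dots> = Im p" by (simp add: p lat_def)
    also have "\<dots> \<le> norm p" using abs_Im_le_cmod[of p] by linarith
    finally show ?thesis by simp
  next
    case 2
    then have "(1::real) \<le> of_int j" by linarith
    then have "1 \<le> a / 2 + (of_int j + b)" using ab by linarith
    then have "(2::real) ^ N * 1 \<le> 2 ^ N * (a / 2 + (of_int j + b))" by (intro mult_left_mono) auto
    also have "\<dots> = Re p" using 2 by (simp add: p lat_def algebra_simps)
    also have "\<dots> \<le> norm p" using abs_Re_le_cmod[of p] by linarith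
    finally show ?thesis using s(2) by linarith
  next
    case 3
    then have "of_int j \<le> (-2::real)" by linarith
    then have "1 \<le> - (a / 2 + (of_int j + b))" using ab by linarith
    then have "(2::real) ^ N * 1 \<le> 2 ^ N * (- (a / 2 + (of_int j + b)))" by (intro mult_left_mono) auto
    also have "\<dots> = - Re p" using 3 by (simp add: p lat_def algebra_simps)
    also have "\<dots> \<le> norm p" using abs_Re_le_cmod[of p] by linarith
    finally show ?thesis using s(2) by linarith
  qed
qed

lemma origin_cell: "{0, vert_a N, vert_b N} \<in> cells N"
proof -
  have "{0, vert_a N, vert_b N} = cell_corners N 0 0"
    by (simp add: cell_corners_def vert_a_lat vert_b_lat zero_lat)
  then show ?thesis using cell_origin(1) by (auto simp: cells_def)
qed

section \<open>Chronological loop erasure of lists\<close>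

fun cutback :: "('a \<Rightarrow> 'v) \<Rightarrow> 'v \<Rightarrow> 'a list \<Rightarrow> 'a list" where
  "cutback e x [] = []"
| "cutback e x (s # ss) = (if x \<in> e ` set (s # ss) then cutback e x ss else s # ss)"

lemma length_cutback: "length (cutback e x ss) \<le> length ss"
  by (induction ss) auto

function lerase :: "('a \<Rightarrow> 'v) \<Rightarrow> 'v \<Rightarrow> 'a list \<Rightarrow> 'a list" where
  "lerase e x ss = (case cutback e x ss of [] \<Rightarrow> [] | s # r \<Rightarrow> s # lerase e (e s) r)"
  by pat_completeness auto
termination
proof (relation "Wellfounded.measure (\<lambda>(e, x, ss). length ss)")
  fix e :: "'a \<Rightarrow> 'v" and x :: 'v and ss s r
  assume "cutback e x ss = s # r"
  then show "((e, e s, r), (e, x, ss)) \<in> Wellfounded.measure (\<lambda>(e, x, ss). length ss)"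
    using length_cutback[of e x ss] by simp
qed simp

declare lerase.simps [simp del]

text \<open>Forward loop erasure of one more step: a revisited vertex truncates the path erased so far.\<close>

fun push :: "('a \<Rightarrow> 'v) \<Rightarrow> 'v \<Rightarrow> 'a list \<Rightarrow> 'a \<Rightarrow> 'a list" where
  "push e x [] s = (if e s = x then [] else [s])"
| "push e x (u # st) s = (if e s = x then [] else u # push e (e u) st s)"

lemma cutback_snoc:
  "cutback e x (ss @ [s]) = (if e s = x then [] else cutback e x ss @ [s])"
  by (induction ss) auto

lemma lerase_Nil [simp]: "lerase e x [] = []"
  by (simp add: lerase.simps)

lemma lerase_snoc: "lerase e x (ss @ [s]) = push e x (lerase e x ss) s"
proof (induction e x ss rule: lerase.induct)
  case (1 e x ss)
  show ?case
  proof (cases "cutback e x ss")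
    case Nil
    then show ?thesis
      by (simp add: lerase.simps[of e x "ss @ [s]"] lerase.simps[of e x ss] cutback_snoc)
  next
    case (Cons u r)
    then show ?thesis using 1[OF Cons]
      by (simp add: lerase.simps[of e x "ss @ [s]"] lerase.simps[of e x ss] cutback_snoc)
  qed
qed

lemma lerase_append: "lerase e x (ss @ rs) = foldl (push e x) (lerase e x ss) rs"
proof (induction rs rule: rev_induct)
  case (snoc s rs)
  then show ?case using lerase_snoc[of e x "ss @ rs" s] by simp
qed simp

lemma set_push: "set (push e x st s) \<subseteq> insert s (set st)"
  by (induction st arbitrary: x) auto

lemma last_push: "last (x # map e (push e x st s)) = e s"
  by (induction st arbitrary: x) auto

lemma last_lerase: "last (x # map e (lerase e x ss)) = last (x # map e ss)"
proof (induction ss rule: rev_induct)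
  case (snoc s ss)
  then show ?case by (simp add: lerase_snoc last_push del: last.simps) simp
qed simp

lemma push_distinct:
  "distinct (x # map e st) \<Longrightarrow> distinct (x # map e (push e x st s))"
  using set_push by (induction st arbitrary: x) (auto, fastforce)

lemma lerase_distinct: "distinct (x # map e (lerase e x ss))"
proof (induction ss rule: rev_induct)
  case (snoc s ss)
  then show ?case unfolding lerase_snoc by (rule push_distinct)
qed simp

lemma push_new: "e s \<notin> set (x # map e st) \<Longrightarrow> push e x st s = st @ [s]"
  by (induction st arbitrary: x) auto

lemma lerase_id: "distinct (x # map e ss) \<Longrightarrow> lerase e x ss = ss"
proof (induction ss rule: rev_induct)
  case (snoc s ss)
  then show ?case using push_new[of e s x ss] by (auto simp: lerase_snoc)
qed simp

lemma push_append:
  "e s \<notin> set (x # map e st) \<Longrightarrow> push e x (st @ out) s = st @ push e (last (x # map e st)) out s"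
  by (induction st arbitrary: x) auto

lemma set_push_old: "e s \<in> set (x # map e st) \<Longrightarrow> set (push e x (st @ out) s) \<subseteq> set st"
  by (induction st arbitrary: x) (cases out, auto)

lemma set_lerase: "set (lerase e x ss) \<subseteq> set ss"
proof (induction ss rule: rev_induct)
  case (snoc s ss)
  then show ?case using set_push[of e x "lerase e x ss" s] by (auto simp: lerase_snoc)
qed simp

lemma push_inj:
  assumes "inj_on f S" "x \<in> S" "s \<in> S" "set st \<subseteq> S"
  shows "push id (f x) (map f st) (f s) = map f (push id x st s)"
  using assms
proof (induction st arbitrary: x)
  case Nil
  then show ?case using inj_on_eq_iff[OF Nil(1), of s x] by simp
next
  case (Cons u st)
  then show ?case using inj_on_eq_iff[OF Cons.prems(1), of s x] by simp
qed

lemma lerase_inj: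
  assumes "inj_on f S" "x \<in> S" "set ss \<subseteq> S"
  shows "lerase id (f x) (map f ss) = map f (lerase id x ss)"
  using assms(3)
proof (induction ss rule: rev_induct)
  case (snoc s ss)
  then have "s \<in> S" "set (lerase id x ss) \<subseteq> S" "set ss \<subseteq> S" using set_lerase[of id x ss] by auto
  then show ?case
    by (simp only: map_append list.map lerase_snoc snoc.IH push_inj[OF assms(1,2)])
qed simp

text \<open>The suffixes that remain after each last visit, which the erasing times count.\<close>

primrec erase_suffix :: "('a \<Rightarrow> 'v) \<Rightarrow> 'v \<Rightarrow> 'a list \<Rightarrow> nat \<Rightarrow> 'a list" where
  "erase_suffix e x ss 0 = cutback e x ss"
| "erase_suffix e x ss (Suc i) =
     (case erase_suffix e x ss i of [] \<Rightarrow> [] | s # r \<Rightarrow> cutback e (e s) r)"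

lemma erase_suffix_shift:
  "cutback e x ss = s # r \<Longrightarrow> erase_suffix e x ss (Suc i) = erase_suffix e (e s) r i"
  by (induction i) auto

lemma lerase_eq_suffixes:
  "erase_suffix e x ss r = [] \<Longrightarrow> (\<And>i. i < r \<Longrightarrow> erase_suffix e x ss i \<noteq> []) \<Longrightarrow>
   lerase e x ss = map (\<lambda>i. hd (erase_suffix e x ss i)) [0..<r]"
proof (induction r arbitrary: x ss)
  case 0
  then show ?case by (simp add: lerase.simps)
next
  case (Suc r)
  from Suc.prems(2)[of 0] obtain s q where sq: "cutback e x ss = s # q" by (auto simp: neq_Nil_conv)
  note shift = erase_suffix_shift[OF sq]
  have "lerase e (e s) q = map (\<lambda>i. hd (erase_suffix e (e s) q i)) [0..<r]"
  proof (rule Suc.IH)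
    show "erase_suffix e (e s) q r = []" using Suc.prems(1) shift by simp
    show "erase_suffix e (e s) q i \<noteq> []" if "i < r" for i
      using Suc.prems(2)[of "Suc i"] shift that by simp
  qed
  then have "lerase e x ss = s # map (\<lambda>i. hd (erase_suffix e x ss (Suc i))) [0..<r]"
    using sq shift by (simp add: lerase.simps[of e x ss])
  also have "\<dots> = map (\<lambda>i. hd (erase_suffix e x ss i)) (0 # map Suc [0..<r])"
    using sq by (simp add: o_def)
  also have "0 # map Suc [0..<r] = [0..<Suc r]" by (simp add: map_Suc_upt upt_conv_Cons del: upt_Suc)
  finally show ?case .
qed

lemma length_erase_suffix: "length (erase_suffix e x ss i) \<le> length ss - i"
proof (induction i)
  case (Suc i)
  then show ?case
  proof (cases "erase_suffix e x ss i")
    case (Cons s r)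
    then show ?thesis using Suc length_cutback[of e "e s" r] by simp
  qed simp
qed (simp add: length_cutback)

lemma cutback_eq_drop:
  "cutback e x ss = drop (Max {j. j \<le> length ss \<and> (x # map e ss) ! j = x}) ss"
proof (induction ss)
  case Nil
  then show ?case by simp
next
  case (Cons s ss)
  define S where "S = {j. j \<le> length ss \<and> (e s # map e ss) ! j = x}"
  have fin: "finite S" unfolding S_def by simp
  have old: "{j. j \<le> length (s # ss) \<and> (x # map e (s # ss)) ! j = x} = insert 0 (Suc ` S)"
  proof (intro set_eqI iffI)
    fix j assume "j \<in> {j. j \<le> length (s # ss) \<and> (x # map e (s # ss)) ! j = x}"
    then show "j \<in> insert 0 (Suc ` S)" by (cases j) (auto simp: S_def)
  qed (auto simp: S_def)
  have new: "{j. j \<le> length ss \<and> (x # map e ss) ! j = x} = insert 0 (S - {0})"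
  proof (intro set_eqI iffI)
    fix j assume "j \<in> {j. j \<le> length ss \<and> (x # map e ss) ! j = x}"
    then show "j \<in> insert 0 (S - {0})" by (cases j) (auto simp: S_def)
  next
    fix j assume "j \<in> insert 0 (S - {0})"
    then show "j \<in> {j. j \<le> length ss \<and> (x # map e ss) ! j = x}" by (cases j) (auto simp: S_def)
  qed
  have iff: "x \<in> e ` set (s # ss) \<longleftrightarrow> S \<noteq> {}"
  proof
    assume "x \<in> e ` set (s # ss)"
    then have "x \<in> set (map e (s # ss))" by simp
    then obtain j where "j < length (map e (s # ss))" "map e (s # ss) ! j = x"
      unfolding in_set_conv_nth by blast
    then have "j \<in> S" by (simp add: S_def)
    then show "S \<noteq> {}" by blast
  next
    assume "S \<noteq> {}"
    then obtain j where "j \<le> length ss" "map e (s # ss) ! j = x" by (auto simp: S_def)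
    then have "x \<in> set (map e (s # ss))" using nth_mem[of j "map e (s # ss)"] by simp
    then show "x \<in> e ` set (s # ss)" by simp
  qed
  show ?case
  proof (cases "S = {}")
    case True
    then show ?thesis using iff unfolding old by simp
  next
    case False
    have "Max (insert 0 (Suc ` S)) = Suc (Max S)"
      using fin False mono_Max_commute[of Suc S] by (simp add: mono_def)
    moreover have "Max (insert 0 (S - {0})) = Max S"
    proof (rule Max_eqI[symmetric, THEN sym])
      show "finite (insert 0 (S - {0}))" using fin by simp
      show "y \<le> Max S" if "y \<in> insert 0 (S - {0})" for y using that fin by auto
      show "Max S \<in> insert 0 (S - {0})" using Max_in[OF fin False] by auto
    qed
    ultimately show ?thesis using Cons.IH iff False unfolding old new by simp
  qed
qed

section \<open>Grouping a list into runs of equal keys\<close>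

function runs :: "('a \<Rightarrow> 'k) \<Rightarrow> 'a list \<Rightarrow> 'a list list" where
  "runs f [] = []"
| "runs f (s # ss) = (s # takeWhile (\<lambda>u. f u = f s) ss) # runs f (dropWhile (\<lambda>u. f u = f s) ss)"
  by pat_completeness auto
termination
  by (relation "Wellfounded.measure (\<lambda>(f, ss). length ss)") (auto simp: le_imp_less_Suc length_dropWhile_le)

lemma concat_runs [simp]: "concat (runs f ss) = ss"
  by (induction f ss rule: runs.induct) auto

lemma runs_nonempty: "g \<in> set (runs f ss) \<Longrightarrow> g \<noteq> []"
  by (induction f ss rule: runs.induct) auto

lemma runs_key: "g \<in> set (runs f ss) \<Longrightarrow> s \<in> set g \<Longrightarrow> f s = f (hd g)"
  by (induction f ss rule: runs.induct) (auto dest: set_takeWhileD)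

lemma runs_drop: "runs f (concat (drop i (runs f ss))) = drop i (runs f ss)"
proof (induction f ss arbitrary: i rule: runs.induct)
  case (2 f s ss)
  show ?case
  proof (cases i)
    case 0
    then show ?thesis using concat_runs[of f "s # ss"] by (simp del: concat.simps)
  next
    case (Suc i')
    then show ?thesis using 2 by simp
  qed
qed simp

lemma runs_singleton: "(\<And>s. s \<in> set ss \<Longrightarrow> f s = k) \<Longrightarrow> ss \<noteq> [] \<Longrightarrow> runs f ss = [ss]"
proof (cases ss)
  case (Cons s r)
  assume "\<And>s. s \<in> set ss \<Longrightarrow> f s = k"
  then have "\<forall>u\<in>set r. f u = f s" using Cons by simp
  then have "takeWhile (\<lambda>u. f u = f s) r = r" "dropWhile (\<lambda>u. f u = f s) r = []" by auto
  then show ?thesis unfolding Cons by (simp only: runs.simps)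
qed simp

lemma runs_append:
  assumes "ss = [] \<or> rs = [] \<or> f (last ss) \<noteq> f (hd rs)"
  shows "runs f (ss @ rs) = runs f ss @ runs f rs"
  using assms
proof (induction f ss rule: runs.induct)
  case (2 f s ss)
  let ?P = "\<lambda>u. f u = f s"
  show ?case
  proof (cases "\<forall>u\<in>set ss. ?P u")
    case True
    then have all: "takeWhile ?P (ss @ rs) = ss @ takeWhile ?P rs" "dropWhile ?P (ss @ rs) = dropWhile ?P rs"
      "takeWhile ?P ss = ss" "dropWhile ?P ss = []" by auto
    have "rs = [] \<or> \<not> ?P (hd rs)" using 2(2) True by (cases "ss = []") auto
    then have "takeWhile ?P rs = []" "dropWhile ?P rs = rs" by (cases rs; auto)+
    then show ?thesis by (simp only: append_Cons runs.simps all append_Nil2 append_Nil)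
  next
    case False
    then obtain u where u: "u \<in> set ss" "\<not> ?P u" by blast
    then have d: "dropWhile ?P ss \<noteq> []" by auto
    have "takeWhile ?P (ss @ rs) = takeWhile ?P ss" "dropWhile ?P (ss @ rs) = dropWhile ?P ss @ rs"
      using u by (simp_all add: takeWhile_append1 dropWhile_append1)
    moreover have "last (dropWhile ?P ss) = last (s # ss)"
    proof -
      have "last (dropWhile ?P ss) = last (takeWhile ?P ss @ dropWhile ?P ss)"
        using d by (rule last_appendR[symmetric])
      also have "\<dots> = last ss" by (simp only: takeWhile_dropWhile_id)
      finally show ?thesis using u(1) by auto
    qed
    ultimately show ?thesis using 2 by simp
  qed
qed simp

lemma runs_map: "map (map f) (runs (k \<circ> f) ss) = runs k (map f ss)"
  by (induction "k \<circ> f" ss rule: runs.induct) (simp_all add: takeWhile_map dropWhile_map o_def)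

lemma runs_cong:
  "(\<And>s u. s \<in> set ss \<Longrightarrow> u \<in> set ss \<Longrightarrow> f s = f u \<longleftrightarrow> g s = g u) \<Longrightarrow> runs f ss = runs g ss"
proof (induction f ss rule: runs.induct)
  case (2 f s ss)
  have "takeWhile (\<lambda>u. f u = f s) ss = takeWhile (\<lambda>u. g u = g s) ss"
    "dropWhile (\<lambda>u. f u = f s) ss = dropWhile (\<lambda>u. g u = g s) ss"
    using 2(2) by (auto intro: takeWhile_cong dropWhile_cong)
  moreover have "runs f (dropWhile (\<lambda>u. f u = f s) ss) = runs g (dropWhile (\<lambda>u. f u = f s) ss)"
    by (rule 2(1)) (use 2(2) in \<open>auto dest!: set_dropWhileD\<close>)
  ultimately show ?case by simp
qed simp

section \<open>Paths as chains of coarse steps\<close>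

lemma is_walk_successively:
  "is_walk w \<longleftrightarrow> w \<noteq> [] \<and> set w \<subseteq> gasket_vertices 0 \<and> successively (adjacent 0) w"
  unfolding is_walk_def successively_conv_nth wlen_def gasket_edge_iff
  by (auto simp: less_diff_conv)

text \<open>The paths that a single step of the level \<open>N\<close> skeleton stands for: they run from \<open>x\<close> to \<open>y\<close>
  and meet no other vertex of that level before \<open>y\<close>.\<close>

definition step_walks :: "nat \<Rightarrow> complex \<Rightarrow> complex \<Rightarrow> walk set" where
  "step_walks N x y = {w. is_walk w \<and> 2 \<le> length w \<and> hd w = x \<and> last w = y \<and>
     x \<in> gasket_vertices N \<and> y \<in> gasket_vertices N \<and> y \<noteq> x \<and>
     (\<forall>i. 0 < i \<longrightarrow> i < wlen w \<longrightarrow> w ! i \<in> gasket_vertices N \<longrightarrow> w ! i = x)}"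

fun chain :: "nat \<Rightarrow> complex \<Rightarrow> walk list \<Rightarrow> bool" where
  "chain N x [] \<longleftrightarrow> True"
| "chain N x (s # ss) \<longleftrightarrow> s \<in> step_walks N x (last s) \<and> chain N (last s) ss"

abbreviation vertex_at :: "complex \<Rightarrow> walk list \<Rightarrow> nat \<Rightarrow> complex" where
  "vertex_at x ss i \<equiv> (x # map last ss) ! i"

definition time_at :: "walk list \<Rightarrow> nat \<Rightarrow> nat" where
  "time_at ss i = sum_list (map wlen (take i ss))"

lemma step_walksD:
  assumes "w \<in> step_walks N x y"
  shows "is_walk w" "2 \<le> length w" "hd w = x" "last w = y" "x \<in> gasket_vertices N"
    "y \<in> gasket_vertices N" "y \<noteq> x" "w \<noteq> []"
    "\<And>i. 0 < i \<Longrightarrow> i < wlen w \<Longrightarrow> w ! i \<in> gasket_vertices N \<Longrightarrow> w ! i = x"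
  using assms unfolding step_walks_def by auto

lemma chain_ConsD:
  assumes "chain N x (s # ss)"
  shows "s \<noteq> []" "hd s = x" "2 \<le> length s" "length (butlast s) = wlen s" "0 < wlen s" "chain N (last s) ss"
  using assms step_walksD(2,3,8)[of s N x "last s"] by (auto simp: wlen_def)

lemma chain_append: "chain N x (ss @ rs) \<longleftrightarrow> chain N x ss \<and> chain N (last (x # map last ss)) rs"
  by (induction ss arbitrary: x) auto

lemma chain_nth:
  "chain N x ss \<Longrightarrow> i < length ss \<Longrightarrow> ss ! i \<in> step_walks N (vertex_at x ss i) (vertex_at x ss (Suc i))"
proof (induction ss arbitrary: x i)
  case (Cons s ss)
  then show ?case by (cases i) auto
qed simp

lemma chain_drop: "chain N x ss \<Longrightarrow> i \<le> length ss \<Longrightarrow> chain N (vertex_at x ss i) (drop i ss)"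
proof (induction ss arbitrary: x i)
  case (Cons s ss)
  then show ?case by (cases i) auto
qed simp

lemma concat_walks_Nil [simp]: "concat_walks x [] = [x]"
  by (simp add: concat_walks_def)

lemma concat_walks_Cons:
  "s \<noteq> [] \<Longrightarrow> hd s = x \<Longrightarrow> concat_walks x (s # ss) = butlast s @ concat_walks (last s) ss"
  unfolding concat_walks_def
  by (cases s rule: rev_cases; cases s) auto

lemma concat_walks_chain_Cons:
  "chain N x (s # ss) \<Longrightarrow> concat_walks x (s # ss) = butlast s @ concat_walks (last s) ss"
  using chain_ConsD(1,2) by (rule concat_walks_Cons)

lemma concat_walks_nonempty [simp]: "concat_walks x ss \<noteq> []"
  by (simp add: concat_walks_def)

lemma hd_concat_walks [simp]: "hd (concat_walks x ss) = x" "concat_walks x ss ! 0 = x"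
  by (simp_all add: concat_walks_def)

lemma concat_walks_singleton: "s \<noteq> [] \<Longrightarrow> hd s = x \<Longrightarrow> concat_walks x [s] = s"
  by (simp add: concat_walks_Cons)

lemma last_concat_walks: "chain N x ss \<Longrightarrow> last (concat_walks x ss) = last (x # map last ss)"
proof (induction ss arbitrary: x)
  case (Cons s ss)
  have "last (concat_walks x (s # ss)) = last (concat_walks (last s) ss)"
    unfolding concat_walks_chain_Cons[OF Cons.prems] by (rule last_appendR) simp
  then show ?case using Cons.IH[OF chain_ConsD(6)[OF Cons.prems]] by simp
qed simp

lemma concat_walks_append:
  "chain N x ss \<Longrightarrow> concat_walks x (ss @ rs) = butlast (concat_walks x ss) @ concat_walks (last (x # map last ss)) rs"
proof (induction ss arbitrary: x)
  case (Cons s ss)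
  note s = chain_ConsD[OF Cons.prems]
  with Cons show ?case using Cons by (simp add: concat_walks_Cons butlast_append)
qed simp

lemma wlen_concat_walks: "chain N x ss \<Longrightarrow> wlen (concat_walks x ss) = sum_list (map wlen ss)"
proof (induction ss arbitrary: x)
  case (Cons s ss)
  note s = chain_ConsD[OF Cons.prems]
  have "wlen (concat_walks x (s # ss)) = wlen s + wlen (concat_walks (last s) ss)"
    unfolding concat_walks_chain_Cons[OF Cons.prems] using s(4)
    by (cases "concat_walks (last s) ss") (auto simp: wlen_def)
  then show ?case using Cons.IH[OF s(6)] by simp
qed (simp add: wlen_def)

lemma time_at_0 [simp]: "time_at ss 0 = 0"
  by (simp add: time_at_def)

lemma time_at_Cons [simp]: "time_at (s # ss) (Suc i) = wlen s + time_at ss i"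
  by (simp add: time_at_def)

lemma time_at_length: "chain N x ss \<Longrightarrow> time_at ss (length ss) = wlen (concat_walks x ss)"
  by (simp add: time_at_def wlen_concat_walks)

lemma time_at_less:
  assumes "chain N x ss" "i < j" "j \<le> length ss"
  shows "time_at ss i < time_at ss j"
  using assms
proof (induction ss arbitrary: x i j)
  case (Cons s ss)
  note s = chain_ConsD[OF Cons.prems(1)]
  show ?case using s(5) Cons.IH[OF s(6)] Cons.prems(2,3) by (cases i; cases j) auto
qed simp

lemma time_at_less_iff:
  assumes "chain N x ss" "i \<le> length ss" "j \<le> length ss"
  shows "time_at ss i < time_at ss j \<longleftrightarrow> i < j"
  using time_at_less[OF assms(1)] assms(2,3) by (metis less_asym linorder_neqE_nat)

lemma drop_concat_walks:
  "chain N x ss \<Longrightarrow> i \<le> length ss \<Longrightarrow>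
   drop (time_at ss i) (concat_walks x ss) = concat_walks (vertex_at x ss i) (drop i ss)"
proof (induction ss arbitrary: x i)
  case (Cons s ss)
  note s = chain_ConsD[OF Cons.prems(1)]
  show ?case using s(4) Cons.IH[OF s(6)] Cons.prems(2) concat_walks_chain_Cons[OF Cons.prems(1)]
    by (cases i) auto
qed (simp add: time_at_def)

lemma take_concat_walks:
  "chain N x ss \<Longrightarrow> i \<le> length ss \<Longrightarrow>
   take (Suc (time_at ss i)) (concat_walks x ss) = concat_walks x (take i ss)"
proof (induction ss arbitrary: x i)
  case (Cons s ss)
  note s = chain_ConsD[OF Cons.prems(1)]
  show ?case
  proof (cases i)
    case 0
    then show ?thesis by (simp add: concat_walks_def)
  next
    case (Suc i')
    then show ?thesis
      using s(4) Cons.IH[OF s(6), of i'] Cons.prems(2) concat_walks_chain_Cons[OF Cons.prems(1)]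
      by (simp add: concat_walks_Cons[OF s(1,2)])
  qed
qed (simp add: time_at_def)

lemma nth_time_at:
  assumes "chain N x ss" "i \<le> length ss"
  shows "concat_walks x ss ! time_at ss i = vertex_at x ss i"
proof -
  have "time_at ss i < length (concat_walks x ss)"
  proof (rule ccontr)
    assume "\<not> ?thesis"
    then have "drop (time_at ss i) (concat_walks x ss) = []" by simp
    then show False using drop_concat_walks[OF assms] by simp
  qed
  then have "concat_walks x ss ! time_at ss i = hd (drop (time_at ss i) (concat_walks x ss))"
    by (simp add: hd_drop_conv_nth)
  then show ?thesis using drop_concat_walks[OF assms] by simp
qed

lemma nth_within_step:
  assumes "chain N x ss" "i < length ss" "d \<le> wlen (ss ! i)"
  shows "concat_walks x ss ! (time_at ss i + d) = (ss ! i) ! d"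
  using assms
proof (induction ss arbitrary: x i)
  case (Cons s ss)
  note s = chain_ConsD[OF Cons.prems(1)]
  note l = s(4)
  show ?case
  proof (cases i)
    case 0
    have "(butlast s @ concat_walks (last s) ss) ! d = s ! d"
    proof (cases "d < wlen s")
      case True
      then show ?thesis using l by (simp add: nth_append nth_butlast)
    next
      case False
      then have "d = wlen s" using Cons.prems(3) 0 by simp
      then show ?thesis using l last_conv_nth[OF s(1)] by (simp add: nth_append wlen_def)
    qed
    then show ?thesis using 0 concat_walks_chain_Cons[OF Cons.prems(1)] by simp
  next
    case (Suc i')
    then show ?thesis
      using Cons.IH[OF s(6), of i'] Cons.prems(2,3) concat_walks_chain_Cons[OF Cons.prems(1)] l
      by (simp add: nth_append)
  qed
qed simp

lemma segment_concat_walks: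
  assumes "chain N x ss" "i \<le> j" "j \<le> length ss"
  shows "segment (concat_walks x ss) (time_at ss i) (time_at ss j) =
    concat_walks (vertex_at x ss i) (take (j - i) (drop i ss))"
proof -
  have "take j ss = take i ss @ take (j - i) (drop i ss)"
    using take_add[of i "j - i" ss] assms(2) by simp
  then have "time_at ss j - time_at ss i = time_at (drop i ss) (j - i)"
    by (simp add: time_at_def)
  then have "segment (concat_walks x ss) (time_at ss i) (time_at ss j) =
      take (Suc (time_at (drop i ss) (j - i))) (concat_walks (vertex_at x ss i) (drop i ss))"
    unfolding segment_def using drop_concat_walks[of N x ss i] assms by simp
  also have "\<dots> = concat_walks (vertex_at x ss i) (take (j - i) (drop i ss))"
    using assms by (intro take_concat_walks chain_drop) auto
  finally show ?thesis .
qed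

lemma hit_time_concat_walks:
  assumes "chain N x ss"
  shows "hit_time N (concat_walks x ss) i = (if i \<le> length ss then enat (time_at ss i) else \<infinity>)"
proof (induction i)
  case 0
  then show ?case by (simp add: zero_enat_def)
next
  case (Suc i)
  let ?w = "concat_walks x ss"
  show ?case
  proof (cases "i \<le> length ss")
    case False
    then show ?thesis using Suc by (simp add: top_enat_def)
  next
    case True
    define S where "S = {enat j | j. j \<le> wlen ?w \<and> enat (time_at ss i) < enat j \<and>
      ?w ! j \<in> gasket_vertices N - {vertex_at x ss i}}"
    have step: "hit_time N ?w (Suc i) = Inf S"
      using Suc True nth_time_at[OF assms True] by (simp add: S_def)
    show ?thesis
    proof (cases "i = length ss")
      case True
      then have "S = {}" unfolding S_def using time_at_length[OF assms] by auto
      then show ?thesis using step True by (simp add: top_enat_def)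
    next
      case False
      then have i: "i < length ss" using \<open>i \<le> length ss\<close> by simp
      have nxt: "time_at ss (Suc i) = time_at ss i + wlen (ss ! i)"
        using i by (simp add: time_at_def take_Suc_conv_app_nth)
      note sw = step_walksD[OF chain_nth[OF assms i]]
      have "time_at ss (Suc i) \<le> wlen ?w"
        using time_at_less[OF assms, of "Suc i" "length ss"] time_at_length[OF assms] i
        by (cases "Suc i = length ss") auto
      then have "enat (time_at ss (Suc i)) \<in> S"
        unfolding S_def using time_at_less[OF assms, of i "Suc i"] i nth_time_at[OF assms, of "Suc i"] sw(6,7)
        by auto
      moreover have "enat (time_at ss (Suc i)) \<le> k" if k: "k \<in> S" for k
      proof (rule ccontr)
        assume c: "\<not> ?thesis"
        obtain j where j: "k = enat j" "time_at ss i < j" "?w ! j \<in> gasket_vertices N" "?w ! j \<noteq> vertex_at x ss i"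
          using k unfolding S_def by auto
        define d where "d = j - time_at ss i"
        have d: "0 < d" "d < wlen (ss ! i)" "j = time_at ss i + d" using j c nxt by (auto simp: d_def)
        then have "?w ! j = (ss ! i) ! d" using nth_within_step[OF assms i, of d] by simp
        then show False using sw(9)[OF d(1,2)] j by simp
      qed
      ultimately have "Inf S = enat (time_at ss (Suc i))"
        by (intro antisym Inf_lower Inf_greatest)
      then show ?thesis using step i by simp
    qed
  qed
qed

lemma hit_num_concat_walks:
  assumes "chain N x ss"
  shows "hit_num N (concat_walks x ss) = length ss"
  unfolding hit_num_def hit_time_concat_walks[OF assms]
  by (rule Least_equality) (auto split: if_splits)

lemma hit_concat_walks:
  assumes "chain N x ss" "i \<le> length ss"
  shows "hit N (concat_walks x ss) i = time_at ss i"
  using hit_time_concat_walks[OF assms(1)] assms(2) by simp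

lemma chain_steps_unique:
  assumes "chain N x ss" "chain N x rs" "concat_walks x ss = concat_walks x rs"
  shows "ss = rs"
proof -
  have *: "ss = map (\<lambda>i. segment w (hit N w i) (hit N w (Suc i))) [0..<hit_num N w]"
    if "chain N x ss" "w = concat_walks x ss" for ss w
  proof (rule nth_equalityI)
    show "length ss = length (map (\<lambda>i. segment w (hit N w i) (hit N w (Suc i))) [0..<hit_num N w])"
      using that hit_num_concat_walks by simp
    fix i assume i: "i < length ss"
    note sw = step_walksD[OF chain_nth[OF that(1) i]]
    have "segment w (hit N w i) (hit N w (Suc i)) = concat_walks (vertex_at x ss i) [ss ! i]"
      unfolding that(2) using hit_concat_walks[OF that(1)] segment_concat_walks[OF that(1), of i "Suc i"] i
      by (simp add: Cons_nth_drop_Suc[symmetric] del: hit_time.simps)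
    also have "\<dots> = ss ! i" using sw by (intro concat_walks_singleton) auto
    finally show "ss ! i = map (\<lambda>i. segment w (hit N w i) (hit N w (Suc i))) [0..<hit_num N w] ! i"
      using i that hit_num_concat_walks by simp
  qed
  show ?thesis using *[OF assms(1) refl] *[OF assms(2,3)] by simp
qed

section \<open>Refining a path into finer steps\<close>

lemma walk_into_steps:
  assumes "is_walk w" "hd w \<in> gasket_vertices N" "last w \<in> gasket_vertices N" "last w \<notin> set (butlast w)"
  shows "\<exists>ss. chain N (hd w) ss \<and> concat_walks (hd w) ss = w"
  using assms
proof (induction "length w" arbitrary: w rule: less_induct)
  case less
  have ne: "w \<noteq> []" using less.prems(1) by (simp add: is_walk_def)
  show ?case
  proof (cases "length w = 1")
    case True
    then obtain x where "w = [x]" by (auto simp: length_Suc_conv)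
    then show ?thesis by (intro exI[of _ "[]"]) simp
  next
    case False
    then have len: "2 \<le> length w" using ne by (cases w; cases "tl w") auto
    have hdlast: "last w \<noteq> hd w"
      using less.prems(4) len by (cases w) (auto split: if_splits)
    define P where "P j \<longleftrightarrow> 0 < j \<and> j \<le> wlen w \<and> w ! j \<in> gasket_vertices N \<and> w ! j \<noteq> hd w" for j
    have "P (wlen w)" unfolding P_def using len less.prems(3) hdlast ne
      by (simp add: wlen_def last_conv_nth)
    define j where "j = (LEAST j. P j)"
    have j: "P j" "\<And>i. i < j \<Longrightarrow> \<not> P i"
      unfolding j_def using LeastI[of P, OF \<open>P (wlen w)\<close>] not_less_Least[of _ P] by blast+
    have jw: "0 < j" "j < length w" using j(1) len unfolding P_def wlen_def by auto
    define s r where "s = take (Suc j) w" and "r = drop j w"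
    have s: "s \<noteq> []" "hd s = hd w" "last s = w ! j" "wlen s = j" "butlast s = take j w"
    proof -
      show "s \<noteq> []" "hd s = hd w" "wlen s = j" "butlast s = take j w"
        using jw ne unfolding s_def wlen_def by (auto simp: min_def butlast_take)
      show "last s = w ! j" using jw(2) unfolding s_def by (simp add: take_Suc_conv_app_nth)
    qed
    have r: "r \<noteq> []" "hd r = w ! j" "last r = last w" "butlast r = drop j (butlast w)"
      using jw unfolding r_def by (auto simp: hd_drop_conv_nth butlast_drop)
    have walk: "is_walk s" "is_walk r"
      using less.prems(1) s(1) r(1) unfolding is_walk_successively s_def r_def successively_conv_nth
      by (auto dest: in_set_takeD in_set_dropD)
    have "s \<in> step_walks N (hd w) (last s)"
      unfolding step_walks_def using walk s j jw less.prems(2)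
      by (auto simp: P_def s_def wlen_def)
    moreover have "\<exists>ss. chain N (hd r) ss \<and> concat_walks (hd r) ss = r"
    proof (rule less.hyps)
      show "length r < length w" using jw by (simp add: r_def)
      show "hd r \<in> gasket_vertices N" using j(1) r(2) by (simp add: P_def)
      show "last r \<in> gasket_vertices N" using less.prems(3) r(3) by simp
      show "last r \<notin> set (butlast r)" using less.prems(4) r(3,4) by (auto dest: in_set_dropD)
    qed (rule walk)
    then obtain ss where "chain N (w ! j) ss" "concat_walks (w ! j) ss = r" using r by auto
    moreover have "butlast s @ r = w" using s(5) by (simp add: r_def)
    ultimately show ?thesis using s
      by (intro exI[of _ "s # ss"]) (simp add: concat_walks_Cons)
  qed
qed

lemma refine_step:
  assumes "w \<in> step_walks (Suc N) x y"
  obtains ss where "chain N x ss" "concat_walks x ss = w" "ss \<noteq> []" "last (map last ss) = y"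
    "\<And>i. i < length ss \<Longrightarrow> vertex_at x ss i = x \<or> vertex_at x ss i \<notin> gasket_vertices (Suc N)"
proof -
  note w = step_walksD[OF assms]
  have "y \<notin> set (butlast w)"
  proof
    assume "y \<in> set (butlast w)"
    then obtain i where i: "i < wlen w" "w ! i = y" by (auto simp: in_set_conv_nth nth_butlast wlen_def)
    then have "i \<noteq> 0" using w(3,7,8) by (metis hd_conv_nth)
    then show False using w(9)[of i] i w(6,7) by simp
  qed
  then obtain ss where ss: "chain N x ss" "concat_walks x ss = w"
    using walk_into_steps[of w N] w gasket_vertices_Suc by blast
  have "ss \<noteq> []" using ss w(2) by auto
  moreover have "last (map last ss) = y"
    using last_concat_walks[OF ss(1)] ss(2) w(4) \<open>ss \<noteq> []\<close> by simp
  moreover have "vertex_at x ss i = x \<or> vertex_at x ss i \<notin> gasket_vertices (Suc N)" if "i < length ss" for i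
  proof (cases "i = 0")
    case False
    then have "0 < time_at ss i" using time_at_less[OF ss(1), of 0 i] that by simp
    moreover have "time_at ss i < wlen w"
      using time_at_less[OF ss(1) that] time_at_length[OF ss(1)] ss(2) by simp
    ultimately show ?thesis using w(9)[of "time_at ss i"] nth_time_at[OF ss(1), of i] that ss(2) by auto
  qed simp
  ultimately show thesis using that ss by blast
qed

text \<open>A path that has met no level \<open>N + 1\<close> vertex besides \<open>x\<close> is still in a cell at \<open>x\<close>.\<close>

lemma stays_near_vertex:
  assumes "x \<in> gasket_vertices (Suc N)" "adjacent N p q"
    "p = x \<or> (p \<notin> gasket_vertices (Suc N) \<and> (\<exists>t\<in>cells (Suc N). x \<in> t \<and> p \<in> nodes t))"
  shows "\<exists>t\<in>cells (Suc N). x \<in> t \<and> q \<in> nodes t"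
  using assms(3)
proof
  assume "p = x"
  with assms(1,2) obtain t y where "t \<in> cells (Suc N)" "x \<in> t" "y \<in> t" "q = midpoint x y"
    using adjacent_coarse_vertex by metis
  then show ?thesis unfolding nodes_def by blast
next
  assume "p \<notin> gasket_vertices (Suc N) \<and> (\<exists>t\<in>cells (Suc N). x \<in> t \<and> p \<in> nodes t)"
  then show ?thesis using adjacent_node assms(2) by blast
qed

lemma step_adjacent: "w \<in> step_walks N x y \<Longrightarrow> adjacent N x y"
proof (induction N arbitrary: w x y)
  case 0
  note w = step_walksD[OF 0]
  have adj: "adjacent 0 (w ! i) (w ! Suc i)" if "i < wlen w" for i
    using w(1) that by (auto simp: is_walk_def gasket_edge_iff)
  have "wlen w = 1"
  proof (rule ccontr)
    assume "wlen w \<noteq> 1"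
    then have "1 < wlen w" using w(2) by (auto simp: wlen_def)
    moreover have "w ! 1 \<in> gasket_vertices 0" using w(1) \<open>1 < wlen w\<close> unfolding is_walk_def
      by (auto simp: wlen_def)
    ultimately have "w ! 1 = x" using w(9) by simp
    then show False using adj[of 0] \<open>1 < wlen w\<close> w(3,8) by (simp add: adjacent_def hd_conv_nth)
  qed
  then show ?case using adj[of 0] w(3,4,8) by (simp add: hd_conv_nth last_conv_nth wlen_def)
next
  case (Suc N)
  note w = step_walksD[OF Suc.prems]
  obtain ss where ss: "chain N x ss" "ss \<noteq> []" "last (map last ss) = y"
    "\<And>i. i < length ss \<Longrightarrow> vertex_at x ss i = x \<or> vertex_at x ss i \<notin> gasket_vertices (Suc N)"
    using refine_step[OF Suc.prems] by metis
  have near: "vertex_at x ss i = x \<or> (\<exists>t\<in>cells (Suc N). x \<in> t \<and> vertex_at x ss i \<in> nodes t)"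
    if "i \<le> length ss" for i
    using that
  proof (induction i)
    case (Suc i)
    then have "adjacent N (vertex_at x ss i) (vertex_at x ss (Suc i))"
      using Suc.IH Suc.prems \<open>\<And>y x w. w \<in> step_walks N x y \<Longrightarrow> adjacent N x y\<close> chain_nth[OF ss(1), of i] by auto
    then show ?case using stays_near_vertex[OF w(5)] Suc ss(4)[of i] by auto
  qed simp
  have "vertex_at x ss (length ss) = y" using ss(2,3) by (simp add: last_conv_nth nth_Cons')
  then obtain t where "t \<in> cells (Suc N)" "x \<in> t" "y \<in> nodes t" using near[of "length ss"] w(7) by auto
  then show ?case using node_vertex_corner w(6,7) unfolding adjacent_def by blast
qed

section \<open>Exit times and erasure on chains\<close>

declare hit_time.simps [simp del]

definition step_triangle :: "nat \<Rightarrow> walk \<Rightarrow> complex set" where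
  "step_triangle N s = triangle_of N (hd s) (last s)"

definition joined :: "walk list \<Rightarrow> walk" where
  "joined g = concat_walks (hd (hd g)) g"

lemma step_cell:
  assumes "s \<in> step_walks N p q"
  obtains t where "t \<in> cells N" "p \<in> t" "q \<in> t" "p \<noteq> q" "step_triangle N s = convex hull t"
proof -
  obtain t where t: "t \<in> cells N" "p \<in> t" "q \<in> t" "p \<noteq> q"
    using step_adjacent[OF assms] unfolding adjacent_def by blast
  moreover have "step_triangle N s = convex hull t"
    unfolding step_triangle_def using triangle_of_eq[OF t] step_walksD(3,4)[OF assms] by simp
  ultimately show thesis by (rule that)
qed

lemma step_triangle_vertex_iff:
  assumes "s \<in> step_walks N p q" "s' \<in> step_walks N p' q'" "p' \<in> step_triangle N s"
  shows "q' \<in> step_triangle N s \<longleftrightarrow> step_triangle N s' = step_triangle N s"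
proof -
  obtain t where t: "t \<in> cells N" "p \<in> t" "q \<in> t" "p \<noteq> q" "step_triangle N s = convex hull t"
    using assms(1) by (rule step_cell)
  obtain t' where t': "t' \<in> cells N" "p' \<in> t'" "q' \<in> t'" "p' \<noteq> q'" "step_triangle N s' = convex hull t'"
    using assms(2) by (rule step_cell)
  have p': "p' \<in> t" using hull_vertices[OF t(1)] assms(3) step_walksD(5)[OF assms(2)] t(5) by blast
  show ?thesis
  proof
    assume "q' \<in> step_triangle N s"
    then have "q' \<in> t" using hull_vertices[OF t(1)] step_walksD(6)[OF assms(2)] t(5) by blast
    then have "t' = t" using cells_eqI[OF t'(1) t(1)] t' p' by blast
    then show "step_triangle N s' = step_triangle N s" using t(5) t'(5) by simp
  next
    assume "step_triangle N s' = step_triangle N s"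
    then show "q' \<in> step_triangle N s" using t'(3,5) hull_inc by metis
  qed
qed

lemma step_end_in_triangle: "s \<in> step_walks N p q \<Longrightarrow> q \<in> step_triangle N s"
  by (metis step_cell hull_inc)

text \<open>Leaving the current triangle means making a step in another triangle, since a step between
  two corners of a triangle lies in no other. So the exit pieces are the runs of steps in a common
  triangle.\<close>

lemma exit_index_chain:
  assumes "chain N x ss"
  defines "gs \<equiv> runs (step_triangle N) ss"
  shows "exit_index N (concat_walks x ss) i = length (concat (take i gs))"
proof (induction i)
  case 0
  then show ?case by simp
next
  case (Suc i)
  let ?w = "concat_walks x ss" and ?key = "step_triangle N"
  define B where "B i = length (concat (take i gs))" for i
  have ss: "ss = concat (take i gs) @ concat (drop i gs)" for i
    using concat_runs[of ?key ss] unfolding gs_def[symmetric]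
    by (simp add: concat_append[symmetric])
  have Ble: "B i \<le> length ss" for i using ss[of i] unfolding B_def by (metis length_append le_add1)
  have dropB: "drop (B i) ss = concat (drop i gs)" for i unfolding B_def by (subst ss[of i]) simp
  define J D S where "J = B i" and
    "D = triangle_of N (?w ! hit N ?w J) (?w ! hit N ?w (Suc J))" and
    "S = {j. j < hit_num N ?w \<and> hit N ?w J < hit N ?w j \<and> ?w ! hit N ?w (Suc j) \<notin> D}"
  have step: "exit_index N ?w (Suc i) = (if S = {} then hit_num N ?w else Min S)"
    unfolding exit_index.simps Let_def S_def D_def J_def B_def Suc by (rule refl)
  have Jle: "J \<le> length ss" using Ble unfolding J_def .
  have S: "S = {j. J < j \<and> j < length ss \<and> vertex_at x ss (Suc j) \<notin> D}"
  proof -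
    have "j \<in> S \<longleftrightarrow> J < j \<and> j < length ss \<and> vertex_at x ss (Suc j) \<notin> D" for j
    proof (cases "j < length ss")
      case True
      then have "hit N ?w j = time_at ss j" "hit N ?w J = time_at ss J"
        "?w ! hit N ?w (Suc j) = vertex_at x ss (Suc j)"
        using hit_concat_walks[OF assms(1)] nth_time_at[OF assms(1), of "Suc j"] Jle
        by simp_all
      then show ?thesis unfolding S_def
        using time_at_less_iff[OF assms(1) Jle, of j] True hit_num_concat_walks[OF assms(1)]
        by auto
    next
      case False
      then show ?thesis unfolding S_def using hit_num_concat_walks[OF assms(1)] by auto
    qed
    then show ?thesis by blast
  qed
  show ?case
  proof (cases "i < length gs")
    case False
    then have "J = length ss" "length (concat (take (Suc i) gs)) = length ss"
      using ss[of i] ss[of "Suc i"] unfolding J_def B_def by auto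
    then show ?thesis using step S hit_num_concat_walks[OF assms(1)] by auto
  next
    case True
    have gi: "gs ! i \<noteq> []" using runs_nonempty[OF nth_mem] True unfolding gs_def by blast
    have BS: "B (Suc i) = J + length (gs ! i)"
      unfolding J_def B_def using True by (simp add: take_Suc_conv_app_nth)
    have dJ: "drop J ss = gs ! i @ drop (B (Suc i)) ss"
      unfolding J_def dropB using True by (simp add: Cons_nth_drop_Suc[symmetric])
    have Jlt: "J < length ss" using BS Ble[of "Suc i"] gi by (cases "gs ! i") auto
    have ssJ: "ss ! J = hd (gs ! i)" using dJ gi Jlt by (metis hd_append2 hd_drop_conv_nth)
    have D: "D = ?key (ss ! J)"
    proof -
      have "?w ! hit N ?w J = vertex_at x ss J" "?w ! hit N ?w (Suc J) = vertex_at x ss (Suc J)"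
        using hit_concat_walks[OF assms(1)] nth_time_at[OF assms(1)] Jlt by simp_all
      then show ?thesis
        unfolding D_def step_triangle_def using step_walksD(3,4)[OF chain_nth[OF assms(1) Jlt]] by simp
    qed
    have keyJ: "?key (ss ! j) = D" if "J \<le> j" "j < B (Suc i)" for j
    proof -
      have "ss ! j = drop J ss ! (j - J)" using that(1) Jlt by simp
      also have "\<dots> = (gs ! i) ! (j - J)"
      proof -
        have "j - J < length (gs ! i)" using that BS by simp
        then show ?thesis unfolding dJ by (simp only: nth_append if_True)
      qed
      finally have "ss ! j = (gs ! i) ! (j - J)" .
      moreover have "j - J < length (gs ! i)" using that BS by simp
      ultimately have "ss ! j \<in> set (gs ! i)" by simp
      then show ?thesis using runs_key[of "gs ! i" ?key ss] True ssJ D unfolding gs_def by simp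
    qed
    have vin: "vertex_at x ss (Suc j) \<in> D" if "J \<le> j" "j < B (Suc i)" for j
      using keyJ[OF that] step_end_in_triangle[OF chain_nth[OF assms(1), of j]] that Ble[of "Suc i"] by simp
    have out: "vertex_at x ss (Suc (B (Suc i))) \<notin> D" if lt: "B (Suc i) < length ss"
    proof -
      let ?k = "B (Suc i)"
      obtain s rest where sr: "drop J ss = s # rest" using Jlt by (metis Cons_nth_drop_Suc)
      have "drop i gs = runs ?key (drop J ss)" unfolding J_def dropB unfolding gs_def by (rule runs_drop[symmetric])
      then have dgs: "drop i gs = (s # takeWhile (\<lambda>u. ?key u = ?key s) rest) # runs ?key (dropWhile (\<lambda>u. ?key u = ?key s) rest)"
        unfolding sr by simp
      then have "drop (Suc i) gs = runs ?key (dropWhile (\<lambda>u. ?key u = ?key s) rest)"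
        using tl_drop[of i gs] by (simp add: drop_Suc)
      then have "drop ?k ss = dropWhile (\<lambda>u. ?key u = ?key s) rest" unfolding dropB by simp
      moreover have "drop ?k ss \<noteq> []" using lt by simp
      ultimately have "?key (hd (drop ?k ss)) \<noteq> ?key s" 
        using hd_dropWhile[of "\<lambda>u. ?key u = ?key s" rest] by simp
      moreover have "hd (drop ?k ss) = ss ! ?k" using lt by (rule hd_drop_conv_nth)
      moreover have "s = ss ! J" using hd_drop_conv_nth[OF Jlt] sr by simp
      ultimately have "?key (ss ! ?k) \<noteq> D" using D by simp
      moreover have "vertex_at x ss ?k \<in> D"
        using vin[of "?k - 1"] BS gi by (cases "gs ! i") auto
      ultimately show ?thesis
        using step_triangle_vertex_iff[OF chain_nth[OF assms(1) Jlt] chain_nth[OF assms(1) lt]] D by simp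
    qed
    show ?thesis
    proof (cases "B (Suc i) < length ss")
      case True
      have "Min S = B (Suc i)"
      proof (rule Min_eqI)
        show "finite S" unfolding S by simp
        show "B (Suc i) \<in> S" unfolding S using True out BS gi by (cases "gs ! i") auto
        show "B (Suc i) \<le> j" if "j \<in> S" for j using that vin[of j] unfolding S by force
      qed
      moreover have "S \<noteq> {}" unfolding S using True out BS gi by (cases "gs ! i") auto
      ultimately show ?thesis using step unfolding B_def by simp
    next
      case False
      then have "B (Suc i) = length ss" using Ble[of "Suc i"] by simp
      moreover from this have "S = {}" unfolding S using vin by auto
      ultimately show ?thesis using step hit_num_concat_walks[OF assms(1)] unfolding B_def by simp
    qed
  qed
qed

lemma exit_pieces_chain:
  assumes "chain N x ss"
  shows "exit_pieces N (concat_walks x ss) = map joined (runs (step_triangle N) ss)"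
proof -
  let ?w = "concat_walks x ss"
  define gs where "gs = runs (step_triangle N) ss"
  define B where "B i = length (concat (take i gs))" for i
  have idx: "exit_index N ?w i = B i" for i
    using exit_index_chain[OF assms] unfolding B_def gs_def .
  have ss: "ss = concat (take i gs) @ concat (drop i gs)" for i
    using concat_runs[of "step_triangle N" ss] unfolding gs_def[symmetric]
    by (simp add: concat_append[symmetric])
  have Ble: "B i \<le> length ss" for i using ss[of i] unfolding B_def by (metis length_append le_add1)
  have dropB: "drop (B i) ss = concat (drop i gs)" for i unfolding B_def by (subst ss[of i]) simp
  have ne: "gs ! i \<noteq> []" if "i < length gs" for i
    using runs_nonempty[OF nth_mem] that unfolding gs_def by blast
  have Blt: "B i < length ss" if "i < length gs" for i
  proof -
    have "concat (drop i gs) \<noteq> []" using ne[OF that] that by (simp add: Cons_nth_drop_Suc[symmetric])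
    then show ?thesis unfolding dropB[symmetric] by simp
  qed
  have "B (length gs) = length ss" using ss[of "length gs"] unfolding B_def by simp
  then have L: "(LEAST r. exit_index N ?w r = hit_num N ?w) = length gs"
    unfolding idx hit_num_concat_walks[OF assms]
    by (rule Least_equality) (use Blt in \<open>metis less_irrefl not_le\<close>)
  have "segment ?w (exit_time N ?w i) (exit_time N ?w (Suc i)) = joined (gs ! i)" if i: "i < length gs" for i
  proof -
    have BS: "B (Suc i) = B i + length (gs ! i)"
      unfolding B_def using i by (simp add: take_Suc_conv_app_nth)
    have "segment ?w (exit_time N ?w i) (exit_time N ?w (Suc i)) =
        concat_walks (vertex_at x ss (B i)) (take (B (Suc i) - B i) (drop (B i) ss))"
      unfolding exit_time_def idx hit_concat_walks[OF assms Ble]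
      by (rule segment_concat_walks[OF assms _ Ble]) (simp add: BS)
    also have "take (B (Suc i) - B i) (drop (B i) ss) = gs ! i"
      unfolding dropB BS using i by (simp add: Cons_nth_drop_Suc[symmetric])
    also have "vertex_at x ss (B i) = hd (hd (gs ! i))"
    proof -
      have "ss ! B i = hd (drop (B i) ss)" using Blt[OF i] by (simp add: hd_drop_conv_nth)
      also have "\<dots> = hd (gs ! i)" unfolding dropB using i ne[OF i] by (simp add: Cons_nth_drop_Suc[symmetric])
      finally show ?thesis using step_walksD(3)[OF chain_nth[OF assms Blt[OF i]]] by simp
    qed
    finally show ?thesis unfolding joined_def .
  qed
  then show ?thesis unfolding exit_pieces_def L gs_def[symmetric]
    by (intro nth_equalityI) auto
qed

lemma erase_index_chain:
  assumes "chain k x ss"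
  shows "erase_index k (concat_walks x ss) i \<le> length ss \<and>
    drop (erase_index k (concat_walks x ss) i) ss = erase_suffix last x ss i"
proof (induction i)
  let ?w = "concat_walks x ss"
  have eq: "{j. j \<le> hit_num k ?w \<and> ?w ! hit k ?w j = v} = {j. j \<le> length ss \<and> vertex_at x ss j = v}" for v
    using hit_num_concat_walks[OF assms] hit_concat_walks[OF assms] nth_time_at[OF assms]
    by auto
  {
    case 0
    let ?S = "{j. j \<le> length ss \<and> vertex_at x ss j = x}"
    have "?w ! hit k ?w 0 = x"
      using hit_concat_walks[OF assms, of 0] by simp
    then have "erase_index k ?w 0 = Max ?S" using eq[of x] by simp
    moreover have "Max ?S \<in> ?S" by (rule Max_in) (auto intro: exI[of _ 0])
    ultimately show ?case using cutback_eq_drop[of last x ss] by simp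
  next
    case (Suc i)
    define \<tau> where "\<tau> = erase_index k ?w i"
    have \<tau>: "\<tau> \<le> length ss" "drop \<tau> ss = erase_suffix last x ss i" using Suc unfolding \<tau>_def by auto
    show ?case
    proof (cases "\<tau> < length ss")
      case False
      then have "erase_index k ?w (Suc i) = length ss"
        using hit_num_concat_walks[OF assms] unfolding \<tau>_def by simp
      moreover have "erase_suffix last x ss i = []" using \<tau> False by simp
      ultimately show ?thesis by simp
    next
      case True
      define v where "v = vertex_at x ss (Suc \<tau>)"
      define r where "r = drop (Suc \<tau>) ss"
      have v: "v = last (ss ! \<tau>)" using True unfolding v_def by simp
      have suf: "erase_suffix last x ss (Suc i) = cutback last v r"
        using \<tau>(2)[symmetric] True v by (simp add: Cons_nth_drop_Suc[symmetric] r_def)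
      let ?S = "{j. j \<le> length ss \<and> vertex_at x ss j = v}"
      let ?R = "{j. j \<le> length r \<and> (v # map last r) ! j = v}"
      have idx: "erase_index k ?w (Suc i) = Max ?S"
      proof -
        have "?w ! hit k ?w (Suc \<tau>) = v"
          using hit_concat_walks[OF assms, of "Suc \<tau>"] nth_time_at[OF assms, of "Suc \<tau>"] True
          by (simp add: v_def)
        then show ?thesis using eq[of v] True hit_num_concat_walks[OF assms] unfolding \<tau>_def
          by simp
      qed
      have shift: "(v # map last r) ! j = vertex_at x ss (Suc \<tau> + j)" if "j \<le> length r" for j
        using that True v by (cases j) (auto simp: r_def)
      have R: "Max ?R \<in> ?R" by (rule Max_in) (auto intro: exI[of _ 0])
      have "Max ?S = Suc \<tau> + Max ?R"
      proof (rule Max_eqI)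
        show "finite ?S" by simp
        show "Suc \<tau> + Max ?R \<in> ?S" using R shift[of "Max ?R"] True by (auto simp: r_def)
        show "j \<le> Suc \<tau> + Max ?R" if "j \<in> ?S" for j
        proof (cases "Suc \<tau> \<le> j")
          case True
          then have "j - Suc \<tau> \<in> ?R" using that shift[of "j - Suc \<tau>"] by (auto simp: r_def)
          then have "j - Suc \<tau> \<le> Max ?R" by (intro Max_ge) auto
          then show ?thesis by simp
        qed simp
      qed
      moreover have "Suc \<tau> + Max ?R \<le> length ss" using R True by (auto simp: r_def)
      moreover have "cutback last v r = drop (Max ?R) r" by (rule cutback_eq_drop)
      ultimately show ?thesis unfolding idx suf by (simp add: r_def add.commute)
    qed
  }
qed

lemma erase_coarse_chain:
  assumes "chain k x ss"
  shows "erase_coarse k (concat_walks x ss) = concat_walks x (lerase last x ss)"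
proof -
  let ?w = "concat_walks x ss" and ?\<tau> = "erase_index k (concat_walks x ss)"
  define r where "r = (LEAST r. \<not> ?\<tau> r < hit_num k ?w)"
  have iff: "\<not> ?\<tau> r < hit_num k ?w \<longleftrightarrow> erase_suffix last x ss r = []" for r
    using erase_index_chain[OF assms, of r] hit_num_concat_walks[OF assms] by (metis drop_eq_Nil not_le)
  have r: "r = (LEAST r. erase_suffix last x ss r = [])" unfolding r_def iff ..
  have "erase_suffix last x ss (length ss) = []" using length_erase_suffix[of last x ss "length ss"] by simp
  then have r': "erase_suffix last x ss r = []" "\<And>i. i < r \<Longrightarrow> erase_suffix last x ss i \<noteq> []"
    unfolding r by (rule LeastI) (rule not_less_Least)
  have "segment ?w (hit k ?w (?\<tau> i)) (hit k ?w (Suc (?\<tau> i))) = hd (erase_suffix last x ss i)" if "i < r" for i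
  proof -
    have t: "?\<tau> i < length ss" using iff[of i] r'(2)[OF that] hit_num_concat_walks[OF assms] by simp
    have "segment ?w (hit k ?w (?\<tau> i)) (hit k ?w (Suc (?\<tau> i))) = concat_walks (vertex_at x ss (?\<tau> i)) [ss ! ?\<tau> i]"
      using hit_concat_walks[OF assms] segment_concat_walks[OF assms, of "?\<tau> i" "Suc (?\<tau> i)"] t
      by (simp add: Cons_nth_drop_Suc[symmetric] del: erase_index.simps)
    also have "\<dots> = ss ! ?\<tau> i"
      using step_walksD[OF chain_nth[OF assms t]] by (intro concat_walks_singleton) auto
    also have "\<dots> = hd (erase_suffix last x ss i)"
      using erase_index_chain[OF assms, of i] t by (metis hd_drop_conv_nth)
    finally show ?thesis .
  qed
  then have "erase_coarse k ?w = concat_walks x (map (\<lambda>i. hd (erase_suffix last x ss i)) [0..<r])"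
    unfolding erase_coarse_def r_def[symmetric] hd_concat_walks(2)
    by (intro arg_cong[where f = "concat_walks x"] map_cong) auto
  also have "map (\<lambda>i. hd (erase_suffix last x ss i)) [0..<r] = lerase last x ss"
    by (rule lerase_eq_suffixes[symmetric]) (fact r')+
  finally show ?thesis .
qed

section \<open>Erasure keeps a piece inside its triangle\<close>

definition refine :: "nat \<Rightarrow> walk \<Rightarrow> walk list" where
  "refine N s = (THE ss. chain N (hd s) ss \<and> concat_walks (hd s) ss = s)"

lemma refine_eq: "chain N x ss \<Longrightarrow> refine N (concat_walks x ss) = ss"
  unfolding refine_def by (rule the_equality) (auto intro: chain_steps_unique)

lemma refine_props:
  assumes "s \<in> step_walks (Suc N) x y"
  shows "chain N x (refine N s)" "concat_walks x (refine N s) = s" "refine N s \<noteq> []"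
    "last (x # map last (refine N s)) = y"
    "\<And>i. i < length (refine N s) \<Longrightarrow>
       vertex_at x (refine N s) i = x \<or> vertex_at x (refine N s) i \<notin> gasket_vertices (Suc N)"
proof -
  obtain ss where ss: "chain N x ss" "concat_walks x ss = s" "ss \<noteq> []" "last (map last ss) = y"
    "\<And>i. i < length ss \<Longrightarrow> vertex_at x ss i = x \<or> vertex_at x ss i \<notin> gasket_vertices (Suc N)"
    using refine_step[OF assms] by metis
  have r: "refine N s = ss" using refine_eq[OF ss(1)] ss(2) by simp
  show "chain N x (refine N s)" "concat_walks x (refine N s) = s" "refine N s \<noteq> []"
    "last (x # map last (refine N s)) = y" unfolding r using ss(1-4) by simp_all
  show "\<And>i. i < length (refine N s) \<Longrightarrow>
       vertex_at x (refine N s) i = x \<or> vertex_at x (refine N s) i \<notin> gasket_vertices (Suc N)"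
    unfolding r using ss(5) .
qed

definition refine_all :: "nat \<Rightarrow> walk list \<Rightarrow> walk list" where
  "refine_all N g = concat (map (refine N) g)"

lemma refine_all_props:
  assumes "chain (Suc N) x g"
  shows "chain N x (refine_all N g)" "concat_walks x (refine_all N g) = concat_walks x g"
    "last (x # map last (refine_all N g)) = last (x # map last g)"
proof -
  have "chain N x (refine_all N g) \<and> concat_walks x (refine_all N g) = concat_walks x g \<and>
    last (x # map last (refine_all N g)) = last (x # map last g)"
    using assms
  proof (induction g arbitrary: x)
    case Nil
    then show ?case by (simp add: refine_all_def)
  next
    case (Cons s g)
    then have "s \<in> step_walks (Suc N) x (last s)" by simp
    note r = refine_props[OF this]
    have IH: "chain N (last s) (refine_all N g)"
      "concat_walks (last s) (refine_all N g) = concat_walks (last s) g"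
      "last (last s # map last (refine_all N g)) = last (last s # map last g)"
      using Cons by simp_all
    have eq: "refine_all N (s # g) = refine N s @ refine_all N g" by (simp add: refine_all_def)
    have "chain N x (refine_all N (s # g))" unfolding eq chain_append r(4) using r(1) IH(1) by simp
    moreover have "concat_walks x (refine_all N (s # g)) = concat_walks x (s # g)"
      unfolding eq concat_walks_append[OF r(1)] r(2,4) IH(2) concat_walks_chain_Cons[OF Cons.prems] ..
    moreover have "last (x # map last (refine_all N (s # g))) = last (x # map last (s # g))"
      using IH(3) r(3,4) unfolding eq by (cases "refine_all N g = []") auto
    ultimately show ?case by blast
  qed
  then show "chain N x (refine_all N g)" "concat_walks x (refine_all N g) = concat_walks x g"
    "last (x # map last (refine_all N g)) = last (x # map last g)" by blast+
qed

lemma last_foldl_push: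
  "last (x # map e (foldl (push e x) st rs)) = last (last (x # map e st) # map e rs)"
proof (induction rs rule: rev_induct)
  case (snoc s rs)
  have "last (x # map e (foldl (push e x) st (rs @ [s]))) = e s"
    using last_push[of x e "foldl (push e x) st rs" s] by simp
  then show ?case by simp
qed simp

text \<open>An excursion into the other triangle at \<open>p\<close> can only come back through \<open>p\<close>, where the
  forward erasure truncates it. So the erased path never ends up with a vertex outside the
  triangle.\<close>

lemma push_step_nodes:
  assumes t: "t \<in> cells (Suc N)" "p \<in> t" "q \<in> t" and s: "s \<in> step_walks (Suc N) p q"
    and st: "last ` set st \<subseteq> nodes t" "x \<in> nodes t" "last (x # map last st) = p"
  shows "last ` set (foldl (push last x) st (refine N s)) \<subseteq> nodes t"
proof -
  define ss where "ss = refine N s"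
  note r = refine_props[OF s, folded ss_def]
  define st' where "st' i = foldl (push last x) st (take i ss)" for i
  define inside where "inside i \<longleftrightarrow> vertex_at p ss i \<in> nodes t \<and> last ` set (st' i) \<subseteq> nodes t" for i
  define outside where "outside i \<longleftrightarrow> (\<exists>st0 out t'. st' i = st0 @ out \<and> last ` set st0 \<subseteq> nodes t \<and>
    last (x # map last st0) = p \<and> t' \<in> cells (Suc N) \<and> p \<in> t' \<and> vertex_at p ss i \<in> nodes t' \<and>
    vertex_at p ss i \<notin> nodes t)" for i
  have p: "p \<in> gasket_vertices (Suc N)" using t by (auto simp: gasket_vertices_eq)
  have cur: "last (x # map last (st' i)) = vertex_at p ss i" if "i \<le> length ss" for i
  proof -
    have "last (x # map last (st' i)) = last (p # map last (take i ss))"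
      unfolding st'_def last_foldl_push st(3) ..
    also have "\<dots> = vertex_at p ss i" using that by (cases i) (auto simp: take_Suc_conv_app_nth)
    finally show ?thesis .
  qed
  have "inside i \<or> outside i" if "i \<le> length ss" for i
    using that
  proof (induction i)
    case 0
    then show ?case using st t corners_nodes by (auto simp: inside_def st'_def)
  next
    case (Suc i)
    define u v where "u = vertex_at p ss (Suc i)" and "v = vertex_at p ss i"
    have i: "i < length ss" using Suc.prems by simp
    have u: "u = last (ss ! i)" using i unfolding u_def by simp
    have adj: "adjacent N v u" using step_adjacent[OF chain_nth[OF r(1) i]] unfolding u_def v_def .
    have v: "v = p \<or> v \<notin> gasket_vertices (Suc N)" using r(5)[OF i] unfolding v_def .
    have nxt: "st' (Suc i) = push last x (st' i) (ss ! i)"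
      using i unfolding st'_def by (simp add: take_Suc_conv_app_nth)
    from Suc have "inside i \<or> outside i" by simp
    then show ?case
    proof
      assume ins: "inside i"
      show ?thesis
      proof (cases "u \<in> nodes t")
        case True
        then have "inside (Suc i)"
          using ins set_push[of last x "st' i" "ss ! i"] u unfolding inside_def nxt u_def[symmetric] by auto
        then show ?thesis ..
      next
        case False
        have vn: "v \<in> nodes t" using ins unfolding inside_def v_def by simp
        then have "v = p" using v adjacent_node[OF t(1) vn _ adj] False by blast
        then obtain t' y where t': "t' \<in> cells (Suc N)" "p \<in> t'" "y \<in> t'" "u = midpoint p y"
          using adjacent_coarse_vertex[OF p] adj by metis
        then have "u \<in> nodes t'" unfolding nodes_def by blast
        moreover have "st' (Suc i) = st' i @ [ss ! i]"
          unfolding nxt using False ins st(2) u unfolding inside_def by (intro push_new) auto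
        moreover have "last (x # map last (st' i)) = p" using cur[of i] i \<open>v = p\<close> unfolding v_def by simp
        ultimately have "outside (Suc i)"
          unfolding outside_def u_def[symmetric] using False t' ins unfolding inside_def by blast
        then show ?thesis ..
      qed
    next
      assume "outside i"
      then obtain st0 out t' where o: "st' i = st0 @ out" "last ` set st0 \<subseteq> nodes t"
        "last (x # map last st0) = p" "t' \<in> cells (Suc N)" "p \<in> t'" "v \<in> nodes t'" "v \<notin> nodes t"
        unfolding outside_def v_def by blast
      have "v \<notin> gasket_vertices (Suc N)" using v o(7) t(2) corners_nodes by blast
      then have un: "u \<in> nodes t'" using adjacent_node[OF o(4,6) _ adj] by blast
      have ne: "t \<noteq> t'" using o(6,7) by blast
      show ?thesis
      proof (cases "u \<in> nodes t")
        case True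
        then have "u \<in> t \<and> u \<in> t'" using nodes_inter[OF t(1) o(4) ne] un by blast
        then have "u = p" using cells_eqI[OF t(1) o(4)] t(2) o(5) ne by blast
        then have "last (ss ! i) \<in> set (x # map last st0)" using o(3) u last_in_set[of "x # map last st0"] by simp
        then have "set (st' (Suc i)) \<subseteq> set st0" unfolding nxt o(1) by (rule set_push_old)
        then have "inside (Suc i)" unfolding inside_def u_def[symmetric] using True o(2) by blast
        then show ?thesis ..
      next
        case False
        then have "last (ss ! i) \<notin> set (x # map last st0)" using o(2) st(2) u by auto
        then have "st' (Suc i) = st0 @ push last (last (x # map last st0)) out (ss ! i)"
          unfolding nxt o(1) by (rule push_append)
        then have "outside (Suc i)" unfolding outside_def u_def[symmetric] using o un False by blast
        then show ?thesis ..
      qed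
    qed
  qed
  moreover have "vertex_at p ss (length ss) = q"
    using r(3,4) by (simp add: last_conv_nth nth_Cons')
  then have "vertex_at p ss (length ss) \<in> nodes t" using t(3) corners_nodes by auto
  ultimately have "inside (length ss)" unfolding outside_def by blast
  then show ?thesis unfolding inside_def st'_def ss_def by simp
qed

lemma lerase_nodes:
  assumes "t \<in> cells (Suc N)" "chain (Suc N) x g" "x \<in> t" "\<And>s. s \<in> set g \<Longrightarrow> last s \<in> t"
  shows "last ` set (lerase last x (refine_all N g)) \<subseteq> nodes t"
proof -
  have "last ` set (foldl (push last x) st (refine_all N g)) \<subseteq> nodes t"
    if "chain (Suc N) p g" "p \<in> t" "last ` set st \<subseteq> nodes t" "last (x # map last st) = p"
      "\<And>s. s \<in> set g \<Longrightarrow> last s \<in> t" for p g st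
    using that
  proof (induction g arbitrary: p st)
    case (Cons s g)
    have s: "s \<in> step_walks (Suc N) p (last s)" using Cons.prems by simp
    have st: "last ` set (foldl (push last x) st (refine N s)) \<subseteq> nodes t"
      by (rule push_step_nodes[OF assms(1) Cons.prems(2) _ s Cons.prems(3)])
        (use Cons.prems subsetD[OF corners_nodes assms(3)] in auto)
    have "last (x # map last (foldl (push last x) st (refine N s))) = last s"
      unfolding last_foldl_push Cons.prems(4) by (rule refine_props(4)[OF s])
    from Cons.IH[OF _ _ st this] Cons.prems show ?case by (simp add: refine_all_def)
  qed (simp add: refine_all_def)
  from this[OF assms(2,3), of "[]"] assms(4) show ?thesis
    using lerase_append[of last x "[]" "refine_all N g"] by simp
qed

lemma chain_lerase: "chain N x ss \<Longrightarrow> chain N x (lerase last x ss)"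
proof (induction "last :: walk \<Rightarrow> complex" x ss rule: lerase.induct)
  case (1 x ss)
  show ?case
  proof (cases "cutback last x ss")
    case Nil
    then show ?thesis by (simp add: lerase.simps)
  next
    case (Cons s r)
    have "chain N x ss \<Longrightarrow> cutback last x ss = s # r \<Longrightarrow> chain N x (s # r)" for ss
    proof -
      define j where "j = Max {j. j \<le> length ss \<and> vertex_at x ss j = x}"
      have "j \<in> {j. j \<le> length ss \<and> vertex_at x ss j = x}"
        unfolding j_def by (rule Max_in) (auto intro: exI[of _ 0])
      moreover assume "chain N x ss" "cutback last x ss = s # r"
      ultimately show "chain N x (s # r)"
        using chain_drop[of N x ss j] cutback_eq_drop[of last x ss] unfolding j_def[symmetric] by auto
    qed
    then have "chain N x (s # r)" using 1(2) Cons by blast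
    then show ?thesis using 1(1)[OF Cons] Cons by (simp add: lerase.simps[of last x ss])
  qed
qed

lemma distinct_steps:
  "chain N x ss \<Longrightarrow> distinct (concat_walks x ss) \<Longrightarrow>
   distinct (x # map last ss) \<and> (\<forall>s\<in>set ss. distinct s)"
proof (induction ss arbitrary: x)
  case (Cons s ss)
  note s = chain_ConsD[OF Cons.prems(1)]
  have d: "distinct (butlast s @ concat_walks (last s) ss)"
    using Cons.prems concat_walks_chain_Cons by metis
  then have IH: "distinct (last s # map last ss)" "\<forall>u\<in>set ss. distinct u"
    using Cons.IH[OF s(6)] by auto
  have sub: "set (last s # map last ss) \<subseteq> set (concat_walks (last s) ss)"
  proof
    fix v assume "v \<in> set (last s # map last ss)"
    then obtain i where "i < length (last s # map last ss)" "v = vertex_at (last s) ss i"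
      by (metis in_set_conv_nth)
    then have i: "i \<le> length ss" "v = concat_walks (last s) ss ! time_at ss i"
      using nth_time_at[OF s(6)] by auto
    have "time_at ss i \<le> wlen (concat_walks (last s) ss)"
      using time_at_less[OF s(6), of i "length ss"] time_at_length[OF s(6)] i(1) by (cases "i = length ss") auto
    then show "v \<in> set (concat_walks (last s) ss)"
      unfolding i(2) wlen_def
      by (intro nth_mem) (metis One_nat_def Suc_pred concat_walks_nonempty le_imp_less_Suc length_greater_0_conv)
  qed
  have "x \<in> set (butlast s)" using s(1-3) by (cases s) auto
  then have "distinct (x # last s # map last ss)" using d IH(1) sub by auto
  moreover have "distinct s"
  proof -
    have "last s \<in> set (concat_walks (last s) ss)" using sub by simp
    then have "distinct (butlast s @ [last s])" using d by auto
    then show ?thesis using s(1) by simp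
  qed
  ultimately show ?case using IH(2) by simp
qed simp

lemma set_concat_walks: "set (concat_walks x ss) \<subseteq> insert x (\<Union>s\<in>set ss. set s)"
  unfolding concat_walks_def by (auto dest: list.set_sel(2)) (metis list.sel(2) list.set_sel(2))

text \<open>A loopless step makes no excursion, so it stays in its triangle at every scale.\<close>

lemma distinct_step_in_hull:
  "s \<in> step_walks N p q \<Longrightarrow> distinct s \<Longrightarrow> t \<in> cells N \<Longrightarrow> p \<in> t \<Longrightarrow> q \<in> t \<Longrightarrow> set s \<subseteq> convex hull t"
proof (induction N arbitrary: s p q t)
  case 0
  note s = step_walksD[OF 0(1)]
  have "wlen s = 1"
  proof (rule ccontr)
    assume "wlen s \<noteq> 1"
    then have l: "1 < wlen s" "1 < length s" using s(2) by (auto simp: wlen_def)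
    moreover have "s ! 1 \<in> gasket_vertices 0" using s(1) l unfolding is_walk_def by auto
    ultimately have "s ! 1 = s ! 0" using s(3,8) s(9)[of 1] by (simp add: hd_conv_nth)
    then show False using 0(2) l nth_eq_iff_index_eq[of s 1 0] by fastforce
  qed
  then have "length s = 2" using s(2) by (simp add: wlen_def)
  then have "s = [p, q]" using s(3,4) by (auto simp: length_Suc_conv numeral_2_eq_2)
  then show ?case using 0(4,5) hull_inc by fastforce
next
  case (Suc N)
  note r = refine_props[OF Suc.prems(1)]
  define ss where "ss = refine N s"
  have ch: "chain N p ss" "concat_walks p ss = s" using r unfolding ss_def by auto
  have d: "distinct (p # map last ss)" "\<forall>u\<in>set ss. distinct u"
    using distinct_steps[OF ch(1)] ch(2) Suc.prems(2) by auto
  have "chain (Suc N) p [s]" using Suc.prems(1) step_walksD(4) by simp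
  then have "last ` set (lerase last p (refine_all N [s])) \<subseteq> nodes t"
    using Suc.prems step_walksD(4)[OF Suc.prems(1)] by (intro lerase_nodes) auto
  then have nodes: "last ` set ss \<subseteq> nodes t"
    using lerase_id[OF d(1)] by (simp add: refine_all_def ss_def)
  have vn: "vertex_at p ss i \<in> nodes t" if "i \<le> length ss" for i
    using that nodes Suc.prems(4) corners_nodes by (cases i) auto
  have "set (ss ! i) \<subseteq> convex hull t" if i: "i < length ss" for i
  proof -
    obtain u where u: "u \<in> cells N" "vertex_at p ss i \<in> u" "vertex_at p ss (Suc i) \<in> u"
      "vertex_at p ss i \<noteq> vertex_at p ss (Suc i)"
      using step_cell[OF chain_nth[OF ch(1) i]] by metis
    then obtain w where w: "w \<in> t" "u = subcell t w"
      using cell_between_nodes[OF Suc.prems(3) u] vn i by (metis Suc_leI less_imp_le)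
    have "set (ss ! i) \<subseteq> convex hull u"
      using Suc.IH[OF chain_nth[OF ch(1) i] _ u(1-3)] d(2) i by simp
    then show ?thesis using subcell_hull[OF w(1)] w(2) by blast
  qed
  then have "(\<Union>u\<in>set ss. set u) \<subseteq> convex hull t" 
    by (intro UN_least) (metis in_set_conv_nth)
  moreover have "p \<in> convex hull t" using Suc.prems(4) by (rule hull_inc)
  ultimately show ?case using set_concat_walks[of p ss] ch(2) by blast
qed

section \<open>Loop erasure acts on the pieces separately\<close>

lemma concat_walks_pieces:
  "concat_walks x (map (\<lambda>g. concat_walks (y g) (f g)) gs) = concat_walks x (concat (map f gs))"
  unfolding concat_walks_def by (induction gs) auto

lemma wlen_pieces: "wlen (concat_walks x ss) = sum_list (map wlen ss)"
  unfolding concat_walks_def wlen_def by (induction ss) auto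

lemma runs_concat:
  assumes "\<And>g. g \<in> set gs \<Longrightarrow> f g \<noteq> []"
    "successively (\<lambda>g h. k (last (f g)) \<noteq> k (hd (f h))) gs"
  shows "runs k (concat (map f gs)) = concat (map (\<lambda>g. runs k (f g)) gs)"
  using assms
proof (induction gs)
  case (Cons g gs)
  have "runs k (f g @ concat (map f gs)) = runs k (f g) @ runs k (concat (map f gs))"
  proof (rule runs_append)
    show "f g = [] \<or> concat (map f gs) = [] \<or> k (last (f g)) \<noteq> k (hd (concat (map f gs)))"
      using Cons.prems by (cases gs) auto
  qed
  then show ?case using Cons by (cases gs) auto
qed simp

lemma successively_runs: "successively (\<lambda>g h. f (hd g) \<noteq> f (hd h)) (runs f ss)"
proof (induction f ss rule: runs.induct)
  case (2 f s ss)
  show ?case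
  proof (cases "dropWhile (\<lambda>u. f u = f s) ss")
    case (Cons u r)
    then have "f u \<noteq> f s" using hd_dropWhile[of "\<lambda>u. f u = f s" ss] by auto
    then show ?thesis using 2 Cons by auto
  next
    case Nil
    then show ?thesis by (simp only: runs.simps successively.simps)
  qed
qed simp

lemma runs_sublist:
  assumes "g \<in> set (runs f ss)"
  obtains ps qs where "ss = ps @ g @ qs"
proof -
  obtain as bs where "runs f ss = as @ g # bs" using assms by (meson split_list)
  then have "ss = concat as @ g @ concat bs" using concat_runs[of f ss] by (metis concat.simps(2) concat_append)
  then show thesis by (rule that)
qed

lemma chain_sublist:
  assumes "chain N x ss" "ss = ps @ g @ qs" "g \<noteq> []"
  shows "chain N (hd (hd g)) g" "hd (hd g) = last (x # map last ps)"
proof -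
  have c: "chain N (last (x # map last ps)) g" using assms(1,2) by (simp add: chain_append)
  obtain s r where g: "g = s # r" using assms(3) by (cases g) auto
  then have "s \<in> step_walks N (last (x # map last ps)) (last s)" using c by simp
  then show "hd (hd g) = last (x # map last ps)" using step_walksD(3) g by simp
  then show "chain N (hd (hd g)) g" using c by simp
qed

lemma chain_runs:
  assumes "chain N x ss" "g \<in> set (runs f ss)"
  shows "chain N (hd (hd g)) g" "g \<noteq> []"
proof -
  show "g \<noteq> []" using runs_nonempty[OF assms(2)] .
  obtain ps qs where "ss = ps @ g @ qs" using assms(2) by (rule runs_sublist)
  then show "chain N (hd (hd g)) g" using chain_sublist(1)[OF assms(1)] \<open>g \<noteq> []\<close> by blast
qed

lemma chain_vertices:
  assumes "chain N x ss" "s \<in> set ss" "x \<in> T" "last ` set ss \<subseteq> T"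
  shows "s \<in> step_walks N (hd s) (last s)" "hd s \<in> T" "last s \<in> T"
proof -
  obtain i where i: "i < length ss" "s = ss ! i" using assms(2) by (auto simp: in_set_conv_nth)
  have sw: "s \<in> step_walks N (vertex_at x ss i) (vertex_at x ss (Suc i))"
    using chain_nth[OF assms(1) i(1)] i(2) by simp
  then show "s \<in> step_walks N (hd s) (last s)" using step_walksD(3,4) by simp
  show "last s \<in> T" using assms(2,4) by auto
  have "vertex_at x ss i \<in> T" using assms(3,4) i(1) by (cases i) auto
  then show "hd s \<in> T" using step_walksD(3)[OF sw] by simp
qed

definition piece_erasure :: "nat \<Rightarrow> walk list \<Rightarrow> walk list" where
  "piece_erasure k g = lerase last (hd (hd g)) (refine_all k g)"

text \<open>A run of steps in one triangle that does not return to its starting point.\<close>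

definition is_piece :: "nat \<Rightarrow> walk list \<Rightarrow> bool" where
  "is_piece N g \<longleftrightarrow> g \<noteq> [] \<and> chain N (hd (hd g)) g \<and> hd (hd g) \<noteq> last (last g) \<and>
     (\<forall>s\<in>set g. step_triangle N s = step_triangle N (hd g))"

lemma is_piece_cell:
  assumes "is_piece N g"
  obtains t where "t \<in> cells N" "hd (hd g) \<in> t" "last ` set g \<subseteq> t" "step_triangle N (hd g) = convex hull t"
proof -
  let ?x = "hd (hd g)"
  have c: "chain N ?x g" and ne: "g \<noteq> []" using assms unfolding is_piece_def by auto
  have sw: "s \<in> step_walks N (hd s) (last s)" if "s \<in> set g" for s
    using chain_vertices(1)[OF c that, of UNIV] by simp
  have "hd g \<in> set g" using ne by simp
  from step_cell[OF sw[OF this]] obtain t where t: "t \<in> cells N" "?x \<in> t" "step_triangle N (hd g) = convex hull t"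
    by metis
  have "last s \<in> t" if "s \<in> set g" for s
  proof -
    have "last s \<in> step_triangle N s" using step_end_in_triangle[OF sw[OF that]] .
    also have "step_triangle N s = convex hull t" using assms that t(3) unfolding is_piece_def by auto
    finally show ?thesis using hull_vertices[OF t(1)] step_walksD(6)[OF sw[OF that]] by blast
  qed
  then show thesis using that t by blast
qed

lemma piece_erasure_props:
  assumes "is_piece (Suc k) g"
  shows "chain k (hd (hd g)) (piece_erasure k g)" "piece_erasure k g \<noteq> []"
    "distinct (hd (hd g) # map last (piece_erasure k g))"
    "last (hd (hd g) # map last (piece_erasure k g)) = last (last g)"
    "erase_coarse k (joined g) = concat_walks (hd (hd g)) (piece_erasure k g)"
    "\<And>t. t \<in> cells (Suc k) \<Longrightarrow> hd (hd g) \<in> t \<Longrightarrow> last ` set g \<subseteq> t \<Longrightarrow> last ` set (piece_erasure k g) \<subseteq> nodes t"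
proof -
  let ?x = "hd (hd g)"
  have c: "chain (Suc k) ?x g" and ne: "g \<noteq> []" "?x \<noteq> last (last g)" using assms unfolding is_piece_def by auto
  note r = refine_all_props[OF c]
  show "chain k ?x (piece_erasure k g)" unfolding piece_erasure_def using r(1) by (rule chain_lerase)
  show "distinct (?x # map last (piece_erasure k g))" unfolding piece_erasure_def by (rule lerase_distinct)
  show l: "last (?x # map last (piece_erasure k g)) = last (last g)"
    unfolding piece_erasure_def last_lerase r(3) using ne(1) by (simp add: last_map)
  show "piece_erasure k g \<noteq> []"
  proof
    assume "piece_erasure k g = []"
    then show False using l ne(2) by simp
  qed
  show "erase_coarse k (joined g) = concat_walks ?x (piece_erasure k g)"
    unfolding joined_def piece_erasure_def using erase_coarse_chain[OF r(1)] r(2) by simp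
  show "last ` set (piece_erasure k g) \<subseteq> nodes t"
    if "t \<in> cells (Suc k)" "?x \<in> t" "last ` set g \<subseteq> t" for t
    unfolding piece_erasure_def by (rule lerase_nodes[OF that(1) c that(2)]) (use that(3) in auto)
qed

lemma piece_erasures_separate:
  assumes "is_piece (Suc k) g" "is_piece (Suc k) h" "step_triangle (Suc k) (hd g) \<noteq> step_triangle (Suc k) (hd h)"
    "s \<in> set (piece_erasure k g)" "s' \<in> set (piece_erasure k h)"
  shows "step_triangle k s \<noteq> step_triangle k s'"
proof
  assume eq: "step_triangle k s = step_triangle k s'"
  obtain t where t: "t \<in> cells (Suc k)" "hd (hd g) \<in> t" "last ` set g \<subseteq> t" "step_triangle (Suc k) (hd g) = convex hull t"
    using assms(1) by (rule is_piece_cell)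
  obtain t' where t': "t' \<in> cells (Suc k)" "hd (hd h) \<in> t'" "last ` set h \<subseteq> t'" "step_triangle (Suc k) (hd h) = convex hull t'"
    using assms(2) by (rule is_piece_cell)
  note g = piece_erasure_props[OF assms(1)] and h = piece_erasure_props[OF assms(2)]
  have s: "s \<in> step_walks k (hd s) (last s)" "hd s \<in> nodes t" "last s \<in> nodes t"
    using chain_vertices[OF g(1) assms(4), of "nodes t"] g(6)[OF t(1-3)] t(2) corners_nodes by blast+
  have s': "s' \<in> step_walks k (hd s') (last s')" "hd s' \<in> nodes t'" "last s' \<in> nodes t'"
    using chain_vertices[OF h(1) assms(5), of "nodes t'"] h(6)[OF t'(1-3)] t'(2) corners_nodes by blast+
  obtain u where u: "u \<in> cells k" "hd s \<in> u" "last s \<in> u" "hd s \<noteq> last s" "step_triangle k s = convex hull u"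
    using s(1) by (rule step_cell)
  obtain u' where u': "u' \<in> cells k" "hd s' \<in> u'" "last s' \<in> u'" "hd s' \<noteq> last s'" "step_triangle k s' = convex hull u'"
    using s'(1) by (rule step_cell)
  have "u = u'" using eq u(5) u'(5) hull_vertices[OF u(1)] hull_vertices[OF u'(1)] by metis
  obtain w where w: "w \<in> t" "u = subcell t w" using cell_between_nodes[OF t(1) u(1-4) s(2,3)] by blast
  obtain w' where w': "w' \<in> t'" "u' = subcell t' w'" using cell_between_nodes[OF t'(1) u'(1-4) s'(2,3)] by blast
  have "u \<subseteq> nodes t" "u \<subseteq> nodes t'" using w w' \<open>u = u'\<close> subcell_nodes by blast+
  moreover have "t \<noteq> t'" using assms(3) t(4) t'(4) by auto
  ultimately have "u \<subseteq> t" "u \<subseteq> t'" using nodes_inter[OF t(1) t'(1)] by blast+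
  then have "t = t'" using cells_eqI[OF t(1) t'(1)] u(2-4) by blast
  then show False using \<open>t \<noteq> t'\<close> by simp
qed

lemma is_piece_runs_of_distinct:
  assumes "chain k x ss" "distinct (x # map last ss)" "g \<in> set (runs (step_triangle k) ss)"
  shows "is_piece k g"
  unfolding is_piece_def
proof (intro conjI)
  show ne: "g \<noteq> []" and c: "chain k (hd (hd g)) g" using chain_runs[OF assms(1,3)] by auto
  show "\<forall>s\<in>set g. step_triangle k s = step_triangle k (hd g)"
    using runs_key[OF assms(3)] by blast
  obtain ps qs where pq: "ss = ps @ g @ qs" using assms(3) by (rule runs_sublist)
  have "hd (hd g) \<in> set (x # map last ps)" unfolding chain_sublist(2)[OF assms(1) pq ne] by (rule last_in_set) simp
  moreover have "last (last g) \<in> set (map last g)" using ne by simp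
  moreover have "distinct ((x # map last ps) @ map last g @ map last qs)" using assms(2) pq by simp
  ultimately show "hd (hd g) \<noteq> last (last g)" by auto
qed

lemma loop_erase_step:
  assumes ch: "chain (Suc k) x ss"
    and pieces: "\<And>g. g \<in> set (runs (step_triangle (Suc k)) ss) \<Longrightarrow> is_piece (Suc k) g"
    and IH: "\<And>x ss. chain k x ss \<Longrightarrow> (\<And>g. g \<in> set (runs (step_triangle k) ss) \<Longrightarrow> is_piece k g) \<Longrightarrow>
      loop_erase k (concat_walks x ss) = concat_walks x (map (\<lambda>g. loop_erase k (joined g)) (runs (step_triangle k) ss))"
  shows "loop_erase (Suc k) (concat_walks x ss) =
    concat_walks x (map (\<lambda>g. loop_erase k (joined g))
      (concat (map (\<lambda>g. runs (step_triangle k) (piece_erasure k g)) (runs (step_triangle (Suc k)) ss))))"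
proof -
  define gs where "gs = runs (step_triangle (Suc k)) ss"
  define rr where "rr = concat (map (piece_erasure k) gs)"
  have p: "is_piece (Suc k) g" if "g \<in> set gs" for g using pieces that unfolding gs_def .
  have "erase_step k (concat_walks x ss) = concat_walks x (map (\<lambda>g. erase_coarse k (joined g)) gs)"
    unfolding erase_step_def exit_pieces_chain[OF ch] gs_def by (simp add: o_def)
  also have "map (\<lambda>g. erase_coarse k (joined g)) gs = map (\<lambda>g. concat_walks (hd (hd g)) (piece_erasure k g)) gs"
    using piece_erasure_props(5)[OF p] by (intro map_cong) auto
  also have "concat_walks x \<dots> = concat_walks x rr" unfolding rr_def by (rule concat_walks_pieces)
  finally have step: "loop_erase (Suc k) (concat_walks x ss) = loop_erase k (concat_walks x rr)" by simp
  have sep: "successively (\<lambda>g h. step_triangle k (last (piece_erasure k g)) \<noteq> step_triangle k (hd (piece_erasure k h))) gs"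
  proof (rule successively_mono[OF successively_runs[of "step_triangle (Suc k)" ss, folded gs_def]])
    fix g h assume gh: "g \<in> set gs" "h \<in> set gs" "step_triangle (Suc k) (hd g) \<noteq> step_triangle (Suc k) (hd h)"
    then show "step_triangle k (last (piece_erasure k g)) \<noteq> step_triangle k (hd (piece_erasure k h))"
      using piece_erasures_separate[OF p p] piece_erasure_props(2)[OF p] by simp
  qed
  have runs: "runs (step_triangle k) rr = concat (map (\<lambda>g. runs (step_triangle k) (piece_erasure k g)) gs)"
    unfolding rr_def using piece_erasure_props(2)[OF p] sep by (rule runs_concat)
  have "chain k x (concat (map (piece_erasure k) hs)) \<and> last (x # map last (concat (map (piece_erasure k) hs))) = last (x # map last (concat hs))"
    if "chain (Suc k) x (concat hs)" "\<And>g. g \<in> set hs \<Longrightarrow> is_piece (Suc k) g" for hs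
    using that
  proof (induction hs rule: rev_induct)
    case (snoc h hs)
    have h: "is_piece (Suc k) h" using snoc.prems by simp
    note ph = piece_erasure_props[OF h]
    have ne: "h \<noteq> []" using h unfolding is_piece_def by simp
    have c: "chain (Suc k) x (concat hs)" "chain (Suc k) (last (x # map last (concat hs))) h"
      using snoc.prems(1) by (simp_all add: chain_append)
    have hd: "hd (hd h) = last (x # map last (concat hs))"
      using chain_sublist(2)[OF snoc.prems(1), of "concat hs" h "[]"] ne by simp
    note IH' = snoc.IH[OF c(1)]
    have "chain k x (concat (map (piece_erasure k) hs) @ piece_erasure k h)"
      unfolding chain_append using IH' snoc.prems(2) ph(1) hd by simp
    moreover have "last (x # map last (concat (map (piece_erasure k) hs) @ piece_erasure k h)) = last (last h)"
      using ph(2,4) by simp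
    moreover have "last (x # map last (concat (hs @ [h]))) = last (last h)" using ne by (simp add: last_map)
    ultimately show ?case by simp
  qed simp
  from this[of gs] have "chain k x rr" using ch p unfolding rr_def gs_def by simp
  moreover have "is_piece k g" if g: "g \<in> set (runs (step_triangle k) rr)" for g
  proof -
    obtain h where h: "h \<in> set gs" "g \<in> set (runs (step_triangle k) (piece_erasure k h))"
      using g unfolding runs set_concat set_map by blast
    then show ?thesis using is_piece_runs_of_distinct piece_erasure_props(1,3)[OF p[OF h(1)]] by blast
  qed
  ultimately have "loop_erase k (concat_walks x rr) =
      concat_walks x (map (\<lambda>g. loop_erase k (joined g)) (runs (step_triangle k) rr))"
    by (rule IH)
  then show ?thesis unfolding step runs gs_def .
qed

lemma loop_erase_chain:
  "chain N x ss \<Longrightarrow> (\<And>g. g \<in> set (runs (step_triangle N) ss) \<Longrightarrow> is_piece N g) \<Longrightarrow>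
   loop_erase N (concat_walks x ss) = concat_walks x (map (\<lambda>g. loop_erase N (joined g)) (runs (step_triangle N) ss))"
proof (induction N arbitrary: x ss)
  case 0
  have "concat_walks x (map joined (runs (step_triangle 0) ss)) = concat_walks x (concat (map (\<lambda>g. g) (runs (step_triangle 0) ss)))"
    unfolding joined_def by (rule concat_walks_pieces[where f = "\<lambda>g. g"])
  then show ?case by simp
next
  case (Suc k)
  let ?F = "\<lambda>g. loop_erase k (joined g)" and ?R = "\<lambda>g. runs (step_triangle k) (piece_erasure k g)"
  define gs where "gs = runs (step_triangle (Suc k)) ss"
  have "loop_erase (Suc k) (joined g) = concat_walks (hd (hd g)) (map ?F (?R g))" if g: "g \<in> set gs" for g
  proof -
    have p: "is_piece (Suc k) g" using Suc.prems(2) g unfolding gs_def .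
    then have c: "chain (Suc k) (hd (hd g)) g" unfolding is_piece_def by simp
    have one: "runs (step_triangle (Suc k)) g = [g]"
      using p unfolding is_piece_def by (intro runs_singleton[where k = "step_triangle (Suc k) (hd g)"]) blast+
    show ?thesis unfolding joined_def[of g]
      using loop_erase_step[OF c _ Suc.IH] p unfolding one by simp
  qed
  then have "map (\<lambda>g. loop_erase (Suc k) (joined g)) gs = map (\<lambda>g. concat_walks (hd (hd g)) (map ?F (?R g))) gs"
    by simp
  then have "concat_walks x (map (\<lambda>g. loop_erase (Suc k) (joined g)) gs) = concat_walks x (concat (map (\<lambda>g. map ?F (?R g)) gs))"
    using concat_walks_pieces by metis
  also have "\<dots> = loop_erase (Suc k) (concat_walks x ss)"
    using loop_erase_step[OF Suc.prems Suc.IH] unfolding gs_def by (simp add: map_concat o_def)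
  finally show ?case unfolding gs_def by simp
qed

text \<open>The erased piece is cut into pieces one scale below, and the further erasure never mixes
  them. This is the branching property of the deterministic map.\<close>

lemma loop_erase_piece:
  assumes "is_piece (Suc k) g"
  shows "loop_erase (Suc k) (joined g) = concat_walks (hd (hd g))
    (map (\<lambda>h. loop_erase k (joined h)) (runs (step_triangle k) (piece_erasure k g)))"
proof -
  have c: "chain (Suc k) (hd (hd g)) g" using assms unfolding is_piece_def by simp
  have one: "runs (step_triangle (Suc k)) g = [g]"
    using assms unfolding is_piece_def by (intro runs_singleton[where k = "step_triangle (Suc k) (hd g)"]) blast+
  show ?thesis unfolding joined_def[of g]
    using loop_erase_step[OF c _ loop_erase_chain] assms unfolding one by simp
qed

section \<open>The skeleton walk inside two triangles\<close>

text \<open>One coarse step from \<open>x\<close> to \<open>y\<close> in a triangle with third corner \<open>z\<close>, seen one scale below: the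
  corners, the midpoints, the three midpoints \<open>Ox1, Ox2, Ox3\<close> of the other triangle at \<open>x\<close>, and
  those of the other triangle at \<open>y\<close>, which only a second coarse step, from \<open>y\<close> to \<open>z\<close>, can reach.\<close>

datatype site = Cx | Cy | Cz | Mxy | Mxz | Myz | Ox1 | Ox2 | Ox3 | Oy1 | Oy2 | Oy3

text \<open>The moves available to the first step: corners other than \<open>x\<close> and \<open>y\<close> are left out, as a path
  reaching them does not represent a step from \<open>x\<close> to \<open>y\<close>.\<close>

fun moves :: "site \<Rightarrow> site list" where
  "moves Cx = [Mxy, Mxz, Ox1, Ox2]"
| "moves Mxy = [Cx, Mxz, Myz, Cy]"
| "moves Mxz = [Cx, Mxy, Myz]"
| "moves Myz = [Mxy, Mxz, Cy]"
| "moves Ox1 = [Cx, Ox2, Ox3]"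
| "moves Ox2 = [Cx, Ox1, Ox3]"
| "moves Ox3 = [Ox1, Ox2]"
| "moves _ = []"

text \<open>The sequence of sites visited after \<open>v\<close>; it stops on reaching \<open>Cy\<close>.\<close>

fun site_walk :: "site \<Rightarrow> site list \<Rightarrow> bool" where
  "site_walk v [] \<longleftrightarrow> v = Cy"
| "site_walk v (u # l) \<longleftrightarrow> u \<in> set (moves v) \<and> site_walk u l"

lemma distinct_moves: "distinct (moves v)" and length_moves: "length (moves v) \<le> 4"
  by (cases v; simp)+

lemma site_walk_Cy: "site_walk Cy l \<longleftrightarrow> l = []"
  by (cases l) auto

lemma site_walk_last: "site_walk v l \<Longrightarrow> last (v # l) = Cy"
  by (induction l arbitrary: v) auto

definition walk_sum :: "site \<Rightarrow> (site list \<Rightarrow> ennreal) \<Rightarrow> ennreal" where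
  "walk_sum v f = (\<integral>\<^sup>+l. ennreal ((1/4) ^ length l) * f l \<partial>count_space {l. site_walk v l})"

lemma walk_sum_Cy: "walk_sum Cy f = f []"
proof -
  have "{l. site_walk Cy l} = {[]}" by (auto simp: site_walk_Cy)
  then show ?thesis unfolding walk_sum_def by (simp add: nn_integral_count_space_finite)
qed

lemma walk_sum_first_step:
  assumes "v \<noteq> Cy"
  shows "walk_sum v f = (\<Sum>u\<leftarrow>moves v. ennreal (1/4) * walk_sum u (\<lambda>l. f (u # l)))"
proof -
  let ?g = "\<lambda>l. ennreal ((1/4) ^ length l) * f l"
  have ind: "indicator {l. site_walk v l} l = (\<Sum>u\<in>set (moves v). indicator ((#) u ` {l. site_walk u l}) l :: ennreal)" for l
  proof (cases l)
    case Nil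
    then show ?thesis using assms by (auto simp: indicator_def)
  next
    case (Cons u l')
    then have "(\<Sum>u\<in>set (moves v). indicator ((#) u ` {l. site_walk u l}) l :: ennreal) =
        (\<Sum>u'\<in>set (moves v). if u' = u then indicator {l. site_walk u l} l' else 0)"
      by (intro sum.cong) (auto simp: indicator_def)
    then show ?thesis using Cons by (auto simp: indicator_def)
  qed
  have "walk_sum v f = (\<integral>\<^sup>+l. ?g l * indicator {l. site_walk v l} l \<partial>count_space UNIV)"
    unfolding walk_sum_def by (rule nn_integral_count_space_indicator) simp
  also have "\<dots> = (\<integral>\<^sup>+l. (\<Sum>u\<in>set (moves v). ?g l * indicator ((#) u ` {l. site_walk u l}) l) \<partial>count_space UNIV)"
    unfolding ind by (simp add: sum_distrib_left)
  also have "\<dots> = (\<Sum>u\<in>set (moves v). \<integral>\<^sup>+l. ?g l * indicator ((#) u ` {l. site_walk u l}) l \<partial>count_space UNIV)"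
    by (rule nn_integral_sum) simp
  also have "\<dots> = (\<Sum>u\<in>set (moves v). ennreal (1/4) * walk_sum u (\<lambda>l. f (u # l)))"
  proof (rule sum.cong[OF refl])
    fix u
    have "(\<integral>\<^sup>+l. ?g l * indicator ((#) u ` {l. site_walk u l}) l \<partial>count_space UNIV) =
        (\<integral>\<^sup>+l. ?g l \<partial>count_space ((#) u ` {l. site_walk u l}))"
      by (rule nn_integral_count_space_indicator[symmetric]) simp
    also have "\<dots> = (\<integral>\<^sup>+l. ?g (u # l) \<partial>count_space {l. site_walk u l})"
      by (rule nn_integral_bij_count_space[symmetric]) (auto simp: bij_betw_def)
    also have "\<dots> = (\<integral>\<^sup>+l. ennreal (1/4) * (ennreal ((1/4) ^ length l) * f (u # l)) \<partial>count_space {l. site_walk u l})"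
      by (intro nn_integral_cong) (simp add: ennreal_mult'' ennreal_mult mult.assoc[symmetric] flip: ennreal_mult')
    also have "\<dots> = ennreal (1/4) * walk_sum u (\<lambda>l. f (u # l))"
      unfolding walk_sum_def by (rule nn_integral_cmult) simp
    finally show "(\<integral>\<^sup>+l. ?g l * indicator ((#) u ` {l. site_walk u l}) l \<partial>count_space UNIV) =
        ennreal (1/4) * walk_sum u (\<lambda>l. f (u # l))" .
  qed
  also have "\<dots> = (\<Sum>u\<leftarrow>moves v. ennreal (1/4) * walk_sum u (\<lambda>l. f (u # l)))"
    by (rule sum_list_distinct_conv_sum_set[symmetric, OF distinct_moves])
  finally show ?thesis .
qed

lemma walk_sum_mono: "(\<And>l. f l \<le> g l) \<Longrightarrow> walk_sum v f \<le> walk_sum v g"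
  unfolding walk_sum_def by (intro nn_integral_mono mult_left_mono) auto

lemma walk_sum_cmult: "walk_sum v (\<lambda>l. c * f l) = c * walk_sum v f"
  unfolding walk_sum_def by (subst nn_integral_cmult[symmetric]) (auto simp: mult_ac)

lemma walk_sum_le_1: "walk_sum v (\<lambda>_. 1) \<le> 1"
proof -
  define T where "T n v = walk_sum v (\<lambda>l. indicator {l. length l \<le> n} l)" for n v
  have step: "T n v \<le> 1" for n v
  proof (induction n arbitrary: v)
    case (0 v)
    show ?case
    proof (cases "v = Cy")
      case False
      have "walk_sum u (\<lambda>l. indicator {l. length l \<le> 0} (u # l)) = 0" for u :: site
        unfolding walk_sum_def by simp
      then show ?thesis unfolding T_def walk_sum_first_step[OF False] by simp
    qed (simp add: T_def walk_sum_Cy)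
  next
    case (Suc n v)
    show ?case
    proof (cases "v = Cy")
      case False
      have "indicator {l. length l \<le> Suc n} (u # l) = (indicator {l. length l \<le> n} l :: ennreal)" for u :: site and l
        by (simp add: indicator_def)
      then have "T (Suc n) v = (\<Sum>u\<leftarrow>moves v. ennreal (1/4) * T n u)"
        unfolding T_def walk_sum_first_step[OF False] by simp
      also have "\<dots> \<le> (\<Sum>u\<leftarrow>moves v. ennreal (1/4))"
      proof (rule sum_list_mono)
        fix u
        show "ennreal (1/4) * T n u \<le> ennreal (1/4)"
          using mult_left_mono[OF Suc, of "ennreal (1/4)"] by simp
      qed
      also have "\<dots> = of_nat (length (moves v)) * ennreal (1/4)"
        by (simp add: sum_list_triv)
      also have "\<dots> = ennreal (real (length (moves v)) * (1/4))"
        by (simp add: ennreal_of_nat_eq_real_of_nat flip: ennreal_mult')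
      also have "\<dots> \<le> 1" using length_moves[of v] by (simp add: ennreal_le_1)
      finally show ?thesis .
    qed (simp add: T_def walk_sum_Cy)
  qed
  have "walk_sum v (\<lambda>_. 1) = (\<integral>\<^sup>+l. (SUP n. ennreal ((1/4) ^ length l) * indicator {l. length l \<le> n} l) \<partial>count_space {l. site_walk v l})"
    unfolding walk_sum_def
  proof (intro nn_integral_cong)
    fix l :: "site list"
    show "ennreal ((1/4) ^ length l) * 1 = (SUP n. ennreal ((1/4) ^ length l) * indicator {l. length l \<le> n} l)"
      by (rule antisym) (auto intro!: SUP_upper2[of "length l"] SUP_least simp: indicator_def)
  qed
  also have "\<dots> = (SUP n. T n v)"
    unfolding T_def walk_sum_def
    by (rule nn_integral_monotone_convergence_SUP) (auto intro!: incseq_SucI le_funI simp: indicator_def)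
  also have "\<dots> \<le> 1" using step by (intro SUP_least) simp
  finally show ?thesis .
qed

text \<open>Expected time until the walk leaves, up to the killed corners: harmonicity defects of bounded
  functions contract by \<open>4/5\<close> in the norm weighted by it.\<close>

fun site_weight :: "site \<Rightarrow> real" where
  "site_weight Cx = 5" | "site_weight Mxy = 4" | "site_weight Mxz = 4" | "site_weight Myz = 3"
| "site_weight Ox1 = 4" | "site_weight Ox2 = 4" | "site_weight Ox3 = 3" | "site_weight Cy = 0"
| "site_weight _ = 1"

lemma site_weight_bounds:
  "v \<noteq> Cy \<Longrightarrow> 1 \<le> site_weight v" "site_weight v \<le> 5"
  "v \<noteq> Cy \<Longrightarrow> (\<Sum>u\<leftarrow>moves v. site_weight u) \<le> 4 * (site_weight v - 1)"
  by (cases v; simp)+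

text \<open>Optional stopping for a state \<open>q\<close> that is updated along the walk: the value of a bounded
  harmonic function at the start is its expected final value. Uniqueness of the solution follows
  from the contraction.\<close>

lemma walk_sum_harmonic:
  fixes h :: "'q \<Rightarrow> real" and upd :: "'q \<Rightarrow> site \<Rightarrow> 'q" and loc :: "'q \<Rightarrow> site"
  assumes upd: "\<And>q u. q \<in> Q \<Longrightarrow> u \<in> set (moves (loc q)) \<Longrightarrow> upd q u \<in> Q \<and> loc (upd q u) = u"
    and bound: "\<And>q. 0 \<le> h q" "\<And>q. h q \<le> C"
    and harm: "\<And>q. q \<in> Q \<Longrightarrow> loc q \<noteq> Cy \<Longrightarrow> (\<Sum>u\<leftarrow>moves (loc q). h (upd q u)) = 4 * h q"
    and q: "q \<in> Q"
  shows "walk_sum (loc q) (\<lambda>l. ennreal (h (foldl upd q l))) = ennreal (h q)"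
proof -
  define I where "I q = walk_sum (loc q) (\<lambda>l. ennreal (h (foldl upd q l)))" for q
  have C: "0 \<le> C" using bound order_trans by blast
  have Ile: "I q \<le> ennreal C" for q
  proof -
    have "I q \<le> walk_sum (loc q) (\<lambda>l. ennreal C * 1)"
      unfolding I_def by (rule walk_sum_mono) (simp add: ennreal_leI bound)
    also have "\<dots> \<le> ennreal C * 1" unfolding walk_sum_cmult by (intro mult_left_mono walk_sum_le_1) simp
    finally show ?thesis by simp
  qed
  define D where "D q = h q - enn2real (I q)" for q
  have ennI: "I q = ennreal (enn2real (I q))" for q
    using Ile[of q] by (metis ennreal_enn2real ennreal_less_top order_le_less_trans)
  have DC: "\<bar>D q\<bar> \<le> C" for q
  proof -
    have "enn2real (I q) \<le> C" using Ile[of q] C by (simp add: enn2real_leI)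
    then show ?thesis using bound[of q] enn2real_nonneg[of "I q"] unfolding D_def by linarith
  qed
  have final: "D q = 0" if "loc q = Cy" for q
    unfolding D_def I_def that walk_sum_Cy using bound(1) by simp
  have step: "4 * D q = (\<Sum>u\<leftarrow>moves (loc q). D (upd q u))" if q: "q \<in> Q" "loc q \<noteq> Cy" for q
  proof -
    have "I q = (\<Sum>u\<leftarrow>moves (loc q). ennreal (1/4) * I (upd q u))"
      unfolding I_def walk_sum_first_step[OF q(2)]
      by (intro arg_cong[where f = sum_list] map_cong) (auto simp: upd[OF q(1)])
    also have "\<dots> = (\<Sum>u\<leftarrow>moves (loc q). ennreal (1/4 * enn2real (I (upd q u))))"
      by (intro arg_cong[where f = sum_list] map_cong refl) (subst ennI, simp flip: ennreal_mult')
    also have "\<dots> = ennreal (\<Sum>u\<leftarrow>moves (loc q). 1/4 * enn2real (I (upd q u)))"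
      by (induction "moves (loc q)") (auto simp: ennreal_plus sum_list_nonneg simp del: ennreal_plus intro: ennreal_plus[symmetric])
    finally have "I q = ennreal (\<Sum>u\<leftarrow>moves (loc q). 1/4 * enn2real (I (upd q u)))" .
    moreover have "0 \<le> (\<Sum>u\<leftarrow>moves (loc q). 1/4 * enn2real (I (upd q u)))" by (rule sum_list_nonneg) auto
    ultimately have "enn2real (I q) = (\<Sum>u\<leftarrow>moves (loc q). 1/4 * enn2real (I (upd q u)))" by simp
    then have "4 * enn2real (I q) = (\<Sum>u\<leftarrow>moves (loc q). enn2real (I (upd q u)))"
      unfolding sum_list_const_mult by simp
    then show ?thesis using harm[OF q] unfolding D_def by (simp add: sum_list_subtractf)
  qed
  have decay: "\<bar>D q\<bar> \<le> C * (4/5) ^ n * site_weight (loc q)" if "q \<in> Q" for n q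
    using that
  proof (induction n arbitrary: q)
    case 0
    show ?case
    proof (cases "loc q = Cy")
      case False
      have "C * 1 \<le> C * site_weight (loc q)" using site_weight_bounds(1)[OF False] C by (intro mult_left_mono)
      then show ?thesis using DC[of q] by simp
    qed (simp add: final)
  next
    case (Suc n)
    show ?case
    proof (cases "loc q = Cy")
      case False
      let ?c = "C * (4/5) ^ n" and ?w = "site_weight (loc q)"
      have c: "0 \<le> ?c" using C by simp
      have "4 * \<bar>D q\<bar> = \<bar>\<Sum>u\<leftarrow>moves (loc q). D (upd q u)\<bar>" using step[OF Suc.prems False] by linarith
      also have "\<dots> \<le> (\<Sum>u\<leftarrow>moves (loc q). \<bar>D (upd q u)\<bar>)" using sum_list_abs[of "map (\<lambda>u. D (upd q u)) (moves (loc q))"] by (simp add: o_def)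
      also have "\<dots> \<le> (\<Sum>u\<leftarrow>moves (loc q). ?c * site_weight u)"
        by (rule sum_list_mono) (use Suc.IH upd[OF Suc.prems] in metis)
      also have "\<dots> = ?c * (\<Sum>u\<leftarrow>moves (loc q). site_weight u)" by (simp add: sum_list_const_mult)
      also have "\<dots> \<le> ?c * (4 * (?w - 1))" using site_weight_bounds(3)[OF False] c by (rule mult_left_mono)
      also have "\<dots> \<le> ?c * (4 * (4/5 * ?w))" using site_weight_bounds(2)[of "loc q"] c by (intro mult_left_mono) auto
      finally show ?thesis by (simp add: mult_ac)
    qed (simp add: final)
  qed
  have "(\<lambda>n. C * (4/5) ^ n * site_weight (loc q)) \<longlonglongrightarrow> C * 0 * site_weight (loc q)"
    by (intro tendsto_intros LIMSEQ_realpow_zero) auto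
  then have "\<bar>D q\<bar> \<le> 0"
    by (intro LIMSEQ_le_const[of "\<lambda>n. C * (4/5) ^ n * site_weight (loc q)"]) (use decay[OF q] in auto)
  then show ?thesis using ennI[of q] unfolding D_def I_def[symmetric] by simp
qed

fun hit_prob :: "site \<Rightarrow> real" where
  "hit_prob Cx = 1/4" | "hit_prob Mxy = 1/2" | "hit_prob Mxz = 3/10" | "hit_prob Myz = 9/20"
| "hit_prob Ox1 = 1/10" | "hit_prob Ox2 = 1/10" | "hit_prob Ox3 = 1/20" | "hit_prob Cy = 1"
| "hit_prob _ = 0"

lemma walk_sum_hit: "walk_sum Cx (\<lambda>_. 1) = ennreal (1/4)"
proof -
  have "walk_sum (id Cx) (\<lambda>l. ennreal (hit_prob (foldl (\<lambda>_ u. u) Cx l))) = ennreal (hit_prob Cx)"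
  proof (rule walk_sum_harmonic[where Q = UNIV and C = 1])
    show "0 \<le> hit_prob q" "hit_prob q \<le> 1" for q by (cases q; simp)+
    show "(\<Sum>u\<leftarrow>moves (id q). hit_prob u) = 4 * hit_prob q" if "id q \<noteq> Cy" for q
      using that by (cases q) auto
  qed auto
  moreover have "walk_sum Cx (\<lambda>l. ennreal (hit_prob (foldl (\<lambda>_ u. u) Cx l))) = walk_sum Cx (\<lambda>_. 1)"
    unfolding walk_sum_def
  proof (intro nn_integral_cong)
    fix l assume "l \<in> space (count_space {l. site_walk Cx l})"
    then have "last (Cx # l) = Cy" using site_walk_last by simp
    moreover have "foldl (\<lambda>_ u. u) v l = last (v # l)" for v :: site by (induction l arbitrary: v) auto
    ultimately show "ennreal ((1/4) ^ length l) * ennreal (hit_prob (foldl (\<lambda>_ u. u) Cx l)) = ennreal ((1/4) ^ length l) * 1"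
      by simp
  qed
  ultimately show ?thesis by simp
qed

definition skeleton_pmf :: "site list pmf" where
  "skeleton_pmf = embed_pmf (\<lambda>l. if site_walk Cx l then 4 * (1/4) ^ length l else 0)"

lemma pmf_skeleton: "pmf skeleton_pmf l = (if site_walk Cx l then 4 * (1/4) ^ length l else 0)"
proof -
  have "(\<integral>\<^sup>+l. ennreal (if site_walk Cx l then 4 * (1/4) ^ length l else 0) \<partial>count_space UNIV) =
      (\<integral>\<^sup>+l. ennreal (4 * (1/4) ^ length l) * indicator {l. site_walk Cx l} l \<partial>count_space UNIV)"
    by (intro nn_integral_cong) (auto simp: indicator_def)
  also have "\<dots> = (\<integral>\<^sup>+l. ennreal (4 * (1/4) ^ length l) \<partial>count_space {l. site_walk Cx l})"
    by (rule nn_integral_count_space_indicator[symmetric]) simp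
  also have "\<dots> = walk_sum Cx (\<lambda>l. 4 * 1)"
    unfolding walk_sum_def by (intro nn_integral_cong) (simp add: ennreal_mult'' mult.commute)
  also have "\<dots> = 1"
    unfolding walk_sum_cmult walk_sum_hit by (simp flip: ennreal_numeral ennreal_mult)
  finally show ?thesis unfolding skeleton_pmf_def by (intro pmf_embed_pmf) auto
qed

lemma set_skeleton_pmf: "l \<in> set_pmf skeleton_pmf \<longleftrightarrow> site_walk Cx l"
  by (simp add: set_pmf_iff pmf_skeleton)

lemma nn_integral_skeleton: "(\<integral>\<^sup>+l. f l \<partial>skeleton_pmf) = 4 * walk_sum Cx f"
proof -
  have "(\<integral>\<^sup>+l. f l \<partial>skeleton_pmf) = (\<integral>\<^sup>+l. ennreal (pmf skeleton_pmf l) * f l \<partial>count_space UNIV)"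
    by (rule nn_integral_measure_pmf)
  also have "\<dots> = (\<integral>\<^sup>+l. (ennreal ((1/4) ^ length l) * (4 * f l)) * indicator {l. site_walk Cx l} l \<partial>count_space UNIV)"
    by (intro nn_integral_cong) (auto simp: pmf_skeleton indicator_def ennreal_mult'' mult_ac)
  also have "\<dots> = walk_sum Cx (\<lambda>l. 4 * f l)"
    unfolding walk_sum_def by (rule nn_integral_count_space_indicator[symmetric]) simp
  finally show ?thesis unfolding walk_sum_cmult .
qed

definition outer :: "site \<Rightarrow> bool" where
  "outer v \<longleftrightarrow> v \<in> {Ox1, Ox2, Ox3, Oy1, Oy2, Oy3}"

text \<open>The cell of an edge inside the triangle; the edges outside are never counted.\<close>

definition edge_cell :: "site \<times> site \<Rightarrow> nat" where
  "edge_cell e = (if set [fst e, snd e] \<subseteq> {Cx, Mxy, Mxz} then 0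
     else if set [fst e, snd e] \<subseteq> {Mxy, Cy, Myz} then 1
     else if set [fst e, snd e] \<subseteq> {Mxz, Myz, Cz} then 2 else 3)"

definition edges :: "'v \<Rightarrow> 'v list \<Rightarrow> ('v \<times> 'v) list" where
  "edges x l = zip (x # l) l"

definition site_pieces :: "site list \<Rightarrow> (site \<times> site) list list" where
  "site_pieces l = runs edge_cell (edges Cx l)"

definition piece_count :: "nat \<Rightarrow> site list \<Rightarrow> nat" where
  "piece_count n l = length (filter (\<lambda>g. length g = n) (site_pieces l))"

text \<open>The moves of the second step, from \<open>y\<close> to \<open>z\<close>, in the coordinates of the first.\<close>

fun rotate_site :: "site \<Rightarrow> site" where
  "rotate_site Cx = Cy" | "rotate_site Cy = Cz" | "rotate_site Mxy = Myz" | "rotate_site Mxz = Mxy"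
| "rotate_site Myz = Mxz" | "rotate_site Ox1 = Oy1" | "rotate_site Ox2 = Oy2" | "rotate_site Ox3 = Oy3"
| "rotate_site _ = Cx"

fun unrotate_site :: "site \<Rightarrow> site" where
  "unrotate_site Cy = Cx" | "unrotate_site Cz = Cy" | "unrotate_site Myz = Mxy" | "unrotate_site Mxy = Mxz"
| "unrotate_site Mxz = Myz" | "unrotate_site Oy1 = Ox1" | "unrotate_site Oy2 = Ox2" | "unrotate_site Oy3 = Ox3"
| "unrotate_site _ = Cz"

section \<open>Mean numbers of pieces\<close>

text \<open>The three tables list, for every erased path inside the triangle, \<open>14797200\<close> times the value
  of the harmonic functions whose boundary values are the numbers of single steps and of double
  steps of the erased path: for a walk from \<open>x\<close> to \<open>y\<close>, for the first half of a walk from \<open>x\<close> via \<open>y\<close>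
  to \<open>z\<close>, and for its second half. They solve the linear equations of the
  finite Markov chain of erased paths, whose solution is checked below. During an excursion into
  the other triangle at a corner, the value at that corner is weighted with the probability of
  coming back: \<open>2/5\<close> from a midpoint next to it and \<open>1/5\<close> from the opposite one.\<close>

definition table_single :: "(site list \<times> int \<times> int) list" where
  "table_single = [([], 6658740, 1479720), ([Mxy], 13317480, 2071608), ([Mxz], 7990488, 2663496),
     ([Mxy, Mxz], 8187784, 2071608), ([Mxy, Myz], 8828996, 4735104), ([Mxy, Cy], 29594400, 0),
     ([Mxz, Mxy], 8385080, 7201304), ([Mxz, Myz], 16918132, 1972960),
     ([Mxy, Mxz, Myz], 12774916, 4735104), ([Mxy, Myz, Mxz], 7201304, 2071608),
     ([Mxy, Myz, Cy], 14797200, 14797200), ([Mxz, Mxy, Myz], 4093892, 9864800),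
     ([Mxz, Mxy, Cy], 14797200, 14797200), ([Mxz, Myz, Mxy], 15290440, 5228344),
     ([Mxz, Myz, Cy], 44391600, 0), ([Mxy, Mxz, Myz, Cy], 29594400, 14797200),
     ([Mxz, Mxy, Myz, Cy], 0, 29594400), ([Mxz, Myz, Mxy, Cy], 29594400, 14797200)]"

definition table_first :: "(site list \<times> int \<times> int) list" where
  "table_first = [([], 1603030, 801515), ([Mxy], 3403356, 1627692), ([Mxz], 1726340, 937156),
     ([Mxy, Mxz], 1829472, 1060466), ([Mxy, Myz], 3477342, 1095217),
     ([Mxy, Cy], 6703580, 3553570), ([Mxz, Mxy], 2941268, 1748406),
     ([Mxz, Myz], 2361062, 1198703), ([Mxy, Mxz, Myz], 2311502, 1812657),
     ([Mxy, Myz, Mxz], 2120932, 881106), ([Mxy, Myz, Cy], 8385080, 1872070),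
     ([Mxz, Mxy, Myz], 2871462, 1337303), ([Mxz, Mxy, Cy], 5564240, 3917650),
     ([Mxz, Myz, Mxy], 2681668, 1359006), ([Mxz, Myz, Cy], 5036240, 2498650),
     ([Mxy, Mxz, Myz, Cy], 4013180, 4562470), ([Mxz, Mxy, Myz, Cy], 6818240, 2663650),
     ([Mxz, Myz, Mxy, Cy], 5036240, 2498650)]"

definition table_second :: "(site list \<times> int \<times> int) list" where
  "table_second = [([Mxy], 8089136, 3378694), ([Mxz], 11739112, 2096270), ([Mxy, Mxz], 6909844, 7349276),
     ([Mxy, Myz], 18743120, 2611930), ([Mxy, Cy], 6703580, 3553570),
     ([Mxz, Mxy], 7824344, 2907520), ([Mxz, Myz], 9537704, 5477560), ([Mxz, Cz], 29594400, 0),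
     ([Mxy, Mxz, Myz], 4753040, 11221210), ([Mxy, Mxz, Cz], 14797200, 14797200),
     ([Mxy, Myz, Mxz], 14106664, 5196956), ([Mxy, Myz, Cy], 8385080, 1872070),
     ([Mxy, Myz, Cz], 44391600, 0), ([Mxy, Cy, Myz], 13362320, 7992730),
     ([Mxz, Mxy, Myz], 13994024, 5616160), ([Mxz, Mxy, Cy], 5564240, 3917650),
     ([Mxz, Myz, Mxy], 6578264, 2518120), ([Mxz, Myz, Cy], 5036240, 2498650),
     ([Mxz, Myz, Cz], 14797200, 14797200), ([Mxy, Mxz, Myz, Cy], 4013180, 4562470),
     ([Mxy, Mxz, Myz, Cz], 0, 29594400), ([Mxy, Myz, Mxz, Cz], 29594400, 14797200),
     ([Mxy, Cy, Myz, Mxz], 9062164, 10241456), ([Mxy, Cy, Myz, Cz], 29594400, 14797200),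
     ([Mxz, Mxy, Myz, Cy], 6818240, 2663650), ([Mxz, Mxy, Myz, Cz], 29594400, 14797200),
     ([Mxz, Mxy, Cy, Myz], 9981224, 9628960), ([Mxz, Myz, Mxy, Cy], 5036240, 2498650),
     ([Mxz, Myz, Cy, Mxy], 6578264, 2518120), ([Mxy, Cy, Myz, Mxz, Cz], 14797200, 29594400),
     ([Mxz, Mxy, Cy, Myz, Cz], 14797200, 29594400)]"

definition lookup :: "(site list \<times> int \<times> int) list \<Rightarrow> nat \<Rightarrow> site list \<Rightarrow> int" where
  "lookup tab n q = (case map_of tab q of None \<Rightarrow> 0 | Some (a, b) \<Rightarrow> if n = 1 then a else b)"

fun return_weight :: "site \<Rightarrow> int" where
  "return_weight Ox3 = 1" | "return_weight Oy3 = 1" | "return_weight _ = 2"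

definition table_value :: "(site list \<times> int \<times> int) list \<Rightarrow> nat \<Rightarrow> site list \<Rightarrow> int" where
  "table_value tab n q = (let b = takeWhile (\<lambda>v. \<not> outer v) q in
     if b = q then 5 * lookup tab n q else return_weight (last q) * lookup tab n b)"

definition excursions :: "(site \<Rightarrow> site) \<Rightarrow> site list list" where
  "excursions f = map (map f) [[Ox1], [Ox2], [Ox1, Ox2], [Ox1, Ox3], [Ox2, Ox1], [Ox2, Ox3],
     [Ox1, Ox2, Ox3], [Ox1, Ox3, Ox2], [Ox2, Ox1, Ox3], [Ox2, Ox3, Ox1]]"

text \<open>The possible erased paths, where \<open>c\<close> is the corner at which excursions start.\<close>

definition states :: "(site list \<times> int \<times> int) list \<Rightarrow> site \<Rightarrow> (site \<Rightarrow> site) \<Rightarrow> site list list" where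
  "states tab c f = concat (map (\<lambda>b. b # (if last (Cx # b) = c then map ((@) b) (excursions f) else [])) (map fst tab))"

definition harmonic_table ::
  "(site list \<times> int \<times> int) list \<Rightarrow> site list list \<Rightarrow> (site list \<Rightarrow> site \<Rightarrow> site list) \<Rightarrow> (site list \<Rightarrow> site) \<Rightarrow> bool" where
  "harmonic_table tab Q upd loc \<longleftrightarrow> list_all (\<lambda>q. let vs = moves (loc q) in
      list_all (\<lambda>u. upd q u \<in> set Q \<and> loc (upd q u) = u) vs \<and>
      (loc q \<noteq> Cy \<longrightarrow> (\<forall>n\<in>{1, 2}. sum_list (map (\<lambda>u. table_value tab n (upd q u)) vs) = 4 * table_value tab n q))) Q"

definition "upd_first q u = push (\<lambda>v. v) Cx q u"
definition "loc_first q = last (Cx # q)"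
definition "upd_second q u = push (\<lambda>v. v) Cx q (rotate_site u)"
definition "loc_second q = unrotate_site (last (Cx # q))"

lemma harmonic_single: "harmonic_table table_single (states table_single Cx id) upd_first loc_first"
  by code_simp

lemma harmonic_first: "harmonic_table table_first (states table_first Cx id) upd_first loc_first"
  by code_simp

lemma harmonic_second: "harmonic_table table_second (states table_second Cy rotate_site) upd_second loc_second"
  by code_simp

definition good_final :: "site list \<Rightarrow> bool" where
  "good_final q \<longleftrightarrow> list_all (\<lambda>g. length g \<in> {1, 2}) (site_pieces q) \<and>
     length (site_pieces q) \<in> {2, 3} \<and> list_all (\<lambda>v. \<not> outer v) q"

lemma final_single: "list_all (\<lambda>q. loc_first q = Cy \<longrightarrow> good_final q \<and>
    (\<forall>n\<in>{1, 2}. table_value table_single n q = 73986000 * int (piece_count n q))) (states table_single Cx id)"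
  by code_simp

lemma final_first: "list_all (\<lambda>q. loc_first q = Cy \<longrightarrow> q \<in> set (states table_second Cy rotate_site) \<and>
    loc_second q = Cx \<and>
    (\<forall>n\<in>{1, 2}. table_value table_first n q = table_value table_second n q)) (states table_first Cx id)"
  by code_simp

lemma final_second: "list_all (\<lambda>q. loc_second q = Cy \<longrightarrow> good_final q \<and>
    (\<forall>n\<in>{1, 2}. table_value table_second n q = 73986000 * int (piece_count n q))) (states table_second Cy rotate_site)"
  by code_simp

lemma table_nonneg:
  "list_all (\<lambda>q. \<forall>n\<in>{1, 2}. 0 \<le> table_value table_single n q) (states table_single Cx id)"
  "list_all (\<lambda>q. \<forall>n\<in>{1, 2}. 0 \<le> table_value table_first n q) (states table_first Cx id)"
  "list_all (\<lambda>q. \<forall>n\<in>{1, 2}. 0 \<le> table_value table_second n q) (states table_second Cy rotate_site)"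
  by code_simp+

definition scaled_value :: "(site list \<times> int \<times> int) list \<Rightarrow> nat \<Rightarrow> site list \<Rightarrow> real" where
  "scaled_value tab n q = of_int (table_value tab n q) / 73986000"

lemma walk_stays_in_states:
  assumes "harmonic_table tab Q upd loc" "q \<in> set Q" "site_walk (loc q) l"
  shows "foldl upd q l \<in> set Q \<and> loc (foldl upd q l) = Cy"
  using assms(2,3)
proof (induction l arbitrary: q)
  case (Cons u l)
  then have "upd q u \<in> set Q \<and> loc (upd q u) = u"
    using assms(1) unfolding harmonic_table_def by (auto simp: list_all_iff Let_def)
  then show ?case using Cons by simp
qed simp

lemma walk_sum_table:
  assumes H: "harmonic_table tab Q upd loc" and q: "q \<in> set Q" and n: "n \<in> {1, 2}"
    and nonneg: "list_all (\<lambda>q. \<forall>n\<in>{1, 2}. 0 \<le> table_value tab n q) Q"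
    and f: "\<And>q. q \<in> set Q \<Longrightarrow> loc q = Cy \<Longrightarrow> f q = scaled_value tab n q"
  shows "walk_sum (loc q) (\<lambda>l. ennreal (f (foldl upd q l))) = ennreal (scaled_value tab n q)"
proof -
  define h where "h q = (if q \<in> set Q then scaled_value tab n q else 0)" for q
  have hnn: "0 \<le> h q" for q
    using nonneg n unfolding h_def scaled_value_def by (auto simp: list_all_iff)
  have upd: "upd q u \<in> set Q \<and> loc (upd q u) = u" if "q \<in> set Q" "u \<in> set (moves (loc q))" for q u
    using H that unfolding harmonic_table_def by (auto simp: list_all_iff Let_def)
  have "walk_sum (loc q) (\<lambda>l. ennreal (h (foldl upd q l))) = ennreal (h q)"
  proof (rule walk_sum_harmonic[where Q = "set Q" and C = "\<Sum>q\<in>set Q. h q"])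
    show "h q \<le> (\<Sum>q\<in>set Q. h q)" for q
    proof (cases "q \<in> set Q")
      case True
      then show ?thesis by (intro member_le_sum) (auto simp: hnn)
    next
      case False
      then show ?thesis using sum_nonneg[of "set Q" h] hnn by (simp add: h_def[of q])
    qed
    show "(\<Sum>u\<leftarrow>moves (loc q). h (upd q u)) = 4 * h q" if q: "q \<in> set Q" "loc q \<noteq> Cy" for q
    proof -
      have "sum_list (map (\<lambda>u. table_value tab n (upd q u)) (moves (loc q))) = 4 * table_value tab n q"
        using H q n unfolding harmonic_table_def by (auto simp: list_all_iff Let_def)
      then have "real_of_int (sum_list (map (\<lambda>u. table_value tab n (upd q u)) (moves (loc q)))) / 73986000 =
          4 * scaled_value tab n q"
        unfolding scaled_value_def by simp
      moreover have "real_of_int (sum_list (map F us)) / 73986000 = (\<Sum>u\<leftarrow>us. real_of_int (F u) / 73986000)"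
        for F :: "site \<Rightarrow> int" and us
        by (induction us) (auto simp: add_divide_distrib)
      moreover have "(\<Sum>u\<leftarrow>moves (loc q). h (upd q u)) = (\<Sum>u\<leftarrow>moves (loc q). real_of_int (table_value tab n (upd q u)) / 73986000)"
        using upd[OF q(1)] by (intro arg_cong[where f = sum_list] map_cong) (auto simp: h_def scaled_value_def)
      ultimately show ?thesis using q(1) by (simp add: h_def)
    qed
  qed (use hnn upd q in auto)
  moreover have "walk_sum (loc q) (\<lambda>l. ennreal (h (foldl upd q l))) = walk_sum (loc q) (\<lambda>l. ennreal (f (foldl upd q l)))"
    unfolding walk_sum_def
  proof (intro nn_integral_cong)
    fix l assume "l \<in> space (count_space {l. site_walk (loc q) l})"
    then have "foldl upd q l \<in> set Q \<and> loc (foldl upd q l) = Cy"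
      using walk_stays_in_states[OF H q] by simp
    then show "ennreal ((1/4) ^ length l) * ennreal (h (foldl upd q l)) = ennreal ((1/4) ^ length l) * ennreal (f (foldl upd q l))"
      using f by (simp add: h_def)
  qed
  ultimately show ?thesis using q by (simp add: h_def)
qed

definition erased_single :: "site list pmf" where
  "erased_single = map_pmf (lerase id Cx) skeleton_pmf"

definition erased_double :: "site list pmf" where
  "erased_double = bind_pmf skeleton_pmf (\<lambda>l1.
     map_pmf (\<lambda>l2. lerase id Cx (l1 @ map rotate_site l2)) skeleton_pmf)"

lemma lerase_first: "lerase id Cx l = foldl upd_first [] l"
proof -
  have "upd_first = push id Cx" by (intro ext) (simp add: upd_first_def id_def)
  then show ?thesis using lerase_append[of id Cx "[]" l] by simp
qed

lemma lerase_second: "lerase id Cx (l1 @ map rotate_site l2) = foldl upd_second (lerase id Cx l1) l2"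
proof -
  have "upd_second = (\<lambda>q u. push id Cx q (rotate_site u))" by (intro ext) (simp add: upd_second_def id_def)
  then show ?thesis by (simp add: lerase_append foldl_map)
qed

lemma initial_states: "[] \<in> set (states table_single Cx id)" "[] \<in> set (states table_first Cx id)"
  "loc_first [] = Cx"
  by code_simp+

lemma first_final:
  assumes "site_walk Cx l"
  shows "foldl upd_first [] l \<in> set (states table_first Cx id)" "loc_first (foldl upd_first [] l) = Cy"
    "foldl upd_first [] l \<in> set (states table_second Cy rotate_site)" "loc_second (foldl upd_first [] l) = Cx"
proof -
  show 1: "foldl upd_first [] l \<in> set (states table_first Cx id)" "loc_first (foldl upd_first [] l) = Cy"
    using walk_stays_in_states[OF harmonic_first initial_states(2)] assms initial_states(3) by auto
  then show "foldl upd_first [] l \<in> set (states table_second Cy rotate_site)" "loc_second (foldl upd_first [] l) = Cx"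
    using final_first by (auto simp: list_all_iff)
qed

lemma set_erased_single: "l \<in> set_pmf erased_single \<Longrightarrow> good_final l"
proof -
  assume "l \<in> set_pmf erased_single"
  then obtain l' where l': "site_walk Cx l'" "l = foldl upd_first [] l'"
    unfolding erased_single_def by (auto simp: set_skeleton_pmf lerase_first)
  then have "l \<in> set (states table_single Cx id) \<and> loc_first l = Cy"
    using walk_stays_in_states[OF harmonic_single initial_states(1)] initial_states(3) by auto
  then show ?thesis using final_single by (auto simp: list_all_iff)
qed

lemma set_erased_double: "l \<in> set_pmf erased_double \<Longrightarrow> good_final l"
proof -
  assume "l \<in> set_pmf erased_double"
  then obtain l1 l2 where l: "site_walk Cx l1" "site_walk Cx l2" "l = foldl upd_second (foldl upd_first [] l1) l2"
    unfolding erased_double_def by (auto simp: set_skeleton_pmf lerase_second) (auto simp: lerase_first)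
  note q = first_final[OF l(1)]
  have "l \<in> set (states table_second Cy rotate_site) \<and> loc_second l = Cy"
    unfolding l(3) using walk_stays_in_states[OF harmonic_second q(3)] l(2) q(4) by auto
  then show ?thesis using final_second by (auto simp: list_all_iff)
qed

lemma initial_values:
  "table_value table_single 1 [] = 33293700" "table_value table_single 2 [] = 7398600"
  "table_value table_first 1 [] = 8015150" "table_value table_first 2 [] = 4007575"
  by code_simp+

lemma nn_mean_single:
  assumes n: "n \<in> {1, 2}"
  shows "(\<integral>\<^sup>+l. ennreal (real (piece_count n l)) \<partial>erased_single) = ennreal (4 * scaled_value table_single n [])"
proof -
  have "walk_sum (loc_first []) (\<lambda>l. ennreal (real (piece_count n (foldl upd_first [] l)))) = ennreal (scaled_value table_single n [])"
  proof (rule walk_sum_table[OF harmonic_single initial_states(1) n table_nonneg(1)])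
    fix q assume "q \<in> set (states table_single Cx id)" "loc_first q = Cy"
    then show "real (piece_count n q) = scaled_value table_single n q"
      using final_single n unfolding scaled_value_def by (auto simp: list_all_iff)
  qed
  then show ?thesis
    unfolding erased_single_def initial_states(3)
    by (simp add: nn_integral_skeleton lerase_first ennreal_mult')
qed

lemma nn_mean_double:
  assumes n: "n \<in> {1, 2}"
  shows "(\<integral>\<^sup>+l. ennreal (real (piece_count n l)) \<partial>erased_double) = ennreal (16 * scaled_value table_first n [])"
proof -
  have second: "(\<integral>\<^sup>+l2. ennreal (real (piece_count n (foldl upd_second q l2))) \<partial>skeleton_pmf) = ennreal (4 * scaled_value table_second n q)"
    if q: "q \<in> set (states table_second Cy rotate_site)" "loc_second q = Cx" for q
  proof -
    have "walk_sum (loc_second q) (\<lambda>l. ennreal (real (piece_count n (foldl upd_second q l)))) = ennreal (scaled_value table_second n q)"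
    proof (rule walk_sum_table[OF harmonic_second q(1) n table_nonneg(3)])
      fix q assume "q \<in> set (states table_second Cy rotate_site)" "loc_second q = Cy"
      then show "real (piece_count n q) = scaled_value table_second n q"
        using final_second n unfolding scaled_value_def by (auto simp: list_all_iff)
    qed
    then show ?thesis using q(2) by (simp add: nn_integral_skeleton ennreal_mult')
  qed
  have "walk_sum (loc_first []) (\<lambda>l. ennreal (scaled_value table_second n (foldl upd_first [] l))) = ennreal (scaled_value table_first n [])"
  proof (rule walk_sum_table[OF harmonic_first initial_states(2) n table_nonneg(2)])
    fix q assume "q \<in> set (states table_first Cx id)" "loc_first q = Cy"
    then show "scaled_value table_second n q = scaled_value table_first n q"
      using final_first n unfolding scaled_value_def by (auto simp: list_all_iff)
  qed
  then have first: "(\<integral>\<^sup>+l1. ennreal (scaled_value table_second n (foldl upd_first [] l1)) \<partial>skeleton_pmf) = ennreal (4 * scaled_value table_first n [])"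
    unfolding initial_states(3) by (simp add: nn_integral_skeleton ennreal_mult')
  have "(\<integral>\<^sup>+l. ennreal (real (piece_count n l)) \<partial>erased_double) =
      (\<integral>\<^sup>+l1. (\<integral>\<^sup>+l2. ennreal (real (piece_count n (foldl upd_second (foldl upd_first [] l1) l2))) \<partial>skeleton_pmf) \<partial>skeleton_pmf)"
    unfolding erased_double_def by (simp add: lerase_second lerase_first[symmetric])
  also have "\<dots> = (\<integral>\<^sup>+l1. ennreal 4 * ennreal (scaled_value table_second n (foldl upd_first [] l1)) \<partial>skeleton_pmf)"
  proof (rule nn_integral_cong_AE, unfold AE_measure_pmf_iff, intro ballI)
    fix l1 assume "l1 \<in> set_pmf skeleton_pmf"
    then have "site_walk Cx l1" by (simp add: set_skeleton_pmf)
    from second[OF first_final(3,4)[OF this]]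
    show "(\<integral>\<^sup>+l2. ennreal (real (piece_count n (foldl upd_second (foldl upd_first [] l1) l2))) \<partial>skeleton_pmf) =
        ennreal 4 * ennreal (scaled_value table_second n (foldl upd_first [] l1))"
      by (simp add: ennreal_mult')
  qed
  also have "\<dots> = ennreal 4 * ennreal (4 * scaled_value table_first n [])"
    unfolding first[symmetric] by (rule nn_integral_cmult) simp
  also have "\<dots> = ennreal (16 * scaled_value table_first n [])"
    by (subst ennreal_mult'[symmetric]) simp_all
  finally show ?thesis .
qed

lemma piece_means:
  "(\<integral>l. real (piece_count 1 l) \<partial>erased_single) = 9/5" "(\<integral>l. real (piece_count 2 l) \<partial>erased_single) = 2/5"
  "(\<integral>l. real (piece_count 1 l) \<partial>erased_double) = 26/15" "(\<integral>l. real (piece_count 2 l) \<partial>erased_double) = 13/15"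
proof -
  have "(\<integral>l. real (piece_count n l) \<partial>M) = enn2real (\<integral>\<^sup>+l. ennreal (real (piece_count n l)) \<partial>M)"
    for n and M :: "site list pmf"
    by (rule integral_eq_nn_integral) auto
  then show "(\<integral>l. real (piece_count 1 l) \<partial>erased_single) = 9/5" "(\<integral>l. real (piece_count 2 l) \<partial>erased_single) = 2/5"
    "(\<integral>l. real (piece_count 1 l) \<partial>erased_double) = 26/15" "(\<integral>l. real (piece_count 2 l) \<partial>erased_double) = 13/15"
    using nn_mean_single[of 1] nn_mean_single[of 2] nn_mean_double[of 1] nn_mean_double[of 2]
    by (simp_all only: scaled_value_def initial_values) simp_all
qed

section \<open>Placing the sites in the gasket\<close>

text \<open>The corner \<open>x\<close> of the cell \<open>t\<close> and the midpoints \<open>m1, m2, m3\<close> of the other cell at \<open>x\<close>.\<close>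

definition outer_midpoints :: "nat \<Rightarrow> complex set \<Rightarrow> complex \<Rightarrow> complex \<Rightarrow> complex \<Rightarrow> complex \<Rightarrow> bool" where
  "outer_midpoints N t x m1 m2 m3 \<longleftrightarrow> (\<exists>p q. {x, p, q} \<in> cells (Suc N) \<and> {x, p, q} \<noteq> t \<and>
     p \<noteq> x \<and> q \<noteq> x \<and> p \<noteq> q \<and> m1 = midpoint x p \<and> m2 = midpoint x q \<and> m3 = midpoint p q)"

definition site_embedding :: "nat \<Rightarrow> (site \<Rightarrow> complex) \<Rightarrow> bool" where
  "site_embedding N e \<longleftrightarrow> {e Cx, e Cy, e Cz} \<in> cells (Suc N) \<and> e Cx \<noteq> e Cy \<and> e Cx \<noteq> e Cz \<and> e Cy \<noteq> e Cz \<and>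
     e Mxy = midpoint (e Cx) (e Cy) \<and> e Mxz = midpoint (e Cx) (e Cz) \<and> e Myz = midpoint (e Cy) (e Cz) \<and>
     outer_midpoints N {e Cx, e Cy, e Cz} (e Cx) (e Ox1) (e Ox2) (e Ox3) \<and>
     outer_midpoints N {e Cx, e Cy, e Cz} (e Cy) (e Oy1) (e Oy2) (e Oy3)"

lemma outer_midpoints_exist:
  assumes "t \<in> cells (Suc N)" "x \<in> t"
  shows "\<exists>m1 m2 m3. outer_midpoints N t x m1 m2 m3"
proof -
  obtain t' where t': "t' \<in> cells (Suc N)" "x \<in> t'" "t' \<noteq> t" using cell_at_vertex_other[OF assms] by metis
  obtain p q where "t' = {x, p, q}" "p \<noteq> x" "q \<noteq> x" "p \<noteq> q" using cell_other_corners[OF t'(1,2)] by metis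
  then show ?thesis unfolding outer_midpoints_def using t' by blast
qed

lemma site_embedding_exists:
  assumes "adjacent (Suc N) x y"
  shows "\<exists>e. site_embedding N e \<and> e Cx = x \<and> e Cy = y"
proof -
  obtain t where t: "t \<in> cells (Suc N)" "x \<in> t" "y \<in> t" "x \<noteq> y" using assms unfolding adjacent_def by blast
  obtain z where z: "t = {x, y, z}" "z \<noteq> x" "z \<noteq> y" using cell_third_corner[OF t] by metis
  obtain a b c where abc: "outer_midpoints N t x a b c" using outer_midpoints_exist[OF t(1,2)] by blast
  obtain a' b' c' where abc': "outer_midpoints N t y a' b' c'" using outer_midpoints_exist[OF t(1,3)] by blast
  define e where "e s = (case s of Cx \<Rightarrow> x | Cy \<Rightarrow> y | Cz \<Rightarrow> z | Mxy \<Rightarrow> midpoint x y | Mxz \<Rightarrow> midpoint x z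
    | Myz \<Rightarrow> midpoint y z | Ox1 \<Rightarrow> a | Ox2 \<Rightarrow> b | Ox3 \<Rightarrow> c | Oy1 \<Rightarrow> a' | Oy2 \<Rightarrow> b' | Oy3 \<Rightarrow> c')" for s
  have "site_embedding N e \<and> e Cx = x \<and> e Cy = y"
    unfolding site_embedding_def e_def using t z abc abc' by simp
  then show ?thesis by blast
qed

lemma outer_midpoints_props:
  assumes "outer_midpoints N t x m1 m2 m3" "t \<in> cells (Suc N)" "x \<in> t"
  obtains t' where "t' \<in> cells (Suc N)" "t' \<noteq> t" "x \<in> t'" "{m1, m2, m3} \<subseteq> nodes t'"
    "m1 \<notin> gasket_vertices (Suc N)" "m2 \<notin> gasket_vertices (Suc N)" "m3 \<notin> gasket_vertices (Suc N)"
    "m1 \<noteq> m2" "m1 \<noteq> m3" "m2 \<noteq> m3"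
proof -
  obtain p q where pq: "{x, p, q} \<in> cells (Suc N)" "{x, p, q} \<noteq> t" "p \<noteq> x" "q \<noteq> x" "p \<noteq> q"
    "m1 = midpoint x p" "m2 = midpoint x q" "m3 = midpoint p q"
    using assms(1) unfolding outer_midpoints_def by blast
  show thesis
  proof (rule that[OF pq(1,2)])
    show "{m1, m2, m3} \<subseteq> nodes {x, p, q}" unfolding nodes_def pq(6-8) by blast
    show "m1 \<notin> gasket_vertices (Suc N)" "m2 \<notin> gasket_vertices (Suc N)" "m3 \<notin> gasket_vertices (Suc N)"
      unfolding pq(6-8) by (rule midpoint_not_vertex[OF pq(1)]; use pq in auto)+
    show "m1 \<noteq> m2" "m1 \<noteq> m3" "m2 \<noteq> m3" using pq(3-5) unfolding pq(6-8) by (auto simp: midpoint_def)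
  qed simp
qed

lemma site_embedding_inj:
  assumes "site_embedding N e"
  shows "inj e" "e v \<in> gasket_vertices (Suc N) \<longleftrightarrow> v \<in> {Cx, Cy, Cz}"
proof -
  let ?G = "gasket_vertices (Suc N)" and ?t = "{e Cx, e Cy, e Cz}"
  have t: "?t \<in> cells (Suc N)" and ne: "e Cx \<noteq> e Cy" "e Cx \<noteq> e Cz" "e Cy \<noteq> e Cz"
    and m: "e Mxy = midpoint (e Cx) (e Cy)" "e Mxz = midpoint (e Cx) (e Cz)" "e Myz = midpoint (e Cy) (e Cz)"
    and ox: "outer_midpoints N ?t (e Cx) (e Ox1) (e Ox2) (e Ox3)"
    and oy: "outer_midpoints N ?t (e Cy) (e Oy1) (e Oy2) (e Oy3)"
    using assms unfolding site_embedding_def by auto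
  obtain tx where tx: "tx \<in> cells (Suc N)" "tx \<noteq> ?t" "e Cx \<in> tx" "{e Ox1, e Ox2, e Ox3} \<subseteq> nodes tx"
    "e Ox1 \<notin> ?G" "e Ox2 \<notin> ?G" "e Ox3 \<notin> ?G" "e Ox1 \<noteq> e Ox2" "e Ox1 \<noteq> e Ox3" "e Ox2 \<noteq> e Ox3"
    using outer_midpoints_props[OF ox t] by blast
  obtain ty where ty: "ty \<in> cells (Suc N)" "ty \<noteq> ?t" "e Cy \<in> ty" "{e Oy1, e Oy2, e Oy3} \<subseteq> nodes ty"
    "e Oy1 \<notin> ?G" "e Oy2 \<notin> ?G" "e Oy3 \<notin> ?G" "e Oy1 \<noteq> e Oy2" "e Oy1 \<noteq> e Oy3" "e Oy2 \<noteq> e Oy3"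
    using outer_midpoints_props[OF oy t] by blast
  have "tx \<noteq> ty" using cells_eqI[OF t tx(1), of "e Cx" "e Cy"] tx(2,3) ty(3) ne by blast
  have corners: "e Cx \<in> ?G" "e Cy \<in> ?G" "e Cz \<in> ?G" using t unfolding gasket_vertices_eq by blast+
  have mids: "e Mxy \<notin> ?G" "e Mxz \<notin> ?G" "e Myz \<notin> ?G"
    unfolding m by (rule midpoint_not_vertex[OF t]; use ne in simp)+
  have mne: "e Mxy \<noteq> e Mxz" "e Mxy \<noteq> e Myz" "e Mxz \<noteq> e Myz"
    using ne unfolding m by (auto simp: midpoint_def)
  have mn: "{e Mxy, e Mxz, e Myz} \<subseteq> nodes ?t" unfolding m nodes_def by blast
  show vert: "e v \<in> ?G \<longleftrightarrow> v \<in> {Cx, Cy, Cz}" for v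
    using corners mids tx(5-7) ty(5-7) by (cases v) simp_all
  define K :: "site \<Rightarrow> nat" where "K v = (case v of Cx \<Rightarrow> 0 | Cy \<Rightarrow> 0 | Cz \<Rightarrow> 0 | Mxy \<Rightarrow> 1 | Mxz \<Rightarrow> 1 | Myz \<Rightarrow> 1
    | Ox1 \<Rightarrow> 2 | Ox2 \<Rightarrow> 2 | Ox3 \<Rightarrow> 2 | Oy1 \<Rightarrow> 3 | Oy2 \<Rightarrow> 3 | Oy3 \<Rightarrow> 3)" for v
  define T where "T n = (if n = 1 then ?t else if n = 2 then tx else ty)" for n :: nat
  have corner_iff: "v \<in> {Cx, Cy, Cz} \<longleftrightarrow> K v = 0" for v by (cases v) (simp_all add: K_def)
  have T: "T (K v) \<in> cells (Suc N)" for v using t tx(1) ty(1) unfolding T_def by simp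
  have memb: "e v \<in> nodes (T (K v))" if "K v \<noteq> 0" for v
  proof -
    have K: "K Cx = 0" "K Cy = 0" "K Cz = 0" by (simp_all add: K_def)
    have "e v \<in> nodes (T (K v)) \<or> v \<in> {Cx, Cy, Cz}"
      using mn tx(4) ty(4) by (cases v) (simp_all add: K_def T_def)
    then show ?thesis using that K by auto
  qed
  have T_inj: "T (K u) \<noteq> T (K v)" if "K u \<noteq> K v" "K u \<noteq> 0" "K v \<noteq> 0" for u v
  proof -
    have "K u \<in> {1, 2, 3}" "K v \<in> {1, 2, 3}"
    proof -
      have "K w \<in> {0, 1, 2, 3}" for w by (cases w) (simp_all add: K_def)
      then show "K u \<in> {1, 2, 3}" "K v \<in> {1, 2, 3}" using that(2,3) by (metis insert_iff)+
    qed
    then show ?thesis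
      using that(1) tx(2) ty(2) \<open>tx \<noteq> ty\<close> tx(2)[symmetric] ty(2)[symmetric] \<open>tx \<noteq> ty\<close>[symmetric]
      unfolding T_def by (elim insertE emptyE) simp_all
  qed
  have same: "u = v" if "e u = e v" "K u = K v" for u v
  proof -
    have inj: "inj_on e {Cx, Cy, Cz}" "inj_on e {Mxy, Mxz, Myz}" "inj_on e {Ox1, Ox2, Ox3}" "inj_on e {Oy1, Oy2, Oy3}"
      using ne mne tx(8-10) ty(8-10) by (simp_all add: inj_on_def)
    have "(u \<in> {Cx, Cy, Cz} \<and> v \<in> {Cx, Cy, Cz}) \<or> (u \<in> {Mxy, Mxz, Myz} \<and> v \<in> {Mxy, Mxz, Myz}) \<or>
        (u \<in> {Ox1, Ox2, Ox3} \<and> v \<in> {Ox1, Ox2, Ox3}) \<or> (u \<in> {Oy1, Oy2, Oy3} \<and> v \<in> {Oy1, Oy2, Oy3})"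
    proof -
      have P: "(K w = 0 \<longleftrightarrow> w \<in> {Cx, Cy, Cz}) \<and> (K w = 1 \<longleftrightarrow> w \<in> {Mxy, Mxz, Myz}) \<and>
          (K w = 2 \<longleftrightarrow> w \<in> {Ox1, Ox2, Ox3}) \<and> (K w = 3 \<longleftrightarrow> w \<in> {Oy1, Oy2, Oy3}) \<and> K w \<in> {0, 1, 2, 3}" for w
        by (cases w) (simp_all add: K_def)
      have "K u \<in> {0, 1, 2, 3}" using P by blast
      then show ?thesis using P[of u] P[of v] that(2) by (metis insertE singletonD)
    qed
    then show ?thesis
      using inj_onD[OF inj(1) that(1)] inj_onD[OF inj(2) that(1)] inj_onD[OF inj(3) that(1)]
        inj_onD[OF inj(4) that(1)] by metis
  qed
  show "inj e"
  proof (rule injI)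
    fix u v assume eq: "e u = e v"
    have "K u = K v"
    proof (rule ccontr)
      assume ne: "K u \<noteq> K v"
      have z: "K u = 0 \<longleftrightarrow> K v = 0" using vert[of u] vert[of v] eq unfolding corner_iff by simp
      then have nz: "K u \<noteq> 0" "K v \<noteq> 0" using ne by auto
      have "e u \<in> T (K u)"
        using nodes_inter[OF T T T_inj[OF ne nz], of "e u"] memb[OF nz(1)] memb[OF nz(2)] eq by simp
      then have "e u \<in> ?G" using T[of u] unfolding gasket_vertices_eq by blast
      then show False using vert[of u] nz(1) unfolding corner_iff by simp
    qed
    then show "u = v" using same[OF eq] by simp
  qed
qed

lemma adjacent_midpoint_cases:
  assumes "{p, q, r} \<in> cells (Suc N)" "p \<noteq> q" "adjacent N (midpoint p q) u"
  shows "u \<in> {p, q, midpoint p r, midpoint q r}"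
proof -
  obtain c where c: "c \<in> cells N" "midpoint p q \<in> c" "u \<in> c" "midpoint p q \<noteq> u"
    using assms(3) unfolding adjacent_def by blast
  then have "c = subcell {p, q, r} p \<or> c = subcell {p, q, r} q"
    using cell_at_midpoint[OF assms(1), of p q] assms(2) by simp
  then show ?thesis using c(3,4) unfolding subcell_def by (auto simp: midpoint_sym)
qed

lemma adjacent_vertex_cases:
  assumes "{x, p, q} \<in> cells (Suc N)" "{x, p', q'} \<in> cells (Suc N)" "{x, p, q} \<noteq> {x, p', q'}" "adjacent N x u"
  shows "u \<in> {midpoint x p, midpoint x q, midpoint x p', midpoint x q'}"
proof -
  have "x \<in> gasket_vertices (Suc N)" using assms(1) unfolding gasket_vertices_eq by blast
  then obtain t y where t: "t \<in> cells (Suc N)" "x \<in> t" "y \<in> t" "y \<noteq> x" "u = midpoint x y"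
    using adjacent_coarse_vertex[OF _ assms(4)] by metis
  have mem: "x \<in> {x, p, q}" "x \<in> {x, p', q'}" by simp_all
  obtain a where a: "\<And>u. u \<in> cells (Suc N) \<Longrightarrow> x \<in> u \<Longrightarrow> u = {x, p, q} \<or> u = a"
    using assms(1) mem(1) by (rule cell_at_vertex_other) blast
  have "{x, p', q'} = a" using a[OF assms(2) mem(2)] assms(3) by metis
  then have "t = {x, p, q} \<or> t = {x, p', q'}" using a[OF t(1,2)] by metis
  then have "y \<in> {p, q, p', q'}" using t(3,4) by blast
  then show ?thesis unfolding t(5) by blast
qed

lemma site_embedding_moves:
  assumes "site_embedding N e" "u \<in> set (moves v)"
  shows "adjacent N (e v) (e u)"
proof -
  have t: "{e Cx, e Cy, e Cz} \<in> cells (Suc N)" and ne: "e Cx \<noteq> e Cy" "e Cx \<noteq> e Cz" "e Cy \<noteq> e Cz"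
    and m: "e Mxy = midpoint (e Cx) (e Cy)" "e Mxz = midpoint (e Cx) (e Cz)" "e Myz = midpoint (e Cy) (e Cz)"
    using assms unfolding site_embedding_def by auto
  obtain p q where pq: "{e Cx, p, q} \<in> cells (Suc N)" "p \<noteq> e Cx" "q \<noteq> e Cx" "p \<noteq> q"
    "e Ox1 = midpoint (e Cx) p" "e Ox2 = midpoint (e Cx) q" "e Ox3 = midpoint p q"
    using assms unfolding site_embedding_def outer_midpoints_def by blast
  note corner = adjacent_corner_midpoint and mid = adjacent_midpoints
  have "adjacent N (e Cx) (e Mxy)" "adjacent N (e Cx) (e Mxz)" "adjacent N (e Cy) (e Mxy)" "adjacent N (e Cy) (e Myz)"
    using corner[OF t, of "e Cx" "e Cy"] corner[OF t, of "e Cx" "e Cz"] corner[OF t, of "e Cy" "e Cx"]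
      corner[OF t, of "e Cy" "e Cz"] ne unfolding m by (simp_all add: midpoint_sym[of "e Cy" "e Cx"])
  moreover have "adjacent N (e Cx) (e Ox1)" "adjacent N (e Cx) (e Ox2)"
    using corner[OF pq(1), of "e Cx" p] corner[OF pq(1), of "e Cx" q] pq by simp_all
  moreover have "adjacent N (e Mxy) (e Mxz)" "adjacent N (e Mxy) (e Myz)" "adjacent N (e Mxz) (e Myz)"
    using mid[OF t, of "e Cx" "e Cy" "e Cz"] mid[OF t, of "e Cy" "e Cx" "e Cz"] mid[OF t, of "e Cz" "e Cx" "e Cy"] ne
    unfolding m by (simp_all add: midpoint_sym[of "e Cy" "e Cx"] midpoint_sym[of "e Cz" "e Cx"] midpoint_sym[of "e Cz" "e Cy"])
  moreover have "adjacent N (e Ox1) (e Ox2)" "adjacent N (e Ox1) (e Ox3)" "adjacent N (e Ox2) (e Ox3)"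
    using mid[OF pq(1), of "e Cx" p q] mid[OF pq(1), of p "e Cx" q] mid[OF pq(1), of q "e Cx" p] pq(2-4)
    unfolding pq(5-7) by (simp_all add: midpoint_sym[of p "e Cx"] midpoint_sym[of q "e Cx"] midpoint_sym[of q p])
  ultimately show ?thesis using assms(2) adjacent_commute
    by (cases v) auto
qed

lemma site_embedding_neighbours:
  assumes e: "site_embedding N e" and v: "moves v \<noteq> []" and adj: "adjacent N (e v) u"
  shows "u \<in> e ` set (moves v) \<or> (u \<in> gasket_vertices (Suc N) \<and> u \<noteq> e Cx \<and> u \<noteq> e Cy)"
proof -
  let ?G = "gasket_vertices (Suc N)"
  have t: "{e Cx, e Cy, e Cz} \<in> cells (Suc N)" and ne: "e Cx \<noteq> e Cy" "e Cx \<noteq> e Cz" "e Cy \<noteq> e Cz"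
    and m: "e Mxy = midpoint (e Cx) (e Cy)" "e Mxz = midpoint (e Cx) (e Cz)" "e Myz = midpoint (e Cy) (e Cz)"
    using assms unfolding site_embedding_def by auto
  have t2: "{e Cx, e Cz, e Cy} \<in> cells (Suc N)" "{e Cy, e Cz, e Cx} \<in> cells (Suc N)"
    using t by (simp_all add: insert_commute)
  obtain p q where pq: "{e Cx, p, q} \<in> cells (Suc N)" "{e Cx, p, q} \<noteq> {e Cx, e Cy, e Cz}" "p \<noteq> e Cx" "q \<noteq> e Cx" "p \<noteq> q"
    "e Ox1 = midpoint (e Cx) p" "e Ox2 = midpoint (e Cx) q" "e Ox3 = midpoint p q"
    using assms unfolding site_embedding_def outer_midpoints_def by blast
  have pq2: "{e Cx, q, p} \<in> cells (Suc N)" "{p, q, e Cx} \<in> cells (Suc N)"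
    using pq(1) by (simp_all add: insert_commute)
  have G: "e Cz \<in> ?G" "p \<in> ?G" "q \<in> ?G" using t pq(1) unfolding gasket_vertices_eq by blast+
  have pqy: "p \<noteq> e Cy" "q \<noteq> e Cy"
    using cells_eqI[OF pq(1) t, of "e Cx" "e Cy"] pq(2) ne(1) by blast+
  note sym = midpoint_sym[of "e Cy" "e Cx"] midpoint_sym[of "e Cz" "e Cx"] midpoint_sym[of "e Cz" "e Cy"]
    midpoint_sym[of p "e Cx"] midpoint_sym[of q "e Cx"] midpoint_sym[of q p]
  show ?thesis
  proof (cases v)
    case Cx
    then show ?thesis using adjacent_vertex_cases[OF t pq(1) pq(2)[symmetric]] adj m pq(6-8) by auto
  next
    case Mxy
    then show ?thesis using adjacent_midpoint_cases[OF t ne(1)] adj m sym by auto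
  next
    case Mxz
    then show ?thesis using adjacent_midpoint_cases[OF t2(1) ne(2)] adj m sym G ne by auto
  next
    case Myz
    then show ?thesis using adjacent_midpoint_cases[OF t2(2) ne(3)] adj m sym G ne by auto
  next
    case Ox1
    then show ?thesis using adjacent_midpoint_cases[OF pq(1)] pq(3-5) adj pq(6-8) sym G pqy by auto
  next
    case Ox2
    then show ?thesis using adjacent_midpoint_cases[OF pq2(1)] pq(3-5) adj pq(6-8) sym G pqy by auto
  next
    case Ox3
    then show ?thesis using adjacent_midpoint_cases[OF pq2(2) pq(5)] pq(3-5) adj pq(6-8) sym G pqy by auto
  qed (use v in auto)
qed

section \<open>The law of a coarse step\<close>

primrec prod_pmf :: "('e \<Rightarrow> 'a pmf) \<Rightarrow> 'e list \<Rightarrow> 'a list pmf" where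
  "prod_pmf K [] = return_pmf []"
| "prod_pmf K (e # es) = map_pmf (\<lambda>(s, ss). s # ss) (pair_pmf (K e) (prod_pmf K es))"

lemma pmf_prod_pmf_Cons:
  fixes K :: "'e \<Rightarrow> 'a pmf"
  shows "pmf (prod_pmf K (e # es)) (s # ss) = pmf (K e) s * pmf (prod_pmf K es) ss"
proof -
  have "inj (\<lambda>(s, ss). s # ss :: 'a list)" by (auto simp: inj_def)
  then have "pmf (map_pmf (\<lambda>(s, ss). s # ss) (pair_pmf (K e) (prod_pmf K es))) ((\<lambda>(s, ss). s # ss) (s, ss)) =
      pmf (pair_pmf (K e) (prod_pmf K es)) (s, ss)" by (rule pmf_map_inj')
  then show ?thesis by (simp add: pmf_pair)
qed

lemma pmf_prod_pmf_Nil: "pmf (prod_pmf K (e # es)) [] = 0"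
  by (auto simp: pmf_eq_0_set_pmf)

definition embedding :: "nat \<Rightarrow> complex \<times> complex \<Rightarrow> site \<Rightarrow> complex" where
  "embedding N p = (SOME e. site_embedding N e \<and> e Cx = fst p \<and> e Cy = snd p)"

lemma embedding_props:
  assumes "adjacent (Suc N) x y"
  shows "site_embedding N (embedding N (x, y))" "embedding N (x, y) Cx = x" "embedding N (x, y) Cy = y"
  using someI_ex[OF site_embedding_exists[OF assms], folded embedding_def[of N "(x, y)", simplified]] by auto

primrec step_pmf :: "nat \<Rightarrow> complex \<times> complex \<Rightarrow> walk pmf" where
  "step_pmf 0 p = return_pmf [fst p, snd p]"
| "step_pmf (Suc N) p = bind_pmf skeleton_pmf (\<lambda>l.
     map_pmf (concat_walks (fst p)) (prod_pmf (step_pmf N) (edges (fst p) (map (embedding N p) l))))"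

lemma step_walks_alt:
  "w \<in> step_walks N x y \<longleftrightarrow> is_walk w \<and> 2 \<le> length w \<and> hd w = x \<and> last w = y \<and>
     x \<in> gasket_vertices N \<and> y \<in> gasket_vertices N \<and> y \<noteq> x \<and> (\<forall>v\<in>set (butlast w). v \<in> gasket_vertices N \<longrightarrow> v = x)"
proof -
  have "(\<forall>i. 0 < i \<longrightarrow> i < wlen w \<longrightarrow> w ! i \<in> gasket_vertices N \<longrightarrow> w ! i = x) \<longleftrightarrow>
      (\<forall>v\<in>set (butlast w). v \<in> gasket_vertices N \<longrightarrow> v = x)" if "2 \<le> length w" "hd w = x"
  proof -
    have "w \<noteq> []" using that(1) by auto
    have "(\<forall>v\<in>set (butlast w). v \<in> gasket_vertices N \<longrightarrow> v = x) \<longleftrightarrow>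
        (\<forall>i<wlen w. w ! i \<in> gasket_vertices N \<longrightarrow> w ! i = x)"
      unfolding all_set_conv_all_nth by (simp add: nth_butlast wlen_def)
    also have "\<dots> \<longleftrightarrow> (\<forall>i. 0 < i \<longrightarrow> i < wlen w \<longrightarrow> w ! i \<in> gasket_vertices N \<longrightarrow> w ! i = x)"
      using that(2) hd_conv_nth[OF \<open>w \<noteq> []\<close>] by (metis gr0I)
    finally show ?thesis ..
  qed
  then show ?thesis unfolding step_walks_def by auto
qed

lemma step_walks_0: "adjacent 0 x y \<Longrightarrow> step_walks 0 x y = {[x, y]}"
proof (intro equalityI subsetI)
  fix w assume w: "w \<in> step_walks 0 x y"
  then have s: "is_walk w" "2 \<le> length w" "hd w = x" "last w = y"
    "\<forall>v\<in>set (butlast w). v \<in> gasket_vertices 0 \<longrightarrow> v = x" unfolding step_walks_alt by auto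
  define w' where "w' = tl w"
  have w': "w = x # w'" "w' \<noteq> []" using s(2,3) unfolding w'_def by (cases w; auto)+
  show "w \<in> {[x, y]}"
  proof (cases "tl w'")
    case Nil
    then show ?thesis using w' s(4) by (cases w') auto
  next
    case (Cons b w'')
    then obtain a where a: "w' = a # b # w''" using w'(2) by (cases w') auto
    then have "a \<in> gasket_vertices 0" "adjacent 0 x a" using s(1) w'(1) unfolding is_walk_successively by auto
    moreover have "a \<in> set (butlast w)" unfolding w'(1) a by simp
    ultimately have "a = x" "a \<noteq> x" using s(5) unfolding adjacent_def by blast+
    then show ?thesis by simp
  qed
next
  fix w assume "adjacent 0 x y" "w \<in> {[x, y]}"
  then show "w \<in> step_walks 0 x y"
    using adjacent_vertices unfolding step_walks_alt is_walk_successively by (auto simp: adjacent_def)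
qed

lemma chain_walk:
  assumes "chain N x ss" "ss \<noteq> []"
  shows "is_walk (concat_walks x ss)" "\<forall>v\<in>set (butlast (concat_walks x ss)). v \<in> gasket_vertices N \<longrightarrow>
    v \<in> set (butlast (x # map last ss))"
proof -
  have "is_walk (concat_walks x ss) \<and> (\<forall>v\<in>set (butlast (concat_walks x ss)). v \<in> gasket_vertices N \<longrightarrow>
      v \<in> set (butlast (x # map last ss)))"
    using assms
  proof (induction ss arbitrary: x)
    case (Cons s ss)
    note s = chain_ConsD[OF Cons.prems(1)]
    have sw: "is_walk s" "\<forall>v\<in>set (butlast s). v \<in> gasket_vertices N \<longrightarrow> v = x"
      using Cons.prems(1) step_walks_alt by auto
    show ?case
    proof (cases "ss = []")
      case True
      then show ?thesis using sw s(1,2) by (simp add: concat_walks_singleton)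
    next
      case False
      from Cons.IH[OF s(6) False]
      have IH: "is_walk (concat_walks (last s) ss)" "\<forall>v\<in>set (butlast (concat_walks (last s) ss)).
          v \<in> gasket_vertices N \<longrightarrow> v \<in> set (butlast (last s # map last ss))" by auto
      obtain us where us: "s = us @ [last s]" using s(1) by (metis append_butlast_last_id)
      obtain ws where ws: "concat_walks (last s) ss = last s # ws" by (simp add: concat_walks_def)
      have eq: "concat_walks x (s # ss) = butlast s @ concat_walks (last s) ss"
        using Cons.prems(1) by (rule concat_walks_chain_Cons)
      have "is_walk (us @ last s # ws)"
      proof -
        have 1: "successively (adjacent 0) (us @ [last s])" "set us \<subseteq> gasket_vertices 0"
          using sw(1) us unfolding is_walk_successively by (metis, metis Un_subset_iff set_append)
        have 2: "successively (adjacent 0) (last s # ws)" "set (last s # ws) \<subseteq> gasket_vertices 0"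
          using IH(1) ws unfolding is_walk_successively by simp_all
        show ?thesis unfolding is_walk_successively using 1 2 by (auto simp: successively_append_iff)
      qed
      moreover have "butlast s = us" using us by (metis butlast_snoc)
      ultimately have "is_walk (concat_walks x (s # ss))" using eq ws by simp
      moreover have "\<forall>v\<in>set (butlast (concat_walks x (s # ss))). v \<in> gasket_vertices N \<longrightarrow>
          v \<in> set (butlast (x # map last (s # ss)))"
        using sw(2) IH(2) False unfolding eq by (auto simp: butlast_append)
      ultimately show ?thesis by blast
    qed
  qed simp
  then show "is_walk (concat_walks x ss)" "\<forall>v\<in>set (butlast (concat_walks x ss)). v \<in> gasket_vertices N \<longrightarrow>
    v \<in> set (butlast (x # map last ss))" by blast+
qed

lemma moves_nonempty: "u \<in> set (moves v) \<Longrightarrow> u \<noteq> Cy \<Longrightarrow> moves u \<noteq> []"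
  by (cases v) auto

lemma site_walk_butlast:
  "site_walk v l \<Longrightarrow> u \<in> set (butlast (v # l)) \<Longrightarrow> moves u \<noteq> []"
proof (induction l arbitrary: v)
  case (Cons a l)
  then show ?case by (cases "u = v") auto
qed simp

lemma moves_corner: "moves u \<noteq> [] \<Longrightarrow> u \<in> {Cx, Cy, Cz} \<Longrightarrow> u = Cx"
  by (cases u) auto

text \<open>Both directions of the coding of coarse steps by site walks.\<close>

lemma site_walk_step:
  assumes e: "site_embedding N e" and l: "site_walk Cx l" and ch: "chain N (e Cx) ss" "map last ss = map e l"
  shows "concat_walks (e Cx) ss \<in> step_walks (Suc N) (e Cx) (e Cy)"
proof -
  note inj = site_embedding_inj[OF e]
  have ne: "l \<noteq> []" "ss \<noteq> []" using l ch(2) by auto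
  note w = chain_walk[OF ch(1) ne(2)]
  have "last (concat_walks (e Cx) ss) = e Cy"
    unfolding last_concat_walks[OF ch(1)] ch(2) using site_walk_last[OF l] ne by (simp add: last_map)
  moreover have "2 \<le> length (concat_walks (e Cx) ss)"
  proof -
    obtain s ss' where "ss = s # ss'" using ne(2) by (cases ss) auto
    then have "0 < wlen (concat_walks (e Cx) ss)" using ch(1) chain_ConsD(5) by (simp add: wlen_pieces)
    then show ?thesis by (simp add: wlen_def)
  qed
  moreover have "v = e Cx" if v: "v \<in> set (butlast (concat_walks (e Cx) ss))" "v \<in> gasket_vertices (Suc N)" for v
  proof -
    have "v \<in> set (butlast (e Cx # map e l))"
      using w(2) v(1) subsetD[OF gasket_vertices_Suc v(2)] unfolding ch(2) by blast
    then have "v \<in> e ` set (butlast (Cx # l))" by (metis list.map(2) map_butlast set_map)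
    then obtain u where u: "u \<in> set (butlast (Cx # l))" "v = e u" by blast
    then show ?thesis using moves_corner[OF site_walk_butlast[OF l u(1)]] inj(2)[of u] v(2) by blast
  qed
  moreover have "e Cx \<in> gasket_vertices (Suc N)" "e Cy \<in> gasket_vertices (Suc N)" "e Cy \<noteq> e Cx"
    using inj(2) injD[OF inj(1), of Cy Cx] by auto
  ultimately show ?thesis unfolding step_walks_alt using w(1) by auto
qed

lemma step_site_walk:
  assumes e: "site_embedding N e" and w: "w \<in> step_walks (Suc N) (e Cx) (e Cy)"
  shows "\<exists>l. site_walk Cx l \<and> map last (refine N w) = map e l"
proof -
  have "\<exists>l. site_walk v l \<and> map last ss = map e l"
    if "chain N (e v) ss" "moves v \<noteq> []" "ss \<noteq> []" "last (last ss) = e Cy"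
      "\<And>s. s \<in> set (butlast ss) \<Longrightarrow> last s = e Cx \<or> last s \<notin> gasket_vertices (Suc N)" for v ss
    using that
  proof (induction ss arbitrary: v)
    case (Cons s ss)
    have adj: "adjacent N (e v) (last s)" using step_adjacent Cons.prems(1) by auto
    have "\<not> (last s \<in> gasket_vertices (Suc N) \<and> last s \<noteq> e Cx \<and> last s \<noteq> e Cy)"
      using Cons.prems(4,5) by (cases "ss = []") auto
    then obtain u where u: "u \<in> set (moves v)" "last s = e u"
      using site_embedding_neighbours[OF e Cons.prems(2) adj] by blast
    show ?case
    proof (cases "ss = []")
      case True
      then have "e u = e Cy" using Cons.prems(4) u(2) by simp
      then have "u = Cy" using site_embedding_inj(1)[OF e] by (simp add: inj_eq)
      then show ?thesis using True u by (intro exI[of _ "[Cy]"]) auto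
    next
      case False
      have "e u = e Cx \<or> e u \<notin> gasket_vertices (Suc N)" using Cons.prems(5)[of s] False u(2) by simp
      then have "u \<noteq> Cy" using site_embedding_inj[OF e] by (auto simp: inj_eq)
      then have mu: "moves u \<noteq> []" using moves_nonempty[OF u(1)] by simp
      have "\<exists>l. site_walk u l \<and> map last ss = map e l"
        by (rule Cons.IH[OF _ mu False]) (use Cons.prems u False in auto)
      then obtain l where "site_walk u l" "map last ss = map e l" by blast
      then show ?thesis using u by (intro exI[of _ "u # l"]) auto
    qed
  qed simp
  note r = refine_props[OF w]
  from this(3) have last: "last (last (refine N w)) = e Cy" using r(4) by (simp add: last_map)
  have bl: "last s = e Cx \<or> last s \<notin> gasket_vertices (Suc N)" if "s \<in> set (butlast (refine N w))" for s
  proof -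
    obtain i where i: "i < length (butlast (refine N w))" "s = butlast (refine N w) ! i"
      using \<open>s \<in> set (butlast (refine N w))\<close> by (metis in_set_conv_nth)
    then have "Suc i < length (refine N w)" "last s = vertex_at (e Cx) (refine N w) (Suc i)"
      by (simp_all add: nth_butlast)
    then show ?thesis using r(5)[of "Suc i"] by simp
  qed
  show ?thesis
    by (rule \<open>\<And>v ss. chain N (e v) ss \<Longrightarrow> moves v \<noteq> [] \<Longrightarrow> ss \<noteq> [] \<Longrightarrow> last (last ss) = e Cy \<Longrightarrow>
      (\<And>s. s \<in> set (butlast ss) \<Longrightarrow> last s = e Cx \<or> last s \<notin> gasket_vertices (Suc N)) \<Longrightarrow>
      \<exists>l. site_walk v l \<and> map last ss = map e l\<close>[OF r(1) _ r(3) last bl]) auto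
qed

definition step_weight :: "nat \<Rightarrow> complex \<Rightarrow> complex \<Rightarrow> walk \<Rightarrow> real" where
  "step_weight N x y w = (if w \<in> step_walks N x y then 4 * (1/4) ^ wlen w else 0)"

lemma site_walk_successively:
  assumes e: "site_embedding N e" and l: "site_walk v l"
  shows "successively (adjacent N) (e v # map e l)"
  using l
proof (induction l arbitrary: v)
  case (Cons u l)
  then show ?case using site_embedding_moves[OF e] by auto
qed simp

lemma pmf_prod_steps:
  assumes IH: "\<And>x y w. adjacent N x y \<Longrightarrow> pmf (step_pmf N (x, y)) w = step_weight N x y w"
    and c: "successively (adjacent N) (x # c)"
  shows "pmf (prod_pmf (step_pmf N) (edges x c)) ss =
    (if chain N x ss \<and> map last ss = c then 4 ^ length ss * (1/4) ^ sum_list (map wlen ss) else 0)"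
  using c
proof (induction c arbitrary: x ss)
  case Nil
  then show ?case by (cases ss) (auto simp: edges_def)
next
  case (Cons y c)
  show ?case
  proof (cases ss)
    case Nil
    then show ?thesis by (simp add: edges_def pmf_prod_pmf_Nil del: prod_pmf.simps)
  next
    case (Cons s ss')
    have "pmf (prod_pmf (step_pmf N) (edges x (y # c))) (s # ss') =
        step_weight N x y s * pmf (prod_pmf (step_pmf N) (edges y c)) ss'"
      using IH[of x y s] Cons.prems by (simp add: edges_def pmf_prod_pmf_Cons del: prod_pmf.simps)
    also have "pmf (prod_pmf (step_pmf N) (edges y c)) ss' =
        (if chain N y ss' \<and> map last ss' = c then 4 ^ length ss' * (1/4) ^ sum_list (map wlen ss') else 0)"
      using Cons.prems by (intro Cons.IH) auto
    finally show ?thesis unfolding Cons step_weight_def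
      using step_walksD(4)[of s N x y] by (auto simp: power_add)
  qed
qed

text \<open>Every coarse step path of length \<open>n\<close> has probability \<open>4 (1/4)\<^sup>n\<close>: the skeleton has
  probability \<open>4 (1/4)\<^sup>m\<close> with \<open>m\<close> its number of steps, and each of these steps contributes a
  further factor \<open>4\<close> by induction.\<close>

lemma pmf_step_pmf: "adjacent N x y \<Longrightarrow> pmf (step_pmf N (x, y)) w = step_weight N x y w"
proof (induction N arbitrary: x y w)
  case 0
  then show ?case by (simp add: step_weight_def step_walks_0 wlen_def indicator_def)
next
  case (Suc N)
  define e where "e = embedding N (x, y)"
  have e: "site_embedding N e" "e Cx = x" "e Cy = y" using embedding_props[OF Suc.prems] unfolding e_def by auto
  define Q where "Q = bind_pmf skeleton_pmf (\<lambda>l. prod_pmf (step_pmf N) (edges x (map e l)))"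
  have step: "step_pmf (Suc N) (x, y) = map_pmf (concat_walks x) Q"
    unfolding Q_def e_def by (simp add: map_bind_pmf)
  have prod: "pmf (prod_pmf (step_pmf N) (edges x (map e l))) ss =
      (if chain N x ss \<and> map last ss = map e l then 4 ^ length ss * (1/4) ^ sum_list (map wlen ss) else 0)"
    if "site_walk Cx l" for l ss
    using pmf_prod_steps[OF Suc.IH site_walk_successively[OF e(1) that]] e(2) by simp
  have supp: "chain N x ss \<and> (\<exists>l. site_walk Cx l \<and> map last ss = map e l)" if ss: "ss \<in> set_pmf Q" for ss
  proof -
    obtain l where l: "site_walk Cx l" "ss \<in> set_pmf (prod_pmf (step_pmf N) (edges x (map e l)))"
      using ss unfolding Q_def by (auto simp: set_skeleton_pmf)
    then show ?thesis using prod[OF l(1), of ss] by (auto simp: set_pmf_iff split: if_splits)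
  qed
  have inj: "inj_on (concat_walks x) (set_pmf Q)"
    by (rule inj_onI) (use supp chain_steps_unique in blast)
  show ?case
  proof (cases "w \<in> step_walks (Suc N) x y")
    case True
    note r = refine_props[OF True]
    obtain l where l: "site_walk Cx l" "map last (refine N w) = map e l"
      using step_site_walk[OF e(1)] True e by auto
    have uniq: "l' = l" if "map e l' = map e l" for l'
      using map_injective[OF that site_embedding_inj(1)[OF e(1)]] .
    have "pmf Q (refine N w) = (\<integral>l'. pmf (prod_pmf (step_pmf N) (edges x (map e l'))) (refine N w) \<partial>skeleton_pmf)"
      unfolding Q_def by (rule pmf_bind)
    also have "\<dots> = (\<Sum>l'\<in>{l}. pmf (prod_pmf (step_pmf N) (edges x (map e l'))) (refine N w) * pmf skeleton_pmf l')"
    proof (rule integral_measure_pmf_real)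
      fix l' assume "l' \<in> set_pmf skeleton_pmf" "pmf (prod_pmf (step_pmf N) (edges x (map e l'))) (refine N w) \<noteq> 0"
      then show "l' \<in> {l}" using prod[of l' "refine N w"] l(2) uniq by (auto simp: set_skeleton_pmf split: if_splits)
    qed simp
    also have "\<dots> = 4 ^ length (refine N w) * (1/4) ^ sum_list (map wlen (refine N w)) * (4 * (1/4) ^ length l)"
      using prod[OF l(1), of "refine N w"] r(1) l by (simp add: pmf_skeleton)
    also have "length l = length (refine N w)" using l(2) by (metis length_map)
    also have "sum_list (map wlen (refine N w)) = wlen w" using wlen_pieces[of x "refine N w"] r(2) by simp
    finally have Qv: "pmf Q (refine N w) = 4 * (1/4) ^ wlen w" by (simp add: power_one_over)
    then have "refine N w \<in> set_pmf Q" by (simp add: set_pmf_iff)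
    then have "pmf (map_pmf (concat_walks x) Q) (concat_walks x (refine N w)) = pmf Q (refine N w)"
      by (rule pmf_map_inj[OF inj])
    then show ?thesis unfolding step using r(2) Qv True by (simp add: step_weight_def)
  next
    case False
    have "w \<notin> set_pmf (step_pmf (Suc N) (x, y))"
    proof
      assume "w \<in> set_pmf (step_pmf (Suc N) (x, y))"
      then obtain ss where ss: "ss \<in> set_pmf Q" "w = concat_walks x ss" unfolding step by auto
      then obtain l where "chain N x ss" "site_walk Cx l" "map last ss = map e l" using supp by blast
      then show False using site_walk_step[OF e(1), of l ss] e ss(2) False by simp
    qed
    then show ?thesis using False by (simp add: step_weight_def set_pmf_iff del: step_pmf.simps)
  qed
qed

section \<open>Independence of the pieces\<close>

lemma set_prod_pmf: "ss \<in> set_pmf (prod_pmf K es) \<longleftrightarrow> list_all2 (\<lambda>s p. s \<in> set_pmf (K p)) ss es"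
proof (induction es arbitrary: ss)
  case (Cons p es)
  then show ?case by (cases ss) auto
qed simp

lemma prod_pmf_append:
  "prod_pmf K (es @ fs) = map_pmf (\<lambda>(a, b). a @ b) (pair_pmf (prod_pmf K es) (prod_pmf K fs))"
proof (induction es)
  case Nil
  then show ?case by (simp add: pair_return_pmf1 pmf.map_comp o_def pmf.map_ident)
next
  case (Cons p es)
  show ?case
    by (simp add: Cons pair_map_pmf1 pair_map_pmf2 pmf.map_comp o_def case_prod_beta pair_pmf_def map_pmf_def bind_assoc_pmf bind_return_pmf)
qed

lemma prod_pmf_drop: "map_pmf (drop j) (prod_pmf K es) = prod_pmf K (drop j es)"
proof (induction es arbitrary: j)
  case (Cons p es)
  show ?case
  proof (cases j)
    case (Suc i)
    have "map_pmf (drop (Suc i)) (prod_pmf K (p # es)) = map_pmf (drop i) (map_pmf snd (pair_pmf (K p) (prod_pmf K es)))"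
      by (simp add: pmf.map_comp o_def case_prod_beta')
    then show ?thesis using Suc Cons by (simp add: map_snd_pair_pmf)
  qed (simp add: pmf.map_ident)
qed simp

lemma edges_Cons [simp]: "edges x (y # c) = (x, y) # edges y c"
  and edges_Nil [simp]: "edges x [] = []"
  by (simp_all add: edges_def)

lemma edges_drop: "j \<le> length c \<Longrightarrow> drop j (edges x c) = edges ((x # c) ! j) (drop j c)"
proof (induction c arbitrary: x j)
  case (Cons y c)
  then show ?case by (cases j) auto
qed simp

lemma edges_append: "edges x (c @ d) = edges x c @ edges (last (x # c)) d"
  by (induction c arbitrary: x) auto

lemma edges_map: "edges (f x) (map f c) = map (map_prod f f) (edges x c)"
  by (induction c arbitrary: x) auto

lemma length_edges [simp]: "length (edges x c) = length c"
  by (simp add: edges_def)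

lemma edges_snd: "map snd (edges x c) = c"
  by (induction c arbitrary: x) auto

lemma prod_pmf_lerase:
  fixes K :: "'v \<times> 'v \<Rightarrow> 'v list pmf" and x :: 'v
  assumes "\<And>p s. p \<in> set (edges x c) \<Longrightarrow> s \<in> set_pmf (K p) \<Longrightarrow> last s = snd p"
  shows "map_pmf (lerase last x) (prod_pmf K (edges x c)) = prod_pmf K (edges x (lerase id x c))"
  using assms
proof (induction "id :: 'v \<Rightarrow> 'v" x c rule: lerase.induct)
  case (1 x c)
  have ends: "map last ss = c" if "ss \<in> set_pmf (prod_pmf K (edges x c))" for ss
  proof -
    have "list_all2 (\<lambda>s p. s \<in> set_pmf (K p)) ss (edges x c)" using that by (simp add: set_prod_pmf)
    then have "list_all2 (\<lambda>s p. last s = snd p) ss (edges x c)"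
      using 1(2) by (auto simp: list_all2_conv_all_nth)
    then have "map last ss = map snd (edges x c)"
      by (auto simp: list_all2_conv_all_nth intro: nth_equalityI)
    then show ?thesis by (simp add: edges_snd)
  qed
  define j where "j = Max {j. j \<le> length c \<and> (x # map id c) ! j = x}"
  have "j \<in> {j. j \<le> length c \<and> (x # map id c) ! j = x}"
    unfolding j_def by (rule Max_in) (auto intro: exI[of _ 0])
  then have j: "j \<le> length c" "(x # c) ! j = x" by auto
  have cut: "cutback id x c = drop j c" unfolding j_def by (rule cutback_eq_drop)
  define f where "f ss = (case drop j ss of [] \<Rightarrow> [] | s # r \<Rightarrow> s # lerase last (last s) r)" for ss :: "'v list list"
  have "lerase last x ss = f ss" if "ss \<in> set_pmf (prod_pmf K (edges x c))" for ss
  proof -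
    have "map last ss = c" using ends[OF that] .
    then have "cutback last x ss = drop j ss"
      using cutback_eq_drop[of last x ss] unfolding j_def by (auto dest: map_eq_imp_length_eq)
    then show ?thesis unfolding f_def by (simp add: lerase.simps)
  qed
  then have "map_pmf (lerase last x) (prod_pmf K (edges x c)) = map_pmf f (prod_pmf K (edges x c))"
    by (intro map_pmf_cong) auto
  also have "\<dots> = map_pmf (\<lambda>ss. case ss of [] \<Rightarrow> [] | s # r \<Rightarrow> s # lerase last (last s) r)
      (map_pmf (drop j) (prod_pmf K (edges x c)))"
    unfolding f_def by (simp add: pmf.map_comp o_def)
  also have "map_pmf (drop j) (prod_pmf K (edges x c)) = prod_pmf K (edges x (drop j c))"
    using prod_pmf_drop edges_drop[OF j(1)] j(2) by metis
  finally have eq: "map_pmf (lerase last x) (prod_pmf K (edges x c)) =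
      map_pmf (\<lambda>ss. case ss of [] \<Rightarrow> [] | s # r \<Rightarrow> s # lerase last (last s) r) (prod_pmf K (edges x (drop j c)))" .
  show ?case
  proof (cases "drop j c")
    case Nil
    then show ?thesis unfolding eq using cut by (simp add: lerase.simps)
  next
    case (Cons v r)
    have sub: "set (edges x (drop j c)) \<subseteq> set (edges x c)"
      using edges_drop[OF j(1), of x] j(2) set_drop_subset by metis
    have lv: "last s = v" if "s \<in> set_pmf (K (x, v))" for s
      using 1(2)[of "(x, v)" s] that sub Cons by auto
    have IH: "map_pmf (lerase last v) (prod_pmf K (edges v r)) = prod_pmf K (edges v (lerase id v r))"
      using 1(1)[of v r] cut Cons 1(2) sub by auto
    have "map_pmf (\<lambda>ss. case ss of [] \<Rightarrow> [] | s # r \<Rightarrow> s # lerase last (last s) r) (prod_pmf K (edges x (drop j c))) =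
        map_pmf (\<lambda>(s, q). s # lerase last (last s) q) (pair_pmf (K (x, v)) (prod_pmf K (edges v r)))"
      using Cons by (simp add: pmf.map_comp o_def case_prod_beta')
    also have "\<dots> = map_pmf (\<lambda>(s, q). s # lerase last v q) (pair_pmf (K (x, v)) (prod_pmf K (edges v r)))"
      using lv by (intro map_pmf_cong) auto
    also have "\<dots> = map_pmf (\<lambda>(s, q). s # q) (pair_pmf (K (x, v)) (map_pmf (lerase last v) (prod_pmf K (edges v r))))"
      by (simp add: pair_map_pmf2 pmf.map_comp o_def case_prod_beta')
    also have "\<dots> = prod_pmf K (edges x (lerase id x c))"
      unfolding IH using cut Cons by (simp add: lerase.simps[of id x c])
    finally show ?thesis unfolding eq .
  qed
qed

lemma nn_integral_prod_runs:
  fixes \<phi> :: "'a list \<Rightarrow> ennreal"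
  assumes "\<And>p s. p \<in> set es \<Longrightarrow> s \<in> set_pmf (K p) \<Longrightarrow> key s = ekey p"
  shows "(\<integral>\<^sup>+ss. prod_list (map \<phi> (runs key ss)) \<partial>prod_pmf K es) =
    prod_list (map (\<lambda>g. \<integral>\<^sup>+ss. \<phi> ss \<partial>prod_pmf K g) (runs ekey es))"
  using assms
proof (induction ekey es rule: runs.induct)
  case (2 ekey p es)
  define A B where "A = p # takeWhile (\<lambda>u. ekey u = ekey p) es" and "B = dropWhile (\<lambda>u. ekey u = ekey p) es"
  have AB: "p # es = A @ B" unfolding A_def B_def by simp
  have runsA: "runs ekey (p # es) = A # runs ekey B" unfolding A_def B_def by simp
  have sub: "set A \<subseteq> set (p # es)" "set B \<subseteq> set (p # es)" unfolding AB by auto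
  have keyA: "ekey q = ekey p" if "q \<in> set A" for q using that unfolding A_def by (auto dest: set_takeWhileD)
  have split: "runs key (a @ b) = a # runs key b"
    if a: "a \<in> set_pmf (prod_pmf K A)" and b: "b \<in> set_pmf (prod_pmf K B)" for a b
  proof -
    have la: "list_all2 (\<lambda>s q. s \<in> set_pmf (K q)) a A" and lb: "list_all2 (\<lambda>s q. s \<in> set_pmf (K q)) b B"
      using a b by (simp_all add: set_prod_pmf)
    have ka: "key s = ekey p" if s: "s \<in> set a" for s
    proof -
      obtain i where i: "i < length a" "s = a ! i" using s by (auto simp: in_set_conv_nth)
      then have "s \<in> set_pmf (K (A ! i))" "A ! i \<in> set A" using la by (auto simp: list_all2_conv_all_nth)
      then show ?thesis using 2(2)[of "A ! i" s] keyA sub by auto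
    qed
    have ne: "a \<noteq> []" using la unfolding A_def by auto
    have "runs key a = [a]" by (rule runs_singleton[where k = "ekey p"]) (use ka ne in auto)
    moreover have "b = [] \<or> key (last a) \<noteq> key (hd b)"
    proof (cases b)
      case (Cons s b')
      then obtain q B' where q: "B = q # B'" "s \<in> set_pmf (K q)" using lb by (cases B) auto
      then have "ekey q \<noteq> ekey p" using hd_dropWhile[of "\<lambda>u. ekey u = ekey p" es] unfolding B_def[symmetric] by simp
      moreover have "key s = ekey q" using 2(2)[of q s] q sub(2) by auto
      ultimately show ?thesis using ka[of "last a"] ne Cons by simp
    qed simp
    ultimately show ?thesis using runs_append[of a b key] by simp
  qed
  have IH: "(\<integral>\<^sup>+ss. prod_list (map \<phi> (runs key ss)) \<partial>prod_pmf K B) =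
      prod_list (map (\<lambda>g. \<integral>\<^sup>+ss. \<phi> ss \<partial>prod_pmf K g) (runs ekey B))"
    unfolding B_def by (rule 2(1)) (use 2(2) sub(2) in \<open>auto simp: B_def\<close>)
  have "(\<integral>\<^sup>+ss. prod_list (map \<phi> (runs key ss)) \<partial>prod_pmf K (p # es)) =
      (\<integral>\<^sup>+a. \<integral>\<^sup>+b. prod_list (map \<phi> (runs key (a @ b))) \<partial>prod_pmf K B \<partial>prod_pmf K A)"
    unfolding AB prod_pmf_append by (simp add: nn_integral_pair_pmf')
  also have "\<dots> = (\<integral>\<^sup>+a. \<integral>\<^sup>+b. \<phi> a * prod_list (map \<phi> (runs key b)) \<partial>prod_pmf K B \<partial>prod_pmf K A)"
    by (intro nn_integral_cong_AE AE_pmfI) (auto simp: AE_measure_pmf_iff split intro!: nn_integral_cong_AE)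
  also have "\<dots> = (\<integral>\<^sup>+a. \<phi> a * prod_list (map (\<lambda>g. \<integral>\<^sup>+ss. \<phi> ss \<partial>prod_pmf K g) (runs ekey B)) \<partial>prod_pmf K A)"
    by (intro nn_integral_cong) (simp add: nn_integral_cmult IH)
  also have "\<dots> = (\<integral>\<^sup>+a. \<phi> a \<partial>prod_pmf K A) * prod_list (map (\<lambda>g. \<integral>\<^sup>+ss. \<phi> ss \<partial>prod_pmf K g) (runs ekey B))"
    by (rule nn_integral_multc) simp
  finally show ?case unfolding runsA by simp
qed simp

section \<open>Runs of edges between sites\<close>

definition cell_corner :: "nat \<Rightarrow> site" where
  "cell_corner k = (if k = 0 then Cx else if k = 1 then Cy else Cz)"

lemma edge_cell_subcell:
  assumes e: "site_embedding N e" and adj: "adjacent N (e u) (e v)" and o: "\<not> outer u" "\<not> outer v"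
  defines "t \<equiv> {e Cx, e Cy, e Cz}"
  shows "edge_cell (u, v) < 3" "e u \<in> subcell t (e (cell_corner (edge_cell (u, v))))"
    "e v \<in> subcell t (e (cell_corner (edge_cell (u, v))))"
proof -
  have t: "t \<in> cells (Suc N)"
    and m: "e Mxy = midpoint (e Cx) (e Cy)" "e Mxz = midpoint (e Cx) (e Cz)" "e Myz = midpoint (e Cy) (e Cz)"
    using e unfolding site_embedding_def t_def by auto
  have sub: "subcell t (e Cx) = e ` {Cx, Mxy, Mxz}" "subcell t (e Cy) = e ` {Mxy, Cy, Myz}"
    "subcell t (e Cz) = e ` {Mxz, Myz, Cz}"
    unfolding subcell_def t_def m by (simp_all add: m midpoint_sym[of "e Cy" "e Cx"] midpoint_sym[of "e Cz" "e Cx"] midpoint_sym[of "e Cz" "e Cy"])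
  have nodes: "e w \<in> nodes t" if "\<not> outer w" for w
  proof -
    have "e w \<in> subcell t (e Cx) \<union> subcell t (e Cy) \<union> subcell t (e Cz)"
      using that unfolding sub outer_def by (cases w) simp_all
    then show ?thesis using subcell_nodes[of _ t] unfolding t_def by blast
  qed
  obtain c where c: "c \<in> cells N" "e u \<in> c" "e v \<in> c" "e u \<noteq> e v" using adj unfolding adjacent_def by blast
  obtain w where w: "w \<in> t" "c = subcell t w"
    using cell_between_nodes[OF t c nodes[OF o(1)] nodes[OF o(2)]] by blast
  have mem: "e s \<in> e ` S \<longleftrightarrow> s \<in> S" for s S
    using site_embedding_inj(1)[OF e] by (simp add: inj_image_mem_iff)
  have ne: "u \<noteq> v" using c(4) by auto
  have "(u \<in> {Cx, Mxy, Mxz} \<and> v \<in> {Cx, Mxy, Mxz}) \<or> (u \<in> {Mxy, Cy, Myz} \<and> v \<in> {Mxy, Cy, Myz}) \<or>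
      (u \<in> {Mxz, Myz, Cz} \<and> v \<in> {Mxz, Myz, Cz})"
    using w(1)[unfolded t_def] c(2,3) w(2)
    by (elim insertE emptyE) (simp_all add: sub inj_eq[OF site_embedding_inj(1)[OF e]])
  then have "edge_cell (u, v) < 3 \<and> u \<in> [{Cx, Mxy, Mxz}, {Mxy, Cy, Myz}, {Mxz, Myz, Cz}] ! edge_cell (u, v) \<and>
      v \<in> [{Cx, Mxy, Mxz}, {Mxy, Cy, Myz}, {Mxz, Myz, Cz}] ! edge_cell (u, v)"
    using ne unfolding edge_cell_def by auto
  then have E: "edge_cell (u, v) < 3" "u \<in> [{Cx, Mxy, Mxz}, {Mxy, Cy, Myz}, {Mxz, Myz, Cz}] ! edge_cell (u, v)"
      "v \<in> [{Cx, Mxy, Mxz}, {Mxy, Cy, Myz}, {Mxz, Myz, Cz}] ! edge_cell (u, v)" by auto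
  have sub': "subcell t (e (cell_corner k)) = e ` ([{Cx, Mxy, Mxz}, {Mxy, Cy, Myz}, {Mxz, Myz, Cz}] ! k)" if "k < 3" for k
  proof -
    have "k = 0 \<or> k = 1 \<or> k = 2" using that by auto
    then show ?thesis using sub by (auto simp: cell_corner_def)
  qed
  show "edge_cell (u, v) < 3" by (rule E(1))
  show "e u \<in> subcell t (e (cell_corner (edge_cell (u, v))))" "e v \<in> subcell t (e (cell_corner (edge_cell (u, v))))"
    unfolding sub'[OF E(1)] using E(2,3) by blast+
qed

lemma subcell_corner_inj:
  assumes e: "site_embedding N e" and "k < 3" "l < 3"
    and eq: "subcell {e Cx, e Cy, e Cz} (e (cell_corner k)) = subcell {e Cx, e Cy, e Cz} (e (cell_corner l))"
  shows "k = l"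
proof (rule ccontr)
  let ?t = "{e Cx, e Cy, e Cz}"
  assume "k \<noteq> l"
  have t: "?t \<in> cells (Suc N)" using e unfolding site_embedding_def by auto
  have kl: "cell_corner k \<in> {Cx, Cy, Cz}" "cell_corner l \<in> {Cx, Cy, Cz}" by (simp_all add: cell_corner_def)
  have ne: "cell_corner k \<noteq> cell_corner l" using \<open>k \<noteq> l\<close> assms(2,3) by (auto simp: cell_corner_def)
  have c: "e (cell_corner k) \<in> ?t" "e (cell_corner l) \<in> ?t" using kl by auto
  have "e (cell_corner k) \<noteq> e (cell_corner l)" using ne site_embedding_inj(1)[OF e] by (simp add: inj_eq)
  moreover have "e (cell_corner k) \<in> subcell ?t (e (cell_corner l))"
    unfolding eq[symmetric] using corner_in_subcell[OF c(1)] .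
  then obtain u where u: "u \<in> ?t" "e (cell_corner k) = midpoint (e (cell_corner l)) u" unfolding subcell_def by blast
  ultimately have "e (cell_corner l) \<noteq> u" by auto
  from midpoint_not_vertex[OF t c(2) u(1) this] u(2) site_embedding_inj(2)[OF e, of "cell_corner k"] kl(1)
  show False by simp
qed

lemma triangle_of_edges_eq_iff:
  assumes e: "site_embedding N e"
    and "adjacent N (e u) (e v)" "\<not> outer u" "\<not> outer v" "adjacent N (e u') (e v')" "\<not> outer u'" "\<not> outer v'"
  shows "triangle_of N (e u) (e v) = triangle_of N (e u') (e v') \<longleftrightarrow> edge_cell (u, v) = edge_cell (u', v')"
proof -
  let ?t = "{e Cx, e Cy, e Cz}"
  have t: "?t \<in> cells (Suc N)" using e unfolding site_embedding_def by auto
  have sc: "subcell ?t (e (cell_corner k)) \<in> cells N" for k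
    by (rule subcell_in_cells[OF t]) (simp add: cell_corner_def)
  note E = edge_cell_subcell[OF e assms(2-4)] and E' = edge_cell_subcell[OF e assms(5-7)]
  have "triangle_of N (e u) (e v) = triangle_of N (e u') (e v') \<longleftrightarrow>
      subcell ?t (e (cell_corner (edge_cell (u, v)))) = subcell ?t (e (cell_corner (edge_cell (u', v'))))"
    using assms(2,5) by (intro triangle_of_eq_iff[OF sc E(2,3) _ sc E'(2,3)]) (auto simp: adjacent_def)
  then show ?thesis using subcell_corner_inj[OF e E(1) E'(1)] by auto
qed

section \<open>The recursion for the generating functions\<close>

definition length_gf :: "real \<Rightarrow> nat \<Rightarrow> (complex \<times> complex) list \<Rightarrow> ennreal" where
  "length_gf z N es = (\<integral>\<^sup>+ss. ennreal (z ^ wlen (loop_erase N (joined ss))) \<partial>prod_pmf (step_pmf N) es)"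

definition piece_monomial :: "real \<times> real \<Rightarrow> site list \<Rightarrow> real" where
  "piece_monomial p q = fst p ^ piece_count 1 q * snd p ^ piece_count 2 q"

primrec gf_pair :: "real \<Rightarrow> nat \<Rightarrow> real \<times> real" where
  "gf_pair z 0 = (z, z\<^sup>2)"
| "gf_pair z (Suc N) = (\<integral>q. piece_monomial (gf_pair z N) q \<partial>erased_single,
     \<integral>q. piece_monomial (gf_pair z N) q \<partial>erased_double)"

lemma piece_monomial_bounds:
  assumes "fst p \<in> {0..1}" "snd p \<in> {0..1}"
  shows "piece_monomial p q \<in> {0..1}"
  using assms unfolding piece_monomial_def by (auto intro!: mult_le_one power_le_one)

lemma expectation_unit_interval:
  assumes "\<And>q. f q \<in> {0..1::real}"
  shows "integrable (measure_pmf M) f" "(\<integral>q. f q \<partial>measure_pmf M) \<in> {0..1}"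
    "(\<integral>\<^sup>+q. ennreal (f q) \<partial>measure_pmf M) = ennreal (\<integral>q. f q \<partial>measure_pmf M)"
proof -
  show i: "integrable (measure_pmf M) f"
    by (rule measure_pmf.integrable_const_bound[where B = 1]) (use assms in auto)
  have "(\<integral>q. f q \<partial>measure_pmf M) \<le> (\<integral>q. 1 \<partial>measure_pmf M)"
    by (rule integral_mono[OF i]) (use assms in auto)
  moreover have "0 \<le> (\<integral>q. f q \<partial>measure_pmf M)" by (rule integral_nonneg_AE) (use assms in auto)
  ultimately show "(\<integral>q. f q \<partial>measure_pmf M) \<in> {0..1}" by simp
  show "(\<integral>\<^sup>+q. ennreal (f q) \<partial>measure_pmf M) = ennreal (\<integral>q. f q \<partial>measure_pmf M)"
    by (rule nn_integral_eq_integral[OF i]) (use assms in auto)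
qed

lemma gf_pair_bounds:
  assumes "z \<in> {0..1}"
  shows "fst (gf_pair z N) \<in> {0..1}" "snd (gf_pair z N) \<in> {0..1}"
proof -
  have "fst (gf_pair z N) \<in> {0..1} \<and> snd (gf_pair z N) \<in> {0..1}"
  proof (induction N)
    case 0
    then show ?case using assms by (auto intro: power_le_one)
  next
    case (Suc N)
    then have "\<And>q. piece_monomial (gf_pair z N) q \<in> {0..1}" using piece_monomial_bounds by blast
    then show ?case
      using expectation_unit_interval(2)[of "piece_monomial (gf_pair z N)" erased_single]
        expectation_unit_interval(2)[of "piece_monomial (gf_pair z N)" erased_double] by simp
  qed
  then show "fst (gf_pair z N) \<in> {0..1}" "snd (gf_pair z N) \<in> {0..1}" by auto
qed

lemma push_successively:
  "successively R (x # st) \<Longrightarrow> R (last (x # st)) u \<Longrightarrow> successively R (x # push id x st u)"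
proof (induction st arbitrary: x)
  case (Cons v st)
  then show ?case by (cases st) auto
qed auto

lemma successively_snoc: "successively R (x # c @ [u]) \<longleftrightarrow> successively R (x # c) \<and> R (last (x # c)) u"
  by (induction c arbitrary: x) auto

lemma lerase_successively: "successively R (x # c) \<Longrightarrow> successively R (x # lerase id x c)"
proof (induction c rule: rev_induct)
  case (snoc u c)
  have c: "successively R (x # c)" "R (last (x # c)) u" using snoc.prems by (simp_all add: successively_snoc)
  have "last (x # lerase id x c) = last (x # c)" using last_lerase[of x id c] by (simp only: list.map_id)
  then have "successively R (x # lerase id x c)" "R (last (x # lerase id x c)) u"
    using snoc.IH[OF c(1)] c(2) by (simp_all only:)
  then show ?case unfolding lerase_snoc by (rule push_successively)
qed simp

lemma edges_successively: "successively R (x # c) \<Longrightarrow> (u, v) \<in> set (edges x c) \<Longrightarrow> R u v"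
  by (induction c arbitrary: x) auto

lemma edges_consecutive:
  "edges x c = ps @ (a, b) # (b', d) # qs \<Longrightarrow> b' = b \<and> a \<in> set (x # c) \<and> (distinct (x # c) \<longrightarrow> a \<noteq> d)"
proof (induction c arbitrary: x ps)
  case (Cons y c)
  show ?case
  proof (cases ps)
    case Nil
    then have "a = x" "b = y" "edges y c = (b', d) # qs" using Cons.prems by auto
    then show ?thesis by (cases c) auto
  next
    case (Cons p ps')
    then have "edges y c = ps' @ (a, b) # (b', d) # qs" using \<open>edges x (y # c) = _\<close> by simp
    from Cons.IH[OF this] show ?thesis by auto
  qed
qed simp

lemma prod_list_monomial:
  assumes "\<And>g. g \<in> set gs \<Longrightarrow> length g \<in> {1, 2}" "0 \<le> a" "0 \<le> b"
  shows "prod_list (map (\<lambda>g. if length g = 1 then ennreal a else ennreal b) gs) =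
    ennreal (a ^ length (filter (\<lambda>g. length g = 1) gs) * b ^ length (filter (\<lambda>g. length g = 2) gs))"
  using assms(1)
proof (induction gs)
  case (Cons g gs)
  then have "length g = 1 \<or> length g = 2" by auto
  then show ?case using Cons assms(2,3) by (auto simp: ennreal_mult[symmetric] mult_ac)
qed simp

text \<open>The generating functions of a piece at level \<open>N\<close>, to be established by induction.\<close>

definition gf_correct :: "real \<Rightarrow> nat \<Rightarrow> bool" where
  "gf_correct z N \<longleftrightarrow>
     (\<forall>x y. adjacent N x y \<longrightarrow> length_gf z N [(x, y)] = ennreal (fst (gf_pair z N))) \<and>
     (\<forall>x y w t. t \<in> cells N \<longrightarrow> x \<in> t \<longrightarrow> y \<in> t \<longrightarrow> w \<in> t \<longrightarrow> x \<noteq> y \<longrightarrow> y \<noteq> w \<longrightarrow> x \<noteq> w \<longrightarrow>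
       length_gf z N [(x, y), (y, w)] = ennreal (snd (gf_pair z N)))"

lemma length_gf_piece:
  assumes e: "site_embedding N e" and z: "z \<in> {0..1}" and IH: "gf_correct z N"
    and q: "good_final q" "distinct (Cx # q)" "successively (adjacent N) (e Cx # map e q)"
    and g: "g \<in> set (site_pieces q)"
  shows "length_gf z N (map (map_prod e e) g) = (if length g = 1 then ennreal (fst (gf_pair z N)) else ennreal (snd (gf_pair z N)))"
proof -
  have "g \<noteq> []" using runs_nonempty g unfolding site_pieces_def by blast
  obtain ps qs where pq: "edges Cx q = ps @ g @ qs" using runs_sublist g unfolding site_pieces_def by metis
  have adj: "adjacent N (e u) (e v)" if "(u, v) \<in> set g" for u v
  proof -
    have "(u, v) \<in> set (edges Cx q)" using that pq by simp
    then have "(e u, e v) \<in> set (edges (e Cx) (map e q))" unfolding edges_map by force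
    then show ?thesis using edges_successively[OF q(3)] by blast
  qed
  have o: "\<not> outer u \<and> \<not> outer v" if "(u, v) \<in> set g" for u v
  proof -
    have "(u, v) \<in> set (edges Cx q)" using that pq by simp
    then have "u \<in> set (Cx # q)" "v \<in> set q" unfolding edges_def by (auto dest: set_zip_leftD set_zip_rightD)
    then show ?thesis using q(1) unfolding good_final_def by (auto simp: list_all_iff outer_def)
  qed
  have len: "length g = 1 \<or> length g = 2" using q(1) g unfolding good_final_def by (auto simp: list_all_iff)
  then show ?thesis
  proof
    assume "length g = 1"
    then obtain u v where "g = [(u, v)]" by (auto simp: length_Suc_conv)
    then show ?thesis using IH adj unfolding gf_correct_def by simp
  next
    assume "length g = 2"
    then obtain u v v' w where g': "g = [(u, v), (v', w)]" by (auto simp: length_Suc_conv numeral_2_eq_2)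
    have vw: "v' = v" "u \<noteq> w" using edges_consecutive[of Cx q ps u v v' w qs] pq g' q(2) by auto
    have c: "edge_cell (v, w) = edge_cell (u, v)" using runs_key[of g edge_cell "edges Cx q" "(v', w)"] g g' vw
      unfolding site_pieces_def by simp
    let ?c = "subcell {e Cx, e Cy, e Cz} (e (cell_corner (edge_cell (u, v))))"
    have t: "{e Cx, e Cy, e Cz} \<in> cells (Suc N)" using e unfolding site_embedding_def by auto
    have "?c \<in> cells N" by (rule subcell_in_cells[OF t]) (simp add: cell_corner_def)
    moreover have "e u \<in> ?c" "e v \<in> ?c" "e w \<in> ?c"
      using edge_cell_subcell[OF e, of u v] edge_cell_subcell[OF e, of v w] adj o g' vw c by auto
    moreover have "e u \<noteq> e v" "e v \<noteq> e w" using adj g' vw unfolding adjacent_def by auto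
    moreover have "e u \<noteq> e w" using vw(2) site_embedding_inj(1)[OF e] by (simp add: inj_eq)
    ultimately show ?thesis using IH g' vw(1) unfolding gf_correct_def by simp
  qed
qed

lemma step_pmf_support: "adjacent N x y \<Longrightarrow> s \<in> set_pmf (step_pmf N (x, y)) \<Longrightarrow> s \<in> step_walks N x y"
  using pmf_step_pmf[of N x y s] by (auto simp: set_pmf_iff step_weight_def split: if_splits)

text \<open>For a random piece whose refinement runs along a random site path, erasing leaves independent
  pieces, one for each run of the erased site path.\<close>

lemma length_gf_recursion:
  assumes e: "site_embedding N e" and z: "z \<in> {0..1}" and IH: "gf_correct z N"
    and D: "map_pmf (refine_all N) D = bind_pmf M (\<lambda>L. prod_pmf (step_pmf N) (edges (e Cx) (map e L)))"
    and pieces: "\<And>g. g \<in> set_pmf D \<Longrightarrow> is_piece (Suc N) g \<and> hd (hd g) = e Cx"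
    and L: "\<And>L. L \<in> set_pmf M \<Longrightarrow> successively (adjacent N) (e Cx # map e L) \<and> good_final (lerase id Cx L)"
  shows "(\<integral>\<^sup>+g. ennreal (z ^ wlen (loop_erase (Suc N) (joined g))) \<partial>D) =
    ennreal (\<integral>q. piece_monomial (gf_pair z N) q \<partial>map_pmf (lerase id Cx) M)"
proof -
  let ?\<phi> = "\<lambda>ss. ennreal (z ^ wlen (loop_erase N (joined ss)))"
  let ?H = "\<lambda>ss. prod_list (map ?\<phi> (runs (step_triangle N) ss))"
  have "(\<integral>\<^sup>+g. ennreal (z ^ wlen (loop_erase (Suc N) (joined g))) \<partial>D) =
      (\<integral>\<^sup>+g. ?H (lerase last (e Cx) (refine_all N g)) \<partial>D)"
  proof (rule nn_integral_cong_AE, unfold AE_measure_pmf_iff, intro ballI)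
    fix g assume "g \<in> set_pmf D"
    then have g: "is_piece (Suc N) g" "hd (hd g) = e Cx" using pieces by auto
    have "z ^ wlen (loop_erase (Suc N) (joined g)) =
        prod_list (map (\<lambda>h. z ^ wlen (loop_erase N (joined h))) (runs (step_triangle N) (piece_erasure N g)))"
    proof -
      have "z ^ sum_list (map f hs) = prod_list (map (\<lambda>h. z ^ f h) hs)" for f :: "walk list \<Rightarrow> nat" and hs
        by (induction hs) (auto simp: power_add)
      then show ?thesis unfolding loop_erase_piece[OF g(1)] wlen_pieces by (simp add: o_def)
    qed
    moreover have "ennreal (prod_list (map f hs)) = prod_list (map (\<lambda>h. ennreal (f h)) hs)"
      if "\<And>h. 0 \<le> f h" for f :: "walk list \<Rightarrow> real" and hs
    proof (induction hs)
      case (Cons h hs)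
      have "0 \<le> prod_list (map f hs)" by (rule prod_list_nonneg) (use that in auto)
      then show ?case using Cons that[of h] by (simp add: ennreal_mult)
    qed simp
    ultimately show "ennreal (z ^ wlen (loop_erase (Suc N) (joined g))) = ?H (lerase last (e Cx) (refine_all N g))"
      using z g(2) unfolding piece_erasure_def by simp
  qed
  also have "\<dots> = (\<integral>\<^sup>+ss. ?H (lerase last (e Cx) ss) \<partial>map_pmf (refine_all N) D)" by simp
  also have "\<dots> = (\<integral>\<^sup>+L. \<integral>\<^sup>+ss. ?H (lerase last (e Cx) ss) \<partial>prod_pmf (step_pmf N) (edges (e Cx) (map e L)) \<partial>M)"
    unfolding D by simp
  also have "\<dots> = (\<integral>\<^sup>+L. ennreal (piece_monomial (gf_pair z N) (lerase id Cx L)) \<partial>M)"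
  proof (rule nn_integral_cong_AE, unfold AE_measure_pmf_iff, intro ballI)
    fix L assume "L \<in> set_pmf M"
    then have L': "successively (adjacent N) (e Cx # map e L)" "good_final (lerase id Cx L)" using L by auto
    define q where "q = lerase id Cx L"
    have q: "good_final q" "distinct (Cx # q)" using L'(2) lerase_distinct[of Cx id L] unfolding q_def by auto
    have eq: "lerase id (e Cx) (map e L) = map e q"
      unfolding q_def by (rule lerase_inj[OF site_embedding_inj(1)[OF e]]) auto
    have adj: "successively (adjacent N) (e Cx # map e q)"
      using lerase_successively[OF L'(1)] unfolding eq .
    have supp: "s \<in> step_walks N (fst p) (snd p)"
      if "p \<in> set (edges (e Cx) c)" "s \<in> set_pmf (step_pmf N p)" "successively (adjacent N) (e Cx # c)" for p s c
      using step_pmf_support[of N "fst p" "snd p" s] edges_successively[OF that(3), of "fst p" "snd p"] that(1,2) by simp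
    define ekey where "ekey p = triangle_of N (fst p) (snd p)" for p
    have "(\<integral>\<^sup>+ss. ?H (lerase last (e Cx) ss) \<partial>prod_pmf (step_pmf N) (edges (e Cx) (map e L))) =
        (\<integral>\<^sup>+ss. ?H ss \<partial>map_pmf (lerase last (e Cx)) (prod_pmf (step_pmf N) (edges (e Cx) (map e L))))" by simp
    also have "map_pmf (lerase last (e Cx)) (prod_pmf (step_pmf N) (edges (e Cx) (map e L))) =
        prod_pmf (step_pmf N) (edges (e Cx) (map e q))"
      unfolding eq[symmetric] by (rule prod_pmf_lerase) (use supp[OF _ _ L'(1)] step_walksD(4) in blast)
    also have "(\<integral>\<^sup>+ss. ?H ss \<partial>prod_pmf (step_pmf N) (edges (e Cx) (map e q))) =
        prod_list (map (length_gf z N) (runs ekey (edges (e Cx) (map e q))))"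
      unfolding length_gf_def
    proof (rule nn_integral_prod_runs)
      fix p s assume "p \<in> set (edges (e Cx) (map e q))" "s \<in> set_pmf (step_pmf N p)"
      from step_walksD(3,4)[OF supp[OF this adj]] show "step_triangle N s = ekey p"
        unfolding step_triangle_def ekey_def by simp
    qed
    also have "runs ekey (edges (e Cx) (map e q)) = map (map (map_prod e e)) (site_pieces q)"
    proof -
      have "runs edge_cell (edges Cx q) = runs (ekey \<circ> map_prod e e) (edges Cx q)"
      proof (rule runs_cong)
        fix a b assume ab: "a \<in> set (edges Cx q)" "b \<in> set (edges Cx q)"
        have P: "adjacent N (e (fst a)) (e (snd a)) \<and> \<not> outer (fst a) \<and> \<not> outer (snd a)" if "a \<in> set (edges Cx q)" for a
        proof -
          obtain u v where uv: "a = (u, v)" by (cases a)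
          have "map_prod e e a \<in> map_prod e e ` set (edges Cx q)" using that by (rule imageI)
          then have "(e (fst a), e (snd a)) \<in> set (edges (e Cx) (map e q))"
            unfolding edges_map uv by simp
          moreover have "fst a \<in> set (Cx # q)" "snd a \<in> set q"
            using that unfolding edges_def uv by (simp_all only: fst_conv snd_conv) (erule set_zip_leftD, erule set_zip_rightD)
          ultimately show ?thesis using edges_successively[OF adj] q(1) unfolding good_final_def
            by (auto simp: list_all_iff outer_def)
        qed
        show "edge_cell a = edge_cell b \<longleftrightarrow> (ekey \<circ> map_prod e e) a = (ekey \<circ> map_prod e e) b"
          using triangle_of_edges_eq_iff[OF e, of "fst a" "snd a" "fst b" "snd b"] P[OF ab(1)] P[OF ab(2)]
          by (simp add: ekey_def)
      qed
      then show ?thesis unfolding site_pieces_def edges_map by (simp add: runs_map)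
    qed
    also have "prod_list (map (length_gf z N) (map (map (map_prod e e)) (site_pieces q))) =
        prod_list (map (\<lambda>g. if length g = 1 then ennreal (fst (gf_pair z N)) else ennreal (snd (gf_pair z N))) (site_pieces q))"
      using length_gf_piece[OF e z IH q adj] by (simp cong: map_cong)
    also have "\<dots> = ennreal (piece_monomial (gf_pair z N) q)"
      unfolding piece_monomial_def piece_count_def
      by (rule prod_list_monomial) (use q(1) gf_pair_bounds[OF z, of N] in \<open>auto simp: good_final_def list_all_iff\<close>)
    finally show "(\<integral>\<^sup>+ss. ?H (lerase last (e Cx) ss) \<partial>prod_pmf (step_pmf N) (edges (e Cx) (map e L))) =
        ennreal (piece_monomial (gf_pair z N) (lerase id Cx L))" unfolding q_def .
  qed
  also have "\<dots> = (\<integral>\<^sup>+q. ennreal (piece_monomial (gf_pair z N) q) \<partial>map_pmf (lerase id Cx) M)" by simp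
  also have "\<dots> = ennreal (\<integral>q. piece_monomial (gf_pair z N) q \<partial>map_pmf (lerase id Cx) M)"
    by (rule expectation_unit_interval(3)) (rule piece_monomial_bounds[OF gf_pair_bounds[OF z]])
  finally show ?thesis .
qed

lemma site_walk_range: "site_walk v l \<Longrightarrow> set l \<subseteq> {Cx, Cy, Mxy, Mxz, Myz, Ox1, Ox2, Ox3}"
proof (induction l arbitrary: v)
  case (Cons u l)
  have "u \<in> set (moves v)" using Cons.prems by simp
  then have "u \<in> {Cx, Cy, Mxy, Mxz, Myz, Ox1, Ox2, Ox3}" by (cases v) auto
  moreover have "set l \<subseteq> {Cx, Cy, Mxy, Mxz, Myz, Ox1, Ox2, Ox3}"
    by (rule Cons.IH[of u]) (use Cons.prems in simp)
  ultimately show ?case by simp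
qed simp

lemma skeleton_chain:
  assumes e: "site_embedding N e" and l: "site_walk Cx l"
    and ss: "ss \<in> set_pmf (prod_pmf (step_pmf N) (edges (e Cx) (map e l)))"
  shows "chain N (e Cx) ss"
proof -
  have "pmf (prod_pmf (step_pmf N) (edges (e Cx) (map e l))) ss \<noteq> 0" using ss by (simp add: set_pmf_iff)
  then show ?thesis
    using pmf_prod_steps[OF pmf_step_pmf site_walk_successively[OF e l], of ss] by (simp split: if_splits)
qed

lemma refine_step_pmf:
  assumes "adjacent (Suc N) x y"
  shows "map_pmf (refine N) (step_pmf (Suc N) (x, y)) =
    bind_pmf skeleton_pmf (\<lambda>l. prod_pmf (step_pmf N) (edges x (map (embedding N (x, y)) l)))"
proof -
  let ?e = "embedding N (x, y)"
  note e = embedding_props[OF assms]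
  have "map_pmf (refine N) (step_pmf (Suc N) (x, y)) =
      bind_pmf skeleton_pmf (\<lambda>l. map_pmf (\<lambda>ss. refine N (concat_walks x ss)) (prod_pmf (step_pmf N) (edges x (map ?e l))))"
    by (simp add: map_bind_pmf pmf.map_comp o_def)
  also have "\<dots> = bind_pmf skeleton_pmf (\<lambda>l. prod_pmf (step_pmf N) (edges x (map ?e l)))"
  proof (rule bind_pmf_cong[OF refl])
    fix l assume "l \<in> set_pmf skeleton_pmf"
    then have l: "site_walk Cx l" by (simp add: set_skeleton_pmf)
    have "map_pmf (\<lambda>ss. refine N (concat_walks x ss)) (prod_pmf (step_pmf N) (edges x (map ?e l))) =
        map_pmf (\<lambda>ss. ss) (prod_pmf (step_pmf N) (edges x (map ?e l)))"
      using skeleton_chain[OF e(1) l] e(2) refine_eq by (intro map_pmf_cong) auto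
    then show "map_pmf (\<lambda>ss. refine N (concat_walks x ss)) (prod_pmf (step_pmf N) (edges x (map ?e l))) =
        prod_pmf (step_pmf N) (edges x (map ?e l))" by (simp add: pmf.map_ident)
  qed
  finally show ?thesis .
qed

lemma is_piece_single:
  assumes "s \<in> step_walks N x y"
  shows "is_piece N [s]"
  using assms step_walksD(3,4,7)[OF assms] unfolding is_piece_def by auto

lemma is_piece_double:
  assumes t: "t \<in> cells N" "x \<in> t" "y \<in> t" "w \<in> t" "x \<noteq> w"
    and s: "s \<in> step_walks N x y" "s' \<in> step_walks N y w"
  shows "is_piece N [s, s']"
proof -
  note d = step_walksD(3,4,7)[OF s(1)] and d' = step_walksD(3,4,7)[OF s(2)]
  have "step_triangle N s = convex hull t" "step_triangle N s' = convex hull t"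
    unfolding step_triangle_def d d' using triangle_of_eq[OF t(1)] t d(3) d'(3) by auto
  then show ?thesis using s d d' t(5) unfolding is_piece_def by auto
qed

lemma double_embedding:
  assumes t: "t \<in> cells (Suc N)" "x \<in> t" "y \<in> t" "w \<in> t" "x \<noteq> y" "y \<noteq> w" "x \<noteq> w"
  obtains e where "site_embedding N e" "e Cx = x"
    "\<And>s. s \<in> {Cx, Cy, Mxy, Mxz, Myz, Ox1, Ox2, Ox3} \<Longrightarrow> e s = embedding N (x, y) s"
    "\<And>s. s \<in> {Cx, Cy, Mxy, Mxz, Myz, Ox1, Ox2, Ox3} \<Longrightarrow> e (rotate_site s) = embedding N (y, w) s"
proof -
  define e1 e2 where "e1 = embedding N (x, y)" and "e2 = embedding N (y, w)"
  have adj: "adjacent (Suc N) x y" "adjacent (Suc N) y w" using t unfolding adjacent_def by blast+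
  note e1 = embedding_props[OF adj(1), folded e1_def] and e2 = embedding_props[OF adj(2), folded e2_def]
  have c1: "{x, y, e1 Cz} \<in> cells (Suc N)" "e1 Cz \<noteq> x" "e1 Cz \<noteq> y"
    and m1: "e1 Mxy = midpoint x y" "e1 Mxz = midpoint x (e1 Cz)" "e1 Myz = midpoint y (e1 Cz)"
    and o1: "outer_midpoints N {x, y, e1 Cz} x (e1 Ox1) (e1 Ox2) (e1 Ox3)"
    using e1 unfolding site_embedding_def by auto
  have c2: "{y, w, e2 Cz} \<in> cells (Suc N)" "e2 Cz \<noteq> y" "e2 Cz \<noteq> w"
    and m2: "e2 Mxy = midpoint y w" "e2 Mxz = midpoint y (e2 Cz)" "e2 Myz = midpoint w (e2 Cz)"
    and o2: "outer_midpoints N {y, w, e2 Cz} y (e2 Ox1) (e2 Ox2) (e2 Ox3)"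
    using e2 unfolding site_embedding_def by auto
  have t1: "t = {x, y, e1 Cz}" using cells_eqI[OF t(1) c1(1), of x y] t by auto
  have t2: "t = {y, w, e2 Cz}" using cells_eqI[OF t(1) c2(1), of y w] t by auto
  have z1: "e1 Cz = w" using t1 t by auto
  have z2: "e2 Cz = x" using t2 t by auto
  have eqs: "{y, w, x} = {x, y, w}" by auto
  have o2': "outer_midpoints N {x, y, w} y (e2 Ox1) (e2 Ox2) (e2 Ox3)" using o2 unfolding z2 eqs .
  define e where "e s = (case s of Oy1 \<Rightarrow> e2 Ox1 | Oy2 \<Rightarrow> e2 Ox2 | Oy3 \<Rightarrow> e2 Ox3 | _ \<Rightarrow> e1 s)" for s
  show thesis
  proof (rule that)
    show "e Cx = x" using e1(2) by (simp add: e_def)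
    show "site_embedding N e"
      using c1 m1 o1 o2' e1(2,3) t(5-7) unfolding site_embedding_def z1 by (simp add: e_def z1)
    show "e s = embedding N (x, y) s" if "s \<in> {Cx, Cy, Mxy, Mxz, Myz, Ox1, Ox2, Ox3}" for s
      using that unfolding e1_def[symmetric] by (auto simp: e_def)
    show "e (rotate_site s) = embedding N (y, w) s" if "s \<in> {Cx, Cy, Mxy, Mxz, Myz, Ox1, Ox2, Ox3}" for s
      using that m1 m2 e1(3) e2(2,3) z1 z2 midpoint_sym unfolding e2_def[symmetric]
      by (auto simp: e_def)
  qed
qed

lemma gf_correct_all:
  assumes z: "z \<in> {0..1}"
  shows "gf_correct z N"
proof (induction N)
  case 0
  have "length_gf z 0 [(x, y)] = ennreal z" for x y
    unfolding length_gf_def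
    by (simp add: pair_return_pmf1 joined_def concat_walks_def wlen_def)
  moreover have "length_gf z 0 [(x, y), (y, w)] = ennreal (z\<^sup>2)" for x y w
    unfolding length_gf_def
    by (simp add: pair_return_pmf1 joined_def concat_walks_def wlen_def numeral_2_eq_2)
  ultimately show ?case unfolding gf_correct_def by simp
next
  case (Suc N)
  show ?case unfolding gf_correct_def
  proof (intro conjI allI impI)
    fix x y assume adj: "adjacent (Suc N) x y"
    let ?e = "embedding N (x, y)" and ?D = "prod_pmf (step_pmf (Suc N)) [(x, y)]"
    note e = embedding_props[OF adj]
    have D: "?D = map_pmf (\<lambda>s. [s]) (step_pmf (Suc N) (x, y))"
      by (simp add: pair_return_pmf2 pmf.map_comp o_def del: step_pmf.simps)
    have "map_pmf (refine_all N) ?D = map_pmf (refine N) (step_pmf (Suc N) (x, y))"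
      unfolding D by (simp add: pmf.map_comp o_def refine_all_def del: step_pmf.simps)
    then have ref: "map_pmf (refine_all N) ?D = bind_pmf skeleton_pmf (\<lambda>L. prod_pmf (step_pmf N) (edges (?e Cx) (map ?e L)))"
      unfolding refine_step_pmf[OF adj] e(2) .
    have "(\<integral>\<^sup>+g. ennreal (z ^ wlen (loop_erase (Suc N) (joined g))) \<partial>?D) =
        ennreal (\<integral>q. piece_monomial (gf_pair z N) q \<partial>map_pmf (lerase id Cx) skeleton_pmf)"
    proof (rule length_gf_recursion[OF e(1) z Suc ref])
      fix g assume "g \<in> set_pmf ?D"
      then obtain s where "s \<in> set_pmf (step_pmf (Suc N) (x, y))" "g = [s]" unfolding D by auto
      then have "s \<in> step_walks (Suc N) x y" "g = [s]" using step_pmf_support[OF adj] by auto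
      then show "is_piece (Suc N) g \<and> hd (hd g) = ?e Cx" using is_piece_single step_walksD(3) e(2) by auto
    next
      fix L assume L: "L \<in> set_pmf skeleton_pmf"
      then have "lerase id Cx L \<in> set_pmf erased_single" unfolding erased_single_def by simp
      then show "successively (adjacent N) (?e Cx # map ?e L) \<and> good_final (lerase id Cx L)"
        using site_walk_successively[OF e(1)] L set_erased_single by (simp add: set_skeleton_pmf)
    qed
    then show "length_gf z (Suc N) [(x, y)] = ennreal (fst (gf_pair z (Suc N)))"
      unfolding length_gf_def erased_single_def[symmetric] by simp
  next
    fix x y w t assume t: "t \<in> cells (Suc N)" "x \<in> t" "y \<in> t" "w \<in> t" "x \<noteq> y" "y \<noteq> w" "x \<noteq> w"
    have adj: "adjacent (Suc N) x y" "adjacent (Suc N) y w" using t unfolding adjacent_def by blast+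
    obtain e where e: "site_embedding N e" "e Cx = x"
      "\<And>s. s \<in> {Cx, Cy, Mxy, Mxz, Myz, Ox1, Ox2, Ox3} \<Longrightarrow> e s = embedding N (x, y) s"
      "\<And>s. s \<in> {Cx, Cy, Mxy, Mxz, Myz, Ox1, Ox2, Ox3} \<Longrightarrow> e (rotate_site s) = embedding N (y, w) s"
      using double_embedding[OF t] by blast
    note e1 = embedding_props[OF adj(1)] and e2 = embedding_props[OF adj(2)]
    have map1: "map (embedding N (x, y)) l = map e l" if "site_walk Cx l" for l
      unfolding map_eq_conv
    proof (intro ballI)
      fix s assume "s \<in> set l"
      then have "s \<in> {Cx, Cy, Mxy, Mxz, Myz, Ox1, Ox2, Ox3}" using site_walk_range[OF that] by blast
      from e(3)[OF this] show "embedding N (x, y) s = e s" by (rule sym)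
    qed
    have map2: "map (embedding N (y, w)) l = map e (map rotate_site l)" if "site_walk Cx l" for l
      unfolding map_map map_eq_conv
    proof (intro ballI)
      fix s assume "s \<in> set l"
      then have "s \<in> {Cx, Cy, Mxy, Mxz, Myz, Ox1, Ox2, Ox3}" using site_walk_range[OF that] by blast
      from e(4)[OF this] show "embedding N (y, w) s = (e \<circ> rotate_site) s" by simp
    qed
    have last1: "last (x # map e l) = y" if "site_walk Cx l" for l
    proof -
      have "last (x # map e l) = e (last (Cx # l))" using e(2) by (simp add: last_map)
      then show ?thesis using site_walk_last[OF that] e(3)[of Cy] e1(3) by simp
    qed
    let ?D = "prod_pmf (step_pmf (Suc N)) [(x, y), (y, w)]"
    let ?M = "bind_pmf skeleton_pmf (\<lambda>l1. map_pmf (\<lambda>l2. l1 @ map rotate_site l2) skeleton_pmf)"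
    let ?S1 = "step_pmf (Suc N) (x, y)" and ?S2 = "step_pmf (Suc N) (y, w)"
    have D: "?D = map_pmf (\<lambda>(s, s'). [s, s']) (pair_pmf ?S1 ?S2)"
      by (simp add: pair_return_pmf2 pair_map_pmf2 pmf.map_comp o_def case_prod_beta' del: step_pmf.simps)
    have "map_pmf (refine_all N) ?D = map_pmf (\<lambda>(a, b). a @ b) (pair_pmf (map_pmf (refine N) ?S1) (map_pmf (refine N) ?S2))"
      unfolding D by (simp add: pair_map_pmf1 pair_map_pmf2 pmf.map_comp o_def case_prod_beta' refine_all_def del: step_pmf.simps)
    also have "\<dots> = bind_pmf skeleton_pmf (\<lambda>l1. bind_pmf skeleton_pmf (\<lambda>l2.
        map_pmf (\<lambda>(a, b). a @ b) (pair_pmf (prod_pmf (step_pmf N) (edges x (map (embedding N (x, y)) l1)))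
          (prod_pmf (step_pmf N) (edges y (map (embedding N (y, w)) l2))))))"
      unfolding refine_step_pmf[OF adj(1)] refine_step_pmf[OF adj(2)] pair_pmf_def map_bind_pmf bind_assoc_pmf
      by (subst bind_commute_pmf) simp
    also have "\<dots> = bind_pmf skeleton_pmf (\<lambda>l1. bind_pmf skeleton_pmf (\<lambda>l2.
        prod_pmf (step_pmf N) (edges (e Cx) (map e (l1 @ map rotate_site l2)))))"
    proof (intro bind_pmf_cong refl)
      fix l1 l2 assume "l1 \<in> set_pmf skeleton_pmf" "l2 \<in> set_pmf skeleton_pmf"
      then have l: "site_walk Cx l1" "site_walk Cx l2" by (simp_all add: set_skeleton_pmf)
      show "map_pmf (\<lambda>(a, b). a @ b) (pair_pmf (prod_pmf (step_pmf N) (edges x (map (embedding N (x, y)) l1)))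
          (prod_pmf (step_pmf N) (edges y (map (embedding N (y, w)) l2)))) =
          prod_pmf (step_pmf N) (edges (e Cx) (map e (l1 @ map rotate_site l2)))"
        unfolding prod_pmf_append[symmetric] map1[OF l(1)] map2[OF l(2)] map_append edges_append e(2) last1[OF l(1)] ..
    qed
    also have "\<dots> = bind_pmf ?M (\<lambda>L. prod_pmf (step_pmf N) (edges (e Cx) (map e L)))"
      by (simp add: bind_assoc_pmf bind_map_pmf)
    finally have ref: "map_pmf (refine_all N) ?D = bind_pmf ?M (\<lambda>L. prod_pmf (step_pmf N) (edges (e Cx) (map e L)))" .
    have M: "map_pmf (lerase id Cx) ?M = erased_double"
      unfolding erased_double_def by (simp add: map_bind_pmf pmf.map_comp o_def)
    have "(\<integral>\<^sup>+g. ennreal (z ^ wlen (loop_erase (Suc N) (joined g))) \<partial>?D) =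
        ennreal (\<integral>q. piece_monomial (gf_pair z N) q \<partial>map_pmf (lerase id Cx) ?M)"
    proof (rule length_gf_recursion[OF e(1) z Suc ref])
      fix g assume "g \<in> set_pmf ?D"
      then obtain s s' where "s \<in> set_pmf ?S1" "s' \<in> set_pmf ?S2" "g = [s, s']" unfolding D by auto
      then have s: "s \<in> step_walks (Suc N) x y" "s' \<in> step_walks (Suc N) y w" "g = [s, s']"
        using step_pmf_support[OF adj(1)] step_pmf_support[OF adj(2)] by auto
      then show "is_piece (Suc N) g \<and> hd (hd g) = e Cx"
        using is_piece_double[OF t(1-4,7) s(1,2)] step_walksD(3)[OF s(1)] e(2) by simp
    next
      fix L assume L: "L \<in> set_pmf ?M"
      then obtain l1 l2 where l: "site_walk Cx l1" "site_walk Cx l2" "L = l1 @ map rotate_site l2"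
        by (auto simp: set_skeleton_pmf)
      have "lerase id Cx L \<in> set_pmf erased_double" unfolding M[symmetric] set_map_pmf using L by (rule imageI)
      then have good: "good_final (lerase id Cx L)" by (rule set_erased_double)
      have s1: "successively (adjacent N) (x # map e l1)"
        using site_walk_successively[OF e1(1) l(1)] unfolding e1(2) map1[OF l(1)] .
      have s2: "successively (adjacent N) (y # map e (map rotate_site l2))"
        using site_walk_successively[OF e2(1) l(2)] unfolding e2(2) map2[OF l(2)] .
      have app: "successively R (a # c @ d)" if "successively R (a # c)" "successively R (last (a # c) # d)"
        for R and a :: complex and c d
        using that by (induction c arbitrary: a) auto
      have "successively (adjacent N) (e Cx # map e L)"
        unfolding l(3) map_append e(2) by (rule app[OF s1]) (use s2 last1[OF l(1)] in simp)
      then show "successively (adjacent N) (e Cx # map e L) \<and> good_final (lerase id Cx L)" using good ..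
    qed
    then show "length_gf z (Suc N) [(x, y), (y, w)] = ennreal (snd (gf_pair z (Suc N)))"
      unfolding length_gf_def M by simp
  qed
qed

section \<open>Growth of the generating functions\<close>

lemma piece_counts:
  assumes "good_final q"
  shows "piece_count 1 q + piece_count 2 q \<in> {2, 3}"
proof -
  have "length (filter (\<lambda>g. length g = 1) gs) + length (filter (\<lambda>g. length g = 2) gs) = length gs"
    if "\<forall>g\<in>set gs. length g \<in> {1, 2}" for gs :: "(site \<times> site) list list"
    using that by (induction gs) auto
  from this[of "site_pieces q"] assms show ?thesis
    unfolding good_final_def piece_count_def by (auto simp: list_all_iff)
qed

lemma prod_list_complement:
  fixes m :: real
  assumes "\<And>x. x \<in> set xs \<Longrightarrow> 0 \<le> x \<and> x \<le> m \<and> x \<le> 1"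
  shows "1 - prod_list (map (\<lambda>x. 1 - x) xs) \<le> sum_list xs"
    "sum_list xs - real (length xs * (length xs - 1)) / 2 * m\<^sup>2 \<le> 1 - prod_list (map (\<lambda>x. 1 - x) xs)"
proof -
  have "1 - prod_list (map (\<lambda>x. 1 - x) xs) \<le> sum_list xs \<and> 0 \<le> prod_list (map (\<lambda>x. 1 - x) xs) \<and>
     prod_list (map (\<lambda>x. 1 - x) xs) \<le> 1 \<and>
     sum_list xs \<le> real (length xs) * m \<and>
     sum_list xs - real (length xs * (length xs - 1)) / 2 * m\<^sup>2 \<le> 1 - prod_list (map (\<lambda>x. 1 - x) xs)"
    using assms
  proof (induction xs)
    case (Cons x xs)
    define p s n where "p = prod_list (map (\<lambda>x. 1 - x) xs)" and "s = sum_list xs" and "n = real (length xs)"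
    have x: "0 \<le> x" "x \<le> m" "x \<le> 1" using Cons.prems by auto
    have IH: "1 - p \<le> s" "0 \<le> p" "p \<le> 1" "s \<le> n * m" "s - n * (n - 1) / 2 * m\<^sup>2 \<le> 1 - p"
      using Cons unfolding p_def s_def n_def by (cases xs; auto simp: algebra_simps)+
    have sn: "0 \<le> s" unfolding s_def by (rule sum_list_nonneg) (use Cons.prems in auto)
    have n0: "0 \<le> n" by (simp add: n_def)
    have "x * (1 - p) \<le> x * s" using IH(1) x(1) by (rule mult_left_mono)
    moreover have "x * s \<le> m * (n * m)" using x sn IH(4) by (intro mult_mono) auto
    ultimately have xp: "x * (1 - p) \<le> n * m\<^sup>2" by (simp add: power2_eq_square mult_ac)
    have eq: "1 - (1 - x) * p = (1 - p) + x - x * (1 - p)" by (simp add: algebra_simps)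
    have c1: "1 - (1 - x) * p \<le> x + s"
      using eq IH(1) mult_nonneg_nonneg[of x "1 - p"] x(1) IH(3) by linarith
    have c2: "0 \<le> (1 - x) * p" "(1 - x) * p \<le> 1" using x IH(2,3) by (auto intro: mult_le_one)
    have c3: "x + s \<le> (n + 1) * m" using x(2) IH(4) by (simp add: distrib_right)
    have "(n + 1) * n / 2 * m\<^sup>2 = n * (n - 1) / 2 * m\<^sup>2 + n * m\<^sup>2" by (simp add: field_simps)
    then have c4: "x + s - (n + 1) * n / 2 * m\<^sup>2 \<le> 1 - (1 - x) * p"
      using eq IH(5) xp by linarith
    from c1 c2 c3 c4 have "1 - (1 - x) * p \<le> x + s \<and> 0 \<le> (1 - x) * p \<and> (1 - x) * p \<le> 1 \<and>
      x + s \<le> (n + 1) * m \<and> x + s - (n + 1) * n / 2 * m\<^sup>2 \<le> 1 - (1 - x) * p" by blast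
    moreover have "real (length (x # xs) * (length (x # xs) - 1)) = (n + 1) * n" "real (length (x # xs)) = n + 1"
      unfolding n_def by (simp_all add: algebra_simps)
    ultimately show ?case unfolding p_def s_def by (simp only: list.map prod_list.Cons sum_list.Cons)
  qed simp
  then show "1 - prod_list (map (\<lambda>x. 1 - x) xs) \<le> sum_list xs"
    "sum_list xs - real (length xs * (length xs - 1)) / 2 * m\<^sup>2 \<le> 1 - prod_list (map (\<lambda>x. 1 - x) xs)" by auto
qed

text \<open>A product of two or three factors \<open>1 - x\<close> differs from \<open>1 - \<Sum> x\<close> by at most three products
  of pairs.\<close>

lemma monomial_bounds:
  fixes p :: "real \<times> real"
  assumes q: "good_final q" and p: "fst p \<in> {0..1}" "snd p \<in> {0..1}"
  defines "u \<equiv> 1 - fst p" and "v \<equiv> 1 - snd p" and "a \<equiv> real (piece_count 1 q)" and "b \<equiv> real (piece_count 2 q)"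
  shows "1 - piece_monomial p q \<le> a * u + b * v"
    "a * u + b * v - 3 * (max u v)\<^sup>2 \<le> 1 - piece_monomial p q"
    "a * u / 3 \<le> 1 - piece_monomial p q" "b * v / 3 \<le> 1 - piece_monomial p q"
    "piece_monomial p q \<le> (max (fst p) (snd p))\<^sup>2"
proof -
  define k l where "k = piece_count 1 q" and "l = piece_count 2 q"
  have kl: "k + l = 2 \<or> k + l = 3" using piece_counts[OF q] unfolding k_def l_def by auto
  define xs where "xs = replicate k u @ replicate l v"
  have P: "prod_list (map (\<lambda>x. 1 - x) xs) = piece_monomial p q"
    unfolding xs_def piece_monomial_def u_def v_def k_def l_def by (simp add: prod_list_replicate map_replicate)
  have S: "sum_list xs = a * u + b * v"
    unfolding xs_def a_def b_def k_def l_def by (simp add: sum_list_replicate)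
  have x: "0 \<le> x \<and> x \<le> max u v \<and> x \<le> 1" if "x \<in> set xs" for x
    using that p unfolding xs_def u_def v_def by (auto split: if_splits)
  show "1 - piece_monomial p q \<le> a * u + b * v" 
  proof -
    have "1 - prod_list (map (\<lambda>x. 1 - x) xs) \<le> sum_list xs" using x by (rule prod_list_complement(1))
    then show ?thesis unfolding P S .
  qed
  have "real (length xs * (length xs - 1)) / 2 \<le> 3" using kl unfolding xs_def by auto
  then have "real (length xs * (length xs - 1)) / 2 * (max u v)\<^sup>2 \<le> 3 * (max u v)\<^sup>2"
    by (rule mult_right_mono) simp
  then show "a * u + b * v - 3 * (max u v)\<^sup>2 \<le> 1 - piece_monomial p q"
  proof -
    have "sum_list xs - real (length xs * (length xs - 1)) / 2 * (max u v)\<^sup>2 \<le> 1 - prod_list (map (\<lambda>x. 1 - x) xs)"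
      using x by (rule prod_list_complement(2))
    then show ?thesis
      using \<open>real (length xs * (length xs - 1)) / 2 * (max u v)\<^sup>2 \<le> 3 * (max u v)\<^sup>2\<close> unfolding P S by linarith
  qed
  have one: "1 - piece_monomial p q \<ge> 0" using piece_monomial_bounds[OF p, of q] by simp
  have fk: "fst p ^ k \<in> {0..1}" "snd p ^ l \<in> {0..1}" using p by (auto intro: power_le_one)
  have mon: "piece_monomial p q = fst p ^ k * snd p ^ l" unfolding piece_monomial_def k_def l_def ..
  have uv: "0 \<le> u" "0 \<le> v" using p unfolding u_def v_def by auto
  show "a * u / 3 \<le> 1 - piece_monomial p q"
  proof (cases "k = 0")
    case True
    then show ?thesis using one unfolding a_def k_def[symmetric] by simp
  next
    case False
    have "a \<le> 3" using kl unfolding a_def k_def[symmetric] by auto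
    then have "a * u \<le> 3 * u" using uv(1) by (rule mult_right_mono)
    moreover have "piece_monomial p q \<le> fst p"
    proof -
      have "fst p ^ k \<le> fst p ^ 1" by (rule power_decreasing) (use False p in auto)
      then show ?thesis unfolding mon using fk mult_left_le[of "snd p ^ l" "fst p ^ k"] by auto
    qed
    ultimately show ?thesis unfolding u_def by simp
  qed
  show "b * v / 3 \<le> 1 - piece_monomial p q"
  proof (cases "l = 0")
    case True
    then show ?thesis using one unfolding b_def l_def[symmetric] by simp
  next
    case False
    have "b \<le> 3" using kl unfolding b_def l_def[symmetric] by auto
    then have "b * v \<le> 3 * v" using uv(2) by (rule mult_right_mono)
    moreover have "piece_monomial p q \<le> snd p"
    proof -
      have "snd p ^ l \<le> snd p ^ 1" by (rule power_decreasing) (use False p in auto)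
      then show ?thesis unfolding mon using fk mult_left_le_one_le[of "snd p ^ l" "fst p ^ k"] by auto
    qed
    ultimately show ?thesis unfolding v_def by simp
  qed
  let ?m = "max (fst p) (snd p)"
  have "fst p ^ k * snd p ^ l \<le> ?m ^ k * ?m ^ l"
    using p by (intro mult_mono power_mono) auto
  also have "\<dots> = ?m ^ (k + l)" by (simp add: power_add)
  also have "\<dots> \<le> ?m ^ 2" by (rule power_decreasing) (use kl p in auto)
  finally show "piece_monomial p q \<le> ?m\<^sup>2" unfolding mon .
qed

lemma integrable_piece_count:
  assumes "\<And>q. q \<in> set_pmf M \<Longrightarrow> good_final q" and n: "n = 1 \<or> n = 2"
  shows "integrable (measure_pmf M) (\<lambda>q. real (piece_count n q))"
proof (rule measure_pmf.integrable_const_bound[where B = 3])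
  show "AE q in measure_pmf M. norm (real (piece_count n q)) \<le> 3"
    unfolding AE_measure_pmf_iff using piece_counts[OF assms(1)] n by fastforce
qed simp

text \<open>Integrated form of the bounds for one monomial: the distribution of the pieces enters only
  through the two means.\<close>

lemma expectation_bounds:
  fixes p :: "real \<times> real"
  assumes M: "\<And>q. q \<in> set_pmf M \<Longrightarrow> good_final q" and p: "fst p \<in> {0..1}" "snd p \<in> {0..1}"
  defines "u \<equiv> 1 - fst p" and "v \<equiv> 1 - snd p" and "E \<equiv> (\<integral>q. piece_monomial p q \<partial>measure_pmf M)"
    and "a \<equiv> (\<integral>q. real (piece_count 1 q) \<partial>measure_pmf M)" and "b \<equiv> (\<integral>q. real (piece_count 2 q) \<partial>measure_pmf M)"
  shows "1 - E \<le> a * u + b * v" "a * u + b * v - 3 * (max u v)\<^sup>2 \<le> 1 - E"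
    "a * u / 3 \<le> 1 - E" "b * v / 3 \<le> 1 - E" "E \<le> (max (fst p) (snd p))\<^sup>2"
proof -
  have ia: "integrable (measure_pmf M) (\<lambda>q. real (piece_count 1 q))"
    and ib: "integrable (measure_pmf M) (\<lambda>q. real (piece_count 2 q))"
    using integrable_piece_count[OF M] by blast+
  have im: "integrable (measure_pmf M) (piece_monomial p)"
    using expectation_unit_interval(1)[OF piece_monomial_bounds[OF p]] .
  have one: "1 - E = (\<integral>q. 1 - piece_monomial p q \<partial>measure_pmf M)" unfolding E_def using im by simp
  note B = monomial_bounds[OF M p, folded u_def v_def]
  have lin: "(\<integral>q. real (piece_count 1 q) * u + real (piece_count 2 q) * v \<partial>measure_pmf M) = a * u + b * v"
    using ia ib by (simp add: a_def b_def)
  show "1 - E \<le> a * u + b * v"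
    unfolding one lin[symmetric]
    by (rule integral_mono_AE) (use ia ib im B(1) in \<open>auto simp: AE_measure_pmf_iff\<close>)
  have "(\<integral>q. (real (piece_count 1 q) * u + real (piece_count 2 q) * v) - 3 * (max u v)\<^sup>2 \<partial>measure_pmf M) =
      a * u + b * v - 3 * (max u v)\<^sup>2"
    using ia ib lin by simp
  moreover have "(\<integral>q. (real (piece_count 1 q) * u + real (piece_count 2 q) * v) - 3 * (max u v)\<^sup>2 \<partial>measure_pmf M) \<le> 1 - E"
    unfolding one by (rule integral_mono_AE) (use ia ib im B(2) in \<open>auto simp: AE_measure_pmf_iff\<close>)
  ultimately show "a * u + b * v - 3 * (max u v)\<^sup>2 \<le> 1 - E" by simp
  have "(\<integral>q. real (piece_count 1 q) * u / 3 \<partial>measure_pmf M) \<le> 1 - E"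
    unfolding one by (rule integral_mono_AE) (use ia im B(3) in \<open>auto simp: AE_measure_pmf_iff\<close>)
  then show "a * u / 3 \<le> 1 - E" by (simp add: a_def)
  have "(\<integral>q. real (piece_count 2 q) * v / 3 \<partial>measure_pmf M) \<le> 1 - E"
    unfolding one by (rule integral_mono_AE) (use ib im B(4) in \<open>auto simp: AE_measure_pmf_iff\<close>)
  then show "b * v / 3 \<le> 1 - E" by (simp add: b_def)
  have "E \<le> (\<integral>q. (max (fst p) (snd p))\<^sup>2 \<partial>measure_pmf M)"
    unfolding E_def by (rule integral_mono_AE) (use im B(5) in \<open>auto simp: AE_measure_pmf_iff\<close>)
  then show "E \<le> (max (fst p) (snd p))\<^sup>2" by simp
qed

lemma lambda_bounds: "34/15 < lerw_lambda" "lerw_lambda < 7/3"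
proof -
  have "14 < sqrt 205" "sqrt 205 < 15" by (rule real_less_rsqrt real_less_lsqrt; simp)+
  then show "34/15 < lerw_lambda" "lerw_lambda < 7/3" unfolding lerw_lambda_def by (simp_all add: field_simps)
qed

lemma lambda_equation: "lerw_lambda\<^sup>2 = 8/3 * lerw_lambda - 13/15"
proof -
  have "15 * lerw_lambda - 20 = sqrt 205" unfolding lerw_lambda_def by (simp add: field_simps)
  then have "(15 * lerw_lambda - 20)\<^sup>2 = 205" by simp
  then show ?thesis by (simp add: power2_eq_square algebra_simps)
qed

text \<open>The left eigenvector \<open>(eigen_weight, 1)\<close> of the matrix of mean numbers of pieces for its
  largest eigenvalue.\<close>

definition eigen_weight :: real where
  "eigen_weight = 5/2 * (lerw_lambda - 13/15)"

lemma eigen_weight_bounds: "1 \<le> eigen_weight" "eigen_weight \<le> 4"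
  using lambda_bounds unfolding eigen_weight_def by auto

lemma eigen_weight_eq:
  "eigen_weight * (9/5) + 26/15 = lerw_lambda * eigen_weight" "eigen_weight * (2/5) + 13/15 = lerw_lambda"
  using lambda_equation unfolding eigen_weight_def by (simp_all add: power2_eq_square algebra_simps)

definition gf_single :: "real \<Rightarrow> nat \<Rightarrow> real" where "gf_single t N = fst (gf_pair (exp (- t)) N)"
definition gf_double :: "real \<Rightarrow> nat \<Rightarrow> real" where "gf_double t N = snd (gf_pair (exp (- t)) N)"

definition defect :: "real \<Rightarrow> nat \<Rightarrow> real" where
  "defect t N = eigen_weight * (1 - gf_single t N) + (1 - gf_double t N)"

text \<open>A piece has two or three descendants. The defects \<open>1 - p\<close> of the generating functions
  therefore follow the mean matrix up to a quadratic error, and the larger of the two generating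
  functions drops at least to its own square.\<close>

lemma gf_step:
  fixes t :: real and N :: nat
  assumes "0 \<le> t"
  defines "u \<equiv> 1 - gf_single t N" and "v \<equiv> 1 - gf_double t N"
    and "u' \<equiv> 1 - gf_single t (Suc N)" and "v' \<equiv> 1 - gf_double t (Suc N)"
  shows "0 \<le> u" "0 \<le> v" "u' \<le> 9/5 * u + 2/5 * v" "v' \<le> 26/15 * u + 13/15 * v"
    "9/5 * u + 2/5 * v - 3 * (max u v)\<^sup>2 \<le> u'" "26/15 * u + 13/15 * v - 3 * (max u v)\<^sup>2 \<le> v'"
    "2/15 * max u v \<le> u'" "2/15 * max u v \<le> v'"
    "max (gf_single t (Suc N)) (gf_double t (Suc N)) \<le> (max (gf_single t N) (gf_double t N))\<^sup>2"
proof -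
  have z: "exp (- t) \<in> {0..1}" using assms(1) by simp
  note b = gf_pair_bounds[OF z, of N]
  show uv: "0 \<le> u" "0 \<le> v" using b unfolding u_def v_def gf_single_def gf_double_def by auto
  note S = expectation_bounds[of erased_single, OF set_erased_single b, unfolded piece_means]
  note D = expectation_bounds[of erased_double, OF set_erased_double b, unfolded piece_means]
  have e: "gf_single t (Suc N) = (\<integral>q. piece_monomial (gf_pair (exp (- t)) N) q \<partial>erased_single)"
    "gf_double t (Suc N) = (\<integral>q. piece_monomial (gf_pair (exp (- t)) N) q \<partial>erased_double)"
    unfolding gf_single_def gf_double_def by simp_all
  have S': "u' \<le> 9/5 * u + 2/5 * v" "9/5 * u + 2/5 * v - 3 * (max u v)\<^sup>2 \<le> u'" "9/5 * u / 3 \<le> u'" "2/5 * v / 3 \<le> u'"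
    using S(1-4) unfolding u_def v_def u'_def e gf_single_def gf_double_def by simp_all
  have D': "v' \<le> 26/15 * u + 13/15 * v" "26/15 * u + 13/15 * v - 3 * (max u v)\<^sup>2 \<le> v'" "26/15 * u / 3 \<le> v'" "13/15 * v / 3 \<le> v'"
    using D(1-4) unfolding u_def v_def v'_def e gf_single_def gf_double_def by simp_all
  show "u' \<le> 9/5 * u + 2/5 * v" "v' \<le> 26/15 * u + 13/15 * v"
    "9/5 * u + 2/5 * v - 3 * (max u v)\<^sup>2 \<le> u'" "26/15 * u + 13/15 * v - 3 * (max u v)\<^sup>2 \<le> v'"
    using S' D' by blast+
  show "2/15 * max u v \<le> u'" "2/15 * max u v \<le> v'" using S'(3,4) D'(3,4) uv by (auto simp: max_def)
  show "max (gf_single t (Suc N)) (gf_double t (Suc N)) \<le> (max (gf_single t N) (gf_double t N))\<^sup>2"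
    using S(5) D(5) unfolding e gf_single_def gf_double_def by simp
qed

lemma defect_bounds:
  assumes "0 \<le> t"
  shows "1 - gf_single t N \<le> defect t N" "1 - gf_double t N \<le> defect t N"
    "defect t N \<le> 5 * max (1 - gf_single t N) (1 - gf_double t N)"
proof -
  define u v where "u = 1 - gf_single t N" and "v = 1 - gf_double t N"
  have uv: "0 \<le> u" "0 \<le> v" using gf_step(1,2)[OF assms, of N] unfolding u_def v_def by auto
  have "1 * u \<le> eigen_weight * u" "eigen_weight * u \<le> 4 * u"
    by (rule mult_right_mono; use eigen_weight_bounds uv in simp)+
  then show "1 - gf_single t N \<le> defect t N" "1 - gf_double t N \<le> defect t N"
    "defect t N \<le> 5 * max (1 - gf_single t N) (1 - gf_double t N)"
    unfolding defect_def u_def[symmetric] v_def[symmetric] using uv by (auto simp: max_def)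
qed

text \<open>Weighted by the eigenvector, the linear part of the recursion is multiplication by \<open>\<lambda>\<close>.\<close>

lemma defect_step:
  assumes "0 \<le> t"
  shows "defect t (Suc N) \<le> lerw_lambda * defect t N"
    "lerw_lambda * defect t N - 15 * (defect t N)\<^sup>2 \<le> defect t (Suc N)"
proof -
  define u v where "u = 1 - gf_single t N" and "v = 1 - gf_double t N"
  define u' v' where "u' = 1 - gf_single t (Suc N)" and "v' = 1 - gf_double t (Suc N)"
  note g = gf_step[OF assms, of N, folded u_def v_def u'_def v'_def]
  note w = eigen_weight_bounds
  have lin: "eigen_weight * (9/5 * u + 2/5 * v) + (26/15 * u + 13/15 * v) = lerw_lambda * (eigen_weight * u + v)"
  proof -
    have "eigen_weight * (9/5 * u + 2/5 * v) + (26/15 * u + 13/15 * v) =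
        (eigen_weight * (9/5) + 26/15) * u + (eigen_weight * (2/5) + 13/15) * v" by (simp add: algebra_simps)
    also have "\<dots> = lerw_lambda * (eigen_weight * u + v)" unfolding eigen_weight_eq by (simp add: algebra_simps)
    finally show ?thesis .
  qed
  have h: "defect t N = eigen_weight * u + v" "defect t (Suc N) = eigen_weight * u' + v'"
    unfolding defect_def u_def v_def u'_def v'_def by simp_all
  have "eigen_weight * u' \<le> eigen_weight * (9/5 * u + 2/5 * v)" using g(3) w by (intro mult_left_mono) auto
  then show "defect t (Suc N) \<le> lerw_lambda * defect t N" unfolding h using g(4) lin by linarith
  have m: "max u v \<le> defect t N" using defect_bounds(1,2)[OF assms, of N] unfolding u_def v_def by simp
  have "(max u v)\<^sup>2 \<le> (defect t N)\<^sup>2" by (rule power_mono[OF m]) (use g(1) in auto)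
  moreover have "(eigen_weight + 1) * (3 * (max u v)\<^sup>2) \<le> 5 * (3 * (max u v)\<^sup>2)" using w by (intro mult_right_mono) auto
  moreover have "eigen_weight * (9/5 * u + 2/5 * v - 3 * (max u v)\<^sup>2) \<le> eigen_weight * u'"
    using g(5) w by (intro mult_left_mono) auto
  then have "lerw_lambda * (eigen_weight * u + v) - (eigen_weight + 1) * (3 * (max u v)\<^sup>2) \<le> eigen_weight * u' + v'"
    using g(6) lin by (simp add: algebra_simps)
  ultimately show "lerw_lambda * defect t N - 15 * (defect t N)\<^sup>2 \<le> defect t (Suc N)" unfolding h by linarith
qed

lemma defect_upper:
  assumes "0 \<le> t"
  shows "defect t N \<le> 6 * lerw_lambda ^ N * t"
proof (induction N)
  case 0
  have e: "1 - exp (- t) \<le> t" "0 \<le> 1 - exp (- t)" using exp_ge_add_one_self[of "- t"] assms by auto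
  have "1 - (exp (- t))\<^sup>2 = (1 - exp (- t)) * (1 + exp (- t))" by (simp add: power2_eq_square algebra_simps)
  also have "\<dots> \<le> t * 2" using e assms by (intro mult_mono) auto
  finally have "1 - (exp (- t))\<^sup>2 \<le> 2 * t" by simp
  moreover have "eigen_weight * (1 - exp (- t)) \<le> 4 * t" using e eigen_weight_bounds by (intro mult_mono) auto
  ultimately show ?case unfolding defect_def gf_single_def gf_double_def by simp
next
  case (Suc N)
  have "lerw_lambda * defect t N \<le> lerw_lambda * (6 * lerw_lambda ^ N * t)"
    using Suc lambda_bounds by (intro mult_left_mono) auto
  then show ?case using defect_step(1)[OF assms, of N] by simp
qed

text \<open>The quadratic error of a step is of order \<open>(\<lambda>\<^sup>N t)\<^sup>2\<close>. It is absorbed by the increase of the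
  correction \<open>540 t \<lambda>\<^sup>N\<close> from one level to the next, because \<open>\<lambda> (\<lambda> - 1) \<ge> 1\<close>.\<close>

lemma defect_lower:
  assumes "0 \<le> t" "t \<le> 1"
  shows "lerw_lambda ^ N * t * (1/2 - 540 * t * lerw_lambda ^ N) \<le> defect t N"
proof (induction N)
  case 0
  have "exp (- t) \<le> 1 / (1 + t)"
    using exp_ge_add_one_self[of t] assms by (simp add: exp_minus field_simps)
  then have "t / (1 + t) \<le> 1 - exp (- t)" using assms by (simp add: field_simps)
  moreover have "t / 2 \<le> t / (1 + t)" using assms by (intro divide_left_mono) auto
  moreover have "1 - exp (- t) \<le> defect t 0" using defect_bounds(1)[OF assms(1), of 0] by (simp add: gf_single_def)
  ultimately have "t / 2 \<le> defect t 0" by linarith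
  moreover have "t * (1/2 - 540 * t) \<le> t / 2" using assms by (simp add: algebra_simps)
  ultimately show ?case by simp
next
  case (Suc N)
  define L h where "L = lerw_lambda ^ N" and "h = defect t N"
  have L: "0 < L" using lambda_bounds unfolding L_def by simp
  have h0: "0 \<le> h" using defect_bounds(1)[OF assms(1), of N] gf_step(1)[OF assms(1), of N] unfolding h_def by linarith
  have "h\<^sup>2 \<le> (6 * L * t)\<^sup>2" using defect_upper[OF assms(1), of N] h0 unfolding h_def L_def by (intro power_mono) auto
  then have sq: "15 * h\<^sup>2 \<le> 540 * (L * t)\<^sup>2" by (simp add: power_mult_distrib)
  have "lerw_lambda * (L * t * (1/2 - 540 * t * L)) \<le> lerw_lambda * h"
    using Suc lambda_bounds unfolding L_def h_def by (intro mult_left_mono) auto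
  moreover have "lerw_lambda * L * t * (1/2 - 540 * t * (lerw_lambda * L)) + 540 * (L * t)\<^sup>2 \<le>
      lerw_lambda * (L * t * (1/2 - 540 * t * L))"
  proof -
    have "1 \<le> lerw_lambda * (lerw_lambda - 1)"
      using mult_mono[of 1 lerw_lambda 1 "lerw_lambda - 1"] lambda_bounds by simp
    then have "540 * (L * t)\<^sup>2 * 1 \<le> 540 * (L * t)\<^sup>2 * (lerw_lambda * (lerw_lambda - 1))" by (intro mult_left_mono) auto
    then show ?thesis by (simp add: algebra_simps power2_eq_square)
  qed
  ultimately show ?case using defect_step(2)[OF assms(1), of N] sq
    unfolding h_def[symmetric] power_Suc L_def[symmetric] by linarith
qed

lemma gf_complement:
  assumes "0 \<le> t"
  shows "1 - gf_single t N \<le> 6 * lerw_lambda ^ N * t" "1 - gf_double t N \<le> 6 * lerw_lambda ^ N * t"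
  using defect_bounds(1,2)[OF assms, of N] defect_upper[OF assms, of N] by linarith+

text \<open>After time \<open>2160\<inverse> \<lambda>\<^sup>-\<^sup>n\<close> of exponential killing, level \<open>n + 1\<close> is survived with a probability
  bounded away from \<open>1\<close>. Every further level at least squares it, as a path crosses at least two
  triangles of the next smaller size.\<close>

lemma gf_tail:
  "max (gf_single (1 / (2160 * lerw_lambda ^ n)) (Suc n + j)) (gf_double (1 / (2160 * lerw_lambda ^ n)) (Suc n + j))
     \<le> (1 - 1/324000) ^ (2 ^ j)"
proof (induction j)
  case 0
  define t where "t = 1 / (2160 * lerw_lambda ^ n)"
  have L: "1 \<le> lerw_lambda ^ n" using lambda_bounds by (intro one_le_power) auto
  have "2160 * 1 \<le> 2160 * lerw_lambda ^ n" using L by (intro mult_left_mono) auto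
  then have t: "0 \<le> t" "t \<le> 1" unfolding t_def by (auto simp: divide_le_eq_1)
  have eq: "lerw_lambda ^ n * t = 1 / 2160" using lambda_bounds unfolding t_def by simp
  have "lerw_lambda ^ n * t * (1/2 - 540 * (lerw_lambda ^ n * t)) \<le> defect t n"
    using defect_lower[OF t, of n] by (simp only: ac_simps)
  then have "1 / 8640 \<le> defect t n" unfolding eq by simp
  then have m: "1 / 43200 \<le> max (1 - gf_single t n) (1 - gf_double t n)"
    using order_trans[OF _ defect_bounds(3)[OF t(1), of n], of "1 / 8640"] by argo
  then show ?case using gf_step(7,8)[OF t(1), of n] unfolding t_def[symmetric] by simp
next
  case (Suc j)
  define t where "t = 1 / (2160 * lerw_lambda ^ n)"
  have t: "0 \<le> t" using lambda_bounds unfolding t_def by simp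
  let ?m = "max (gf_single t (Suc n + j)) (gf_double t (Suc n + j))"
  have m0: "0 \<le> ?m" using gf_pair_bounds[of "exp (- t)" "Suc n + j"] t unfolding gf_single_def by (auto simp: le_max_iff_disj)
  have "max (gf_single t (Suc n + Suc j)) (gf_double t (Suc n + Suc j)) \<le> ?m\<^sup>2" using gf_step(9)[OF t, of "Suc n + j"] by simp
  also have "\<dots> \<le> ((1 - 1/324000) ^ (2 ^ j))\<^sup>2" using Suc m0 unfolding t_def[symmetric] by (intro power_mono) auto
  also have "\<dots> = (1 - 1/324000) ^ (2 ^ Suc j)" by (simp add: power_mult[symmetric] mult.commute)
  finally show ?case unfolding t_def[symmetric] .
qed

section \<open>The laws of the erased walks\<close>

lemma origin_vertex: "0 \<in> gasket_vertices N"
  using origin_cell unfolding gasket_vertices_eq by blast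

lemma chain_end_vertex:
  assumes "chain N x ss" "x \<in> gasket_vertices N"
  shows "last (x # map last ss) \<in> gasket_vertices N"
proof (cases ss rule: rev_cases)
  case Nil
  then show ?thesis using assms(2) by simp
next
  case (snoc rs u)
  then have "u \<in> step_walks N (last (x # map last rs)) (last u)" using assms(1) by (simp add: chain_append)
  then show ?thesis using step_walksD(6) snoc by simp
qed

text \<open>The hitting times cut a path into its coarse steps: between two of them the path meets no
  vertex of level \<open>N\<close> except the one it came from.\<close>

lemma hit_time_prefix:
  assumes w: "is_walk w" "hd w \<in> gasket_vertices N" and j: "hit_time N w i = enat j"
  shows "j \<le> wlen w \<and> (\<exists>ss. chain N (hd w) ss \<and> length ss = i \<and> concat_walks (hd w) ss = take (Suc j) w)"
  using j
proof (induction i arbitrary: j)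
  case 0
  then have "j = 0" by (simp add: hit_time.simps zero_enat_def)
  moreover have "take (Suc 0) w = [hd w]" using w(1) unfolding is_walk_def by (cases w) auto
  ultimately show ?case by (intro conjI exI[of _ "[]"]) auto
next
  case (Suc i)
  define A where "A = {enat k | k. k \<le> wlen w \<and> hit_time N w i < enat k \<and>
    w ! k \<in> gasket_vertices N - {w ! hit N w i}}"
  have inf: "Inf A = enat j" using Suc.prems unfolding A_def by (simp add: hit_time.simps)
  then have "A \<noteq> {}" by (auto simp: top_enat_def)
  then have "enat j \<in> A" using inf wellorder_InfI by (metis ex_in_conv)
  then have j: "j \<le> wlen w" "hit_time N w i < enat j" "w ! j \<in> gasket_vertices N" "w ! j \<noteq> w ! hit N w i"
    unfolding A_def by auto
  then obtain j0 where j0: "hit_time N w i = enat j0" by (cases "hit_time N w i") auto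
  have less: "j0 < j" using j(2) j0 by simp
  have between: "w ! k = w ! j0" if k: "j0 < k" "k < j" "w ! k \<in> gasket_vertices N" for k
  proof (rule ccontr)
    assume "w ! k \<noteq> w ! j0"
    then have "enat k \<in> A" unfolding A_def using k j(1) j0 by auto
    then have "enat j \<le> enat k" unfolding inf[symmetric] by (rule Inf_lower)
    then show False using k by simp
  qed
  from Suc.IH[OF j0] obtain ss where ss: "chain N (hd w) ss" "length ss = i" "concat_walks (hd w) ss = take (Suc j0) w"
    by blast
  define s where "s = segment w j0 j"
  have lw: "length w = Suc (wlen w)" using w(1) unfolding is_walk_def wlen_def by (cases w) auto
  have ls: "length s = Suc (j - j0)" using j(1) less lw unfolding s_def segment_def by simp
  have ns: "s ! k = w ! (j0 + k)" if "k \<le> j - j0" for k using that j(1) less lw unfolding s_def segment_def by simp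
  have end0: "last (hd w # map last ss) = w ! j0"
    using last_concat_walks[OF ss(1)] unfolding ss(3) using j(1) less lw by (simp add: take_Suc_conv_app_nth)
  have ends: "hd s = w ! j0" "last s = w ! j"
  proof -
    have "s \<noteq> []" using ls by auto
    then show "hd s = w ! j0" "last s = w ! j" using ns[of 0] ns[of "j - j0"] ls less by (simp_all add: hd_conv_nth last_conv_nth)
  qed
  have "is_walk s"
  proof -
    have "set s \<subseteq> set w" unfolding s_def segment_def by (meson order_trans set_drop_subset set_take_subset)
    moreover have "{s ! k, s ! Suc k} \<in> gasket_edges 0" if "k < wlen s" for k
      using that ns[of k] ns[of "Suc k"] w(1) ls j(1) unfolding is_walk_def wlen_def by auto
    ultimately show ?thesis using w(1) ls unfolding is_walk_def by auto
  qed
  then have s: "s \<in> step_walks N (w ! j0) (w ! j)"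
    using ls less ends j(3,4) j0 between ns chain_end_vertex[OF ss(1) w(2)] end0
    unfolding step_walks_def wlen_def by auto
  have "chain N (hd w) (ss @ [s])" using ss(1) s ends end0 by (simp add: chain_append)
  moreover have "concat_walks (hd w) (ss @ [s]) = take (Suc j) w"
  proof -
    have "concat_walks (hd w) (ss @ [s]) = butlast (take (Suc j0) w) @ s"
      using ends ls by (subst concat_walks_append[OF ss(1)], subst end0, subst concat_walks_singleton) (auto simp: ss(3))
    also have "\<dots> = take j0 w @ take (Suc j - j0) (drop j0 w)"
      using less j(1) lw unfolding s_def segment_def by (simp add: butlast_take Suc_diff_le)
    also have "\<dots> = take (Suc j) w" using take_add[of j0 "Suc j - j0" w] less by simp
    finally show ?thesis .
  qed
  ultimately show ?case using j(1) ss(2) by (intro conjI exI[of _ "ss @ [s]"]) auto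
qed

definition crossings :: "nat \<Rightarrow> complex list \<Rightarrow> walk set" where
  "crossings N c = {concat_walks 0 ss | ss. chain N 0 ss \<and> map last ss = c}"

lemma crossings_iff:
  assumes "c \<noteq> []"
  shows "w \<in> crossings N c \<longleftrightarrow> is_walk w \<and> w ! 0 = 0 \<and> hit_time N w (length c) = enat (wlen w) \<and>
    (\<forall>i<length c. w ! hit N w (Suc i) = c ! i)"
proof
  assume "w \<in> crossings N c"
  then obtain ss where ss: "chain N 0 ss" "map last ss = c" "w = concat_walks 0 ss" unfolding crossings_def by auto
  have l: "length ss = length c" using ss(2) by auto
  have "ss \<noteq> []" using ss(2) assms by auto
  then have "is_walk w" using chain_walk(1)[OF ss(1)] ss(3) by simp
  moreover have "hit_time N w (length c) = enat (wlen w)"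
    using hit_time_concat_walks[OF ss(1)] time_at_length[OF ss(1)] l ss(3) by simp
  moreover have "w ! hit N w (Suc i) = c ! i" if "i < length c" for i
    using hit_concat_walks[OF ss(1), of "Suc i"] nth_time_at[OF ss(1), of "Suc i"] that l ss(2,3) by simp
  ultimately show "is_walk w \<and> w ! 0 = 0 \<and> hit_time N w (length c) = enat (wlen w) \<and>
    (\<forall>i<length c. w ! hit N w (Suc i) = c ! i)" using ss(3) by simp
next
  assume w: "is_walk w \<and> w ! 0 = 0 \<and> hit_time N w (length c) = enat (wlen w) \<and>
    (\<forall>i<length c. w ! hit N w (Suc i) = c ! i)"
  then have h: "hd w = 0" unfolding is_walk_def by (auto simp: hd_conv_nth)
  have lw: "length w = Suc (wlen w)" using w unfolding is_walk_def wlen_def by (cases w) auto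
  from hit_time_prefix[of w N "length c" "wlen w"] w h origin_vertex[of N]
  obtain ss where ss: "chain N 0 ss" "length ss = length c" "concat_walks 0 ss = w" using lw by auto
  have "last (ss ! i) = c ! i" if i: "i < length c" for i
  proof -
    have "w ! hit N w (Suc i) = last (ss ! i)"
      using hit_concat_walks[OF ss(1), of "Suc i"] nth_time_at[OF ss(1), of "Suc i"] i ss(2,3) by simp
    then show ?thesis using w i by metis
  qed
  then have "map last ss = c" using ss(2) by (auto intro: nth_equalityI)
  then show "w \<in> crossings N c" using ss unfolding crossings_def by auto
qed

lemma walks_W_crossings: "walks_W N x = crossings N [x]"
  using crossings_iff[of "[x]"] unfolding walks_W_def by auto

lemma walks_V_crossings: "walks_V N x y = crossings N [x, y]"
  using crossings_iff[of "[x, y]"] unfolding walks_V_def by (auto simp: less_Suc_eq numeral_2_eq_2)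

definition crossing_pmf :: "nat \<Rightarrow> complex list \<Rightarrow> walk pmf" where
  "crossing_pmf N c = map_pmf (concat_walks 0) (prod_pmf (step_pmf N) (edges 0 c))"

lemma set_prod_steps:
  assumes "successively (adjacent N) (x # c)"
  shows "set_pmf (prod_pmf (step_pmf N) (edges x c)) = {ss. chain N x ss \<and> map last ss = c}"
  unfolding set_pmf_eq using pmf_prod_steps[OF pmf_step_pmf assms] by auto

text \<open>The weight of a path factorises, each coarse step of length \<open>n\<close> contributing \<open>4 (1/4)\<^sup>n\<close>. So
  the coarse steps of a random crossing are independent.\<close>

lemma pmf_crossing:
  assumes "successively (adjacent N) (0 # c)" "w \<in> crossings N c"
  shows "pmf (crossing_pmf N c) w = (1/4) ^ (wlen w - length c)"
proof -
  obtain ss where ss: "chain N 0 ss" "map last ss = c" "w = concat_walks 0 ss"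
    using assms(2) unfolding crossings_def by auto
  let ?M = "prod_pmf (step_pmf N) (edges 0 c)"
  have "inj_on (concat_walks 0) (set_pmf ?M)" unfolding set_prod_steps[OF assms(1)]
    using chain_steps_unique by (auto intro: inj_onI)
  then have "pmf (crossing_pmf N c) w = pmf ?M ss"
    using ss unfolding crossing_pmf_def ss(3) by (intro pmf_map_inj) (auto simp: set_prod_steps[OF assms(1)])
  also have "\<dots> = 4 ^ length c * (1/4) ^ wlen w"
    using pmf_prod_steps[OF _ assms(1), of ss] pmf_step_pmf ss by (auto simp: wlen_pieces)
  also have "\<dots> = (1/4) ^ (wlen w - length c)"
  proof -
    have "1 \<le> wlen s" if "s \<in> set ss" for s
      using chain_vertices(1)[OF ss(1) that, of UNIV] step_walksD(2) unfolding wlen_def by fastforce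
    then have "length ss \<le> wlen w" unfolding ss(3) wlen_pieces
      using sum_list_mono[of ss "\<lambda>_. 1" wlen] by (simp add: sum_list_triv)
    then have "wlen w = length c + (wlen w - length c)" using ss(2) by auto
    then have "(1/4::real) ^ wlen w = (1/4) ^ length c * (1/4) ^ (wlen w - length c)" by (metis power_add)
    moreover have "(4::real) ^ length c * (1/4) ^ length c = 1" by (simp flip: power_mult_distrib)
    ultimately show ?thesis by (simp add: mult.assoc[symmetric])
  qed
  finally show ?thesis .
qed

lemma set_crossing_pmf:
  assumes "successively (adjacent N) (0 # c)"
  shows "set_pmf (crossing_pmf N c) = crossings N c"
  unfolding crossing_pmf_def set_map_pmf set_prod_steps[OF assms] crossings_def by auto

definition erased_crossing :: "nat \<Rightarrow> complex list \<Rightarrow> walk pmf" where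
  "erased_crossing N c = map_pmf (loop_erase N) (crossing_pmf N c)"

lemma erased_prob_crossing:
  assumes c: "successively (adjacent N) (0 # c)"
  shows "erased_prob N (point_measure (crossings N c) (\<lambda>w. ennreal ((1/4) ^ (wlen w - length c)))) \<gamma> =
    pmf (erased_crossing N c) \<gamma>"
proof -
  let ?f = "\<lambda>w. ennreal ((1/4) ^ (wlen w - length c))" and ?A = "crossings N c" and ?M = "crossing_pmf N c"
  define X where "X = loop_erase N -` {\<gamma>} \<inter> ?A"
  have "emeasure (point_measure ?A ?f) X = (\<integral>\<^sup>+w. ?f w * indicator X w \<partial>count_space ?A)"
    unfolding point_measure_def by (rule emeasure_density) (auto simp: X_def)
  also have "\<dots> = (\<integral>\<^sup>+w. ennreal (pmf ?M w) * indicator X w \<partial>count_space ?A)"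
    by (intro nn_integral_cong) (simp add: pmf_crossing[OF c])
  also have "\<dots> = (\<integral>\<^sup>+w. ennreal (pmf ?M w) * indicator X w * indicator ?A w \<partial>count_space UNIV)"
    by (rule nn_integral_count_space_indicator) simp
  also have "\<dots> = (\<integral>\<^sup>+w. ennreal (pmf ?M w) * indicator X w \<partial>count_space UNIV)"
    by (intro nn_integral_cong) (auto simp: X_def indicator_def)
  also have "\<dots> = (\<integral>\<^sup>+w. ennreal (pmf ?M w) \<partial>count_space X)"
    by (rule nn_integral_count_space_indicator[symmetric]) simp
  also have "\<dots> = emeasure ?M X" by (rule nn_integral_pmf)
  finally have X: "emeasure (point_measure ?A ?f) X = emeasure ?M X" .
  have "emeasure (distr (point_measure ?A ?f) (count_space UNIV) (loop_erase N)) {\<gamma>} = emeasure (point_measure ?A ?f) X"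
    by (subst emeasure_distr) (auto simp: X_def space_point_measure measurable_point_measure_eq1)
  then have "erased_prob N (point_measure ?A ?f) \<gamma> = measure ?M X" unfolding erased_prob_def measure_def X by simp
  also have "\<dots> = pmf (erased_crossing N c) \<gamma>"
    unfolding erased_crossing_def pmf_map X_def set_crossing_pmf[OF c, symmetric] by (rule measure_Int_set_pmf)
  finally show ?thesis .
qed

text \<open>The four kinds of walks have the vertices of the triangle \<open>O a\<^sub>N b\<^sub>N\<close> as their coarse paths.\<close>

definition routes :: "nat \<Rightarrow> complex list set" where
  "routes N = {[vert_a N], [vert_b N], [vert_b N, vert_a N], [vert_a N, vert_b N]}"

lemma vert_distinct: "vert_a N \<noteq> 0" "vert_b N \<noteq> 0" "vert_a N \<noteq> vert_b N"
  by (simp_all add: vert_a_lat vert_b_lat zero_lat)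

lemma corners_adjacent:
  "x \<in> {0, vert_a N, vert_b N} \<Longrightarrow> y \<in> {0, vert_a N, vert_b N} \<Longrightarrow> x \<noteq> y \<Longrightarrow> adjacent N x y"
  unfolding adjacent_def by (intro conjI bexI[of _ "{0, vert_a N, vert_b N}"] origin_cell)

lemma routes_adjacent:
  assumes "c \<in> routes N"
  shows "successively (adjacent N) (0 # c)"
proof -
  have "adjacent N 0 (vert_a N)" "adjacent N 0 (vert_b N)" "adjacent N (vert_a N) (vert_b N)" "adjacent N (vert_b N) (vert_a N)"
    by (rule corners_adjacent; use vert_distinct[of N] in simp)+
  then show ?thesis using assms unfolding routes_def by (elim insertE emptyE) simp_all
qed

text \<open>Routes of one and of two steps are a single and a double piece at the origin.\<close>

lemma erased_crossing_gf:
  assumes c: "c \<in> routes N" and z: "z \<in> {0..1}"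
  shows "(\<integral>\<^sup>+\<gamma>. ennreal (z ^ wlen \<gamma>) \<partial>erased_crossing N c) =
    ennreal (if length c = 1 then fst (gf_pair z N) else snd (gf_pair z N))"
proof -
  note adj = routes_adjacent[OF c]
  have "joined ss = concat_walks 0 ss" if ss: "ss \<in> set_pmf (prod_pmf (step_pmf N) (edges 0 c))" for ss
  proof -
    have "ss \<noteq> []" "chain N 0 ss" using ss c unfolding set_prod_steps[OF adj] routes_def by auto
    then have "hd (hd ss) = 0" using chain_ConsD(2)[of N 0 "hd ss" "tl ss"] by simp
    then show ?thesis unfolding joined_def by simp
  qed
  then have "(\<integral>\<^sup>+\<gamma>. ennreal (z ^ wlen \<gamma>) \<partial>erased_crossing N c) = length_gf z N (edges 0 c)"
    unfolding erased_crossing_def crossing_pmf_def length_gf_def nn_integral_map_pmf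
    by (intro nn_integral_cong_AE) (auto simp: AE_measure_pmf_iff)
  also have "\<dots> = ennreal (if length c = 1 then fst (gf_pair z N) else snd (gf_pair z N))"
  proof -
    note g = gf_correct_all[OF z, of N, unfolded gf_correct_def]
    let ?t = "{0, vert_a N, vert_b N}"
    have a: "adjacent N 0 (vert_a N)" "adjacent N 0 (vert_b N)"
      by (rule corners_adjacent; use vert_distinct[of N] in simp)+
    have two: "length_gf z N [(0, x), (x, y)] = ennreal (snd (gf_pair z N))"
      if "x \<in> ?t" "y \<in> ?t" "0 \<noteq> x" "x \<noteq> y" "0 \<noteq> y" for x y
      using conjunct2[OF g, rule_format, of ?t 0 x y, OF origin_cell[of N]] that by simp
    have "length_gf z N [(0, vert_a N)] = ennreal (fst (gf_pair z N))" "length_gf z N [(0, vert_b N)] = ennreal (fst (gf_pair z N))"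
      using conjunct1[OF g] a by blast+
    moreover have "length_gf z N [(0, vert_a N), (vert_a N, vert_b N)] = ennreal (snd (gf_pair z N))"
      "length_gf z N [(0, vert_b N), (vert_b N, vert_a N)] = ennreal (snd (gf_pair z N))"
      by (rule two; use vert_distinct[of N] in simp)+
    ultimately show ?thesis using c unfolding routes_def by (elim insertE emptyE) simp_all
  qed
  finally show ?thesis .
qed

section \<open>The length of the walk up to a given level\<close>

lemma proj_upto_last: "last (proj_upto N \<omega>) = \<omega> N"
  unfolding proj_upto_def by simp

lemma Omega_determined:
  "\<omega> \<in> Omega \<Longrightarrow> \<omega>' \<in> Omega \<Longrightarrow> \<omega> N = \<omega>' N \<Longrightarrow> proj_upto N \<omega> = proj_upto N \<omega>'"
proof (induction N)
  case 0
  then show ?case by (simp add: proj_upto_def)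
next
  case (Suc N)
  have "\<omega> N = \<omega>' N" using Suc.prems unfolding Omega_def by (metis (mono_tags, lifting) mem_Collect_eq)
  then show ?case using Suc by (simp add: proj_upto_def)
qed

lemma proj_upto_measurable:
  assumes "is_lerw_law P"
  shows "proj_upto N \<in> measurable P (count_space (proj_upto N ` Omega))"
proof (rule measurableI)
  fix C assume "C \<in> sets (count_space (proj_upto N ` Omega))"
  then have "proj_upto N -` C \<inter> Omega \<in> {proj_upto N -` C \<inter> Omega | N C. C \<subseteq> proj_upto N ` Omega}" by auto
  then have "proj_upto N -` C \<inter> Omega \<in> sets cylinder_space"
    unfolding cylinder_space_def by (subst sets_measure_of) auto
  then show "proj_upto N -` C \<inter> space P \<in> sets P" using assms unfolding is_lerw_law_def by simp
qed (use assms in \<open>auto simp: is_lerw_law_def\<close>)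

lemma ennreal_mixture:
  assumes "0 \<le> p" "0 \<le> q" "0 \<le> a" "0 \<le> b" "0 \<le> c" "0 \<le> d"
  shows "ennreal (p * (a + b) + q * (c + d)) =
    ennreal p * (ennreal a + ennreal b) + ennreal q * (ennreal c + ennreal d)"
  using assms by (simp add: ennreal_plus ennreal_mult)

lemma ennreal_double: "ennreal (2 * x) = ennreal x * 2"
  using ennreal_mult'[of 2 x] by (simp add: mult.commute)

text \<open>The last path determines the whole history, so that the marginal law becomes a law on paths,
  and the mixture weights \<open>11/28, 11/28, 3/28, 3/28\<close> add up to \<open>1\<close>.\<close>

lemma law_integral_le:
  assumes P: "is_lerw_law P" and le: "\<And>c. c \<in> routes N \<Longrightarrow> (\<integral>\<^sup>+\<gamma>. f \<gamma> \<partial>erased_crossing N c) \<le> B"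
  shows "(\<integral>\<^sup>+\<omega>. f (\<omega> N) \<partial>P) \<le> B"
proof -
  let ?S = "proj_upto N ` Omega"
  define p where "p c \<gamma> = ennreal (pmf (erased_crossing N c) \<gamma>)" for c \<gamma>
  define W where "W \<gamma> = ennreal (11/28) * (p [vert_a N] \<gamma> + p [vert_b N] \<gamma>) +
    ennreal (3/28) * (p [vert_b N, vert_a N] \<gamma> + p [vert_a N, vert_b N] \<gamma>)" for \<gamma>
  have laws: "law_W N x = point_measure (crossings N [x]) (\<lambda>w. ennreal ((1/4) ^ (wlen w - length [x])))"
    "law_V N x y = point_measure (crossings N [x, y]) (\<lambda>w. ennreal ((1/4) ^ (wlen w - length [x, y])))" for x y
    unfolding law_W_def law_V_def walks_W_crossings walks_V_crossings by (simp_all add: numeral_2_eq_2)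
  have r: "[vert_a N] \<in> routes N" "[vert_b N] \<in> routes N" "[vert_b N, vert_a N] \<in> routes N" "[vert_a N, vert_b N] \<in> routes N"
    unfolding routes_def by auto
  have m: "marginal N = point_measure ?S (\<lambda>c. W (last c))"
    unfolding marginal_def laws r[THEN routes_adjacent, THEN erased_prob_crossing] W_def p_def
    by (subst ennreal_mixture) simp_all
  have inj: "inj_on last ?S"
  proof (rule inj_onI)
    fix c c' assume c: "c \<in> ?S" "c' \<in> ?S" "last c = last c'"
    from c(1) obtain \<omega> where \<omega>: "\<omega> \<in> Omega" "c = proj_upto N \<omega>" by (rule imageE) blast
    from c(2) obtain \<omega>' where \<omega>': "\<omega>' \<in> Omega" "c' = proj_upto N \<omega>'" by (rule imageE) blast
    show "c = c'" using Omega_determined[OF \<omega>(1) \<omega>'(1)] c(3) unfolding \<omega>(2) \<omega>'(2) proj_upto_last .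
  qed
  have "(\<integral>\<^sup>+\<omega>. f (\<omega> N) \<partial>P) = (\<integral>\<^sup>+c. f (last c) \<partial>distr P (count_space ?S) (proj_upto N))"
    by (subst nn_integral_distr[OF proj_upto_measurable[OF P]]) (simp_all add: proj_upto_last)
  also have "\<dots> = (\<integral>\<^sup>+c. f (last c) \<partial>point_measure ?S (\<lambda>c. W (last c)))" using P m unfolding is_lerw_law_def by simp
  also have "\<dots> = (\<integral>\<^sup>+c. W (last c) * f (last c) \<partial>count_space ?S)"
    unfolding point_measure_def by (rule nn_integral_density) auto
  also have "\<dots> = (\<integral>\<^sup>+\<gamma>. W \<gamma> * f \<gamma> \<partial>count_space (last ` ?S))"
    by (rule nn_integral_bij_count_space[OF inj_on_imp_bij_betw[OF inj]])
  also have "\<dots> \<le> (\<integral>\<^sup>+\<gamma>. W \<gamma> * f \<gamma> \<partial>count_space UNIV)"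
    by (subst nn_integral_count_space_indicator) (auto simp: indicator_def intro!: nn_integral_mono)
  also have "\<dots> = (\<integral>\<^sup>+\<gamma>. ennreal (11/28) * (p [vert_a N] \<gamma> * f \<gamma> + p [vert_b N] \<gamma> * f \<gamma>) +
    ennreal (3/28) * (p [vert_b N, vert_a N] \<gamma> * f \<gamma> + p [vert_a N, vert_b N] \<gamma> * f \<gamma>) \<partial>count_space UNIV)"
    unfolding W_def by (simp add: distrib_left distrib_right mult.assoc)
  also have "\<dots> = ennreal (11/28) * ((\<integral>\<^sup>+\<gamma>. p [vert_a N] \<gamma> * f \<gamma> \<partial>count_space UNIV) + (\<integral>\<^sup>+\<gamma>. p [vert_b N] \<gamma> * f \<gamma> \<partial>count_space UNIV)) +
    ennreal (3/28) * ((\<integral>\<^sup>+\<gamma>. p [vert_b N, vert_a N] \<gamma> * f \<gamma> \<partial>count_space UNIV) + (\<integral>\<^sup>+\<gamma>. p [vert_a N, vert_b N] \<gamma> * f \<gamma> \<partial>count_space UNIV))"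
    by (simp add: nn_integral_add nn_integral_cmult)
  also have "\<dots> \<le> ennreal (11/28) * (B + B) + ennreal (3/28) * (B + B)"
    by (intro add_mono mult_left_mono; use le[OF r(1)] le[OF r(2)] le[OF r(3)] le[OF r(4)] in \<open>simp add: p_def nn_integral_measure_pmf\<close>)
  also have "\<dots> = (ennreal (11/28) + ennreal (11/28) + ennreal (3/28) + ennreal (3/28)) * B" by (simp add: distrib_left distrib_right)
  also have "\<dots> = B" by (simp flip: ennreal_plus)
  finally show ?thesis .
qed

lemma law_gf:
  fixes t :: real
  assumes P: "is_lerw_law P" and t: "0 \<le> t"
  shows "(\<integral>\<^sup>+\<omega>. ennreal (exp (- t * wlen (\<omega> N))) \<partial>P) \<le> ennreal (max (gf_single t N) (gf_double t N))"
    "(\<integral>\<^sup>+\<omega>. ennreal (1 - exp (- t * wlen (\<omega> N))) \<partial>P) \<le> ennreal (6 * lerw_lambda ^ N * t)"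
proof -
  have z: "exp (- t) \<in> {0..1}" using t by simp
  have e: "exp (- t * wlen \<gamma>) = exp (- t) ^ wlen \<gamma>" for \<gamma> :: walk using exp_of_nat2_mult[of "- t" "wlen \<gamma>"] .
  note gf = erased_crossing_gf[OF _ z, of _ N, folded gf_single_def gf_double_def]
  show "(\<integral>\<^sup>+\<omega>. ennreal (exp (- t * wlen (\<omega> N))) \<partial>P) \<le> ennreal (max (gf_single t N) (gf_double t N))"
    by (rule law_integral_le[OF P, of N "\<lambda>\<gamma>. ennreal (exp (- t * wlen \<gamma>))"], unfold e, subst gf) (auto intro: ennreal_leI)
  show "(\<integral>\<^sup>+\<omega>. ennreal (1 - exp (- t * wlen (\<omega> N))) \<partial>P) \<le> ennreal (6 * lerw_lambda ^ N * t)"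
  proof (rule law_integral_le[OF P, of N "\<lambda>\<gamma>. ennreal (1 - exp (- t * wlen \<gamma>))"])
    fix c assume c: "c \<in> routes N"
    define a where "a = (if length c = 1 then gf_single t N else gf_double t N)"
    let ?f = "\<lambda>\<gamma>. exp (- t) ^ wlen \<gamma>" and ?M = "erased_crossing N c"
    have f: "?f \<gamma> \<in> {0..1}" for \<gamma> using z by (auto intro: power_le_one)
    note u = expectation_unit_interval[of ?f ?M, OF f]
    have a0: "0 \<le> a" using gf_pair_bounds[OF z, of N] unfolding a_def gf_single_def gf_double_def by auto
    have "ennreal (\<integral>\<gamma>. ?f \<gamma> \<partial>?M) = ennreal a" using gf[OF c] u(3) unfolding a_def by simp
    then have fa: "(\<integral>\<gamma>. ?f \<gamma> \<partial>?M) = a" using a0 u(2) by simp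
    have "(\<integral>\<^sup>+\<gamma>. ennreal (1 - ?f \<gamma>) \<partial>?M) = ennreal (\<integral>\<gamma>. 1 - ?f \<gamma> \<partial>?M)"
      by (rule expectation_unit_interval(3)) (use f in auto)
    also have "(\<integral>\<gamma>. 1 - ?f \<gamma> \<partial>?M) = 1 - a" using u(1) fa by simp
    also have "ennreal (1 - a) \<le> ennreal (6 * lerw_lambda ^ N * t)"
      using gf_complement[OF t, of N] unfolding a_def by (auto intro: ennreal_leI)
    finally show "(\<integral>\<^sup>+\<gamma>. ennreal (1 - exp (- t * wlen \<gamma>)) \<partial>?M) \<le> ennreal (6 * lerw_lambda ^ N * t)" unfolding e .
  qed
qed

lemma level_measurable:
  assumes "is_lerw_law P"
  shows "{\<omega> \<in> Omega. Q (\<omega> N)} \<in> sets P"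
proof -
  have "{c \<in> proj_upto N ` Omega. Q (last c)} \<in> sets (count_space (proj_upto N ` Omega))" by simp
  from measurable_sets[OF proj_upto_measurable[OF assms] this]
  have "proj_upto N -` {c \<in> proj_upto N ` Omega. Q (last c)} \<inter> Omega \<in> sets P" using assms unfolding is_lerw_law_def by simp
  moreover have "proj_upto N -` {c \<in> proj_upto N ` Omega. Q (last c)} \<inter> Omega = {\<omega> \<in> Omega. Q (\<omega> N)}"
    by (auto simp: proj_upto_last)
  ultimately show ?thesis by simp
qed

lemma law_prob_le:
  assumes P: "is_lerw_law P" and f: "\<And>\<gamma>. 0 \<le> f \<gamma>" "\<And>\<gamma>. Q \<gamma> \<Longrightarrow> 1 \<le> f \<gamma>"
    and le: "(\<integral>\<^sup>+\<omega>. ennreal (f (\<omega> N)) \<partial>P) \<le> ennreal b" "0 \<le> b"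
  shows "measure P {\<omega> \<in> Omega. Q (\<omega> N)} \<le> b"
proof -
  interpret prob_space P using P unfolding is_lerw_law_def by simp
  have "emeasure P {\<omega> \<in> Omega. Q (\<omega> N)} = (\<integral>\<^sup>+\<omega>. indicator {\<omega> \<in> Omega. Q (\<omega> N)} \<omega> \<partial>P)"
    using level_measurable[OF P] by simp
  also have "\<dots> \<le> (\<integral>\<^sup>+\<omega>. ennreal (f (\<omega> N)) \<partial>P)"
    by (intro nn_integral_mono) (auto simp: indicator_def f)
  also have "\<dots> \<le> ennreal b" by (rule le)
  finally show ?thesis unfolding emeasure_eq_measure using le(2) by simp
qed

text \<open>Markov's inequality for \<open>exp (- t L)\<close> with \<open>t \<lambda>\<^sup>n = 1/2160\<close> as in \<open>gf_tail\<close>; the factor \<open>2\<close>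
  bounds \<open>exp (1/2160)\<close>.\<close>

lemma short_walk_prob:
  assumes P: "is_lerw_law P"
  shows "measure P {\<omega> \<in> Omega. wlen (\<omega> (Suc n + j)) \<le> lerw_lambda ^ n} \<le> 2 * (1 - 1/324000) ^ (2 ^ j)"
proof -
  define t where "t = 1 / (2160 * lerw_lambda ^ n)"
  have t: "0 < t" using lambda_bounds unfolding t_def by simp
  have small: "1 \<le> 2 * exp (- t * wlen \<gamma>)" if "wlen \<gamma> \<le> lerw_lambda ^ n" for \<gamma> :: walk
  proof -
    have "t * wlen \<gamma> \<le> t * lerw_lambda ^ n" using that t by (intro mult_left_mono) auto
    also have "\<dots> = 1 / 2160" using lambda_bounds unfolding t_def by simp
    finally have "1/2 \<le> 1 + - t * wlen \<gamma>" by simp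
    also have "\<dots> \<le> exp (- t * wlen \<gamma>)" by (rule exp_ge_add_one_self)
    finally show ?thesis by simp
  qed
  have "(\<integral>\<^sup>+\<omega>. ennreal (2 * exp (- t * wlen (\<omega> (Suc n + j)))) \<partial>P) =
      (\<integral>\<^sup>+\<omega>. ennreal (exp (- t * wlen (last (proj_upto (Suc n + j) \<omega>)))) * 2 \<partial>P)"
    by (simp only: proj_upto_last ennreal_double)
  also have "\<dots> = (\<integral>\<^sup>+\<omega>. ennreal (exp (- t * wlen (last (proj_upto (Suc n + j) \<omega>)))) \<partial>P) * 2"
    by (intro nn_integral_multc measurable_compose[OF proj_upto_measurable[OF P]]) simp
  also have "\<dots> \<le> ennreal (max (gf_single t (Suc n + j)) (gf_double t (Suc n + j))) * 2"
    using law_gf(1)[OF P, of t "Suc n + j"] t by (intro mult_right_mono) (auto simp: proj_upto_last)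
  also have "\<dots> \<le> ennreal ((1 - 1/324000) ^ (2 ^ j)) * 2"
    using gf_tail[of n j] unfolding t_def by (intro mult_right_mono ennreal_leI) auto
  also have "\<dots> = ennreal (2 * (1 - 1/324000) ^ (2 ^ j))" by (simp add: ennreal_mult mult.commute)
  finally show ?thesis
    by (intro law_prob_le[OF P, of "\<lambda>\<gamma>. 2 * exp (- t * wlen \<gamma>)"]) (use small in auto)
qed

text \<open>Markov's inequality for \<open>1 - exp (- t L)\<close>, which is at least \<open>1/2\<close> once \<open>t L \<ge> 1\<close>. The
  constant \<open>24\<close> is chosen to make \<open>2 \<cdot> 6 \<lambda>\<^sup>N t\<close> equal to \<open>1/2\<close>.\<close>

lemma long_walk_prob:
  assumes P: "is_lerw_law P"
  shows "measure P {\<omega> \<in> Omega. 24 * lerw_lambda ^ N < wlen (\<omega> N)} \<le> 1/2"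
proof -
  define t where "t = 1 / (24 * lerw_lambda ^ N)"
  have t: "0 < t" using lambda_bounds unfolding t_def by simp
  have e: "2 \<le> exp (1::real)" using exp_ge_add_one_self[of "1::real"] by simp
  have large: "1 \<le> 2 * (1 - exp (- t * wlen \<gamma>))" if "24 * lerw_lambda ^ N < wlen \<gamma>" for \<gamma> :: walk
  proof -
    have "1 = t * (24 * lerw_lambda ^ N)" using lambda_bounds unfolding t_def by simp
    also have "\<dots> \<le> t * wlen \<gamma>" using that t by (intro mult_left_mono) auto
    finally have "exp (- t * wlen \<gamma>) \<le> exp (- 1)" by simp
    also have "\<dots> \<le> 1/2" using e by (simp add: exp_minus field_simps)
    finally show ?thesis by simp
  qed
  have "(\<integral>\<^sup>+\<omega>. ennreal (2 * (1 - exp (- t * wlen (\<omega> N)))) \<partial>P) =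
      (\<integral>\<^sup>+\<omega>. ennreal (1 - exp (- t * wlen (last (proj_upto N \<omega>)))) * 2 \<partial>P)"
    by (simp only: proj_upto_last ennreal_double)
  also have "\<dots> = (\<integral>\<^sup>+\<omega>. ennreal (1 - exp (- t * wlen (last (proj_upto N \<omega>)))) \<partial>P) * 2"
    by (intro nn_integral_multc measurable_compose[OF proj_upto_measurable[OF P]]) simp
  also have "\<dots> \<le> ennreal (6 * lerw_lambda ^ N * t) * 2"
    using law_gf(2)[OF P, of t N] t by (intro mult_right_mono) (auto simp: proj_upto_last)
  also have "6 * lerw_lambda ^ N * t = 1/4" using lambda_bounds unfolding t_def by simp
  also have "ennreal (1/4) * 2 = ennreal (1/2)"
    using ennreal_mult[of "1/4" 2] by simp
  finally show ?thesis using t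
    by (intro law_prob_le[OF P, of "\<lambda>\<gamma>. 2 * (1 - exp (- t * wlen \<gamma>))"]) (use large in auto)
qed

section \<open>How far the walk is from the origin\<close>

lemma loopless_route:
  assumes "w \<in> loopless_walks N"
  obtains ss where "chain N 0 ss" "map last ss \<in> routes N" "w = concat_walks 0 ss" "distinct w"
proof -
  have "\<exists>c\<in>routes N. w \<in> crossings N c"
    using assms unfolding loopless_walks_def walks_U_def walks_W_crossings walks_V_crossings routes_def by auto
  then obtain c where "c \<in> routes N" "w \<in> crossings N c" by blast
  moreover have "distinct w" using assms unfolding loopless_walks_def by simp
  ultimately show ?thesis using that unfolding crossings_def by blast
qed

lemma route_props:
  assumes "c \<in> routes N"
  shows "c \<noteq> []" "set c \<subseteq> {0, vert_a N, vert_b N}" "last c \<in> {vert_a N, vert_b N}"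
  using assms unfolding routes_def by (elim insertE emptyE; simp)+

text \<open>Every coarse step of a loopless path stays in its triangle, since an excursion out of it could
  only return through the vertex where it began.\<close>

lemma loopless_in_hull:
  assumes "w \<in> loopless_walks N" "v \<in> set w"
  shows "v \<in> convex hull {0, vert_a N, vert_b N}"
proof -
  let ?T = "{0, vert_a N, vert_b N}"
  obtain ss where ss: "chain N 0 ss" "map last ss \<in> routes N" "w = concat_walks 0 ss" "distinct w"
    using loopless_route[OF assms(1)] .
  have T: "last ` set ss \<subseteq> ?T" using route_props(2)[OF ss(2)] unfolding set_map .
  have d: "\<forall>s\<in>set ss. distinct s" using distinct_steps[OF ss(1)] ss(3,4) by simp
  have "v = 0 \<or> (\<exists>s\<in>set ss. v \<in> set s)" using set_concat_walks[of 0 ss] assms(2) ss(3) by blast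
  then show ?thesis
  proof
    assume "v = 0"
    then show ?thesis by (simp add: hull_inc)
  next
    assume "\<exists>s\<in>set ss. v \<in> set s"
    then obtain s where s: "s \<in> set ss" "v \<in> set s" by blast
    note v = chain_vertices[OF ss(1) s(1) insertI1 T]
    have "set s \<subseteq> convex hull ?T" by (rule distinct_step_in_hull[OF v(1) _ origin_cell v(2,3)]) (use d s in blast)
    then show ?thesis using s(2) by blast
  qed
qed

lemma loopless_end:
  assumes "w \<in> loopless_walks N"
  shows "w \<noteq> []" "w ! 0 = 0" "last w \<in> {vert_a N, vert_b N}" "norm (last w) = 2 ^ N" "w ! wlen w = last w"
proof -
  obtain ss where ss: "chain N 0 ss" "map last ss \<in> routes N" "w = concat_walks 0 ss" "distinct w"
    using loopless_route[OF assms] .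
  show w: "w \<noteq> []" "w ! 0 = 0" using ss(3) by simp_all
  have "last w = last (map last ss)" using last_concat_walks[OF ss(1)] ss(3) route_props(1)[OF ss(2)] by simp
  then show e: "last w \<in> {vert_a N, vert_b N}" using route_props(3)[OF ss(2)] by simp
  have "0 \<noteq> last w" using e vert_distinct[of N] by (elim insertE emptyE) simp_all
  moreover have "last w \<in> {0, vert_a N, vert_b N}" using e by (rule insertI2)
  ultimately have "dist 0 (last w) = 2 ^ N" using cell_side_length[OF origin_cell insertI1] by simp
  then show "norm (last w) = 2 ^ N" by simp
  show "w ! wlen w = last w" using w by (simp add: wlen_def last_conv_nth)
qed

lemma walk_dist:
  assumes "is_walk w" "i \<le> wlen w"
  shows "dist (w ! 0) (w ! i) \<le> real i"
  using assms(2)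
proof (induction i)
  case 0
  then show ?case by simp
next
  case (Suc i)
  have "adjacent 0 (w ! i) (w ! Suc i)"
    using assms(1) Suc.prems unfolding is_walk_def gasket_edge_iff[symmetric] by simp
  then obtain t where "t \<in> cells 0" "w ! i \<in> t" "w ! Suc i \<in> t" "w ! i \<noteq> w ! Suc i" unfolding adjacent_def by blast
  from cell_side_length[OF this] have "dist (w ! i) (w ! Suc i) = 1" by simp
  then show ?case using Suc dist_triangle[of "w ! 0" "w ! Suc i" "w ! i"] by simp
qed

lemma loopless_walk: "w \<in> loopless_walks N \<Longrightarrow> is_walk w"
  unfolding loopless_walks_def walks_U_def walks_W_def walks_V_def by auto

lemma loopless_length:
  assumes "w \<in> loopless_walks N"
  shows "2 ^ N \<le> wlen w"
proof -
  have "real (2 ^ N) \<le> real (wlen w)"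
    using walk_dist[OF loopless_walk[OF assms] order_refl] loopless_end[OF assms] by simp
  then show ?thesis by linarith
qed

lemma OmegaD:
  assumes "\<omega> \<in> Omega"
  shows "\<omega> N \<in> loopless_walks N" "\<omega> N = take (Suc (exit_time N (\<omega> (Suc N)) 1)) (\<omega> (Suc N))"
proof -
  show "\<omega> N \<in> loopless_walks N" using assms unfolding Omega_def by simp
  have "stopped N (\<omega> (Suc N)) = \<omega> N" using assms unfolding Omega_def by simp
  then show "\<omega> N = take (Suc (exit_time N (\<omega> (Suc N)) 1)) (\<omega> (Suc N))" unfolding stopped_def segment_def by simp
qed

lemma Omega_extends:
  assumes "\<omega> \<in> Omega" "N \<le> M" "n \<le> wlen (\<omega> N)"
  shows "n \<le> wlen (\<omega> M) \<and> \<omega> M ! n = \<omega> N ! n"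
  using assms(2)
proof (induction rule: dec_induct)
  case base
  then show ?case using assms(3) by simp
next
  case (step M)
  let ?u = "\<omega> M" and ?w = "\<omega> (Suc M)"
  have u: "?u = take (Suc (exit_time M ?w 1)) ?w" by (rule OmegaD(2)[OF assms(1)])
  have ne: "?u \<noteq> []" by (rule loopless_end(1)[OF OmegaD(1)[OF assms(1)]])
  have n: "n < length ?u" using step.IH ne unfolding wlen_def by (cases ?u) auto
  have l: "length ?u = min (length ?w) (Suc (exit_time M ?w 1))" using u by (metis length_take)
  have "take (Suc (exit_time M ?w 1)) ?w ! n = ?w ! n" by (rule nth_take) (use n l in simp)
  then have "?w ! n = ?u ! n" using u by simp
  moreover have "n \<le> wlen ?w" using n l unfolding wlen_def by linarith
  ultimately show ?case using step.IH by simp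
qed

lemma Omega_wlen_mono: "\<omega> \<in> Omega \<Longrightarrow> N \<le> M \<Longrightarrow> wlen (\<omega> N) \<le> wlen (\<omega> M)"
  using Omega_extends by blast

lemma level_reaching: "\<omega> \<in> Omega \<Longrightarrow> n \<le> wlen (\<omega> n)"
  using loopless_length[OF OmegaD(1), of \<omega> n] less_exp[of n] by linarith

lemma lerw_eq:
  assumes "\<omega> \<in> Omega" "n \<le> wlen (\<omega> N)"
  shows "lerw \<omega> n = \<omega> N ! n"
proof -
  define K where "K = (LEAST N. n \<le> 2 ^ N)"
  have "n \<le> 2 ^ K" unfolding K_def by (rule LeastI[of _ n]) (simp add: less_imp_le)
  then have "n \<le> wlen (\<omega> K)" using loopless_length[OF OmegaD(1)[OF assms(1)], of K] by linarith
  then have "\<omega> (max N K) ! n = \<omega> K ! n" using Omega_extends[OF assms(1), of K "max N K" n] by simp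
  moreover have "\<omega> (max N K) ! n = \<omega> N ! n" using Omega_extends[OF assms(1), of N "max N K" n] assms(2) by simp
  ultimately show ?thesis unfolding lerw_def K_def by simp
qed

lemma nth_in_walk: "w \<noteq> [] \<Longrightarrow> n \<le> wlen w \<Longrightarrow> w ! n \<in> set w"
  unfolding wlen_def by (intro nth_mem) (cases w; simp)

lemma lerw_norm_le:
  assumes "\<omega> \<in> Omega" "n \<le> wlen (\<omega> N)"
  shows "norm (lerw \<omega> n) \<le> 2 ^ N"
proof -
  note w = OmegaD(1)[OF assms(1), of N]
  have "\<omega> N ! n \<in> set (\<omega> N)" by (rule nth_in_walk[OF loopless_end(1)[OF w] assms(2)])
  from norm_in_hull_le[OF origin_cell insertI1 loopless_in_hull[OF w this]]
  show ?thesis unfolding lerw_eq[OF assms] .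
qed

lemma lerw_nonzero_norm:
  assumes "\<omega> \<in> Omega" "1 \<le> n"
  shows "sqrt 3 / 2 \<le> norm (lerw \<omega> n)"
proof -
  note w = OmegaD(1)[OF assms(1), of n]
  have n: "n \<le> wlen (\<omega> n)" by (rule level_reaching[OF assms(1)])
  have s3: "sqrt 3 / 2 \<le> 1" using real_sqrt_le_mono[of 3 4] by simp
  have l: "n < length (\<omega> n)" "0 < length (\<omega> n)" using n loopless_end(1)[OF w] unfolding wlen_def by (cases "\<omega> n"; simp)+
  define v where "v = \<omega> n ! n"
  have "distinct (\<omega> n)" using w unfolding loopless_walks_def by simp
  from nth_eq_iff_index_eq[OF this l] have "v \<noteq> 0" using assms(2) loopless_end(2)[OF w] unfolding v_def by auto
  have "v \<in> gasket_vertices 0"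
    using loopless_walk[OF w] nth_mem[OF l(1)] unfolding is_walk_def v_def by blast
  then obtain t where t: "t \<in> cells 0" "v \<in> t" unfolding gasket_vertices_eq by blast
  have "sqrt 3 / 2 \<le> norm v"
  proof (cases "0 \<in> t")
    case True
    then have "dist v 0 = 1" using cell_side_length[OF t True] \<open>v \<noteq> 0\<close> by simp
    then show ?thesis using s3 by simp
  next
    case False
    then show ?thesis using norm_in_hull_ge[OF t(1) False hull_inc[OF t(2)]] by simp
  qed
  then show ?thesis unfolding lerw_eq[OF assms(1) n] v_def .
qed

lemma cell_at_origin_in_triangle:
  assumes t: "t \<in> cells N" "0 \<in> t" "p \<in> t" "q \<in> t" "p \<noteq> q"
    and nodes: "p \<in> nodes {0, vert_a (Suc N), vert_b (Suc N)}" "q \<in> nodes {0, vert_a (Suc N), vert_b (Suc N)}"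
  shows "t = subcell {0, vert_a (Suc N), vert_b (Suc N)} 0"
proof -
  let ?T = "{0, vert_a (Suc N), vert_b (Suc N)}"
  obtain w where w: "w \<in> ?T" "t = subcell ?T w"
    using cell_between_nodes[OF origin_cell[of "Suc N"] t(1,3,4,5) nodes] by blast
  then have "0 \<in> (\<lambda>u. midpoint w u) ` ?T" using t(2) unfolding subcell_def by simp
  then obtain u where u: "u \<in> ?T" "0 = midpoint w u" by (rule imageE)
  then have "w + u = 0" by (simp add: midpoint_def)
  moreover have im: "0 \<le> Im x \<and> 0 \<le> Re x \<and> (Re x = 0 \<longrightarrow> x = 0)" if x: "x \<in> ?T" for x
    using x by (elim insertE emptyE) (simp_all add: vert_a_lat vert_b_lat lat_def)
  moreover have "Re w + Re u = 0" using \<open>w + u = 0\<close> by (metis plus_complex.simps(1) zero_complex.simps(1))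
  ultimately have "w = 0" using im[OF w(1)] im[OF u(1)] by linarith
  then show ?thesis using w(2) by simp
qed

text \<open>Once the walk has left the triangle \<open>O a\<^sub>N b\<^sub>N\<close>, no later step of size \<open>2\<^sup>N\<close> can lie in a
  triangle at the origin: that triangle could only be the one just left, and a step in it avoiding
  the origin would have to continue the first step within it.\<close>

lemma later_steps_off_origin:
  assumes ch: "chain N 0 ss" "distinct (0 # map last ss)"
    and nodes: "last ` set ss \<subseteq> nodes {0, vert_a (Suc N), vert_b (Suc N)}"
    and s: "s \<in> set (drop (length (concat (take 1 (runs (step_triangle N) ss)))) ss)"
    and t: "t \<in> cells N" "hd s \<in> t" "last s \<in> t"
  shows "0 \<notin> t"
proof
  assume zero: "0 \<in> t"
  let ?T = "{0, vert_a (Suc N), vert_b (Suc N)}" and ?f = "step_triangle N"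
  define k where "k = length (concat (take 1 (runs ?f ss)))"
  have "ss \<noteq> []" using s by auto
  then obtain s0 r where ss: "ss = s0 # r" by (cases ss) auto
  have k: "k = Suc (length (takeWhile (\<lambda>u. ?f u = ?f s0) r))" unfolding k_def ss by simp
  obtain i where i: "i < length (drop k ss)" "drop k ss ! i = s" using s unfolding k_def[symmetric] in_set_conv_nth by blast
  define j where "j = k + i"
  have j: "1 \<le> j" "k \<le> j" "j < length ss" "ss ! j = s" using i k unfolding j_def by auto
  let ?c = "0 # map last ss"
  have idx: "?c ! a = ?c ! b \<longleftrightarrow> a = b" if "a \<le> length ss" "b \<le> length ss" for a b
    using nth_eq_iff_index_eq[OF ch(2), of a b] that by simp
  have step: "s \<in> step_walks N (?c ! j) (?c ! Suc j)" using chain_nth[OF ch(1) j(3)] j(4) by simp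
  have ends: "?c ! j = hd s" "?c ! Suc j = last s" using step_walksD(3,4)[OF step] by simp_all
  have step0: "s0 \<in> step_walks N 0 (last s0)" using chain_nth[OF ch(1), of 0] ss by simp
  have c1: "?c ! 1 = last s0" using ss by simp
  have nz: "hd s \<noteq> 0" "last s \<noteq> 0" "hd s \<noteq> last s" "last s \<noteq> last s0"
    using idx[of j 0] idx[of "Suc j" 0] idx[of j "Suc j"] idx[of "Suc j" 1] j ends c1 by auto
  have in_nodes: "?c ! a \<in> nodes ?T" if "a \<le> length ss" for a
  proof (cases a)
    case 0
    then show ?thesis using corners_nodes[of ?T] by auto
  next
    case (Suc b)
    then have "?c ! a = last (ss ! b)" "ss ! b \<in> set ss" using that by auto
    then show ?thesis using nodes by auto
  qed
  have T: "t = subcell ?T 0"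
    using cell_at_origin_in_triangle[OF t(1) zero t(2,3) nz(3)] in_nodes[of j] in_nodes[of "Suc j"] j ends by simp
  obtain t0 where t0: "t0 \<in> cells N" "0 \<in> t0" "last s0 \<in> t0" "0 \<noteq> last s0" "?f s0 = convex hull t0"
    using step_cell[OF step0] .
  have "0 \<in> nodes ?T" "last s0 \<in> nodes ?T" using in_nodes[of 0] in_nodes[of 1] c1 j(3) by auto
  then have "t0 = subcell ?T 0" by (rule cell_at_origin_in_triangle[OF t0(1,2,2,3,4)])
  then have "t0 = t" using T by simp
  obtain z where z: "t = {0, last s0, z}" "z \<noteq> 0" "z \<noteq> last s0"
    using cell_third_corner[OF t0(1-4)] \<open>t0 = t\<close> by blast
  have "hd s = last s0" using t(2,3) nz unfolding z(1) by auto
  then have "?c ! j = ?c ! 1" using ends c1 by simp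
  then have "j = 1" using idx[of j 1] j by simp
  then have "k = 1" using k j(2) by simp
  have "?f s = convex hull t"
    unfolding step_triangle_def by (rule triangle_of_eq[OF t nz(3)])
  then have "?f s = ?f s0" using t0(5) \<open>t0 = t\<close> by simp
  moreover obtain r' where "r = s # r'" using j(3,4) \<open>j = 1\<close> ss by (cases r) auto
  ultimately show False using k \<open>k = 1\<close> by simp
qed

text \<open>At scale \<open>2\<^sup>N\<close>, the path of level \<open>N + 1\<close> has left the triangle \<open>O a\<^sub>N b\<^sub>N\<close> for good at the end
  of the path of level \<open>N\<close>. Its later steps lie in triangles that do not contain the origin, and the
  distance of such a triangle from the origin is at least the height of a triangle.\<close>

lemma lerw_norm_ge_level:
  assumes \<omega>: "\<omega> \<in> Omega" and n: "wlen (\<omega> N) \<le> n" "n \<le> wlen (\<omega> (Suc N))"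
  shows "sqrt 3 / 2 * 2 ^ N \<le> norm (\<omega> (Suc N) ! n)"
proof -
  let ?T = "{0, vert_a (Suc N), vert_b (Suc N)}" and ?w = "\<omega> (Suc N)"
  note u = OmegaD(1)[OF \<omega>, of N] and wl = OmegaD(1)[OF \<omega>, of "Suc N"]
  have s3: "sqrt 3 / 2 \<le> 1" using real_sqrt_le_mono[of 3 4] by simp
  obtain g where g: "chain (Suc N) 0 g" "map last g \<in> routes (Suc N)" "?w = concat_walks 0 g" "distinct ?w"
    using loopless_route[OF wl] .
  define ss where "ss = refine_all N g"
  have ch: "chain N 0 ss" and w: "concat_walks 0 ss = ?w" using refine_all_props[OF g(1)] g(3) unfolding ss_def by simp_all
  have d: "distinct (0 # map last ss)" "\<forall>s\<in>set ss. distinct s" using distinct_steps[OF ch] g(4) w by simp_all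
  have gT: "last s \<in> ?T" if "s \<in> set g" for s
    using that route_props(2)[OF g(2)] unfolding set_map by blast
  have nodes: "last ` set ss \<subseteq> nodes ?T"
    using lerase_nodes[OF origin_cell g(1) insertI1 gT] lerase_id[OF d(1)] unfolding ss_def by simp
  define k where "k = length (concat (take 1 (runs (step_triangle N) ss)))"
  let ?gs = "runs (step_triangle N) ss"
  have "k + length (concat (drop 1 ?gs)) = length (concat (take 1 ?gs @ drop 1 ?gs))"
    unfolding k_def concat_append length_append ..
  then have k: "k \<le> length ss" "exit_index N ?w 1 = k"
    using exit_index_chain[OF ch, of 1] w unfolding k_def append_take_drop_id concat_runs by (linarith, simp)
  have "exit_time N ?w 1 = time_at ss k"
    using hit_concat_walks[OF ch k(1)] unfolding exit_time_def k(2) w .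
  then have "\<omega> N = take (Suc (time_at ss k)) ?w" using OmegaD(2)[OF \<omega>, of N] by simp
  then have uk: "\<omega> N = concat_walks 0 (take k ss)" using take_concat_walks[OF ch k(1)] w by simp
  have len: "wlen (\<omega> N) = time_at ss k" unfolding uk wlen_pieces time_at_def ..
  have vk: "vertex_at 0 ss k = last (\<omega> N)"
  proof -
    have "last (\<omega> N) = \<omega> N ! wlen (\<omega> N)" using loopless_end(5)[OF u] by simp
    also have "\<dots> = ?w ! wlen (\<omega> N)" using Omega_extends[OF \<omega>, of N "Suc N" "wlen (\<omega> N)"] by simp
    also have "\<dots> = vertex_at 0 ss k" using nth_time_at[OF ch k(1)] unfolding w len .
    finally show ?thesis by simp
  qed
  have "?w ! n \<in> set (drop (time_at ss k) ?w)"
  proof -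
    have "n < length ?w" using n(2) loopless_end(1)[OF wl] unfolding wlen_def by (cases ?w) auto
    then have "drop (time_at ss k) ?w ! (n - time_at ss k) = ?w ! n" "n - time_at ss k < length (drop (time_at ss k) ?w)"
      using n(1) len by simp_all
    then show ?thesis using nth_mem by metis
  qed
  also have "drop (time_at ss k) ?w = concat_walks (vertex_at 0 ss k) (drop k ss)"
    using drop_concat_walks[OF ch k(1)] unfolding w .
  finally have "?w ! n = vertex_at 0 ss k \<or> (\<exists>s\<in>set (drop k ss). ?w ! n \<in> set s)"
    using set_concat_walks[of "vertex_at 0 ss k" "drop k ss"] by blast
  then show ?thesis
  proof
    assume "?w ! n = vertex_at 0 ss k"
    then have "norm (?w ! n) = 2 ^ N" using vk loopless_end(4)[OF u] by simp
    then show ?thesis using s3 by simp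
  next
    assume "\<exists>s\<in>set (drop k ss). ?w ! n \<in> set s"
    then obtain s where s: "s \<in> set (drop k ss)" "?w ! n \<in> set s" by blast
    have sss: "s \<in> set ss" using s(1) by (rule in_set_dropD)
    have step: "s \<in> step_walks N (hd s) (last s)" by (rule chain_vertices(1)[OF ch sss UNIV_I subset_UNIV])
    obtain t where t: "t \<in> cells N" "hd s \<in> t" "last s \<in> t" using step_cell[OF step] by blast
    have "0 \<notin> t" by (rule later_steps_off_origin[OF ch d(1) nodes s(1)[unfolded k_def] t])
    moreover have "set s \<subseteq> convex hull t" by (rule distinct_step_in_hull[OF step _ t]) (use d(2) sss in blast)
    ultimately show ?thesis using norm_in_hull_ge[OF t(1)] s(2) by blast
  qed
qed

lemma lerw_norm_ge:
  assumes \<omega>: "\<omega> \<in> Omega" and n: "wlen (\<omega> N) \<le> n"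
  shows "sqrt 3 / 2 * 2 ^ N \<le> norm (lerw \<omega> n)"
proof -
  have s3: "sqrt 3 / 2 \<le> 1" using real_sqrt_le_mono[of 3 4] by simp
  define M where "M = (LEAST M. n \<le> wlen (\<omega> M))"
  have M: "n \<le> wlen (\<omega> M)" unfolding M_def by (rule LeastI[of "\<lambda>M. n \<le> wlen (\<omega> M)", OF level_reaching[OF \<omega>]])
  show ?thesis
  proof (cases "M \<le> N")
    case True
    then have "n = wlen (\<omega> N)" using M n Omega_wlen_mono[OF \<omega> True] by simp
    then have "norm (lerw \<omega> n) = 2 ^ N"
      using lerw_eq[OF \<omega>, of n N] loopless_end(4,5)[OF OmegaD(1)[OF \<omega>, of N]] by simp
    then show ?thesis using s3 by simp
  next
    case False
    then obtain K where K: "M = Suc K" "N \<le> K" by (cases M) auto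
    have "\<not> n \<le> wlen (\<omega> K)" using not_less_Least[of K "\<lambda>M. n \<le> wlen (\<omega> M)"] K(1) unfolding M_def by simp
    then have "sqrt 3 / 2 * 2 ^ K \<le> norm (\<omega> (Suc K) ! n)"
      using lerw_norm_ge_level[OF \<omega>, of K n] M K(1) by simp
    also have "\<omega> (Suc K) ! n = lerw \<omega> n" using lerw_eq[OF \<omega> M] K(1) by simp
    finally have "sqrt 3 / 2 * 2 ^ K \<le> norm (lerw \<omega> n)" .
    moreover have "sqrt 3 / 2 * 2 ^ N \<le> sqrt 3 / 2 * (2::real) ^ K"
      using K(2) by (intro mult_left_mono power_increasing) auto
    ultimately show ?thesis by linarith
  qed
qed

section \<open>The displacement exponent\<close>

lemma two_power_eq: "(2::real) ^ k = (lerw_lambda ^ k) powr lerw_nu"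
proof -
  have l: "1 < lerw_lambda" using lambda_bounds by simp
  then have pos: "0 < lerw_lambda ^ k" "ln lerw_lambda \<noteq> 0" by simp_all
  have "(lerw_lambda ^ k) powr lerw_nu = exp (lerw_nu * ln (lerw_lambda ^ k))" using l by (simp add: powr_def)
  also have "lerw_nu * ln (lerw_lambda ^ k) = real k * ln 2"
    using l pos(2) by (simp add: ln_realpow lerw_nu_def)
  also have "exp (real k * ln 2) = (2::real) ^ k" by (subst exp_of_nat_mult) simp
  finally show ?thesis by simp
qed

lemma two_power_powr: "((2::real) ^ k) powr s = (lerw_lambda ^ k) powr (s * lerw_nu)"
  unfolding two_power_eq powr_powr by (simp add: mult.commute)

text \<open>Ratio test: consecutive terms have the quotient \<open>2\<^sup>s q\<close> with \<open>q\<close> raised to the power \<open>2\<^sup>j\<close>.\<close>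

lemma doubly_exponential_summable:
  fixes q s :: real
  assumes "0 < q" "q < 1"
  shows "summable (\<lambda>j. ((2::real) ^ j) powr s * q ^ (2 ^ j))"
proof -
  define c where "c = (2::real) powr s"
  have c: "0 < c" unfolding c_def by simp
  then obtain n0 where n0: "q ^ n0 < 1 / (2 * c)" using real_arch_pow_inv[of "1 / (2 * c)" q] assms by auto
  show ?thesis
  proof (rule summable_ratio_test[of "1/2" n0])
    fix j assume j: "n0 \<le> j"
    let ?a = "((2::real) ^ j) powr s * q ^ (2 ^ j)"
    have a: "0 \<le> ?a" using assms by simp
    have "n0 \<le> 2 ^ j" using j less_exp[of j] by linarith
    then have "q ^ (2 ^ j) \<le> q ^ n0" using assms by (intro power_decreasing) auto
    then have "c * q ^ (2 ^ j) \<le> c * (1 / (2 * c))" using n0 c by (intro mult_left_mono) auto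
    also have "\<dots> = 1/2" using c by simp
    finally have h: "c * q ^ (2 ^ j) \<le> 1/2" .
    have "((2::real) ^ Suc j) powr s * q ^ (2 ^ Suc j) = ?a * (c * q ^ (2 ^ j))"
    proof -
      have "((2::real) ^ Suc j) powr s = c * (2 ^ j) powr s" unfolding c_def power_Suc by (rule powr_mult)
      moreover have "q ^ (2 ^ Suc j) = q ^ (2 ^ j) * q ^ (2 ^ j)" by (simp add: mult_2 power_add)
      ultimately show ?thesis by simp
    qed
    also have "\<dots> \<le> ?a * (1/2)" by (rule mult_left_mono[OF h a])
    finally have "((2::real) ^ Suc j) powr s * q ^ (2 ^ Suc j) \<le> 1/2 * ?a" by simp
    moreover have "0 \<le> ((2::real) ^ Suc j) powr s * q ^ (2 ^ Suc j)" using assms by (intro mult_nonneg_nonneg) auto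
    ultimately show "norm (((2::real) ^ Suc j) powr s * q ^ (2 ^ Suc j)) \<le> 1/2 * norm ?a" using a
      by (simp only: real_norm_def abs_of_nonneg)
  qed simp
qed

lemma lerw_integrable:
  assumes P: "is_lerw_law P" and s: "0 < s"
  shows "integrable P (\<lambda>\<omega>. norm (lerw \<omega> n) powr s)"
proof -
  interpret prob_space P using P unfolding is_lerw_law_def by simp
  have sp: "space P = Omega" using P unfolding is_lerw_law_def by simp
  define K where "K = (LEAST N. n \<le> 2 ^ N)"
  have "(\<lambda>\<omega>. norm (last (proj_upto K \<omega>) ! n) powr s) \<in> borel_measurable P"
    by (rule measurable_compose[OF proj_upto_measurable[OF P]]) simp
  then have m: "(\<lambda>\<omega>. norm (lerw \<omega> n) powr s) \<in> borel_measurable P"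
    unfolding proj_upto_last lerw_def K_def .
  have "norm (norm (lerw \<omega> n) powr s) \<le> (2 ^ n) powr s" if "\<omega> \<in> Omega" for \<omega>
  proof -
    have "norm (lerw \<omega> n) powr s \<le> (2 ^ n) powr s"
      by (rule powr_mono2[OF less_imp_le[OF s] norm_ge_zero lerw_norm_le[OF that level_reaching[OF that]]])
    then show ?thesis by simp
  qed
  then show ?thesis using m by (intro integrable_const_bound[where B = "(2 ^ n) powr s"] AE_I2) (simp_all add: sp)
qed

lemma lerw_moment_ge:
  assumes P: "is_lerw_law P" and s: "0 < s" and A: "A \<in> sets P" "1/2 \<le> measure P A"
    and r: "0 \<le> r" "\<And>\<omega>. \<omega> \<in> A \<Longrightarrow> r \<le> norm (lerw \<omega> n)"
  shows "1/2 * r powr s \<le> (\<integral>\<omega>. norm (lerw \<omega> n) powr s \<partial>P)"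
proof -
  interpret prob_space P using P unfolding is_lerw_law_def by simp
  have "1/2 * r powr s \<le> measure P A * r powr s" using A(2) by (intro mult_right_mono) auto
  also have "\<dots> = (\<integral>\<omega>. indicator A \<omega> * r powr s \<partial>P)"
    using A(1) sets.sets_into_space[OF A(1)] by (simp add: Int_absorb2)
  also have "\<dots> \<le> (\<integral>\<omega>. norm (lerw \<omega> n) powr s \<partial>P)"
  proof (rule integral_mono)
    show "integrable P (\<lambda>\<omega>. indicator A \<omega> * r powr s)"
      by (rule integrable_mult_left, rule integrable_real_indicator[OF A(1)]) (simp add: emeasure_eq_measure)
    show "integrable P (\<lambda>\<omega>. norm (lerw \<omega> n) powr s)" by (rule lerw_integrable[OF P s])
    show "indicator A \<omega> * r powr s \<le> norm (lerw \<omega> n) powr s" for \<omega>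
      using r powr_mono2[OF less_imp_le[OF s] r(1), of "norm (lerw \<omega> n)"] by (cases "\<omega> \<in> A") simp_all
  qed
  finally show ?thesis .
qed

text \<open>The level \<open>m\<close> is the last with \<open>24 \<lambda>\<^sup>m \<le> n\<close>; it is completed by time \<open>n\<close> with probability at
  least \<open>1/2\<close>. For \<open>n < 24\<close>, level \<open>0\<close> serves, as a vertex other than the origin has distance at least
  \<open>\<surd>3 / 2\<close> from it.\<close>

lemma lerw_lower_bound:
  assumes P: "is_lerw_law P" and s: "0 < s" and n: "1 \<le> n"
  shows "1/2 * (sqrt 3 / 2) powr s * (1 / (24 * lerw_lambda)) powr (s * lerw_nu) * real n powr (s * lerw_nu)
    \<le> (\<integral>\<omega>. norm (lerw \<omega> n) powr s \<partial>P)"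
proof -
  interpret prob_space P using P unfolding is_lerw_law_def by simp
  have sp: "space P = Omega" using P unfolding is_lerw_law_def by simp
  have l: "1 < lerw_lambda" using lambda_bounds by simp
  have nu: "0 < lerw_nu" using l unfolding lerw_nu_def by simp
  have "\<exists>m A. A \<in> sets P \<and> 1/2 \<le> measure P A \<and> (\<forall>\<omega>\<in>A. sqrt 3 / 2 * 2 ^ m \<le> norm (lerw \<omega> n)) \<and>
    real n \<le> 24 * lerw_lambda ^ Suc m"
  proof (cases "24 \<le> n")
    case False
    have "real n \<le> 24 * lerw_lambda ^ Suc 0" using False l by simp
    moreover have "\<forall>\<omega>\<in>Omega. sqrt 3 / 2 * 2 ^ 0 \<le> norm (lerw \<omega> n)" using lerw_nonzero_norm[OF _ n] by simp
    moreover have "Omega \<in> sets P" "1/2 \<le> measure P Omega" using sets.top[of P] prob_space sp by simp_all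
    ultimately show ?thesis by (intro exI[of _ 0] exI[of _ Omega] conjI)
  next
    case True
    define M where "M = (LEAST M. real n < 24 * lerw_lambda ^ M)"
    obtain M0 where "real n / 24 < lerw_lambda ^ M0" using real_arch_pow[OF l] by blast
    then have "real n < 24 * lerw_lambda ^ M0" by simp
    then have M: "real n < 24 * lerw_lambda ^ M" unfolding M_def by (rule LeastI)
    then have "M \<noteq> 0" using True by (intro notI) simp
    then obtain m where m: "M = Suc m" by (cases M) auto
    have "\<not> real n < 24 * lerw_lambda ^ m"
      using not_less_Least[of m "\<lambda>M. real n < 24 * lerw_lambda ^ M"] m unfolding M_def by simp
    then have le: "24 * lerw_lambda ^ m \<le> real n" by simp
    define B where "B = {\<omega> \<in> Omega. 24 * lerw_lambda ^ m < wlen (\<omega> m)}"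
    have B: "B \<in> sets P" unfolding B_def by (rule level_measurable[OF P])
    have A: "space P - B \<in> sets P" by (rule sets.compl_sets[OF B])
    have half: "1/2 \<le> measure P (space P - B)"
      using prob_compl[OF B] long_walk_prob[OF P, of m] unfolding B_def[symmetric] by simp
    have off: "sqrt 3 / 2 * 2 ^ m \<le> norm (lerw \<omega> n)" if \<omega>: "\<omega> \<in> space P - B" for \<omega>
    proof -
      have "\<omega> \<in> Omega" "real (wlen (\<omega> m)) \<le> real n" using \<omega> le sp unfolding B_def by auto
      then show ?thesis using lerw_norm_ge[of \<omega> m n] by simp
    qed
    have le': "real n \<le> 24 * lerw_lambda ^ Suc m" using M unfolding m by (rule less_imp_le)
    show ?thesis by (intro exI[of _ m] exI[of _ "space P - B"] conjI ballI A half off le')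
  qed
  then obtain m A where A: "A \<in> sets P" "1/2 \<le> measure P A" "\<And>\<omega>. \<omega> \<in> A \<Longrightarrow> sqrt 3 / 2 * 2 ^ m \<le> norm (lerw \<omega> n)"
    and nm: "real n \<le> 24 * lerw_lambda ^ Suc m" by blast
  have "1 / (24 * lerw_lambda) * real n \<le> lerw_lambda ^ m"
    using nm l by (simp add: field_simps)
  then have "(1 / (24 * lerw_lambda) * real n) powr (s * lerw_nu) \<le> (lerw_lambda ^ m) powr (s * lerw_nu)"
    using l s nu by (intro powr_mono2) auto
  also have "\<dots> = (2 ^ m) powr s" by (rule two_power_powr[symmetric])
  finally have "(1 / (24 * lerw_lambda)) powr (s * lerw_nu) * real n powr (s * lerw_nu) \<le> (2 ^ m) powr s"
    unfolding powr_mult .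
  then have "1/2 * (sqrt 3 / 2) powr s * ((1 / (24 * lerw_lambda)) powr (s * lerw_nu) * real n powr (s * lerw_nu)) \<le>
      1/2 * (sqrt 3 / 2) powr s * (2 ^ m) powr s"
    by (intro mult_left_mono) auto
  also have "\<dots> = 1/2 * (sqrt 3 / 2 * 2 ^ m) powr s" by (simp only: powr_mult mult.assoc)
  also have "\<dots> \<le> (\<integral>\<omega>. norm (lerw \<omega> n) powr s \<partial>P)"
    by (rule lerw_moment_ge[OF P s A(1,2) _ A(3)]) auto
  finally show ?thesis by (simp only: mult.assoc)
qed

text \<open>A walk that is far away at time \<open>n\<close> must have been short on some level: with \<open>n \<le> \<lambda>\<^sup>k\<close>, either
  level \<open>k + 1\<close> is not yet completed at time \<open>n\<close>, or the last completed level \<open>k + 1 + j\<close> was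
  completed in fewer than \<open>\<lambda>\<^sup>k\<close> steps.\<close>

lemma lerw_powr_le:
  assumes \<omega>: "\<omega> \<in> Omega" and s: "0 < s" and n: "real n \<le> lerw_lambda ^ k"
  shows "norm (lerw \<omega> n) powr s \<le> (2 ^ Suc k) powr s +
    (\<Sum>j\<le>n. (2 ^ Suc (Suc k + j)) powr s * indicator {\<omega> \<in> Omega. wlen (\<omega> (Suc k + j)) \<le> lerw_lambda ^ k} \<omega>)"
proof -
  let ?x = "\<lambda>j. (2 ^ Suc (Suc k + j)) powr s * indicator {\<omega> \<in> Omega. wlen (\<omega> (Suc k + j)) \<le> lerw_lambda ^ k} \<omega>"
  have x: "0 \<le> ?x j" for j by simp
  define M where "M = (LEAST M. n \<le> wlen (\<omega> M))"
  have M: "n \<le> wlen (\<omega> M)" unfolding M_def by (rule LeastI[of "\<lambda>M. n \<le> wlen (\<omega> M)", OF level_reaching[OF \<omega>]])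
  have Mn: "M \<le> n" unfolding M_def by (rule Least_le[of "\<lambda>M. n \<le> wlen (\<omega> M)", OF level_reaching[OF \<omega>]])
  have up: "norm (lerw \<omega> n) powr s \<le> (2 ^ M) powr s"
    by (rule powr_mono2[OF less_imp_le[OF s] norm_ge_zero lerw_norm_le[OF \<omega> M]])
  show ?thesis
  proof (cases "M \<le> Suc k")
    case True
    then have "(2::real) ^ M \<le> 2 ^ Suc k" by (intro power_increasing) auto
    then have "(2 ^ M) powr s \<le> (2 ^ Suc k) powr s" using s by (intro powr_mono2) auto
    moreover have "0 \<le> sum ?x {..n}" by (rule sum_nonneg) (rule x)
    ultimately show ?thesis using up by linarith
  next
    case False
    then obtain K where K: "M = Suc K" "Suc k \<le> K" by (cases M) auto
    then obtain j where j: "K = Suc k + j" using le_Suc_ex by blast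
    have "\<not> n \<le> wlen (\<omega> K)" using not_less_Least[of K "\<lambda>M. n \<le> wlen (\<omega> M)"] K(1) unfolding M_def by simp
    then have "real (wlen (\<omega> (Suc k + j))) \<le> lerw_lambda ^ k" using n j by simp
    then have "\<omega> \<in> {\<omega> \<in> Omega. wlen (\<omega> (Suc k + j)) \<le> lerw_lambda ^ k}" using \<omega> by blast
    then have "?x j = (2 ^ M) powr s" unfolding K(1) j by (simp only: indicator_simps mult_1_right)
    moreover have "?x j \<le> sum ?x {..n}"
    proof (rule member_le_sum)
      show "j \<in> {..n}" using Mn K(1) j by simp
      show "0 \<le> ?x i" for i by (rule x)
    qed simp
    ultimately have "(2 ^ M) powr s \<le> sum ?x {..n}" by linarith
    moreover have "0 \<le> ((2::real) ^ Suc k) powr s" by simp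
    ultimately show ?thesis using up by linarith
  qed
qed

text \<open>Relative to \<open>(2\<^sup>k)\<^sup>s\<close>, which is of order \<open>n\<close> to the power \<open>s \<nu>\<close> for the first \<open>k\<close> with
  \<open>n \<le> \<lambda>\<^sup>k\<close>, the level \<open>k + 1 + j\<close> contributes a multiple of \<open>(2\<^sup>j)\<^sup>s\<close> times a doubly exponentially small
  probability, so the levels have a finite total.\<close>

lemma lerw_upper_bound:
  assumes P: "is_lerw_law P" and s: "0 < s" and n: "1 \<le> n"
  defines "S \<equiv> (\<Sum>j. ((2::real) ^ j) powr s * (1 - 1/324000) ^ (2 ^ j))"
  shows "(\<integral>\<omega>. norm (lerw \<omega> n) powr s \<partial>P) \<le>
    (2 powr s + 2 * 4 powr s * S) * lerw_lambda powr (s * lerw_nu) * real n powr (s * lerw_nu)"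
proof -
  interpret prob_space P using P unfolding is_lerw_law_def by simp
  have sp: "space P = Omega" using P unfolding is_lerw_law_def by simp
  have l: "1 < lerw_lambda" using lambda_bounds by simp
  have nu: "0 < lerw_nu" using l unfolding lerw_nu_def by simp
  define q :: real where "q = 1 - 1/324000"
  have q: "0 < q" "q < 1" unfolding q_def by simp_all
  define a where "a j = ((2::real) ^ j) powr s * q ^ (2 ^ j)" for j
  have a0: "0 \<le> a j" for j unfolding a_def using q by simp
  have sa: "summable a" using doubly_exponential_summable[OF q] unfolding a_def .
  have S: "S = suminf a" unfolding S_def a_def q_def ..
  have S0: "0 \<le> S" unfolding S by (rule suminf_nonneg[OF sa a0])
  define k where "k = (LEAST k. real n \<le> lerw_lambda ^ k)"
  obtain k0 where "real n < lerw_lambda ^ k0" using real_arch_pow[OF l] by blast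
  then have "real n \<le> lerw_lambda ^ k0" by (rule less_imp_le)
  then have k: "real n \<le> lerw_lambda ^ k" unfolding k_def by (rule LeastI)
  have kn: "lerw_lambda ^ k \<le> lerw_lambda * real n"
  proof (cases k)
    case 0
    then show ?thesis using mult_mono[of 1 lerw_lambda 1 "real n"] l n by simp
  next
    case (Suc i)
    have "\<not> real n \<le> lerw_lambda ^ i"
      using not_less_Least[of i "\<lambda>k. real n \<le> lerw_lambda ^ k"] Suc unfolding k_def by simp
    then have "lerw_lambda * lerw_lambda ^ i \<le> lerw_lambda * real n" using l by (intro mult_left_mono) auto
    then show ?thesis using Suc by simp
  qed
  let ?E = "\<lambda>j. {\<omega> \<in> Omega. wlen (\<omega> (Suc k + j)) \<le> lerw_lambda ^ k}"
  let ?c = "\<lambda>j. ((2::real) ^ Suc (Suc k + j)) powr s"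
  have E: "?E j \<in> sets P" for j by (rule level_measurable[OF P])
  have iE: "integrable P (\<lambda>\<omega>. ?c j * indicator (?E j) \<omega>)" for j
    by (rule integrable_mult_right, rule integrable_real_indicator[OF E]) (simp add: emeasure_eq_measure)
  have ind: "(\<integral>\<omega>. c * indicator B \<omega> \<partial>P) = c * measure P B" if B: "B \<in> sets P" for c :: real and B
    using B sets.sets_into_space[OF B] by (simp add: Int_absorb2)
  have cE: "(\<integral>\<omega>. ?c j * indicator (?E j) \<omega> \<partial>P) = ?c j * measure P (?E j)" for j
    by (rule ind[OF E])
  have isum: "integrable P (\<lambda>\<omega>. \<Sum>j\<le>n. ?c j * indicator (?E j) \<omega>)"
    by (intro Bochner_Integration.integrable_sum iE)
  have const: "(\<integral>\<omega>. c \<partial>P) = c" for c :: real by (simp add: prob_space)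
  have "(\<integral>\<omega>. norm (lerw \<omega> n) powr s \<partial>P) \<le>
      (\<integral>\<omega>. (2 ^ Suc k) powr s + (\<Sum>j\<le>n. ?c j * indicator (?E j) \<omega>) \<partial>P)"
  proof (rule integral_mono)
    show "integrable P (\<lambda>\<omega>. norm (lerw \<omega> n) powr s)" by (rule lerw_integrable[OF P s])
    show "integrable P (\<lambda>\<omega>. (2 ^ Suc k) powr s + (\<Sum>j\<le>n. ?c j * indicator (?E j) \<omega>))"
      by (rule Bochner_Integration.integrable_add[OF integrable_const isum])
    show "norm (lerw \<omega> n) powr s \<le> (2 ^ Suc k) powr s + (\<Sum>j\<le>n. ?c j * indicator (?E j) \<omega>)" if "\<omega> \<in> space P" for \<omega>
      by (rule lerw_powr_le[OF _ s k]) (use that sp in simp)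
  qed
  also have "\<dots> = (2 ^ Suc k) powr s + (\<integral>\<omega>. (\<Sum>j\<le>n. ?c j * indicator (?E j) \<omega>) \<partial>P)"
    by (subst Bochner_Integration.integral_add[OF integrable_const isum]) (simp only: const)
  finally have head: "(\<integral>\<omega>. norm (lerw \<omega> n) powr s \<partial>P) \<le>
      (2 ^ Suc k) powr s + (\<integral>\<omega>. (\<Sum>j\<le>n. ?c j * indicator (?E j) \<omega>) \<partial>P)" .
  have "(\<integral>\<omega>. (\<Sum>j\<le>n. ?c j * indicator (?E j) \<omega>) \<partial>P) = (\<Sum>j\<le>n. ?c j * measure P (?E j))"
    by (subst Bochner_Integration.integral_sum[OF iE]) (simp only: cE)
  also have "\<dots> \<le> (\<Sum>j\<le>n. (2 * 4 powr s * (2 ^ k) powr s) * a j)"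
  proof (rule sum_mono)
    fix j
    have "(2::real) ^ Suc (Suc k + j) = 4 * 2 ^ k * 2 ^ j" by (simp add: power_add)
    then have c: "?c j = 4 powr s * (2 ^ k) powr s * (2 ^ j) powr s" by (simp only: powr_mult)
    have "measure P (?E j) \<le> 2 * q ^ (2 ^ j)" using short_walk_prob[OF P, of k j] unfolding q_def .
    then have "?c j * measure P (?E j) \<le> ?c j * (2 * q ^ (2 ^ j))" by (rule mult_left_mono) simp
    also have "\<dots> = (2 * 4 powr s * (2 ^ k) powr s) * a j" unfolding c a_def by (simp only: ac_simps)
    finally show "?c j * measure P (?E j) \<le> (2 * 4 powr s * (2 ^ k) powr s) * a j" .
  qed
  also have "\<dots> = (2 * 4 powr s * (2 ^ k) powr s) * (\<Sum>j\<le>n. a j)" by (rule sum_distrib_left[symmetric])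
  also have "\<dots> \<le> (2 * 4 powr s * (2 ^ k) powr s) * S"
  proof (rule mult_left_mono)
    show "(\<Sum>j\<le>n. a j) \<le> S" unfolding S by (rule sum_le_suminf[OF sa finite_atMost a0])
  qed simp
  finally have main: "(\<integral>\<omega>. norm (lerw \<omega> n) powr s \<partial>P) \<le> (2 ^ Suc k) powr s + (2 * 4 powr s * (2 ^ k) powr s) * S"
    using head by linarith
  have "(2 ^ Suc k) powr s = 2 powr s * (2 ^ k) powr s" unfolding power_Suc by (rule powr_mult)
  then have eq: "(2 ^ Suc k) powr s + (2 * 4 powr s * (2 ^ k) powr s) * S = (2 powr s + 2 * 4 powr s * S) * (2 ^ k) powr s"
    by (simp add: algebra_simps)
  have "(2 ^ k) powr s = (lerw_lambda ^ k) powr (s * lerw_nu)" by (rule two_power_powr)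
  also have "\<dots> \<le> (lerw_lambda * real n) powr (s * lerw_nu)" using kn l s nu by (intro powr_mono2) auto
  also have "\<dots> = lerw_lambda powr (s * lerw_nu) * real n powr (s * lerw_nu)" by (rule powr_mult)
  finally have "(2 powr s + 2 * 4 powr s * S) * (2 ^ k) powr s \<le>
      (2 powr s + 2 * 4 powr s * S) * (lerw_lambda powr (s * lerw_nu) * real n powr (s * lerw_nu))"
    using S0 by (intro mult_left_mono) auto
  with main[unfolded eq] show ?thesis unfolding mult.assoc by (rule order_trans)
qed

theorem theorem2:
  fixes P :: "(nat \<Rightarrow> walk) measure" and s :: real
  assumes "is_lerw_law P" and "s > 0"
  shows "\<exists>C1 C2. C1 > 0 \<and> C2 > 0 \<and> (\<forall>n::nat. n \<ge> 1 \<longrightarrow>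
           C1 * real n powr (s * lerw_nu) \<le> (\<integral>\<omega>. norm (lerw \<omega> n) powr s \<partial>P) \<and>
           (\<integral>\<omega>. norm (lerw \<omega> n) powr s \<partial>P) \<le> C2 * real n powr (s * lerw_nu))"
proof -
  define S where "S = (\<Sum>j. ((2::real) ^ j) powr s * (1 - 1/324000) ^ (2 ^ j))"
  define C1 where "C1 = 1/2 * (sqrt 3 / 2) powr s * (1 / (24 * lerw_lambda)) powr (s * lerw_nu)"
  define C2 where "C2 = (2 powr s + 2 * 4 powr s * S) * lerw_lambda powr (s * lerw_nu)"
  have l: "0 < lerw_lambda" using lambda_bounds by simp
  have "0 \<le> S" unfolding S_def by (rule suminf_nonneg[OF doubly_exponential_summable]) simp_all
  then have "0 < 2 powr s + 2 * 4 powr s * S" by (intro add_pos_nonneg) auto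
  then have C2: "C2 > 0" unfolding C2_def using l by (intro mult_pos_pos) auto
  have C1: "C1 > 0" unfolding C1_def using l by (intro mult_pos_pos) auto
  show ?thesis
  proof (intro exI conjI allI impI)
    show "C1 > 0" "C2 > 0" by (rule C1, rule C2)
    fix n :: nat assume n: "n \<ge> 1"
    show "C1 * real n powr (s * lerw_nu) \<le> (\<integral>\<omega>. norm (lerw \<omega> n) powr s \<partial>P)"
      unfolding C1_def by (rule lerw_lower_bound[OF assms n])
    show "(\<integral>\<omega>. norm (lerw \<omega> n) powr s \<partial>P) \<le> C2 * real n powr (s * lerw_nu)"
      unfolding C2_def S_def by (rule lerw_upper_bound[OF assms n])
  qed
qed

end
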